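(* Let $d \in \mathbb{N}^\ast$. There is a constant $K_0 = K_0(d)$, depending only on $d$, such that for all $\delta \in (0,1/2)$, all $E \in \mathbb{R}$, all measurable and bounded $V \colon \mathbb{R}^d \to \mathbb{R}$, all $L \in \mathbb{N}^\ast$, all sequences $(z_j)_{j \in \mathbb{Z}^d} \subset \mathbb{R}^d$ such that $B(z_j,\delta) \subset \Lambda_1 + j$ for all $j \in \mathbb{Z}^d$, each of the choices of Dirichlet, Neumann or periodic boundary conditions for $H_L$, and all linear combinations of eigenfunctions \[ \psi = \sum_{n \in \mathbb{N}^\ast \colon E_n \le E} \alpha_n \psi_n , \] where $\psi_n \in W^{2,2}(\Lambda_L;\mathbb{R})$, $n \in \mathbb{N}^\ast$, form an orthonormal basis (of $L^2(\Lambda_L)$) and satisfy $H_L \psi_n = E_n \psi_n$, and $(\alpha_n)_{n \in \mathbb{N}^\ast}$ is a sequence in $\mathbb{C}$, we have \[ \int_{S_{L,\delta}} |\psi|^2 \ \ge\ C_{\mathrm{sfuc}} \int_{\Lambda_L} |\psi|^2, \qquad \text{where} \quad C_{\mathrm{sfuc}} = \delta^{K_0\left(1 + \|V\|_\infty^{2/3} + |E|^{1/2}\right)} . \]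
   Context: $\mathbb{N}^\ast = \{1,2,3,\ldots\}$. For $L>0$, $\Lambda_L = (-L/2, L/2)^d \subset \mathbb{R}^d$. $B(z,\delta)$ is the ball in $\mathbb{R}^d$ with center $z$ and radius $\delta$. For $L \in \mathbb{N}^\ast$, $\delta > 0$ and a sequence $(z_j)_{j\in\mathbb{Z}^d}$ in $\mathbb{R}^d$, \[ S_{L,\delta} = \Lambda_L \cap \Big( \bigcup_{j \in \mathbb{Z}^d} B(z_j,\delta) \Big). \] For $V \colon \mathbb{R}^d \to \mathbb{R}$ measurable and bounded, $H_L$ denotes the self-adjoint restriction of the Schrödinger operator $-\Delta + V$ to $L^2(\Lambda_L)$ with either Dirichlet, Neumann, or periodic boundary conditions. *)

theory Defs
  imports "HOL-Analysis.Analysis" "HOL-Probability.Essential_Supremum"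
begin

text \<open>
  Functions on an open set \<open>\<Omega>\<close> are represented by functions on the whole space whose values
  outside \<open>\<Omega>\<close> are irrelevant; elements of \<open>L\<^sup>2\<close> and of Sobolev spaces are not quotiented by
  almost everywhere equality. The dimension \<open>d\<close> is \<open>CARD('n)\<close>.
\<close>

section \<open>Smooth functions\<close>

definition pderiv_at :: "'n \<Rightarrow> (real^'n \<Rightarrow> complex) \<Rightarrow> real^'n::finite \<Rightarrow> complex" where
  "pderiv_at i f x = frechet_derivative f (at x) (axis i 1)"

text \<open>For \<open>k > 0\<close>: differentiable with all partial derivatives of class \<open>C\<close> to the \<open>k - 1\<close>.\<close>

primrec C_k :: "nat \<Rightarrow> (real^'n::finite \<Rightarrow> complex) \<Rightarrow> bool" where
  "C_k 0 f = continuous_on UNIV f"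
| "C_k (Suc k) f = ((\<forall>x. f differentiable at x) \<and> (\<forall>i. C_k k (pderiv_at i f)))"

definition smooth :: "(real^'n::finite \<Rightarrow> complex) set" where
  "smooth = {f. \<forall>k. C_k k f}"

definition test_functions :: "(real^'n::finite) set \<Rightarrow> (real^'n \<Rightarrow> complex) set" where
  "test_functions \<Omega> =
    {f \<in> smooth. compact (closure {x. f x \<noteq> 0}) \<and> closure {x. f x \<noteq> 0} \<subseteq> \<Omega>}"

section \<open>Square integrable functions\<close>

definition L2 :: "(real^'n::finite) set \<Rightarrow> (real^'n \<Rightarrow> complex) set" where
  "L2 \<Omega> = {f \<in> borel_measurable (lebesgue_on \<Omega>).
            integrable (lebesgue_on \<Omega>) (\<lambda>x. (cmod (f x))\<^sup>2)}"

definition L2_norm_sq :: "(real^'n::finite) set \<Rightarrow> (real^'n \<Rightarrow> complex) \<Rightarrow> real" where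
  "L2_norm_sq \<Omega> f = (LINT x|lebesgue_on \<Omega>. (cmod (f x))\<^sup>2)"

definition L2_inner ::
    "(real^'n::finite) set \<Rightarrow> (real^'n \<Rightarrow> complex) \<Rightarrow> (real^'n \<Rightarrow> complex) \<Rightarrow> complex" where
  "L2_inner \<Omega> f g = (LINT x|lebesgue_on \<Omega>. cnj (f x) * g x)"

text \<open>Sequences are indexed by the positive integers; the value at \<open>0\<close> plays no role.\<close>

definition orthonormal_basis_L2 ::
    "(real^'n::finite) set \<Rightarrow> (nat \<Rightarrow> real^'n \<Rightarrow> complex) \<Rightarrow> bool" where
  "orthonormal_basis_L2 \<Omega> e \<longleftrightarrow>
     (\<forall>n\<ge>1. e n \<in> L2 \<Omega>) \<and>
     (\<forall>m\<ge>1. \<forall>n\<ge>1. L2_inner \<Omega> (e m) (e n) = (if m = n then 1 else 0)) \<and>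
     (\<forall>f\<in>L2 \<Omega>. (\<lambda>N. L2_norm_sq \<Omega> (\<lambda>x. f x - (\<Sum>n=1..N. L2_inner \<Omega> (e n) f * e n x)))
                   \<longlonglongrightarrow> 0)"

section \<open>Weak derivatives and Sobolev spaces\<close>

definition locally_integrable :: "(real^'n::finite) set \<Rightarrow> (real^'n \<Rightarrow> complex) \<Rightarrow> bool" where
  "locally_integrable \<Omega> f \<longleftrightarrow>
     (\<forall>K. compact K \<and> K \<subseteq> \<Omega> \<longrightarrow> f absolutely_integrable_on K)"

definition has_weak_pderiv ::
    "(real^'n::finite) set \<Rightarrow> 'n \<Rightarrow> (real^'n \<Rightarrow> complex) \<Rightarrow> (real^'n \<Rightarrow> complex) \<Rightarrow> bool" where
  "has_weak_pderiv \<Omega> i u g \<longleftrightarrow>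
     locally_integrable \<Omega> u \<and> locally_integrable \<Omega> g \<and>
     (\<forall>\<phi>\<in>test_functions \<Omega>.
        (LINT x|lebesgue_on \<Omega>. u x * pderiv_at i \<phi> x) = - (LINT x|lebesgue_on \<Omega>. g x * \<phi> x))"

text \<open>An arbitrary representative; any two of them agree almost everywhere on the open set \<open>\<Omega>\<close>.\<close>

definition weak_pderiv ::
    "(real^'n::finite) set \<Rightarrow> 'n \<Rightarrow> (real^'n \<Rightarrow> complex) \<Rightarrow> real^'n \<Rightarrow> complex" where
  "weak_pderiv \<Omega> i u = (SOME g. has_weak_pderiv \<Omega> i u g)"

definition W12 :: "(real^'n::finite) set \<Rightarrow> (real^'n \<Rightarrow> complex) set" where
  "W12 \<Omega> = {u \<in> L2 \<Omega>. \<forall>i. \<exists>g\<in>L2 \<Omega>. has_weak_pderiv \<Omega> i u g}"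

definition W22 :: "(real^'n::finite) set \<Rightarrow> (real^'n \<Rightarrow> complex) set" where
  "W22 \<Omega> = {u \<in> W12 \<Omega>. \<forall>i. weak_pderiv \<Omega> i u \<in> W12 \<Omega>}"

definition W12_norm_sq :: "(real^'n::finite) set \<Rightarrow> (real^'n \<Rightarrow> complex) \<Rightarrow> real" where
  "W12_norm_sq \<Omega> u = L2_norm_sq \<Omega> u + (\<Sum>i\<in>UNIV. L2_norm_sq \<Omega> (weak_pderiv \<Omega> i u))"

definition W12_closure ::
    "(real^'n::finite) set \<Rightarrow> (real^'n \<Rightarrow> complex) set \<Rightarrow> (real^'n \<Rightarrow> complex) set" where
  "W12_closure \<Omega> S =
     {u \<in> W12 \<Omega>. \<exists>\<phi>::nat \<Rightarrow> real^'n \<Rightarrow> complex.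
        (\<forall>k. \<phi> k \<in> S) \<and> (\<lambda>k. W12_norm_sq \<Omega> (\<lambda>x. \<phi> k x - u x)) \<longlonglongrightarrow> 0}"

definition weak_laplacian ::
    "(real^'n::finite) set \<Rightarrow> (real^'n \<Rightarrow> complex) \<Rightarrow> real^'n \<Rightarrow> complex" where
  "weak_laplacian \<Omega> u x = (\<Sum>i\<in>UNIV. weak_pderiv \<Omega> i (weak_pderiv \<Omega> i u) x)"

section \<open>Schroedinger operators on cubes\<close>

definition cube :: "real \<Rightarrow> (real^'n::finite) set" where
  "cube L = {x. \<forall>i. - L / 2 < x $ i \<and> x $ i < L / 2}"

datatype boundary_condition = Dirichlet | Neumann | Periodic

definition periodic_smooth :: "real \<Rightarrow> (real^'n::finite \<Rightarrow> complex) set" where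
  "periodic_smooth L = {f \<in> smooth. \<forall>i x. f (x + axis i L) = f x}"

fun form_domain :: "boundary_condition \<Rightarrow> real \<Rightarrow> (real^'n::finite \<Rightarrow> complex) set" where
  "form_domain Dirichlet L = W12_closure (cube L) (test_functions (cube L))"
| "form_domain Neumann L = W12 (cube L)"
| "form_domain Periodic L = W12_closure (cube L) (periodic_smooth L)"

text \<open>
  The domain of the self-adjoint Laplacian on the cube. Green's identity against the whole form
  domain, i.e. the vanishing of the boundary terms, is automatic for \<open>Dirichlet\<close>, expresses for
  \<open>Neumann\<close> that the normal derivative vanishes on the boundary, and for \<open>Periodic\<close> that the
  normal derivatives match on opposite faces. By elliptic regularity on the cube this is also the
  domain of the operator associated with the closed form with domain \<open>form_domain bc L\<close>; adding
  a bounded potential does not change it.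
\<close>

definition H_domain :: "boundary_condition \<Rightarrow> real \<Rightarrow> (real^'n::finite \<Rightarrow> complex) set" where
  "H_domain bc L =
     {u \<in> W22 (cube L) \<inter> form_domain bc L. \<forall>\<phi>\<in>form_domain bc L.
        (\<Sum>i\<in>UNIV. L2_inner (cube L) (weak_pderiv (cube L) i \<phi>) (weak_pderiv (cube L) i u))
          = L2_inner (cube L) \<phi> (\<lambda>x. - weak_laplacian (cube L) u x)}"

definition H_op ::
    "(real^'n::finite \<Rightarrow> real) \<Rightarrow> real \<Rightarrow> (real^'n \<Rightarrow> complex) \<Rightarrow> real^'n \<Rightarrow> complex" where
  "H_op V L u x = - weak_laplacian (cube L) u x + complex_of_real (V x) * u x"

text \<open>\<open>H_L u = \<mu> u\<close>, as an identity in \<open>L\<^sup>2\<close>.\<close>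

definition H_eigen_eq ::
    "boundary_condition \<Rightarrow> (real^'n::finite \<Rightarrow> real) \<Rightarrow> real \<Rightarrow> real \<Rightarrow> (real^'n \<Rightarrow> complex) \<Rightarrow> bool"
  where
  "H_eigen_eq bc V L \<mu> u \<longleftrightarrow>
     u \<in> H_domain bc L \<and>
     (AE x in lebesgue_on (cube L). H_op V L u x = complex_of_real \<mu> * u x)"

section \<open>The equidistributed set and the constant\<close>

definition lattice_point :: "int^'n \<Rightarrow> real^'n::finite" where
  "lattice_point j = (\<chi> i. of_int (j $ i))"

definition S_set :: "real \<Rightarrow> real \<Rightarrow> (int^'n \<Rightarrow> real^'n) \<Rightarrow> (real^'n::finite) set" where
  "S_set L \<delta> z = cube L \<inter> (\<Union>j. ball (z j) \<delta>)"

definition sup_norm :: "(real^'n::finite \<Rightarrow> real) \<Rightarrow> real" where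
  "sup_norm V = real_of_ereal (esssup lebesgue (\<lambda>x. ereal \<bar>V x\<bar>))"

definition C_sfuc :: "real \<Rightarrow> real \<Rightarrow> (real^'n::finite \<Rightarrow> real) \<Rightarrow> real \<Rightarrow> real" where
  "C_sfuc K0 \<delta> V E = \<delta> powr (K0 * (1 + sup_norm V powr (2/3) + \<bar>E\<bar> powr (1/2)))"

end

(*
  Adding a constant to V, one may assume E_n >= 0. The combination psi of the psi_n is extended by a ghost variable t:
  U(x, t), the sum of al_n sinh(sqrt(E_n) t) / sqrt(E_n) psi_n(x), solves Delta U = V U with U(x, 0) = 0 and
  d_t U(x, 0) = psi(x). Since the psi_n are only in W^{2,2}, U is replaced by its projections to the trigonometric
  basis adapted to the boundary condition. These are smooth, extend to the whole space by reflection or periodicity,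
  and Delta U - V U tends to 0 in L^2.

  The Carleman weight on the half-space t > 0 is exp(2 tau (kappa rho - ln rho)) with rho the squared distance to a
  centre y0; the convex term kappa rho yields the factor tau^3, which absorbs V once tau^3 dominates |V|^2.
  With y0 slightly below (z_j, 0) the boundary term is an integral of (d_t U)^2 = psi^2 over B(z_j, delta), and it
  controls U on a small half-ball. With y0 = (z_j, 0) the boundary term vanishes, and U on the small half-ball
  controls U on a half-ball containing the unit cell, up to a small multiple of U on a larger half-ball.
  Summed over the cells, the remainder is a small multiple of the norm of U on a slab of bounded height, which exceeds
  that of psi by at most exp(C sqrt E), and is absorbed for tau of order (1 + |V|^(2/3) + |E|^(1/2)) ln(1/delta).
*)
theory Submission
 imports Defs
begin

text \<open>A combination of eigenfunctions with different eigenvalues in general solves no equation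
  Delta psi = W psi with bounded W; the ghost variable produces one, and the energy then enters
  through the growth of the extension in t, as exp (C sqrt E), instead of through a potential of
  size E. The remainder of the local estimate cannot be absorbed cell by cell, since nothing bounds
  the mass of a neighbouring cell by that of a given one; this is why it is summed first, and why
  the extension across the faces must have the same norm on every copy of the cube. The two Carleman
  steps carry different parameters. The interior one, \<open>ta\<close>, has the order g = 1 +
  |V|^(2/3) + |E|^(1/2) and beats the growth in t. Passing from a half-ball of size delta to a unit
  cell then costs exp (C ta ln (1/delta)), and the boundary parameter \<open>s\<close>, larger by a
  factor ln (1/delta), has to beat that. Projection does not commute with V, so the approximations
  satisfy the equation only up to an error; its constant may have any size, because it is fixed
  before the order of the projection tends to infinity.\<close>

abbreviation (input) "cont \<equiv> continuous_on UNIV"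
abbreviation (input) "cm L \<equiv> lebesgue_on (cube L)"
abbreviation (input) "wpd L \<equiv> weak_pderiv (cube L)"
abbreviation (input) "hwpd L \<equiv> has_weak_pderiv (cube L)"
abbreviation (input) "cr \<equiv> complex_of_real"
abbreviation (input) "ind \<equiv> indicator"
abbreviation (input) "bmeas \<equiv> borel_measurable"
abbreviation (input) hrd :: "(real => real) => real => real filter => bool" (infix "hrd" 50)
 where "f hrd D \<equiv> (f has_field_derivative D)"
abbreviation (input) lim_to :: "(nat => 'a::topological_space) => 'a => bool" ("((_)/ ~~> (_))" [60, 60] 60)
 where "X ~~> l \<equiv> X \<longlonglongrightarrow> l"
notation inner (infix "<.>" 70)
notation scaleR (infixr "*:" 75)
lemmas Lint_add = Bochner_Integration.integral_add
lemmas Lint_cong = Bochner_Integration.integral_cong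
lemmas Lint_diff = Bochner_Integration.integral_diff
lemmas Lint_mult_right_zero = Bochner_Integration.integral_mult_right_zero
lemmas Lint_sum = Bochner_Integration.integral_sum
lemmas Lintb_add = Bochner_Integration.integrable_add
lemmas Lintb_bound = Bochner_Integration.integrable_bound
lemmas Lintb_cong = Bochner_Integration.integrable_cong
lemmas Lintb_ind = integrable_mult_indicator
lemmas Lintb_sum = Bochner_Integration.integrable_sum
lemmas bmeas_contI = borel_measurable_continuous_onI
lemmas cont_atI = continuous_at_imp_continuous_on
lemmas cont_comp2 = continuous_on_compose2
lemmas hrd_transform = has_field_derivative_transform_within_open

section \<open>Functions of class C2 with explicit gradient and Hessian\<close>

text \<open>Gradient and Hessian are arguments rather than existential witnesses, so that the
  Laplacian of a product or a composition can be read off as the trace of an explicit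
  \<open>H\<close>. Symmetry of the Hessian belongs to the definition, which avoids an appeal to
  Schwarz's theorem.\<close>

definition c2 :: "('b::euclidean_space => real) => ('b => 'b) => ('b => 'b => 'b) => bool" where
 "c2 f G H \<longleftrightarrow> (\<forall>y. (f has_derivative (%h. G y <.> h)) (at y)) &
   (\<forall>y. (G has_derivative H y) (at y)) & (\<forall>y h k. H y h <.> k = h <.> H y k) &
   (\<forall>h. cont (%y. H y h))"

definition lap :: "('b::euclidean_space => 'b => 'b) => 'b => real" where
 "lap H y = (\<Sum>b\<in>Basis. H y b <.> b)"

text \<open>A relation instead of a trace of \<open>frechet_derivative\<close>: the product rules
  below then deliver the value of the divergence together with differentiability.\<close>

definition has_div :: "('b::euclidean_space => 'b) => 'b => real => bool" where
 "has_div F y d \<longleftrightarrow> (\<exists>F'. (F has_derivative F') (at y) & d = (\<Sum>b\<in>Basis. F' b <.> b))"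

lemma c2D:
 assumes "c2 f G H"
 shows "(f has_derivative (%h. G y <.> h)) (at y)" "(G has_derivative H y) (at y)"
  "H y h <.> k = h <.> H y k" "cont (%y. H y h)" using assms unfolding c2_def by blast+

lemma c2_cont:
 assumes "c2 f G H"
 shows "cont f" "cont G" "cont (lap H)"
proof -
 show "cont f" using c2D(1)[OF assms] by (meson has_derivative_continuous cont_atI)
 show "cont G" using c2D(2)[OF assms] by (meson has_derivative_continuous cont_atI)
 show "cont (lap H)" unfolding lap_def using c2D(4)[OF assms] by (intro continuous_intros)
qed

lemma c2_measurable [measurable_dest]:
 assumes "c2 f G H"
 shows "f : bmeas borel" "G : bmeas borel" "lap H : bmeas borel"
 using c2_cont[OF assms] by (auto intro: bmeas_contI)

lemma c2_const: "c2 (%_. c) (%_. 0) (%_ _. 0)"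
 unfolding c2_def by (auto intro!: has_derivative_eq_rhs[OF has_derivative_const] simp: fun_eq_iff)

lemma c2_add:
 assumes "c2 f F F'" "c2 g G G'"
 shows "c2 (%y. f y + g y) (%y. F y + G y) (%y h. F' y h + G' y h)" unfolding c2_def using c2D[OF assms(1)] c2D[OF assms(2)]
 by (auto intro!: derivative_eq_intros continuous_intros simp: inner_simps)

lemma c2_mult:
 assumes "c2 f F F'" "c2 g G G'"
 shows "c2 (%y. f y*g y) (%y. f y *: G y + g y *: F y)
      (%y h. f y *: G' y h + (F y <.> h) *: G y + (g y *: F' y h + (G y <.> h) *: F y))" unfolding c2_def
proof (intro conjI allI)
 fix y
 show "((%y. f y*g y) has_derivative (%h. (f y *: G y + g y *: F y) <.> h)) (at y)"
  by (rule derivative_eq_intros c2D(1)[OF assms(1)] c2D(1)[OF assms(2)] refl)+ (auto simp: inner_simps)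
 show "((%y. f y *: G y + g y *: F y) has_derivative
     (%h. f y *: G' y h + (F y <.> h) *: G y + (g y *: F' y h + (G y <.> h) *: F y))) (at y)"
  by (rule derivative_eq_intros c2D(1,2)[OF assms(1)] c2D(1,2)[OF assms(2)] refl)+
next
 fix y h k
 show "(f y *: G' y h + (F y <.> h) *: G y + (g y *: F' y h + (G y <.> h) *: F y)) <.> k =
    h <.> (f y *: G' y k + (F y <.> k) *: G y + (g y *: F' y k + (G y <.> k) *: F y))"
  using c2D(3)[OF assms(1), of y h k] c2D(3)[OF assms(2), of y h k] by (simp add: inner_simps inner_commute)
next
 fix h
 show "cont
     (%y. f y *: G' y h + (F y <.> h) *: G y + (g y *: F' y h + (G y <.> h) *: F y))"
  using c2_cont[OF assms(1)] c2_cont[OF assms(2)] c2D(4)[OF assms(1)] c2D(4)[OF assms(2)] by (intro continuous_intros) auto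
qed

text \<open>Each of the two rank-one terms in the Hessian of a product contributes
  \<open>F y <.> G y\<close> to the trace.\<close>

lemma lap_mult:
 "lap (%y h. f y *: G' y h + (F y <.> h) *: G y + (g y *: F' y h + (G y <.> h) *: F y)) y
   = f y*lap G' y + g y*lap F' y + 2*(F y <.> G y)" unfolding lap_def euclidean_inner[of "F y" "G y"]
 by (simp add: inner_simps sum.distrib sum_distrib_left algebra_simps)

lemma c2_scale:
 assumes "c2 f F F'"
 shows "c2 (%y. c*f y) (%y. c *: F y) (%y h. c *: F' y h)" using c2_mult[OF c2_const[of c] assms] by simp

lemma c2_sum:
 assumes "!!i. i : I ==> c2 (f i) (F i) (F' i)"
 shows "c2 (%y. \<Sum>i\<in>I. f i y) (%y. \<Sum>i\<in>I. F i y) (%y h. \<Sum>i\<in>I. F' i y h)" using assms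
proof (induction I rule: infinite_finite_induct)
 case (insert i I)
 then show ?case using c2_add[of "f i" "F i" "F' i"] by simp
qed (auto intro: c2_const)

lemma lap_sum: "lap (%y h. \<Sum>i\<in>I. F' i y h) y = (\<Sum>i\<in>I. lap (F' i) y)"
 unfolding lap_def by (simp add: inner_sum_left sum.swap[of _ I])

lemma lap_scale: "lap (%y h. c *: F' y h) y = c*lap F' y" unfolding lap_def by (simp add: sum_distrib_left)

lemma c2_inner_comp:
 assumes "!!s. (b hrd b' s) (at s)" "!!s. (b' hrd b'' s) (at s)" "cont b''"
 shows "c2 (%y. b (y <.> e)) (%y. b' (y <.> e) *: e) (%y h. (b'' (y <.> e)*(h <.> e)) *: e)"
proof -
 have *: "((%y. g (y <.> e)) has_derivative (%h. g'*(h <.> e))) (at y)"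
  if "(g hrd g') (at (y <.> e))" for g :: "real => real" and g' and y
 proof -
  have "((%y. y <.> e) has_derivative (%h. h <.> e)) (at y)" by (rule derivative_eq_intros refl)+ simp
  from has_derivative_compose[OF this, of g "%h. g'*h"] that
  show ?thesis unfolding has_field_derivative_def by simp
 qed
 show ?thesis unfolding c2_def
 proof (intro conjI allI)
  fix y
  show "((%y. b (y <.> e)) has_derivative (%h. b' (y <.> e) *: e <.> h)) (at y)"
   using *[OF assms(1)] by (simp add: inner_commute[of e])
  show "((%y. b' (y <.> e) *: e) has_derivative (%h. (b'' (y <.> e)*(h <.> e)) *: e)) (at y)"
   by (rule derivative_eq_intros *[OF assms(2)] refl)+ simp
 next
  show "cont (%y. (b'' (y <.> e)*(h <.> e)) *: e)" for h
   by (intro continuous_intros cont_comp2[OF assms(3)]) auto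
 qed (simp add: inner_commute)
qed

lemma lap_inner_comp: "lap (%y h. (b'' y*(h <.> e)) *: e) y = b'' y*(e <.> e)" unfolding lap_def euclidean_inner[of e e]
 by (simp add: sum_distrib_left algebra_simps inner_commute)

text \<open>\<open>f\<close> acts on the squared distance and not on the distance, so that a radial
  function stays C2 at its centre \<open>y0\<close>.\<close>

lemma c2_radial:
 fixes y0 :: "'b::euclidean_space"
 assumes "!!s. (f hrd f' s) (at s)" "!!s. (f' hrd f'' s) (at s)" "cont f''"
 defines "rh \<equiv> %y. (y - y0) <.> (y - y0)"
 shows "c2 (%y. f (rh y)) (%y. (2*f' (rh y)) *: (y - y0))
   (%y h. (4*f'' (rh y)*((y - y0) <.> h)) *: (y - y0) + (2*f' (rh y)) *: h)"
proof -
 have r: "(rh has_derivative (%h. 2*((y - y0) <.> h))) (at y)" for y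
  unfolding rh_def by (rule derivative_eq_intros refl)+ (auto simp: inner_commute)
 have rc: "cont rh" unfolding rh_def by (intro continuous_intros)
 have *: "((%y. g (rh y)) has_derivative (%h. g'*(2*((y - y0) <.> h)))) (at y)"
  if "(g hrd g') (at (rh y))" for g :: "real => real" and g' and y
  using has_derivative_compose[OF r, of g "%h. g'*h" y] that unfolding has_field_derivative_def by simp
 show ?thesis unfolding c2_def
 proof (intro conjI allI)
  fix y
  show "((%y. f (rh y)) has_derivative (%h. (2*f' (rh y)) *: (y - y0) <.> h)) (at y)"
   using *[OF assms(1)] by (simp add: mult_ac)
  show "((%y. (2*f' (rh y)) *: (y - y0)) has_derivative
    (%h. (4*f'' (rh y)*((y - y0) <.> h)) *: (y - y0) + (2*f' (rh y)) *: h)) (at y)"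
   by (rule derivative_eq_intros *[OF assms(2)] refl)+ (simp add: algebra_simps)
 next
  show "cont (%y. (4*f'' (rh y)*((y - y0) <.> h)) *: (y - y0) + (2*f' (rh y)) *: h)" for h
  proof -
   have "cont f'" using assms(2) by (meson DERIV_continuous cont_atI)
   then show ?thesis by (intro continuous_intros cont_comp2[OF assms(3)] rc cont_comp2[of UNIV f' UNIV rh]) auto
  qed
 qed (simp add: inner_simps inner_commute)
qed

lemma lap_radial:
 fixes y0 :: "'b::euclidean_space"
 shows "lap (%y h. (4*f'' y*((y - y0) <.> h)) *: (y - y0) + (2*f' y) *: h) y
   = 4*f'' y*((y - y0) <.> (y - y0)) + 2*f' y*DIM('b)" unfolding lap_def euclidean_inner[of "y - y0" "y - y0"]
 by (simp add: inner_simps sum.distrib sum_distrib_left inner_Basis mult.assoc)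

lemma c2_power2_grad: "c2 f G H ==> ((%y. G y <.> G y) has_derivative (%h. 2*(H y (G y) <.> h))) (at y)"
 using c2D(3)[of f G H y] by (auto intro!: derivative_eq_intros c2D(2) simp: inner_commute)

lemma has_div_add: "has_div F y d ==> has_div G y e ==> has_div (%y. F y + G y) y (d + e)" unfolding has_div_def
proof (elim exE conjE)
 fix F' G'
 assume "(F has_derivative F') (at y)" "(G has_derivative G') (at y)"
  and "d = (\<Sum>b\<in>Basis. F' b <.> b)" "e = (\<Sum>b\<in>Basis. G' b <.> b)"
 then show "\<exists>K. ((%y. F y + G y) has_derivative K) (at y) & d + e = (\<Sum>b\<in>Basis. K b <.> b)"
  by (intro exI[of _ "%h. F' h + G' h"] conjI has_derivative_add) (auto simp: inner_simps sum.distrib)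
qed

lemma has_div_scale:
 assumes "(al has_derivative (%h. g <.> h)) (at y)" "has_div F y d"
 shows "has_div (%y. al y *: F y) y (g <.> F y + al y*d)"
proof -
 obtain F' where F': "(F has_derivative F') (at y)" "d = (\<Sum>b\<in>Basis. F' b <.> b)" using assms(2) unfolding has_div_def by auto
 have "((%y. al y *: F y) has_derivative (%h. al y *: F' h + (g <.> h) *: F y)) (at y)"
  by (rule derivative_eq_intros assms F' refl)+
 moreover have "g <.> F y + al y*d = (\<Sum>b\<in>Basis. (al y *: F' b + (g <.> b) *: F y) <.> b)"
  unfolding F'(2) euclidean_inner[of g "F y"] by (simp add: inner_simps sum.distrib sum_distrib_left algebra_simps)
 ultimately show ?thesis unfolding has_div_def by blast
qed

lemma has_div_grad: "c2 f G H ==> has_div G y (lap H y)" unfolding has_div_def lap_def using c2D(2) by blast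

lemma has_div_id: "has_div (%y. y - y0) y (DIM('b))" for y0 :: "'b::euclidean_space" unfolding has_div_def
 by (rule exI[of _ "%h. h"]) (auto intro!: derivative_eq_intros simp: inner_Basis)

section \<open>The divergence theorem on a half-space\<close>

text \<open>Continuity of the derivative is asked direction by direction, which is the form in which
  the fundamental theorem and dominated convergence use it.\<close>

definition C1 :: "'b::euclidean_space set => ('b => 'c::real_normed_vector) => bool" where
 "C1 S F \<longleftrightarrow> (\<exists>F'. (\<forall>y\<in>S. (F has_derivative F' y) (at y)) & (\<forall>h. continuous_on S (%y. F' y h)))"

lemma C1_const: "C1 S (%_. c)" unfolding C1_def by (rule exI[of _ "%_ _. 0"]) auto

lemma C1_cont: "C1 S F ==> continuous_on S F" unfolding C1_def
 by (elim exE conjE) (rule cont_atI, blast intro: has_derivative_continuous)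

lemma C1_add:
 assumes "C1 S F" "C1 S G"
 shows "C1 S (%y. F y + G y)"
proof -
 obtain F' G' where "\<forall>y\<in>S. (F has_derivative F' y) (at y)" "\<forall>h. continuous_on S (%y. F' y h)"
  "\<forall>y\<in>S. (G has_derivative G' y) (at y)" "\<forall>h. continuous_on S (%y. G' y h)" using assms unfolding C1_def by blast
 then show ?thesis unfolding C1_def by (intro exI[of _ "%y h. F' y h + G' y h"]) (auto intro!: continuous_intros has_derivative_add)
qed

lemma C1_bilinear:
 assumes "C1 S F" "C1 S G" "bounded_bilinear p"
 shows "C1 S (%y. p (F y) (G y))"
proof -
 interpret bounded_bilinear p by fact
 obtain F' G' where FG: "\<forall>y\<in>S. (F has_derivative F' y) (at y)" "\<forall>h. continuous_on S (%y. F' y h)"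
  "\<forall>y\<in>S. (G has_derivative G' y) (at y)" "\<forall>h. continuous_on S (%y. G' y h)" using assms unfolding C1_def by blast
 show ?thesis unfolding C1_def
 proof (intro exI[of _ "%y h. p (F y) (G' y h) + p (F' y h) (G y)"] conjI ballI allI)
  show "((%y. p (F y) (G y)) has_derivative (%h. p (F y) (G' y h) + p (F' y h) (G y))) (at y)" if "y : S" for y
   using FG(1,3) that by (intro FDERIV) auto
  show "continuous_on S (%y. p (F y) (G' y h) + p (F' y h) (G y))" for h using FG(2,4) C1_cont[OF assms(1)] C1_cont[OF assms(2)]
   by (intro continuous_on_add continuous_on) auto
 qed
qed

lemmas C1_scaleR = C1_bilinear[OF _ _ bounded_bilinear_scaleR] lemmas C1_mult = C1_bilinear[OF _ _ bounded_bilinear_mult]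
lemmas C1_inner = C1_bilinear[OF _ _ bounded_bilinear_inner]

lemma C1_c2:
 assumes "c2 f G H"
 shows "C1 S f" "C1 S G"
proof -
 have "continuous_on S (%y. G y <.> h)" for h using c2_cont(2)[OF assms] by (intro continuous_intros) (auto intro: continuous_on_subset)
 then show "C1 S f" unfolding C1_def using c2D(1)[OF assms] by (intro exI[of _ "%y h. G y <.> h"]) auto
 show "C1 S G" unfolding C1_def using c2D(2,4)[OF assms] by (intro exI[of _ H]) (auto intro: continuous_on_subset)
qed

lemma C1_id: "C1 S (%y. y - y0)" unfolding C1_def by (rule exI[of _ "%_ h. h"]) (auto intro!: derivative_eq_intros)

text \<open>This removes the singularity of the weight: the vector field of the Carleman estimate is
  C1 away from \<open>y0\<close> and vanishes identically near \<open>y0\<close>. On the overlap the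
  two derivative witnesses agree by uniqueness.\<close>

lemma C1_UN:
 assumes "C1 S F" "C1 T F" "open S" "open T"
 shows "C1 (S \<union> T) F"
proof -
 obtain F' G' where FG: "\<forall>y\<in>S. (F has_derivative F' y) (at y)" "\<forall>h. continuous_on S (%y. F' y h)"
  "\<forall>y\<in>T. (F has_derivative G' y) (at y)" "\<forall>h. continuous_on T (%y. G' y h)" using assms unfolding C1_def by blast
 define K where "K y = (if y : S then F' y else G' y)" for y
 have eq: "K y = G' y" if "y : T" for y using that FG(1,3) has_derivative_unique[of F "F' y" y "G' y"] unfolding K_def by auto
 have "continuous_on S (%y. K y h)" "continuous_on T (%y. K y h)" for h
  using FG(2,4) by (simp_all add: K_def[abs_def] eq[unfolded K_def] cong: continuous_on_cong)
 then have "continuous_on (S \<union> T) (%y. K y h)" for h using assms by (intro continuous_on_open_Un) auto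
 then show ?thesis unfolding C1_def using FG by (intro exI[of _ K]) (auto simp: K_def)
qed

lemma C1_radial_rat:
 fixes y0 :: "'b::euclidean_space"
 shows "C1 (- {y0}) (%y. 1/((y - y0) <.> (y - y0)))"
proof -
 have "((%y. 1/((y - y0) <.> (y - y0))) has_derivative
   (%h. - ((2*((y - y0) <.> h))/((y - y0) <.> (y - y0))^2))) (at y)" if "y ~= y0" for y
 proof -
  have "((%y. (y - y0) <.> (y - y0)) has_derivative (%h. 2*((y - y0) <.> h))) (at y)"
   by (rule derivative_eq_intros refl)+ (simp add: inner_commute[of _ "y - y0"])
  moreover have "((%r. 1/r) has_derivative (%h. - (h/((y - y0) <.> (y - y0))^2))) (at ((y - y0) <.> (y - y0)))"
  proof -
   have "((%r. 1/r) hrd - (1/r^2)) (at r)" if "r ~= 0" for r :: real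
    using that by (auto intro!: derivative_eq_intros simp: power2_eq_square)
   from this[of "(y - y0) <.> (y - y0)"] that
   show ?thesis unfolding has_field_derivative_def by (auto elim!: has_derivative_eq_rhs)
  qed
  ultimately show ?thesis by (rule has_derivative_compose)
 qed
 then show ?thesis unfolding C1_def
  by (intro exI[of _ "%y h. - ((2*((y - y0) <.> h))/((y - y0) <.> (y - y0))^2)"] conjI allI ballI continuous_intros) auto
qed

lemma integrable_bounded_support:
 fixes f :: "'b::euclidean_space => 'c::{banach, second_countable_topology}"
 assumes "cont f" "!!x. norm x > R ==> f x = 0"
 shows "integrable lborel f"
proof -
 have "integrable lborel (%x. ind (cball 0 R) x *: f x)"
  using assms(1) by (intro borel_integrable_compact) (auto intro: continuous_on_subset)
 also have "(%x. ind (cball 0 R) x *: f x) = f" using assms(2) by (auto simp: fun_eq_iff indicator_def)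
 finally show ?thesis .
qed

lemma integral_translate:
 fixes f :: "'b::euclidean_space => 'c::{banach, second_countable_topology}"
 assumes "f : bmeas borel"
 shows "(LBINT x. f (x + c)) = (LBINT x. f x)"
proof -
 have "(LBINT x. f x) = (LINT x|distr lborel borel ((+) c). f x)" using lborel_distr_plus[of c] by simp
 also have "... = (LBINT x. f (c + x))" using assms by (subst integral_distr) auto
 finally show ?thesis by (simp add: add.commute)
qed

lemma derivative_zero_outside:
 assumes "!!x. R < norm x ==> g x = 0" "(g has_derivative g') (at x)" "R < norm (x::'b::euclidean_space)"
 shows "g' h = 0"
proof -
 have "open (norm -` {R<..} :: 'b set)" by (intro open_vimage continuous_intros open_greaterThan)
 then have "(g has_derivative (%_. 0)) (at x)" by (rule has_derivative_transform_within_open[OF has_derivative_const[of 0]]) (use assms in auto)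
 then show ?thesis using has_derivative_unique[OF assms(2)] by metis
qed

text \<open>Difference quotients in direction \<open>b\<close> have integral zero by translation
  invariance. The mean value theorem dominates them by a constant on a fixed ball, so their
  integrals converge to that of the derivative, and no coordinates adapted to \<open>b\<close> have
  to be introduced.\<close>

lemma integral_directional_derivative_eq_0:
 fixes g :: "'b::euclidean_space => real"
 assumes g: "!!x. (g has_derivative g' x) (at x)" and D: "cont (%x. g' x b)"
  and R: "!!x. norm x > R ==> g x = 0"
 shows "(LBINT x. g' x b) = 0"
proof -
 have D0: "g' x b = 0" if "norm x > R" for x using derivative_zero_outside[OF R g that] .
 have gc: "cont g" using g by (meson has_derivative_continuous cont_atI)
 have gi: "integrable lborel g" by (rule integrable_bounded_support[OF gc R])
 have gm [measurable]: "g : bmeas borel" using gc by (rule bmeas_contI)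
 have Dm [measurable]: "(%x. g' x b) : bmeas borel" using D by (rule bmeas_contI)
 obtain B where B: "!!x. \<bar>g' x b\<bar> <= B"
 proof -
  have "compact ((%x. g' x b) ` cball 0 R)" using D by (intro compact_continuous_image) (auto intro: continuous_on_subset)
  then obtain B where "\<forall>x\<in>cball 0 R. \<bar>g' x b\<bar> <= B" by (fastforce dest!: compact_imp_bounded simp: bounded_iff)
  then have "\<bar>g' x b\<bar> <= max B 0" for x using D0[of x] by (cases "norm x > R") (auto simp: le_max_iff_disj)
  then show ?thesis using that by blast
 qed
 have line: "((%s. g (x + s *: b)) hrd g' (x + s *: b) b) (at s)" for x s
 proof -
  have "((%s. x + s *: b) has_derivative (%h. h *: b)) (at s)" by (auto intro!: derivative_eq_intros)
  from has_derivative_compose[OF this g]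
  have "((%s. g (x + s *: b)) has_derivative (%h. g' (x + s *: b) (h *: b))) (at s)" .
  moreover have "g' (x + s *: b) (h *: b) = g' (x + s *: b) b*h" for h
   using has_derivative_linear[OF g] by (simp add: linear_scale)
  ultimately show ?thesis unfolding has_field_derivative_def by simp
 qed
 define q where "q n x = (g (x + (1/real (Suc n)) *: b) - g x)*real (Suc n)" for n x
 have qlim: "(%n. q n x) ~~> g' x b" for x
 proof -
  have "((%h. (g (x + h *: b) - g x)/h) \<longlongrightarrow> g' x b) (at 0)" using line[of x 0] unfolding DERIV_def by simp
  moreover have "filterlim (%n. 1/real (Suc n)) (at 0) sequentially" by (rule filterlim_atI) (use LIMSEQ_Suc[OF lim_1_over_n] in auto)
  ultimately have "(%n. (g (x + (1/real (Suc n)) *: b) - g x)/(1/real (Suc n))) ~~> g' x b"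
   by (rule filterlim_compose)
  then show ?thesis unfolding q_def by simp
 qed
 \<comment> \<open>The step sizes \<open>1/Suc n\<close> are at most 1, so the ball enlarged by
   \<open>norm b\<close> contains the supports of all the quotients.\<close>
 have qB: "norm (q n x) <= B*ind (cball 0 (R + norm b)) x" for n x
 proof (cases "x : cball 0 (R + norm b)")
  case True
  have "\<exists>s. 0 < s & s < 1/real (Suc n) &
    g (x + (1/real (Suc n)) *: b) - g (x + 0 *: b) = (1/real (Suc n) - 0)*g' (x + s *: b) b" using line by (intro MVT2) auto
  then obtain s where s: "g (x + (1/real (Suc n)) *: b) - g x = (1/real (Suc n))*g' (x + s *: b) b" by auto
  have "q n x = g' (x + s *: b) b" unfolding q_def s by simp
  then show ?thesis using B True by simp
 next
  case False
  then have "norm x > R + norm b" by simp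
  moreover have "norm (x + (1/real (Suc n)) *: b) >= norm x - norm b"
  proof -
   have "norm ((1/real (Suc n)) *: b) <= norm b" using mult_left_le_one_le[of "norm b" "1/real (Suc n)"] by simp
   then show ?thesis using norm_diff_ineq[of x "(1/real (Suc n)) *: b"] by simp
  qed
  ultimately have "g x = 0" "g (x + (1/real (Suc n)) *: b) = 0"
   using R[of x] R[of "x + (1/real (Suc n)) *: b"] norm_ge_zero[of b] by linarith+
  then show ?thesis using False by (simp add: q_def)
 qed
 have "(%n. LBINT x. q n x) ~~> (LBINT x. g' x b)"
 proof (rule integral_dominated_convergence[where w="%x. B*ind (cball 0 (R + norm b)) x"])
  show "integrable lborel (%x. B*ind (cball 0 (R + norm b)) x)" using emeasure_bounded_finite[of "cball 0 (R + norm b)"]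
   by (intro integrable_mult_right integrable_real_indicator) (auto simp: bounded_cball)
  show "(%x. g' x b) : bmeas lborel" "!!n. q n : bmeas lborel" unfolding q_def by measurable
  show "AE x in lborel. (%n. q n x) ~~> g' x b" using qlim by simp
  show "AE x in lborel. norm (q n x) <= B*ind (cball 0 (R + norm b)) x" for n using qB by simp
 qed
 moreover have "(LBINT x. q n x) = 0" for n
 proof -
  have "integrable lborel (%x. g (x + (1/real (Suc n)) *: b))"
  proof (rule integrable_bounded_support[where R="R + norm ((1/real (Suc n)) *: b)"])
   show "cont (%x. g (x + (1/real (Suc n)) *: b))" by (intro cont_comp2[OF gc] continuous_intros) auto
   show "g (x + (1/real (Suc n)) *: b) = 0" if "R + norm ((1/real (Suc n)) *: b) < norm x" for x
    using that R norm_diff_ineq[of x "(1/real (Suc n)) *: b"] by auto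
  qed
  then show ?thesis unfolding q_def using gi by (simp add: integral_translate)
 qed
 ultimately show ?thesis by (simp add: LIMSEQ_const_iff)
qed

definition halfspace :: "('a::euclidean_space \<times> real) set" where "halfspace = {y. 0 <= snd y}"

lemma halfspace_borel [measurable]: "halfspace : sets borel" unfolding halfspace_def by (intro borel_closed closed_Collect_le continuous_intros)

text \<open>By Fubini, tangential derivatives integrate to zero on every slice of fixed height, and
  the normal derivative integrates along every vertical line to minus the boundary value.\<close>

theorem halfspace_divergence:
 fixes F :: "'a::euclidean_space \<times> real => 'a \<times> real"
 assumes F: "C1 UNIV F" and R: "!!y. norm y > R ==> F y = 0"
  and d: "!!y. y : halfspace ==> has_div F y (d y)"
 shows "integrable lborel (%y. ind halfspace y*d y)"
  and "(LBINT y. ind halfspace y*d y) = - (LBINT x. F (x, 0) <.> (0, 1))"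
proof -
 obtain F' where F': "!!y. (F has_derivative F' y) (at y)" "!!h. cont (%y. F' y h)" using F unfolding C1_def by auto
 define D where "D b y = F' y b <.> b" for b y
 have deq: "d y = (\<Sum>b\<in>Basis. D b y)" if "y : halfspace" for y
 proof -
  from d[OF that] obtain G where "(F has_derivative G) (at y)" "d y = (\<Sum>b\<in>Basis. G b <.> b)" unfolding has_div_def by blast
  then show ?thesis using has_derivative_unique[OF F'(1)] unfolding D_def by metis
 qed
 have Dc: "cont (D b)" for b unfolding D_def using F'(2) by (intro continuous_intros)
 have Fb: "((%y. F y <.> b) has_derivative (%h. F' y h <.> b)) (at y)" for b y by (intro derivative_intros F')
 have R': "F y <.> b = 0" if "norm y > R" for y b using R[OF that] by simp
 have D0: "D b y = 0" if "norm y > R" for b y unfolding D_def using derivative_zero_outside[OF R' Fb that] .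
 have Di: "integrable lborel (D b)" for b by (rule integrable_bounded_support[OF Dc D0])
 have ind: "integrable lborel (%y. ind halfspace y*D b y)" for b using Lintb_ind[OF _ Di, of halfspace b] by simp
 have eq: "(%y. ind halfspace y*d y) = (%y. \<Sum>b\<in>Basis. ind halfspace y*D b y)"
  by (auto simp: fun_eq_iff indicator_def deq)
 show "integrable lborel (%y. ind halfspace y*d y)" unfolding eq using ind by (rule Lintb_sum)
 have pr: "(LBINT y. f y) = (LINT y|(lborel \<Otimes>\<^sub>M lborel). f y)" for f :: "'a \<times> real => real"
  by (simp add: lborel_prod)
 have tang: "(LBINT y. ind halfspace y*D (b, 0) y) = 0" for b :: 'a
 proof -
  have "(LBINT y. ind halfspace y*D (b, 0) y) = (LBINT t. LBINT x. ind halfspace (x, t)*D (b, 0) (x, t))" unfolding pr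
   using ind[of "(b, 0)"] by (subst lborel_pair.integral_snd) (simp_all only: lborel_prod split_beta' prod.collapse)
  also have "... = (LINT t|(lborel :: real measure). 0)"
  proof (rule Lint_cong)
   fix t :: real
   have *: "(LBINT x. D (b, 0) (x, t)) = 0" unfolding D_def
   proof (rule integral_directional_derivative_eq_0[of "%x. F (x, t) <.> (b, 0)" "%x h. F' (x, t) (h, 0) <.> (b, 0)" b R])
    show "((%x. F (x, t) <.> (b, 0)) has_derivative (%h. F' (x, t) (h, 0) <.> (b, 0))) (at x)" for x
    proof -
     have "((%x. (x, t)) has_derivative (%h. (h, 0))) (at x)" by (intro has_derivative_Pair has_derivative_ident has_derivative_const)
     from has_derivative_compose[OF this Fb] show ?thesis .
    qed
    show "cont (%x. F' (x, t) (b, 0) <.> (b, 0))" by (intro continuous_intros cont_comp2[OF F'(2)]) auto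
    show "F (x, t) <.> (b, 0) = 0" if "norm x > R" for x using that R[of "(x, t)"] norm_fst_le[of x t] by simp
   qed
   show "(LBINT x. ind halfspace (x, t)*D (b, 0) (x, t)) = 0" using * by (cases "0 <= t") (auto simp: halfspace_def)
  qed simp
  finally show ?thesis by simp
 qed
 have normal: "(LBINT y. ind halfspace y*D (0, 1) y) = - (LBINT x. F (x, 0) <.> (0, 1))"
 proof -
  have "(LBINT y. ind halfspace y*D (0, 1) y) = (LBINT x. LBINT t. ind halfspace (x, t)*D (0, 1) (x, t))" unfolding pr
   using ind[of "(0, 1)"] by (subst lborel_pair.integral_fst) (simp_all only: lborel_prod split_beta' prod.collapse)
  also have "... = (LBINT x. - (F (x, 0) <.> (0, 1)))"
  proof (rule Lint_cong)
   fix x :: 'a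
   define T where "T = \<bar>R\<bar> + 1"
   have far: "norm (x, t) > R" if "t >= T" for t using that norm_snd_le[of t x] unfolding T_def by simp
   have "(LBINT t. ind halfspace (x, t)*D (0, 1) (x, t)) = (LBINT t. D (0, 1) (x, t)*ind {0..T} t)"
   proof (rule Lint_cong)
    show "ind halfspace (x, t)*D (0, 1) (x, t) = D (0, 1) (x, t)*ind {0..T} t" for t
     using D0[OF far, of t "(0, 1)"] by (cases "t <= T") (auto simp: indicator_def halfspace_def)
   qed simp
   also have "... = F (x, T) <.> (0, 1) - F (x, 0) <.> (0, 1)"
   proof (rule integral_FTC_Icc_real)
    show "0 <= T" unfolding T_def by simp
    show "((%t. F (x, t) <.> (0, 1)) hrd D (0, 1) (x, t)) (at t)" for t
    proof -
     have "((%t. (x, t)) has_derivative (%h. (0, h))) (at t)" by (intro has_derivative_Pair has_derivative_ident has_derivative_const)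
     from has_derivative_compose[OF this Fb]
     have "((%t. F (x, t) <.> (0, 1)) has_derivative (%h. F' (x, t) (0, h) <.> (0, 1))) (at t)" .
     moreover have "F' (x, t) (0, h) <.> (0, 1) = D (0, 1) (x, t)*h" for h
     proof -
      have "F' (x, t) (0, h) = h *: F' (x, t) (0, 1)" using linear_scale[OF has_derivative_linear[OF F'(1)], of "(x,t)" h "(0, 1)"]
       by (simp only: scaleR_Pair scaleR_zero_right real_scaleR_def mult_1_right)
      then have "F' (x, t) (0, h) <.> (0, 1) = (h *: F' (x, t) (0, 1)) <.> (0, 1)" by (rule arg_cong)
      then show ?thesis unfolding D_def by (simp only: inner_scaleR_left mult.commute)
     qed
     ultimately show ?thesis unfolding has_field_derivative_def by (simp only:)
    qed
    have "cont (%t. D (0, 1) (x, t))" by (intro cont_comp2[OF Dc] continuous_intros) auto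
    then show "isCont (%t. D (0, 1) (x, t)) t" for t by (simp add: continuous_on_eq_continuous_at)
   qed
   also have "F (x, T) = 0" using R far by simp
   finally show "(LBINT t. ind halfspace (x, t)*D (0, 1) (x, t)) = - (F (x, 0) <.> (0, 1))" by simp
  qed simp
  finally show ?thesis by simp
 qed
 have "(LBINT y. ind halfspace y*d y) = (\<Sum>b\<in>Basis. LBINT y. ind halfspace y*D b y)"
  unfolding eq using ind by (rule Lint_sum)
 also have "... = - (LBINT x. F (x, 0) <.> (0, 1))"
 proof -
  have "(\<Sum>b\<in>(Basis :: ('a \<times> real) set). g b) = (\<Sum>b\<in>Basis. g (b, 0)) + g (0, 1)" for g :: "'a \<times> real => real"
   unfolding Basis_prod_def by (subst sum.union_disjoint) (auto simp: sum.reindex inj_on_def)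
  then show ?thesis by (simp only: tang normal sum.neutral_const)
 qed
 finally show "(LBINT y. ind halfspace y*d y) = - (LBINT x. F (x, 0) <.> (0, 1))" .
qed

text \<open>For \<open>v = w u\<close> with \<open>w = exp (ta (ka rho - ln rho))\<close> and
  \<open>k = 1/rho\<close>, the conjugated Laplacian \<open>w Delta (v/w)\<close> is the sum of
  \<open>L + p v\<close> and \<open>4 ta (k - ka) e + q v\<close>, where \<open>L\<close> is the
  Laplacian of \<open>v\<close>, \<open>e\<close> its radial derivative, \<open>s\<close> its
  squared gradient and \<open>hs\<close> the Hessian paired with \<open>y - y0\<close> and the
  gradient. The zero-order term is divided between \<open>p\<close> and \<open>q\<close> in the one
  way that makes all \<open>s\<close> cancel in the large bracket, which is a divergence; outside it
  remain a square in \<open>e\<close> and a multiple of \<open>v^2\<close>. The coefficient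
  \<open>m\<close> is chosen to match the terms in \<open>v e\<close>, and \<open>m'\<close> is
  \<open>2 rho\<close> times the derivative of \<open>m\<close> in \<open>rho\<close>.\<close>

lemma carleman_algebra:
 fixes k rh ka ta D e s L v hs :: real
 assumes "k*rh = 1"
 defines "p \<equiv> 4*ta^2*(ka^2*rh - 2*ka + k) + 4*ta*(k - ka)"
  and "q \<equiv> ta*((2*D - 8)*k + (4 - 2*D)*ka)"
  and "m \<equiv> 16*ta^3*(k^2 - 3*ka*k + 3*ka^2 - ka^3*rh) + 16*ta^2*(k - ka)^2 - 4*ta*(D - 4)*k^2"
  and "m' \<equiv> 16*ta^3*(- 4*k^2 + 6*ka*k - 2*ka^3*rh) - 64*ta^2*(k - ka)*k + 16*ta*(D - 4)*k^2"
 shows "2*(L + p* v)*(4*ta*(k - ka)*e + q* v) =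
   ((- 16*ta*k^2*e^2 + 8*ta*(k - ka)*(s + hs) + 8*ta*(k - ka)*e*L)
   + (8*ta*k* s - 8*ta*(k - ka)*hs - 4*ta*(k - ka)*D* s) + (- 4*ta*(2*D - 8)*k^2* v * e + 2*q* s + 2*q* v * L)
   + (m'* v^2 + 2*m* v * e + m* v^2*D)) + 16*ta*k^2*(e + (D - 4)/2* v)^2
   + (64*ta^3*ka*(ka^2*rh - 2*ka + k) + 32*ta^2*ka*(k - ka))* v^2"
proof -
 have *: "rh = inverse k" using assms(1) by (metis inverse_unique mult.commute)
 have [simp]: "k ~= 0" using assms(1) by auto
 show ?thesis unfolding p_def q_def m_def m'_def * by (simp add: power2_eq_square power3_eq_cube field_simps)
qed

lemma derivative_zero_on_open:
 assumes "(g has_derivative g') (at x)" "open S" "x : S" "!!y. y : S ==> g y = 0"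
 shows "g' h = 0"
proof -
 have "(g has_derivative (%_. 0)) (at x)" by (rule has_derivative_transform_within_open[OF has_derivative_const[of 0]]) (use assms in auto)
 then show ?thesis using has_derivative_unique[OF assms(1)] by metis
qed

lemma continuous_on_puncture:
 fixes f :: "'b::euclidean_space => 'c::real_normed_vector"
 assumes "continuous_on (- {y0}) f" "r > 0" "!!y. (y - y0) <.> (y - y0) < r ==> f y = 0"
 shows "cont f"
proof -
 let ?S = "{y. (y - y0) <.> (y - y0) < r}"
 have "continuous_on ?S f" by (rule continuous_on_eq[OF continuous_on_const[of _ 0]]) (simp add: assms(3))
 moreover have "open ?S" by (intro open_Collect_less continuous_intros)
 ultimately have "continuous_on (- {y0} \<union> ?S) f" using assms(1) by (intro continuous_on_open_Un) auto
 also have "- {y0} \<union> ?S = UNIV" using \<open>r > 0\<close> by auto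
 finally show ?thesis .
qed

text \<open>From \<open>(A + B)^2 >= 2 A B\<close> with the two parts \<open>A\<close>,
  \<open>B\<close> of \<open>carleman_algebra\<close>: after integration the divergence becomes the
  boundary term, the square in the radial derivative is dropped, and the term in \<open>v^2\<close>
  of order \<open>ta^3\<close> is kept.\<close>

lemma carleman_conjugated:
 fixes v :: "'a::euclidean_space \<times> real => real" and y0 :: "'a \<times> real"
 defines "rh \<equiv> %y. (y - y0) <.> (y - y0)"
 defines "k \<equiv> %y. 1/rh y"
 defines "D \<equiv> real DIM('a \<times> real)"
 assumes v: "c2 v G H" and r: "r > 0" "!!y. rh y < r ==> v y = 0"
  and R: "!!y. norm y > R ==> v y = 0" and bd: "!!x. v (x, 0) = 0"
  and pos: "ta > 0" "ka > 0" "!!y. v y ~= 0 ==> ka*rh y <= 1"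
 defines "p \<equiv> %y. 4*ta^2*(ka^2*rh y - 2*ka + k y) + 4*ta*(k y - ka)"
  and "q \<equiv> %y. ta*((2*D - 8)*k y + (4 - 2*D)*ka)"
 defines "P \<equiv> %y. lap H y + 4*ta*(k y - ka)*(G y <.> (y - y0)) + (p y + q y)* v y"
  and "W \<equiv> %y. 64*ta^3*ka*(ka^2*rh y - 2*ka + k y)*(v y)^2"
 shows "integrable lborel (%y. ind halfspace y*W y)"
  and "(LBINT y. ind halfspace y*W y) + 4*ta* snd y0*(LBINT x. (k (x, 0) - ka)*(G (x, 0) <.> (0, 1))^2)
   <= (LBINT y. ind halfspace y*(P y)^2)"
proof -
 let ?S = "{y. rh y < r}"
 have oS: "open ?S" unfolding rh_def by (intro open_Collect_less continuous_intros)
 have G0: "G y = 0" if "rh y < r" for y using derivative_zero_on_open[OF c2D(1)[OF v] oS, of y "G y"] that r(2) by simp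
 have GR: "G y = 0" if "norm y > R" for y using derivative_zero_outside[OF R c2D(1)[OF v] that, of "G y"] by simp
 have HR: "H y h = 0" if "norm y > R" for y h using derivative_zero_outside[OF GR c2D(2)[OF v] that, of h] by simp
 have rhpos: "rh y > 0" if "y ~= y0" for y using that unfolding rh_def by simp
 define m where "m = (%y. 16*ta^3*((k y)^2 - 3*ka*k y + 3*ka^2 - ka^3*rh y)
   + 16*ta^2*(k y - ka)^2 - 4*ta*(D - 4)*(k y)^2)"
 define m' where "m' = (%y. 16*ta^3*(- 4*(k y)^2 + 6*ka*k y - 2*ka^3*rh y)
   - 64*ta^2*(k y - ka)*k y + 16*ta*(D - 4)*(k y)^2)"
 define e where "e = (%y. G y <.> (y - y0))"
 define s where "s = (%y. G y <.> G y)"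
 define hs where "hs = (%y. H y (y - y0) <.> G y)"
 \<comment> \<open>In this order the four fields produce the product of \<open>e\<close> with the
   Laplacian, the compensation of \<open>hs\<close>, the product of \<open>q v\<close> with the
   Laplacian, and the terms in \<open>v e\<close>.\<close>
 define F where "F = (%y. (8*ta*(k y - ka)*e y) *: G y + (- 4*ta*(k y - ka)* s y) *: (y - y0)
   + ((2*q y* v y) *: G y + (m y*(v y)^2) *: (y - y0)))"
 define d where "d = (%y. (- 16*ta*(k y)^2*(e y)^2 + 8*ta*(k y - ka)*(s y + hs y) + 8*ta*(k y - ka)*e y*lap H y)
   + (8*ta*k y* s y - 8*ta*(k y - ka)*hs y - 4*ta*(k y - ka)*D* s y)
   + ((- 4*ta*(2*D - 8)*(k y)^2* v y*e y + 2*q y* s y + 2*q y* v y*lap H y)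
   + (m' y*(v y)^2 + 2*m y* v y*e y + m y*(v y)^2*D)))"
 have rhd: "(rh has_derivative (%h. 2*((y - y0) <.> h))) (at y)" for y
  unfolding rh_def by (rule derivative_eq_intros refl)+ (simp add: inner_commute[of _ "y - y0"])
 have kd: "(k has_derivative (%h. - 2*(k y)^2*((y - y0) <.> h))) (at y)" if "y ~= y0" for y
 proof -
  have "((%r. 1/r) hrd - (1/r^2)) (at r)" if "r ~= 0" for r :: real
   using that by (auto intro!: derivative_eq_intros simp: power2_eq_square)
  from this[of "rh y"] rhpos[OF that]
  have "((%r. 1/r) has_derivative (%h. - (1/(rh y)^2)*h)) (at (rh y))"
   unfolding has_field_derivative_def by (auto elim!: has_derivative_eq_rhs)
  from has_derivative_compose[OF rhd this] show ?thesis unfolding k_def by (simp add: power_divide mult_ac)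
 qed
 have ed: "(e has_derivative (%h. (G y + H y (y - y0)) <.> h)) (at y)" for y unfolding e_def
  by (rule derivative_eq_intros c2D(2)[OF v] refl)+ (simp add: fun_eq_iff inner_add_left c2D(3)[OF v, of y _ "y - y0"] inner_commute[of "H y (y - y0)"])
 have sd: "(s has_derivative (%h. 2*(H y (G y) <.> h))) (at y)" for y unfolding s_def by (rule c2_power2_grad[OF v])
 note vd = c2D(1)[OF v]
 have div: "has_div F y (d y)" for y
 proof (cases "rh y < r")
  case True
  have "(F has_derivative (%_. 0)) (at y)"
  proof (rule has_derivative_transform_within_open[OF has_derivative_const[of 0] oS])
   show "y : ?S" using True by simp
   show "0 = F y" if "y : ?S" for y using that G0[of y] r(2)[of y] by (simp add: F_def e_def s_def)
  qed
  moreover have "d y = 0" using True G0[of y] r(2)[of y] by (simp add: d_def e_def s_def hs_def)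
  ultimately show ?thesis unfolding has_div_def by (intro exI[of _ "%_. 0"]) simp
 next
  case False
  then have y: "y ~= y0" using r(1) by (auto simp: rh_def)
  note kd' = kd[OF y]
  have krh: "k y*rh y = 1" using rhpos[OF y] by (simp add: k_def)
  have yy: "(y - y0) <.> (y - y0) = rh y" by (simp add: rh_def)
  have t1: "has_div (%y. (8*ta*(k y - ka)*e y) *: G y) y
   (((8*ta*(- 2*(k y)^2)*e y) *: (y - y0) + (8*ta*(k y - ka)) *: (G y + H y (y - y0))) <.> G y
    + 8*ta*(k y - ka)*e y*lap H y)" by (intro has_div_scale has_div_grad[OF v])
     (rule derivative_eq_intros kd' ed refl | simp add: inner_simps algebra_simps)+
  have t2: "has_div (%y. (- 4*ta*(k y - ka)* s y) *: (y - y0)) y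
   (((- 4*ta*(- 2*(k y)^2)* s y) *: (y - y0) + (- 4*ta*(k y - ka)*2) *: (H y (G y))) <.> (y - y0)
    + - 4*ta*(k y - ka)* s y*D)" unfolding D_def by (intro has_div_scale has_div_id)
     (rule derivative_eq_intros kd' sd refl | simp add: inner_simps algebra_simps)+
  have t3: "has_div (%y. (2*q y* v y) *: G y) y
   (((2*ta*(2*D - 8)*(- 2*(k y)^2)* v y) *: (y - y0) + (2*q y) *: G y) <.> G y + 2*q y* v y*lap H y)"
   unfolding q_def by (intro has_div_scale has_div_grad[OF v]) (rule derivative_eq_intros kd' vd refl | simp add: inner_simps algebra_simps)+
  have t4: "has_div (%y. (m y*(v y)^2) *: (y - y0)) y (((16*ta^3*(- 4*(k y)^3 + 6*ka*(k y)^2 - 2*ka^3)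
     - 64*ta^2*(k y - ka)*(k y)^2 + 16*ta*(D - 4)*(k y)^3)*(v y)^2) *: (y - y0) <.> (y - y0)
    + (2*m y* v y) *: G y <.> (y - y0) + m y*(v y)^2*D)" unfolding m_def D_def inner_add_left[symmetric]
   by (intro has_div_scale has_div_id) (rule derivative_eq_intros kd' rhd vd refl | simp add: inner_simps algebra_simps power2_eq_square power3_eq_cube)+
  have k3: "(k y)^3*rh y = (k y)^2" "(k y)^2*rh y = k y" using krh by (simp_all add: power2_eq_square power3_eq_cube mult.assoc)
  have hs': "H y (G y) <.> (y - y0) = hs y" unfolding hs_def using c2D(3)[OF v, of y "G y" "y - y0"] by (simp add: inner_commute)
  have e': "(y - y0) <.> G y = e y" by (simp add: e_def inner_commute)
  have c1: "((8*ta*(- 2*(k y)^2)*e y) *: (y - y0) + (8*ta*(k y - ka)) *: (G y + H y (y - y0))) <.> G y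
    + 8*ta*(k y - ka)*e y*lap H y
   = - 16*ta*(k y)^2*(e y)^2 + 8*ta*(k y - ka)*(s y + hs y) + 8*ta*(k y - ka)*e y*lap H y"
   unfolding inner_add_left inner_scaleR_left e' s_def[symmetric] hs_def[symmetric] by (simp add: s_def hs_def power2_eq_square)
  have c2: "((- 4*ta*(- 2*(k y)^2)* s y) *: (y - y0) + (- 4*ta*(k y - ka)*2) *: (H y (G y))) <.> (y - y0)
    + - 4*ta*(k y - ka)* s y*D = 8*ta*k y* s y - 8*ta*(k y - ka)*hs y - 4*ta*(k y - ka)*D* s y"
  proof -
   have "- 4*ta*(- 2*(k y)^2)* s y*rh y = 8*ta*((k y)^2*rh y)* s y" by simp
   then show ?thesis unfolding inner_add_left inner_scaleR_left hs' yy k3 by simp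
  qed
  have c3: "((2*ta*(2*D - 8)*(- 2*(k y)^2)* v y) *: (y - y0) + (2*q y) *: G y) <.> G y + 2*q y* v y*lap H y
   = - 4*ta*(2*D - 8)*(k y)^2* v y*e y + 2*q y* s y + 2*q y* v y*lap H y"
   unfolding inner_add_left inner_scaleR_left e' s_def[symmetric] by (simp add: s_def)
  have c4: "((16*ta^3*(- 4*(k y)^3 + 6*ka*(k y)^2 - 2*ka^3)
     - 64*ta^2*(k y - ka)*(k y)^2 + 16*ta*(D - 4)*(k y)^3)*(v y)^2) *: (y - y0) <.> (y - y0)
    + (2*m y* v y) *: G y <.> (y - y0) + m y*(v y)^2*D = m' y*(v y)^2 + 2*m y* v y*e y + m y*(v y)^2*D"
  proof -
   have "(16*ta^3*(- 4*(k y)^3 + 6*ka*(k y)^2 - 2*ka^3)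
     - 64*ta^2*(k y - ka)*(k y)^2 + 16*ta*(D - 4)*(k y)^3)*rh y =
    16*ta^3*(- 4*((k y)^3*rh y) + 6*ka*((k y)^2*rh y) - 2*ka^3*rh y)
     - 64*ta^2*(k y - ka)*((k y)^2*rh y) + 16*ta*(D - 4)*((k y)^3*rh y)" by (simp add: algebra_simps)
   also have "... = m' y" unfolding k3 m'_def ..
   finally show ?thesis unfolding inner_scaleR_left yy e_def[symmetric] by (simp add: e_def mult_ac)
  qed
  show ?thesis unfolding F_def d_def by (intro has_div_add t1[unfolded c1] t2[unfolded c2] t3[unfolded c3] t4[unfolded c4])
 qed
 have C1F: "C1 UNIV F"
 proof -
  have C1k: "C1 (- {y0}) k" unfolding k_def rh_def by (rule C1_radial_rat)
  have C1r: "C1 (- {y0}) rh" unfolding rh_def by (intro C1_inner C1_id)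
  note C1v = C1_c2[OF v]
  have sub: "C1 (- {y0}) (%y. f y - c)" if "C1 (- {y0}) f" for f :: "'a \<times> real => real" and c
   using C1_add[OF that C1_const[of _ "- c"]] by simp
  have C1e: "C1 (- {y0}) e" "C1 (- {y0}) s" unfolding e_def s_def by (intro C1_inner C1_id C1v)+
  have C1q: "C1 (- {y0}) q" unfolding q_def by (intro C1_mult C1_add C1_const C1k)
  have C1m: "C1 (- {y0}) m"
  proof -
   have "m = (%y. 16*ta^3*(k y*k y + (- 3*ka*k y + (3*ka^2 + (- (ka^3))*rh y)))
    + (16*ta^2*((k y - ka)*(k y - ka)) + - 4*ta*(D - 4)*(k y*k y)))" unfolding m_def by (auto simp: fun_eq_iff power2_eq_square)
   then show ?thesis by (simp only:) (intro C1_mult C1_add C1_const C1k C1r sub)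
  qed
  have "C1 (- {y0}) F" unfolding F_def power2_eq_square by (intro C1_add C1_scaleR C1_mult C1_const C1v C1e C1q C1m C1_id C1k sub)
  moreover have "C1 ?S F" unfolding C1_def
  proof (intro exI[of _ "%_ _. 0"] conjI ballI allI)
   fix y assume "y : ?S"
   show "(F has_derivative (%_. 0)) (at y)"
   proof (rule has_derivative_transform_within_open[OF has_derivative_const[of 0] oS \<open>y : ?S\<close>])
    show "0 = F y" if "y : ?S" for y using that G0[of y] r(2)[of y] by (simp add: F_def e_def s_def)
   qed
  qed auto
  ultimately have "C1 (- {y0} \<union> ?S) F" using oS by (intro C1_UN) auto
  also have "- {y0} \<union> ?S = UNIV" using r(1) by (auto simp: rh_def)
  finally show ?thesis .
 qed
 have FR: "F y = 0" if "norm y > R" for y using R[OF that] GR[OF that] by (simp add: F_def e_def s_def)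
 note hd = halfspace_divergence[OF C1F FR div]
 have kc: "continuous_on (- {y0}) k" unfolding k_def rh_def by (intro continuous_intros) auto
 have rc: "continuous_on (- {y0}) rh" unfolding rh_def by (intro continuous_intros)
 have vc: "continuous_on (- {y0}) v" "continuous_on (- {y0}) G" using c2_cont[OF v] by (auto intro: continuous_on_subset)
 have Wc: "cont W"
 proof (rule continuous_on_puncture)
  show "continuous_on (- {y0}) W" unfolding W_def by (intro continuous_intros kc rc vc)
  show "W y = 0" if "(y - y0) <.> (y - y0) < r" for y using r(2)[of y] that by (simp add: W_def rh_def)
 qed (rule r(1))
 have Wi: "integrable lborel W" using Wc by (rule integrable_bounded_support[where R=R]) (simp add: W_def R)
 show Wi': "integrable lborel (%y. ind halfspace y*W y)" using Lintb_ind[OF _ Wi, of halfspace] by simp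
 have Pc: "cont P"
 proof -
  have "cont (%y. 4*ta*(k y - ka)*(G y <.> (y - y0)) + (p y + q y)* v y)"
  proof (rule continuous_on_puncture)
   show "continuous_on (- {y0}) (%y. 4*ta*(k y - ka)*(G y <.> (y - y0)) + (p y + q y)* v y)"
    unfolding p_def q_def by (intro continuous_intros kc rc vc)
   show "4*ta*(k y - ka)*(G y <.> (y - y0)) + (p y + q y)* v y = 0" if "(y - y0) <.> (y - y0) < r" for y
    using r(2)[of y] G0[of y] that by (simp add: rh_def)
  qed (rule r(1))
  from continuous_on_add[OF c2_cont(3)[OF v] this] show ?thesis unfolding P_def by (simp add: add.assoc)
 qed
 have Pi: "integrable lborel (%y. (P y)^2)" by (rule integrable_bounded_support[where R=R])
    (use Pc in \<open>auto intro!: continuous_intros simp: P_def R GR HR lap_def\<close>)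
 have Pi': "integrable lborel (%y. ind halfspace y*(P y)^2)" using Lintb_ind[OF _ Pi, of halfspace] by simp
 have pw: "d y + W y <= (P y)^2" for y
 proof (cases "rh y < r")
  case True
  then show ?thesis using G0[of y] r(2)[of y] by (simp add: d_def W_def e_def s_def hs_def)
 next
  case False
  then have y: "y ~= y0" using r(1) by (auto simp: rh_def)
  have krh: "k y*rh y = 1" using rhpos[OF y] by (simp add: k_def)
  define A where "A = lap H y + p y* v y"
  define B where "B = 4*ta*(k y - ka)*e y + q y* v y"
  have "P y = A + B" unfolding P_def A_def B_def e_def by (simp add: algebra_simps)
  moreover have "(A + B)^2 >= 2*A*B" using sum_squares_ge_zero[of A B] by (simp add: power2_eq_square algebra_simps)
  moreover have "2*A*B = d y + 16*ta*(k y)^2*(e y + (D - 4)/2* v y)^2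
    + (64*ta^3*ka*(ka^2*rh y - 2*ka + k y) + 32*ta^2*ka*(k y - ka))*(v y)^2"
   unfolding A_def B_def p_def q_def d_def m_def m'_def using carleman_algebra[OF krh, of "lap H y" ta ka "v y" "e y" D "s y" "hs y"]
   by (simp add: algebra_simps)
  moreover have "16*ta*(k y)^2*(e y + (D - 4)/2* v y)^2 >= 0" using pos by simp
  \<comment> \<open>Here the condition on the support enters: \<open>ka rho <= 1\<close> means
    \<open>ka <= k\<close>.\<close>
  moreover have "32*ta^2*ka*(k y - ka)*(v y)^2 >= 0"
  proof (cases "v y = 0")
   case False
   then have "ka <= k y" using pos(3)[of y] rhpos[OF y] by (simp add: k_def field_simps)
   then show ?thesis using pos by simp
  qed simp
  ultimately show ?thesis unfolding W_def by (simp add: algebra_simps)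
 qed
 have "(LBINT y. ind halfspace y*d y) + (LBINT y. ind halfspace y*W y)
   = (LBINT y. ind halfspace y*d y + ind halfspace y*W y)" using hd(1) Wi' by (rule Lint_add[symmetric])
 also have "... <= (LBINT y. ind halfspace y*(P y)^2)"
 proof (rule integral_mono)
  show "integrable lborel (%y. ind halfspace y*d y + ind halfspace y*W y)"
   using hd(1) Wi' by (rule Lintb_add)
  show "ind halfspace y*d y + ind halfspace y*W y <= ind halfspace y*(P y)^2" for y
   using pw[of y] by (simp add: indicator_def)
 qed (rule Pi')
 also have "(LBINT y. ind halfspace y*d y) = - (LBINT x. F (x, 0) <.> (0, 1))" by (rule hd(2))
 also have "... = 4*ta* snd y0*(LBINT x. (k (x, 0) - ka)*(G (x, 0) <.> (0, 1))^2)"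
 proof -
  have "F (x, 0) <.> (0, 1) = - (4*ta* snd y0)*((k (x, 0) - ka)*(G (x, 0) <.> (0, 1))^2)" for x
  proof -
   \<comment> \<open>Differentiating \<open>v (x, 0) = 0\<close> along the boundary leaves only the
     normal component of the gradient, so the boundary terms collapse to its square with a
     coefficient proportional to \<open>snd y0\<close>.\<close>
   have "fst (G (x, 0)) = 0"
   proof -
    have "((%x. (x, 0)) has_derivative (%h. (h, 0::real))) (at x)" by (intro has_derivative_Pair has_derivative_ident has_derivative_const)
    from has_derivative_compose[OF this vd]
    have "((%x. v (x, 0)) has_derivative (%h. G (x, 0) <.> (h, 0))) (at x)" .
    moreover have "((%x. v (x, 0)) has_derivative (%h. 0)) (at x)" unfolding bd by simp
    ultimately have "(%h. G (x, 0) <.> (h, 0)) = (%h. 0)" by (rule has_derivative_unique)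
    from fun_cong[OF this, of "fst (G (x, 0))"] show ?thesis by (simp add: inner_prod_def)
   qed
   then obtain g where g: "G (x, 0) = (0, g)" by (metis prod.collapse)
   show ?thesis unfolding F_def e_def s_def g bd by (simp add: inner_prod_def power2_eq_square algebra_simps)
  qed
  then show ?thesis by simp
 qed
 finally show "(LBINT y. ind halfspace y*W y) + 4*ta* snd y0*(LBINT x. (k (x, 0) - ka)*(G (x, 0) <.> (0, 1))^2)
   <= (LBINT y. ind halfspace y*(P y)^2)" by simp
qed

section \<open>The Carleman inequality with a weight made C2 at its centre\<close>

lemma DERIV_glue:
 fixes f g :: "real => real"
 assumes "!!s. s <= r ==> (f hrd f' s) (at s)"
  "!!s. r <= s ==> (g hrd g' s) (at s)" "f r = g r" "f' r = g' r"
 shows "((%s. if s < r then f s else g s) hrd (if s < r then f' s else g' s)) (at s)"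
proof -
 consider "s < r" | "s > r" | "s = r" by linarith
 then show ?thesis
 proof cases
  case 1
  have "(f hrd f' s) (at s)" using assms(1) 1 by simp
  then have "((%s. if s < r then f s else g s) hrd f' s) (at s)"
   by (rule hrd_transform[where S="{..<r}"]) (use 1 in auto)
  then show ?thesis using 1 by simp
 next
  case 2
  have "(g hrd g' s) (at s)" using assms(2) 2 by simp
  then have "((%s. if s < r then f s else g s) hrd g' s) (at s)"
   by (rule hrd_transform[where S="{r<..}"]) (use 2 in auto)
  then show ?thesis using 2 by simp
 next
  case 3
  have "((%s. if s < r then f s else g s) hrd g' r) (at r within {..r})"
   by (rule has_field_derivative_transform_within[where f=f and d=1]) (use assms(3) DERIV_subset[OF assms(1)[of r]] assms(4) in auto)
  moreover have "((%s. if s < r then f s else g s) hrd g' r) (at r within {r..})"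
   by (rule has_field_derivative_transform_within[where f=g and d=1]) (use DERIV_subset[OF assms(2)[of r]] in auto)
  ultimately have "((%s. if s < r then f s else g s) hrd g' r) (at r within {..r} \<union> {r..})"
   unfolding has_field_derivative_iff by (rule Lim_Un)
  moreover have "{..r} \<union> {r..} = (UNIV :: real set)" by auto
  ultimately show ?thesis using 3 by simp
 qed
qed

lemma continuous_glue:
 fixes f g :: "real => real"
 assumes "continuous_on {..r} f" "continuous_on {r..} g" "f r = g r"
 shows "cont (%s. if s < r then f s else g s)"
proof -
 have "continuous_on ({..r} \<union> {r..}) (%s. if s < r then f s else g s)"
 proof (rule continuous_on_closed_Un)
  show "continuous_on {..r} (%s. if s < r then f s else g s)" by (rule continuous_on_eq[OF assms(1)]) (use assms(3) in auto)
  show "continuous_on {r..} (%s. if s < r then f s else g s)" by (rule continuous_on_eq[OF assms(2)]) auto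
 qed auto
 moreover have "{..r} \<union> {r..} = (UNIV :: real set)" by auto
 ultimately show ?thesis by simp
qed

text \<open>The quadratic Taylor polynomial at \<open>r\<close> continues the logarithm, so that the Carleman weight
 becomes a C2 function on the whole space.\<close>

definition glog :: "real => real => real" where
 "glog r s = (if s < r then ln r + (s - r)/r - (s - r)^2/(2*r^2) else ln s)"
definition glog' :: "real => real => real" where "glog' r s = (if s < r then 1/r - (s - r)/r^2 else 1/s)"
definition glog'' :: "real => real => real" where "glog'' r s = (if s < r then - 1/r^2 else - 1/s^2)"

lemma glog_DERIV:
 assumes "r > 0"
 shows "(glog r hrd glog' r s) (at s)" "(glog' r hrd glog'' r s) (at s)" "cont (glog'' r)"
proof -
 show "(glog r hrd glog' r s) (at s)" unfolding glog_def[abs_def] glog'_def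
  by (rule DERIV_glue) (use assms in \<open>auto intro!: derivative_eq_intros simp: field_simps power2_eq_square\<close>)
 show "(glog' r hrd glog'' r s) (at s)" unfolding glog'_def[abs_def] glog''_def
  by (rule DERIV_glue) (use assms in \<open>auto intro!: derivative_eq_intros simp: field_simps power2_eq_square\<close>)
 show "cont (glog'' r)" unfolding glog''_def[abs_def]
  by (rule continuous_glue) (use assms in \<open>auto intro!: continuous_intros\<close>)
qed

definition carl_weight :: "real => real => real => real" where "carl_weight ta ka s = exp (2*ta*(ka* s - ln s))"

text \<open>Up to the factor \<open>2 ta\<close>, the exponent has derivative
  \<open>ka - 1/s\<close>, which is negative for \<open>ka s < 1\<close>; the inequality
  \<open>ln x <= x - 1\<close> replaces the integration.\<close>

lemma carl_weight_mono:
 assumes "0 < s" "s <= t" "ka*t <= 1" "ta >= 0"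
 shows "carl_weight ta ka t <= carl_weight ta ka s"
proof -
 have "ln (t/s) >= 1 - s/t" using ln_le_minus_one[of "s/t"] assms by (simp add: ln_div)
 also have "1 - s/t = (t - s)/t" using assms by (simp add: field_simps)
 also have "(t - s)/t >= ka*(t - s)"
 proof -
  have "ka <= 1/t" using assms by (simp add: field_simps)
  then show ?thesis using mult_right_mono[of ka "1/t" "t - s"] assms by simp
 qed
 finally have "ka*t - ln t <= ka* s - ln s" using assms by (simp add: ln_div algebra_simps)
 then show ?thesis using assms unfolding carl_weight_def by (auto intro!: mult_left_mono)
qed

text \<open>Since \<open>u\<close> vanishes for \<open>rho < r\<close>, the weight may be changed
  there: with \<open>glog\<close> in place of \<open>ln\<close>, the product of \<open>u\<close> and
  the weight is C2 on the whole space and the conjugated inequality applies to it. Its coefficient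
  is then bounded below by a constant.\<close>

theorem carleman:
 fixes u :: "'a::euclidean_space \<times> real => real" and y0 :: "'a \<times> real"
 defines "rh \<equiv> %y. (y - y0) <.> (y - y0)"
 assumes u: "c2 u G H" and r: "r > 0" "!!y. rh y < r ==> u y = 0"
  and R: "!!y. norm y > R ==> u y = 0" and bd: "!!x. u (x, 0) = 0"
  and pos: "ta > 0" "ka > 0" "!!y. u y ~= 0 ==> ka*rh y <= 1/2"
 defines "E \<equiv> %y. carl_weight ta ka (rh y)"
 shows "integrable lborel (%y. ind halfspace y*(E y*(u y)^2))"
  and "integrable lborel (%y. ind halfspace y*(E y*(lap H y)^2))"
  and "32*ta^3*ka^2*(LBINT y. ind halfspace y*(E y*(u y)^2))
    + 4*ta* snd y0*(LBINT x. (1/rh (x, 0) - ka)*(E (x, 0)*(G (x, 0) <.> (0, 1))^2))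
   <= (LBINT y. ind halfspace y*(E y*(lap H y)^2))"
proof -
 define f where "f s = exp (ta*(ka* s - glog r s))" for s
 define f' where "f' s = ta*(ka - glog' r s)*f s" for s
 define f'' where "f'' s = (ta^2*(ka - glog' r s)^2 - ta*glog'' r s)*f s" for s
 note gl = glog_DERIV[OF r(1)]
 have fd: "(f hrd f' s) (at s)" for s unfolding f_def[abs_def] f'_def by (auto intro!: derivative_eq_intros gl(1))
 have fd': "(f' hrd f'' s) (at s)" for s unfolding f'_def[abs_def] f''_def
  by (auto intro!: derivative_eq_intros gl(2) fd simp: f'_def power2_eq_square algebra_simps)
 have fc: "cont f''" unfolding f''_def[abs_def]
 proof (intro continuous_intros gl(3))
  show "cont (glog' r)" "cont f" using gl(2) fd by (meson DERIV_continuous cont_atI)+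
 qed
 define w where "w = (%y. f (rh y))"
 define Gw where "Gw = (%y. (2*f' (rh y)) *: (y - y0))"
 define Hw where "Hw = (%y h. (4*f'' (rh y)*((y - y0) <.> h)) *: (y - y0) + (2*f' (rh y)) *: h)"
 have w: "c2 w Gw Hw" unfolding w_def Gw_def Hw_def rh_def by (rule c2_radial[OF fd fd' fc])
 have lw: "lap Hw y = 4*f'' (rh y)*rh y + 2*f' (rh y)*real DIM('a \<times> real)" for y unfolding Hw_def lap_radial by (simp add: rh_def)
 define v where "v = (%y. u y*w y)"
 define Gv where "Gv = (%y. u y *: Gw y + w y *: G y)"
 define Hv where "Hv = (%y h. u y *: Hw y h + (G y <.> h) *: Gw y + (w y *: H y h + (Gw y <.> h) *: G y))"
 have v: "c2 v Gv Hv" unfolding v_def Gv_def Hv_def by (rule c2_mult[OF u w])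
 have lv: "lap Hv y = u y*lap Hw y + w y*lap H y + 2*(G y <.> Gw y)" for y unfolding Hv_def by (rule lap_mult)
 let ?S = "{y. rh y < r}"
 have oS: "open ?S" unfolding rh_def by (intro open_Collect_less continuous_intros)
 have G0: "G y = 0" if "rh y < r" for y using derivative_zero_on_open[OF c2D(1)[OF u] oS, of y "G y"] that r(2) by simp
 have H0: "H y h = 0" if "rh y < r" for y h using derivative_zero_on_open[OF c2D(2)[OF u] oS, of y h] that G0 by simp
 have GR: "G y = 0" if "norm y > R" for y using derivative_zero_outside[OF R c2D(1)[OF u] that, of "G y"] by simp
 have HR: "H y h = 0" if "norm y > R" for y h using derivative_zero_outside[OF GR c2D(2)[OF u] that, of h] by simp
 have wE: "(w y)^2 = E y" if "\<not> rh y < r" for y using that unfolding w_def f_def E_def carl_weight_def glog_def exp_double[symmetric]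
  by (simp add: mult.assoc)
 define D where "D = real DIM('a \<times> real)"
 \<comment> \<open>For \<open>rho >= r\<close> the conjugated operator applied to
   \<open>v = w u\<close> gives back \<open>w\<close> times the Laplacian of \<open>u\<close>; for
   \<open>rho < r\<close> both sides are zero.\<close>
 have P: "lap Hv y + 4*ta*(1/rh y - ka)*(Gv y <.> (y - y0))
   + (4*ta^2*(ka^2*rh y - 2*ka + 1/rh y) + 4*ta*(1/rh y - ka)
    + ta*((2*D - 8)*(1/rh y) + (4 - 2*D)*ka))* v y = w y*lap H y" for y
 proof (cases "rh y < r")
  case True
  then show ?thesis unfolding lv using G0[of y] H0[of y] r(2)[of y] by (simp add: v_def Gv_def lap_def)
 next
  case False
  define s where "s = rh y"
  have s: "s > 0" "glog' r s = 1/s" "glog'' r s = - 1/s^2" using False r(1) by (auto simp: s_def glog'_def glog''_def)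
  have e: "Gv y <.> (y - y0) = u y*(2*f' s)* s + w y*(G y <.> (y - y0))"
   unfolding Gv_def Gw_def by (simp add: inner_add_left s_def rh_def)
  have g: "G y <.> Gw y = 2*f' s*(G y <.> (y - y0))" unfolding Gw_def s_def by simp
  have w: "w y = f s" by (simp add: w_def s_def)
  show ?thesis unfolding lv lw e g v_def D_def[symmetric] s_def[symmetric] w f'_def f''_def s(2,3) using s(1) by (simp add: field_simps power2_eq_square)
 qed
 have car: "integrable lborel (%y. ind halfspace y*(64*ta^3*ka*(ka^2*rh y - 2*ka + 1/rh y)*(v y)^2))"
  "(LBINT y. ind halfspace y*(64*ta^3*ka*(ka^2*rh y - 2*ka + 1/rh y)*(v y)^2))
   + 4*ta* snd y0*(LBINT x. (1/rh (x, 0) - ka)*(Gv (x, 0) <.> (0, 1))^2)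
   <= (LBINT y. ind halfspace y*(w y*lap H y)^2)"
 proof -
  have 1: "!!y. (y - y0) <.> (y - y0) < r ==> v y = 0" using r(2) by (simp add: v_def rh_def)
  have 2: "!!y. R < norm y ==> v y = 0" using R by (simp add: v_def)
  have 3: "!!x. v (x, 0) = 0" using bd by (simp add: v_def)
  have 4: "!!y. v y ~= 0 ==> ka*((y - y0) <.> (y - y0)) <= 1" using pos(3) by (force simp: v_def rh_def)
  have rh: "(y - y0) <.> (y - y0) = rh y" for y by (simp add: rh_def)
  note c = carleman_conjugated[OF v r(1) 1 2 3 pos(1,2) 4, unfolded rh, folded D_def, unfolded P]
  show "integrable lborel (%y. ind halfspace y *
    (64*ta^3*ka*(ka^2*rh y - 2*ka + 1/rh y)*(v y)^2))" by (rule c(1))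
  show "(LBINT y. ind halfspace y*(64*ta^3*ka*(ka^2*rh y - 2*ka + 1/rh y)*(v y)^2))
   + 4*ta* snd y0*(LBINT x. (1/rh (x, 0) - ka)*(Gv (x, 0) <.> (0, 1))^2)
   <= (LBINT y. ind halfspace y*(w y*lap H y)^2)" by (rule c(2))
 qed
 have vu: "(v y)^2 = E y*(u y)^2" for y using wE[of y] r(2)[of y] by (cases "rh y < r") (auto simp: v_def power_mult_distrib)
 have wl: "(w y*lap H y)^2 = E y*(lap H y)^2" for y
  using wE[of y] H0[of y] by (cases "rh y < r") (auto simp: power_mult_distrib lap_def)
 have Gvu: "(Gv (x, 0) <.> (0, 1))^2 = E (x, 0)*(G (x, 0) <.> (0, 1))^2" for x
 proof (cases "rh (x, 0) < r")
  case True
  then show ?thesis using bd G0[OF True] by (simp add: Gv_def)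
 next
  case False
  then show ?thesis using wE[OF False] bd by (simp add: Gv_def power_mult_distrib)
 qed
 have vi: "integrable lborel (%y. (v y)^2)" using c2_cont(1)[OF v]
  by (intro integrable_bounded_support[where R=R] continuous_intros) (simp_all add: v_def R)
 show i1: "integrable lborel (%y. ind halfspace y*(E y*(u y)^2))"
  using Lintb_ind[OF _ vi, of halfspace] by (simp add: vu)
 have wi: "integrable lborel (%y. (w y*lap H y)^2)" using c2_cont(1)[OF w] c2_cont(3)[OF u]
  by (intro integrable_bounded_support[where R=R] continuous_intros) (simp_all add: lap_def HR)
 show "integrable lborel (%y. ind halfspace y*(E y*(lap H y)^2))"
  using Lintb_ind[OF _ wi, of halfspace] by (simp add: wl)
 have "32*ta^3*ka^2*(LBINT y. ind halfspace y*(E y*(u y)^2))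
   = (LBINT y. 32*ta^3*ka^2*(ind halfspace y*(E y*(u y)^2)))" by simp
 also have "... <= (LBINT y. ind halfspace y*(64*ta^3*ka*(ka^2*rh y - 2*ka + 1/rh y)*(v y)^2))"
 proof (rule integral_mono[OF _ car(1)])
  show "integrable lborel (%y. 32*ta^3*ka^2*(ind halfspace y*(E y*(u y)^2)))" using i1 by simp
  fix y
  show "32*ta^3*ka^2*(ind halfspace y*(E y*(u y)^2))
   <= ind halfspace y*(64*ta^3*ka*(ka^2*rh y - 2*ka + 1/rh y)*(v y)^2)"
  proof (cases "u y = 0")
   case True
   then show ?thesis by (simp add: v_def)
  next
   case False
   have rr: "rh y > 0" using r False by (meson not_less order_less_le_trans)
   have k: "ka*rh y <= 1/2" using pos(3)[OF False] .
   \<comment> \<open>The coefficient of \<open>carleman_conjugated\<close> is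
     \<open>(1 - ka rho)^2 / rho\<close>, hence at least \<open>1/(4 rho)\<close>, and
     \<open>ka rho <= 1/2\<close> once more makes this at least \<open>ka/2\<close>. So
     \<open>64 ta^3 ka\<close> becomes \<open>32 ta^3 ka^2\<close>.\<close>
   have "(1 - ka*rh y)^2 >= (1/2)^2" using k by (intro power_mono) auto
   then have "ka^2*rh y - 2*ka + 1/rh y >= (1/2)^2/rh y" using rr by (simp add: field_simps power2_eq_square)
   moreover have "(1/2)^2/rh y >= ka/2" using k rr by (simp add: field_simps power2_eq_square)
   ultimately have "ka/2 <= ka^2*rh y - 2*ka + 1/rh y" by linarith
   then have "64*ta^3*ka*(ka/2)*(v y)^2 <= 64*ta^3*ka*(ka^2*rh y - 2*ka + 1/rh y)*(v y)^2"
    using pos by (intro mult_right_mono mult_left_mono) auto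
   moreover have "64*ta^3*ka*(ka/2)*(v y)^2 = 32*ta^3*ka^2*(E y*(u y)^2)" by (simp add: vu power2_eq_square[of ka])
   ultimately have "32*ta^3*ka^2*(E y*(u y)^2)
    <= 64*ta^3*ka*(ka^2*rh y - 2*ka + 1/rh y)*(v y)^2" by linarith
   then show ?thesis by (cases "y : halfspace") (simp_all only: indicator_simps mult_1 mult_zero_left mult_zero_right order_refl not_False_eq_True)
  qed
 qed
 finally show "32*ta^3*ka^2*(LBINT y. ind halfspace y*(E y*(u y)^2))
    + 4*ta* snd y0*(LBINT x. (1/rh (x, 0) - ka)*(E (x, 0)*(G (x, 0) <.> (0, 1))^2))
   <= (LBINT y. ind halfspace y*(E y*(lap H y)^2))" using car(2) unfolding wl Gvu by linarith
qed

section \<open>Cutoff functions and the Caccioppoli inequality\<close>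

definition cub :: "real => real" where "cub x = (max 0 x)^3"

lemma cub_DERIV: "(cub hrd 3*(max 0 x)^2) (at x)"
 "((%x. 3*(max 0 x)^2) hrd 6*max 0 x) (at x)"
proof -
 have m: "max 0 x ^ n = (if x < 0 then 0 else x ^ n)" if "n > 0" for x :: real and n using that by (auto simp: max_def)
 have "((%x. if x < 0 then 0 else x ^ 3) hrd (if x < 0 then 0 else 3*x^2)) (at x)"
  by (rule DERIV_glue) (auto intro!: derivative_eq_intros)
 then show "(cub hrd 3*(max 0 x)^2) (at x)" unfolding cub_def[abs_def] by (simp add: m if_distrib cong: if_cong)
 have "((%x. if x < 0 then 0 else 3*x^2) hrd (if x < 0 then 0 else 6*x)) (at x)"
  by (rule DERIV_glue) (auto intro!: derivative_eq_intros)
 moreover have "(%x. if x < 0 then 0 else 3*x^2) = (%x::real. 3*(max 0 x)^2)"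
  "(if x < 0 then 0 else 6*x) = 6*max 0 x" by (auto simp: fun_eq_iff max_def)
 ultimately show "((%x. 3*(max 0 x)^2) hrd 6*max 0 x) (at x)" by simp
qed

text \<open>A step from 0 to 1 on the unit interval. It is C2 because the cube of a positive part
  vanishes to second order, at the left end directly and at the right end through the outer
  \<open>cub\<close>. Being explicit, it comes with the numerical bounds 9 and 72 on its
  derivatives.\<close>

definition cut :: "real => real" where "cut x = 1 - cub (1 - cub x)"
definition cut' :: "real => real" where "cut' x = 9*(max 0 (1 - cub x))^2*(max 0 x)^2"
definition cut'' :: "real => real" where "cut'' x = 18*(max 0 (1 - cub x))^2*max 0 x - 54*max 0 (1 - cub x)*(max 0 x)^4"

lemma cut_DERIV: "(cut hrd cut' x) (at x)" "(cut' hrd cut'' x) (at x)" "cont cut''"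
proof -
 note c1 = cub_DERIV(1)
 have i: "((%x. 1 - cub x) hrd - (3*(max 0 x)^2)) (at x)" for x by (auto intro!: derivative_eq_intros c1)
 show "(cut hrd cut' x) (at x)" unfolding cut_def[abs_def] cut'_def
  using DERIV_diff[OF DERIV_const[of 1] DERIV_chain2[OF c1 i]] by (simp add: mult_ac)
 have "((%x. 3*(max 0 (1 - cub x))^2) hrd 6*max 0 (1 - cub x)*- (3*(max 0 x)^2)) (at x)"
  by (rule DERIV_chain2[OF cub_DERIV(2) i])
 from DERIV_mult[OF this cub_DERIV(2)[of x]]
 show "(cut' hrd cut'' x) (at x)" unfolding cut'_def[abs_def] cut''_def by (simp add: mult_ac power2_eq_square power4_eq_xxxx)
 have "cont cub" unfolding cub_def[abs_def] by (intro continuous_intros)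
 then show "cont cut''" unfolding cut''_def[abs_def] by (intro continuous_intros)
qed

lemma cut_simps: "x <= 0 ==> cut x = 0" "1 <= x ==> cut x = 1" "0 <= cut x" "cut x <= 1"
 "x <= 0 ==> cut' x = 0" "1 <= x ==> cut' x = 0" "x <= 0 ==> cut'' x = 0" "1 <= x ==> cut'' x = 0"
 "\<bar>cut' x\<bar> <= 9" "\<bar>cut'' x\<bar> <= 72"
proof -
 have c: "x <= 0 ==> cub x = 0" "cub x >= 0" "x >= 1 ==> cub x >= 1" "x <= 1 ==> cub x <= 1" for x
  unfolding cub_def by (auto simp: power_le_one)
 have c1: "cub 1 = 1" by (simp add: cub_def)
 show a: "x <= 0 ==> cut x = 0" "1 <= x ==> cut x = 1" "x <= 0 ==> cut' x = 0" "1 <= x ==> cut' x = 0"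
  "x <= 0 ==> cut'' x = 0" "1 <= x ==> cut'' x = 0" using c(1)[of x] c(3)[of x] c(1)[of "1 - cub x"] c1
  by (auto simp: cut_def cut'_def cut''_def max_def)
 show "0 <= cut x" "cut x <= 1" using c(2)[of x] c(2)[of "1 - cub x"] c(4)[of "1 - cub x"] by (auto simp: cut_def)
 have b: "0 <= x ==> x <= 1 ==> \<bar>cut' x\<bar> <= 9 & \<bar>cut'' x\<bar> <= 72"
 proof -
  assume x: "0 <= x" "x <= 1"
  define m where "m = max 0 (1 - cub x)"
  have m: "0 <= m" "m <= 1" using c(2)[of x] by (auto simp: m_def)
  have p: "0 <= m^2" "m^2 <= 1" "0 <= x^2" "x^2 <= 1" "0 <= x^4" "x^4 <= 1"
   using m x by (auto simp: power_le_one)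
  have "m^2*x^2 <= 1" "m^2*x <= 1" "m*x^4 <= 1" "0 <= m^2*x^2" "0 <= m^2*x" "0 <= m*x^4"
   using p m x by (auto intro!: mult_le_one)
  moreover have "cut' x = 9*(m^2*x^2)" "cut'' x = 18*(m^2*x) - 54*(m*x^4)"
   using x by (simp_all add: cut'_def cut''_def m_def)
  ultimately show ?thesis unfolding abs_le_iff by linarith
 qed
 show "\<bar>cut' x\<bar> <= 9" "\<bar>cut'' x\<bar> <= 72" using a(3-6) b by (cases "0 <= x"; cases "x <= 1"; force)+
qed

lemma integrable_compact_cont:
 fixes f :: "'b::euclidean_space => real"
 assumes "cont f" "compact K"
 shows "integrable lborel (%y. ind K y*f y)"
proof -
 have "integrable lborel (%x. ind K x *: f x)" using assms by (intro borel_integrable_compact) (auto intro: continuous_on_subset)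
 then show ?thesis by simp
qed

text \<open>The divergence theorem for \<open>ze U grad U - (U^2/2) grad ze\<close>. Every boundary
  contribution contains a factor \<open>U\<close> and vanishes.\<close>

lemma caccioppoli_identity:
 fixes U :: "'a::euclidean_space \<times> real => real"
 assumes U: "c2 U G H" and bd: "!!x. U (x, 0) = 0"
  and ze: "c2 ze Gze Hze" and R: "!!y. norm y > R ==> ze y = 0"
 shows "(LBINT y. ind halfspace y*(ze y*(G y <.> G y)))
   = (LBINT y. ind halfspace y*(lap Hze y/2*(U y)^2 - ze y*(U y*lap H y)))"
proof -
 define F where "F = (%y. (ze y*U y) *: G y + (- 1/2*(U y)^2) *: Gze y)"
 have GR: "Gze y = 0" if "norm y > R" for y using derivative_zero_outside[OF R c2D(1)[OF ze] that, of "Gze y"] by simp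
 have HR: "Hze y h = 0" if "norm y > R" for y h using derivative_zero_outside[OF GR c2D(2)[OF ze] that, of h] by simp
 have C: "C1 UNIV F" unfolding F_def power2_eq_square by (intro C1_add C1_scaleR C1_mult C1_const C1_c2[OF U] C1_c2[OF ze])
 have FR: "F y = 0" if "norm y > R" for y using R[OF that] GR[OF that] by (simp add: F_def)
 have d: "has_div F y (ze y*(G y <.> G y) - (lap Hze y/2*(U y)^2 - ze y*(U y*lap H y)))" for y
 proof -
  have 1: "has_div (%y. (ze y*U y) *: G y) y ((ze y *: G y + U y *: Gze y) <.> G y + ze y*U y*lap H y)"
   by (intro has_div_scale has_div_grad[OF U]) (rule derivative_eq_intros c2D(1)[OF U] c2D(1)[OF ze] refl | simp add: inner_simps algebra_simps)+
  have 2: "has_div (%y. (- 1/2*(U y)^2) *: Gze y) y ((- U y *: G y) <.> Gze y + (- 1/2*(U y)^2)*lap Hze y)"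
   by (intro has_div_scale has_div_grad[OF ze]) (rule derivative_eq_intros c2D(1)[OF U] refl | simp add: inner_simps algebra_simps)+
  have "(ze y *: G y + U y *: Gze y) <.> G y + ze y*U y*lap H y + ((- U y *: G y) <.> Gze y + (- 1/2*(U y)^2)*lap Hze y)
   = ze y*(G y <.> G y) - (lap Hze y/2*(U y)^2 - ze y*(U y*lap H y))" by (simp add: inner_simps inner_commute)
  note eq = this
  show ?thesis unfolding F_def eq[symmetric] by (rule has_div_add[OF 1 2])
 qed
 note hd = halfspace_divergence[OF C FR d]
 have "integrable lborel (%y. ze y*(G y <.> G y))" using c2_cont[OF U] c2_cont[OF ze]
  by (intro integrable_bounded_support[where R=R] continuous_intros) (simp_all add: R)
 then have i1: "integrable lborel (%y. ind halfspace y*(ze y*(G y <.> G y)))"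
  using Lintb_ind[of halfspace lborel "%y. ze y*(G y <.> G y)"] by simp
 have "integrable lborel (%y. lap Hze y/2*(U y)^2 - ze y*(U y*lap H y))" using c2_cont[OF U] c2_cont[OF ze]
  by (intro integrable_bounded_support[where R=R] continuous_intros) (simp_all add: R lap_def HR)
 then have i2: "integrable lborel (%y. ind halfspace y*(lap Hze y/2*(U y)^2 - ze y*(U y*lap H y)))"
  using Lintb_ind[of halfspace lborel "%y. lap Hze y/2*(U y)^2 - ze y*(U y*lap H y)"] by simp
 have "F (x, 0) = 0" for x using bd by (simp add: F_def)
 then show ?thesis using hd(2) i1 i2 by (simp add: right_diff_distrib)
qed

section \<open>The local estimate\<close>

text \<open>The parameter \<open>r\<close> is the squared radius, so doubling \<open>r\<close>
  enlarges the radius by \<open>sqrt 2\<close>. The ball is cut off by the half-space, and its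
  centre may lie below it.\<close>

definition hball :: "'a::euclidean_space \<times> real => real => ('a \<times> real) set" where
 "hball y0 r = {y. 0 <= snd y & (y - y0) <.> (y - y0) <= r}"

definition hball_int :: "'a::euclidean_space \<times> real => real => ('a \<times> real => real) => real" where
 "hball_int y0 r f = (LBINT y. ind (hball y0 r) y*f y)"

lemma compact_rho_ball: "compact {y. (y - y0) <.> (y - y0) <= r}" for y0 :: "'b::euclidean_space"
proof -
 have "y : cball y0 (sqrt r)" if "(y - y0) <.> (y - y0) <= r" for y
 proof -
  have "(norm (y - y0))^2 <= r" using that by (simp add: power2_norm_eq_inner)
  then show ?thesis by (simp add: dist_norm norm_minus_commute real_le_rsqrt)
 qed
 then have "bounded {y. (y - y0) <.> (y - y0) <= r}" by (intro bounded_subset[OF bounded_cball]) auto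
 moreover have "closed {y. (y - y0) <.> (y - y0) <= r}" by (intro closed_Collect_le continuous_intros)
 ultimately show ?thesis by (simp add: compact_eq_bounded_closed)
qed

lemma compact_hball: "compact (hball y0 r)"
proof -
 have "hball y0 r = {y. (y - y0) <.> (y - y0) <= r} \<inter> {y. 0 <= snd y}" by (auto simp: hball_def)
 moreover have "closed {y :: 'a \<times> real. 0 <= snd y}" by (intro closed_Collect_le continuous_intros)
 ultimately show ?thesis using compact_rho_ball[of y0 r] by (simp add: compact_Int_closed)
qed

lemma hball_borel [measurable]: "hball y0 r : sets borel" by (intro borel_compact compact_hball)

lemma hball_int_integrable: "cont f ==> integrable lborel (%y. ind (hball y0 r) y*f y :: real)"
 by (rule integrable_compact_cont[OF _ compact_hball])

lemma hball_int_add: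
 assumes "cont f" "cont g"
 shows "hball_int y0 r (%y. f y + g y) = hball_int y0 r f + hball_int y0 r g" unfolding hball_int_def distrib_left using assms
 by (intro Lint_add hball_int_integrable)

lemma hball_int_scale: "hball_int y0 r (%y. c*f y) = c*hball_int y0 r f" unfolding hball_int_def by (simp add: mult.left_commute[of _ c])

lemma hball_int_nonneg: "(!!y. f y >= 0) ==> hball_int y0 r f >= 0" unfolding hball_int_def by (intro integral_nonneg_AE) auto

lemma hball_int_mono:
 assumes "cont f" "cont g" "!!y. y : hball y0 r ==> f y <= g y"
 shows "hball_int y0 r f <= hball_int y0 r g" unfolding hball_int_def
 by (intro integral_mono hball_int_integrable assms(1,2)) (use assms(3) in \<open>auto simp: indicator_def\<close>)

lemma hball_int_mono_radius:
 assumes "cont f" "!!y. f y >= 0" "r <= r'"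
 shows "hball_int y0 r f <= hball_int y0 r' f" unfolding hball_int_def by (intro integral_mono hball_int_integrable assms(1))
   (use assms(2,3) in \<open>auto simp: indicator_def hball_def\<close>)

text \<open>The cutoff falls from 1 to 0 while the squared distance grows from \<open>r\<close> to
  \<open>2 r\<close>. Its Laplacian is at most 4 times \<open>72/r^2\<close> times
  \<open>2 r\<close> plus 2 times \<open>9/r\<close> times the dimension, and half of this is the
  constant over \<open>r\<close>. The additional 1 and the last term bound the product of
  \<open>U\<close> with its Laplacian.\<close>

lemma caccioppoli_ball:
 fixes U :: "'a::euclidean_space \<times> real => real"
 assumes U: "c2 U G H" and bd: "!!x. U (x, 0) = 0" and r: "r > 0"
 shows "hball_int y0 r (%y. G y <.> G y)
  <= ((288 + 9*real DIM('a \<times> real))/r + 1)*hball_int y0 (2*r) (%y. (U y)^2)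
    + hball_int y0 (2*r) (%y. (lap H y)^2)"
proof -
 define D where "D = real DIM('a \<times> real)"
 define rh where "rh = (%y. (y - y0) <.> (y - y0))"
 define f where "f s = cut (2 - s/r)" for s
 define f' where "f' s = - cut' (2 - s/r)/r" for s
 define f'' where "f'' s = cut'' (2 - s/r)/r^2" for s
 have i: "((%s. 2 - s/r) hrd - 1/r) (at s)" for s using r by (auto intro!: derivative_eq_intros)
 have fd: "(f hrd f' s) (at s)" for s unfolding f_def[abs_def] f'_def using DERIV_chain2[OF cut_DERIV(1) i] by simp
 have fd': "(f' hrd f'' s) (at s)" for s unfolding f'_def[abs_def] f''_def
  using DERIV_cdivide[OF DERIV_minus[OF DERIV_chain2[OF cut_DERIV(2) i]], of r s] by (simp add: power2_eq_square)
 have fc: "cont f''" unfolding f''_def[abs_def] by (intro continuous_intros cont_comp2[OF cut_DERIV(3)]) (use r in auto)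
 note ze = c2_radial[OF fd fd' fc, of y0]
 define ze where "ze = (%y. f (rh y))"
 define Hze where "Hze = (%y h. (4*f'' (rh y)*((y - y0) <.> h)) *: (y - y0) + (2*f' (rh y)) *: h)"
 obtain Gze where ze: "c2 ze Gze Hze" using ze unfolding ze_def Hze_def rh_def by blast
 have l: "lap Hze y = 4*f'' (rh y)*rh y + 2*f' (rh y)*D" for y unfolding Hze_def lap_radial by (simp add: rh_def D_def)
 have rh0: "rh y >= 0" for y by (simp add: rh_def)
 have D0: "D >= 0" by (simp add: D_def)
 have out: "ze y = 0" "lap Hze y = 0" if "rh y > 2*r" for y
 proof -
  have "2 - rh y/r <= 0" using that r by (simp add: field_simps)
  then show "ze y = 0" "lap Hze y = 0" unfolding l ze_def f_def f'_def f''_def by (simp_all add: cut_simps)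
 qed
 have ins: "ze y = 1" if "rh y <= r" for y using that r unfolding ze_def f_def by (intro cut_simps) (simp add: field_simps)
 have ze01: "0 <= ze y" "ze y <= 1" for y unfolding ze_def f_def by (simp_all add: cut_simps)
 have lb: "\<bar>lap Hze y\<bar> <= 2*((288 + 9*D)/r)" if "rh y <= 2*r" for y
 proof -
  have "\<bar>f'' (rh y)\<bar> <= 72/r^2" "\<bar>f' (rh y)\<bar> <= 9/r"
   unfolding f'_def f''_def using cut_simps(9,10) r by (simp_all add: abs_divide divide_right_mono)
  then have "4*\<bar>f'' (rh y)\<bar>*rh y <= 4*(72/r^2)*(2*r)" "2*\<bar>f' (rh y)\<bar>*D <= 2*(9/r)*D"
   using that rh0[of y] r D0 by (intro mult_mono mult_left_mono mult_right_mono; simp)+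
  moreover have "\<bar>4*f'' (rh y)*rh y\<bar> = 4*\<bar>f'' (rh y)\<bar>*rh y" "\<bar>2*f' (rh y)*D\<bar> = 2*\<bar>f' (rh y)\<bar>*D"
   using rh0[of y] D0 by (simp_all add: abs_mult)
  ultimately have "\<bar>lap Hze y\<bar> <= 4*(72/r^2)*(2*r) + 2*(9/r)*D" unfolding l by linarith
  also have "... = 2*((288 + 9*D)/r)" using r by (simp add: field_simps power2_eq_square)
  finally show ?thesis .
 qed
 obtain R where R: "!!y. norm y > R ==> rh y > 2*r"
 proof -
  obtain R where "\<forall>y\<in>{y. (y - y0) <.> (y - y0) <= 2*r}. norm y <= R"
   using compact_imp_bounded[OF compact_rho_ball[of y0 "2*r"]] unfolding bounded_iff by blast
  then have "rh y > 2*r" if "norm y > R" for y using that by (simp add: rh_def not_le[symmetric] del: split_paired_All) blast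
  then show ?thesis using that by blast
 qed
 have id: "(LBINT y. ind halfspace y*(ze y*(G y <.> G y)))
   = (LBINT y. ind halfspace y*(lap Hze y/2*(U y)^2 - ze y*(U y*lap H y)))"
  using out R by (intro caccioppoli_identity[OF U bd ze]) blast
 note cU = c2_cont[OF U] and cze = c2_cont[OF ze]
 have ii: "integrable lborel (%y. ind halfspace y*g y)"
  if "cont g" "!!y. rh y > 2*r ==> g y = 0" for g :: "'a \<times> real => real"
  using Lintb_ind[of halfspace lborel g] integrable_bounded_support[OF that(1), of R] that(2) R by simp
 have "hball_int y0 r (%y. G y <.> G y) <= (LBINT y. ind halfspace y*(ze y*(G y <.> G y)))"
  unfolding hball_int_def
 proof (rule integral_mono)
  show "integrable lborel (%y. ind (hball y0 r) y*(G y <.> G y))" by (intro hball_int_integrable continuous_intros cU)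
  show "integrable lborel (%y. ind halfspace y*(ze y*(G y <.> G y)))" by (intro ii continuous_intros cU cze) (simp add: out)
  show "ind (hball y0 r) y*(G y <.> G y) <= ind halfspace y*(ze y*(G y <.> G y))" for y
   using ins[of y] ze01(1)[of y] by (auto simp: indicator_def hball_def halfspace_def rh_def)
 qed
 also have "... <= hball_int y0 (2*r) (%y. ((288 + 9*D)/r + 1)*(U y)^2 + (lap H y)^2)" unfolding id hball_int_def
 proof (rule integral_mono)
  show "integrable lborel (%y. ind halfspace y*(lap Hze y/2*(U y)^2 - ze y*(U y*lap H y)))"
   by (intro ii continuous_intros cU cze) (simp_all add: out)
  show "integrable lborel (%y. ind (hball y0 (2*r)) y*(((288 + 9*D)/r + 1)*(U y)^2 + (lap H y)^2))"
   by (intro hball_int_integrable continuous_intros cU)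
  fix y
  show "ind halfspace y*(lap Hze y/2*(U y)^2 - ze y*(U y*lap H y))
    <= ind (hball y0 (2*r)) y*(((288 + 9*D)/r + 1)*(U y)^2 + (lap H y)^2)"
  proof (cases "rh y > 2*r")
   case True
   then show ?thesis by (simp add: out hball_def rh_def)
  next
   case False
   have "lap Hze y/2*(U y)^2 <= (288 + 9*D)/r*(U y)^2" using lb[of y] False by (intro mult_right_mono) (auto simp: abs_le_iff)
   moreover have "- (ze y*(U y*lap H y)) <= (U y)^2 + (lap H y)^2"
   proof -
    have "- (ze y*(U y*lap H y)) <= \<bar>ze y\<bar>*\<bar>U y*lap H y\<bar>" unfolding abs_mult[symmetric] by simp
    also have "... <= 1*\<bar>U y*lap H y\<bar>" using ze01[of y] by (intro mult_right_mono) auto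
    also have "... <= (U y)^2 + (lap H y)^2" using sum_squares_bound[of "\<bar>U y\<bar>" "\<bar>lap H y\<bar>"]
      mult_nonneg_nonneg[OF abs_ge_zero abs_ge_zero, of "U y" "lap H y"] unfolding abs_mult power2_abs mult.assoc by linarith
    finally show ?thesis .
   qed
   moreover have "y : hball y0 (2*r) \<longleftrightarrow> y : halfspace" using False by (auto simp: hball_def halfspace_def rh_def)
   ultimately show ?thesis by (simp add: indicator_def algebra_simps)
  qed
 qed
 also have "... = ((288 + 9*D)/r + 1)*hball_int y0 (2*r) (%y. (U y)^2) + hball_int y0 (2*r) (%y. (lap H y)^2)"
  by (simp add: hball_int_add hball_int_scale continuous_intros cU)
 finally show ?thesis unfolding D_def .
qed

text \<open>The Carleman inequality is applied to \<open>U\<close> times a cutoff that rises for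
  squared distances from \<open>r1\<close> to \<open>r2\<close> and falls from \<open>r3\<close> to
  \<open>r4\<close>. \<open>B\<close> and \<open>B'\<close> bound the Laplacian of the cutoff on the
  two rings. As the weight decreases outwards, the inner ring is weighted by \<open>E r1\<close> and
  the outer ring by \<open>E r3\<close>. The condition \<open>M^2 <= 4 ta^3 ka^2\<close> allows the
  potential term to be absorbed into half of the left side.\<close>

lemma local_carleman:
 fixes U :: "'a::euclidean_space \<times> real => real" and y0 :: "'a \<times> real"
 assumes U: "c2 U G H" and bd: "!!x. U (x, 0) = 0"
  and lapU: "!!y. \<bar>lap H y\<bar> <= M*\<bar>U y\<bar> + err y"
  and err: "cont err" "!!y. err y >= 0" and M: "M >= 0" "M^2 <= 4*ta^3*ka^2"
  and r: "0 < r1" "r1 < r2" "r2 <= r3" "r3 < r4" "ka*r4 <= 1/2" and rs: "r2 <= rs" "rs <= r3"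
  and pos: "ta > 0" "ka > 0" and y0: "snd y0 <= 0"
 defines "E \<equiv> carl_weight ta ka" and "D \<equiv> real DIM('a \<times> real)"
 defines "B \<equiv> 288*r2/(r2 - r1)^2 + 18*D/(r2 - r1)"
  and "B' \<equiv> 288*r4/(r4 - r3)^2 + 18*D/(r4 - r3)"
 shows "16*ta^3*ka^2*(E rs*(hball_int y0 rs (%y. (U y)^2) - hball_int y0 r2 (%y. (U y)^2)))
  <= 4*E r1*hball_int y0 r4 (%y. (err y)^2)
   + 2*E r1*hball_int y0 r2 (%y. 2*B^2*(U y)^2 + 9*B*(G y <.> G y))
   + 2*E r3*hball_int y0 r4 (%y. 2*B'^2*(U y)^2 + 9*B'*(G y <.> G y)) + 4*ta*(- snd y0)/r1*E r1 *
     (LBINT x. ind {x. ((x, 0) - y0) <.> ((x, 0) - y0) <= r4} x*(G (x, 0) <.> (0, 1))^2)"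
proof -
 define rh where "rh = (%y. (y - y0) <.> (y - y0))"
 define w1 where "w1 = r2 - r1"
 define w2 where "w2 = r4 - r3"
 have w: "w1 > 0" "w2 > 0" using r by (simp_all add: w1_def w2_def)
 define c1 where "c1 s = cut ((s - r1)/w1)" for s
 define c1' where "c1' s = cut' ((s - r1)/w1)/w1" for s
 define c1'' where "c1'' s = cut'' ((s - r1)/w1)/w1^2" for s
 define d1 where "d1 s = cut ((r4 - s)/w2)" for s
 define d1' where "d1' s = - cut' ((r4 - s)/w2)/w2" for s
 define d1'' where "d1'' s = cut'' ((r4 - s)/w2)/w2^2" for s
 have i: "((%s. (s - r1)/w1) hrd 1/w1) (at s)" for s using w by (auto intro!: derivative_eq_intros)
 have i2: "((%s. (r4 - s)/w2) hrd - 1/w2) (at s)" for s using w by (auto intro!: derivative_eq_intros)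
 have cd: "(c1 hrd c1' s) (at s)" for s unfolding c1_def[abs_def] c1'_def using DERIV_chain2[OF cut_DERIV(1) i] by simp
 have cd': "(c1' hrd c1'' s) (at s)" for s unfolding c1'_def[abs_def] c1''_def
  using DERIV_cdivide[OF DERIV_chain2[OF cut_DERIV(2) i], of w1 s] by (simp add: power2_eq_square)
 have dd: "(d1 hrd d1' s) (at s)" for s unfolding d1_def[abs_def] d1'_def using DERIV_chain2[OF cut_DERIV(1) i2] by simp
 have dd': "(d1' hrd d1'' s) (at s)" for s unfolding d1'_def[abs_def] d1''_def
  using DERIV_cdivide[OF DERIV_minus[OF DERIV_chain2[OF cut_DERIV(2) i2]], of w2 s] by (simp add: power2_eq_square)
 have cc: "cont c1''" "cont d1''" unfolding c1''_def[abs_def] d1''_def[abs_def]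
  by (intro continuous_intros cont_comp2[OF cut_DERIV(3)]; use w in auto)+
 define f where "f s = c1 s*d1 s" for s
 define f' where "f' s = c1' s*d1 s + d1' s*c1 s" for s
 define f'' where "f'' s = c1'' s*d1 s + d1' s*c1' s + (d1'' s*c1 s + c1' s*d1' s)" for s
 have fd: "(f hrd f' s) (at s)" for s unfolding f_def[abs_def] f'_def by (rule DERIV_mult[OF cd dd])
 have fd': "(f' hrd f'' s) (at s)" for s unfolding f'_def[abs_def] f''_def
  by (rule DERIV_add[OF DERIV_mult[OF cd' dd] DERIV_mult[OF dd' cd]])
 have ci: "cont c1" "cont c1'" "cont d1" "cont d1'"
  using cd cd' dd dd' by (meson DERIV_continuous cont_atI)+
 have fc: "cont f''" unfolding f''_def[abs_def] by (intro continuous_intros cc ci)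
 have cbound: "\<bar>c1' s\<bar> <= 9/w1" "\<bar>c1'' s\<bar> <= 72/w1^2" "\<bar>d1' s\<bar> <= 9/w2" "\<bar>d1'' s\<bar> <= 72/w2^2" for s
  unfolding c1'_def c1''_def d1'_def d1''_def using cut_simps(9,10) w by (simp_all add: abs_divide divide_right_mono)
 have lo: "c1 s = 0" "c1' s = 0" "c1'' s = 0" if "s <= r1" for s
  unfolding c1_def c1'_def c1''_def using that w by (simp_all add: cut_simps divide_le_0_iff)
 have hi: "c1 s = 1" "c1' s = 0" "c1'' s = 0" if "r2 <= s" for s
 proof -
  have "(s - r1)/w1 >= 1" using that w by (simp add: w1_def)
  then show "c1 s = 1" "c1' s = 0" "c1'' s = 0" unfolding c1_def c1'_def c1''_def by (simp_all add: cut_simps)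
 qed
 have lo2: "d1 s = 1" "d1' s = 0" "d1'' s = 0" if "s <= r3" for s
 proof -
  have "(r4 - s)/w2 >= 1" using that w by (simp add: w2_def)
  then show "d1 s = 1" "d1' s = 0" "d1'' s = 0" unfolding d1_def d1'_def d1''_def by (simp_all add: cut_simps)
 qed
 have hi2: "d1 s = 0" "d1' s = 0" "d1'' s = 0" if "r4 <= s" for s
  unfolding d1_def d1'_def d1''_def using that w by (simp_all add: cut_simps divide_le_0_iff)
 have f01: "0 <= f s" "f s <= 1" for s unfolding f_def c1_def d1_def by (simp_all add: cut_simps mult_le_one)
 define eh where "eh = (%y. f (rh y))"
 define Geh where "Geh = (%y. (2*f' (rh y)) *: (y - y0))"
 define Heh where "Heh = (%y h. (4*f'' (rh y)*((y - y0) <.> h)) *: (y - y0) + (2*f' (rh y)) *: h)"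
 have eh: "c2 eh Geh Heh" unfolding eh_def Geh_def Heh_def rh_def by (rule c2_radial[OF fd fd' fc])
 have leh: "lap Heh y = 4*f'' (rh y)*rh y + 2*f' (rh y)*D" for y unfolding Heh_def lap_radial by (simp add: rh_def D_def)
 have geh: "Geh y <.> Geh y = 4*(f' (rh y))^2*rh y" for y unfolding Geh_def by (simp add: rh_def power2_eq_square)
 define u where "u = (%y. eh y*U y)"
 define Gu where "Gu = (%y. eh y *: G y + U y *: Geh y)"
 define Hu where "Hu = (%y h. eh y *: H y h + (Geh y <.> h) *: G y + (U y *: Heh y h + (G y <.> h) *: Geh y))"
 have u: "c2 u Gu Hu" unfolding u_def Gu_def Hu_def by (rule c2_mult[OF eh U])
 have lu: "lap Hu y = eh y*lap H y + (U y*lap Heh y + 2*(Geh y <.> G y))" for y unfolding Hu_def lap_mult by simp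
 obtain R where R: "!!y. norm y > R ==> rh y > r4"
 proof -
  obtain R where "\<forall>y\<in>{y. (y - y0) <.> (y - y0) <= r4}. norm y <= R"
   using compact_imp_bounded[OF compact_rho_ball[of y0 r4]] unfolding bounded_iff by blast
  then have "rh y > r4" if "norm y > R" for y using that by (simp add: rh_def not_le[symmetric] del: split_paired_All) blast
  then show ?thesis using that by blast
 qed
 have rh0: "rh y >= 0" for y by (simp add: rh_def)
 have D0: "D >= 0" by (simp add: D_def)
 have ehlo: "eh y = 0" if "rh y <= r1" for y using lo[OF that] by (simp add: eh_def f_def)
 have ehhi: "eh y = 0" if "r4 <= rh y" for y using hi2[OF that] by (simp add: eh_def f_def)
 have eh01: "0 <= eh y" "eh y <= 1" for y using f01 by (simp_all add: eh_def)
 have E0: "E s > 0" for s by (simp add: E_def carl_weight_def)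
 have ka4: "ka*r4 <= 1" using r(5) by simp
 have Emono: "E t <= E s" if "0 < s" "s <= t" "t <= r4" for s t unfolding E_def
 proof (rule carl_weight_mono)
  show "ka*t <= 1" using mult_left_mono[OF that(3), of ka] pos ka4 by linarith
 qed (use that pos in auto)
 have car: "integrable lborel (%y. ind halfspace y*(E (rh y)*(u y)^2))"
  "integrable lborel (%y. ind halfspace y*(E (rh y)*(lap Hu y)^2))"
  "32*ta^3*ka^2*(LBINT y. ind halfspace y*(E (rh y)*(u y)^2))
    + 4*ta* snd y0*(LBINT x. (1/rh (x, 0) - ka)*(E (rh (x, 0))*(Gu (x, 0) <.> (0, 1))^2))
   <= (LBINT y. ind halfspace y*(E (rh y)*(lap Hu y)^2))"
 proof -
  have 1: "!!y. (y - y0) <.> (y - y0) < r1 ==> u y = 0" using ehlo by (simp add: u_def rh_def)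
  have 2: "!!y. R < norm y ==> u y = 0" using ehhi R by (simp add: u_def less_imp_le)
  have 3: "!!x. u (x, 0) = 0" using bd by (simp add: u_def)
  have 4: "ka*((y - y0) <.> (y - y0)) <= 1/2" if "u y ~= 0" for y
  proof -
   have "rh y <= r4" using ehhi[of y] that by (cases "r4 <= rh y") (auto simp: u_def)
   then have "ka*rh y <= ka*r4" using pos by (intro mult_left_mono) auto
   then show ?thesis using r(5) by (simp add: rh_def)
  qed
  note c = carleman[OF u r(1) 1 2 3 pos 4]
  show "integrable lborel (%y. ind halfspace y*(E (rh y)*(u y)^2))" unfolding E_def rh_def by (rule c(1))
  show "integrable lborel (%y. ind halfspace y*(E (rh y)*(lap Hu y)^2))" unfolding E_def rh_def by (rule c(2))
  show "32*ta^3*ka^2*(LBINT y. ind halfspace y*(E (rh y)*(u y)^2))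
    + 4*ta* snd y0*(LBINT x. (1/rh (x, 0) - ka)*(E (rh (x, 0))*(Gu (x, 0) <.> (0, 1))^2))
   <= (LBINT y. ind halfspace y*(E (rh y)*(lap Hu y)^2))" unfolding E_def rh_def by (rule c(3))
 qed
 have B0: "B >= 0" "B' >= 0" using r D0 by (auto simp: B_def B'_def)
 define g1 where "g1 = (%y. 2*B^2*(U y)^2 + 9*B*(G y <.> G y))"
 define g2 where "g2 = (%y. 2*B'^2*(U y)^2 + 9*B'*(G y <.> G y))"
 have g0: "g1 y >= 0" "g2 y >= 0" for y using B0 by (auto simp: g1_def g2_def)
 \<comment> \<open>One bound for both rings. The squared gradient of the cutoff is at most
   \<open>9/8 b\<close>, and 9 is 2 times 4 times 9/8.\<close>
 have ring: "(U y*lap Heh y + 2*(Geh y <.> G y))^2 <= 2*b^2*(U y)^2 + 9*b*(G y <.> G y)"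
  if "\<bar>f' (rh y)\<bar> <= 9/w" "\<bar>f'' (rh y)\<bar> <= 72/w^2" "w > 0" "rh y <= r" "b = 288*r/w^2 + 18*D/w" for y w r b
 proof -
  have r0: "r >= 0" using that(4) rh0[of y] by simp
  have b0: "b >= 0" using that(3,5) r0 D0 by simp
  have "4*\<bar>f'' (rh y)\<bar>*rh y <= 4*(72/w^2)*r" "2*\<bar>f' (rh y)\<bar>*D <= 2*(9/w)*D"
   using that rh0[of y] D0 by (intro mult_mono mult_left_mono mult_right_mono; simp)+
  moreover have "\<bar>4*f'' (rh y)*rh y\<bar> = 4*\<bar>f'' (rh y)\<bar>*rh y" "\<bar>2*f' (rh y)*D\<bar> = 2*\<bar>f' (rh y)\<bar>*D"
   using rh0[of y] D0 by (simp_all add: abs_mult)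
  ultimately have "\<bar>lap Heh y\<bar> <= 4*(72/w^2)*r + 2*(9/w)*D" unfolding leh by linarith
  also have "... = b" by (simp add: that(5))
  finally have lb: "\<bar>lap Heh y\<bar> <= b" .
  have "(f' (rh y))^2 <= (9/w)^2" using that(1,3) by (intro power2_le_iff_abs_le[THEN iffD2]) auto
  then have "4*(f' (rh y))^2*rh y <= 4*(9/w)^2*r" using that(4) rh0[of y] by (intro mult_mono) auto
  also have "... = 9/8*(288*r/w^2)" by (simp add: power_divide)
  also have "... <= 9/8*b" using that(3,5) D0 by simp
  finally have gb: "Geh y <.> Geh y <= 9/8*b" unfolding geh .
  have "(U y*lap Heh y + 2*(Geh y <.> G y))^2 <= 2*(U y*lap Heh y)^2 + 2*(2*(Geh y <.> G y))^2"
   using sum_squares_bound[of "U y*lap Heh y" "2*(Geh y <.> G y)"] by (simp add: power2_sum)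
  also have "(U y*lap Heh y)^2 <= (U y)^2*b^2"
   unfolding power_mult_distrib using lb b0 by (intro mult_left_mono power2_le_iff_abs_le[THEN iffD2]) auto
  also have "(2*(Geh y <.> G y))^2 <= 4*((9/8*b)*(G y <.> G y))"
  proof -
   have "(Geh y <.> G y)^2 <= (Geh y <.> Geh y)*(G y <.> G y)" by (rule Cauchy_Schwarz_ineq)
   also have "... <= (9/8*b)*(G y <.> G y)" using gb by (intro mult_right_mono) auto
   finally show ?thesis by (simp add: power_mult_distrib)
  qed
  finally show ?thesis by (simp add: algebra_simps)
 qed
 have pw: "E (rh y)*(lap Hu y)^2 <= 4*M^2*(E (rh y)*(u y)^2) + (4*E r1*(ind {y. rh y <= r4} y*(err y)^2)
   + (2*E r1*(ind {y. rh y <= r2} y*g1 y) + 2*E r3*(ind {y. rh y <= r4} y*g2 y)))" for y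
 proof -
  have base: "0 <= 4*M^2*(E (rh y)*(u y)^2)" "0 <= 4*E r1*(ind {y. rh y <= r4} y*(err y)^2)"
   "0 <= 2*E r1*(ind {y. rh y <= r2} y*g1 y)" "0 <= 2*E r3*(ind {y. rh y <= r4} y*g2 y)"
   using E0 g0 by (auto simp: less_imp_le)
  show ?thesis
  proof (cases "rh y <= r1 \<or> r4 <= rh y")
   case True
   have "f' (rh y) = 0" "f'' (rh y) = 0" "eh y = 0" using True lo[of "rh y"] hi2[of "rh y"] by (auto simp: f'_def f''_def eh_def f_def)
   then have "lap Hu y = 0" unfolding lu leh by (simp add: Geh_def)
   then show ?thesis using base by simp
  next
   case False
   then have rh: "r1 < rh y" "rh y < r4" by auto
   define z where "z = U y*lap Heh y + 2*(Geh y <.> G y)"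
   have "(lap Hu y)^2 <= 2*(eh y*lap H y)^2 + 2*z^2"
    using sum_squares_bound[of "eh y*lap H y" z] unfolding lu z_def[symmetric] by (simp add: power2_sum)
   also have "(eh y*lap H y)^2 <= 2*M^2*(u y)^2 + 2*(err y)^2"
   proof -
    have "\<bar>eh y*lap H y\<bar> <= eh y*(M*\<bar>U y\<bar> + err y)" using lapU[of y] eh01 by (simp add: abs_mult mult_left_mono)
    also have "... <= M*\<bar>u y\<bar> + err y" using eh01[of y] err(2)[of y] mult_right_mono[of "eh y" 1 "err y"]
     by (simp add: u_def abs_mult algebra_simps)
    finally have "(eh y*lap H y)^2 <= (M*\<bar>u y\<bar> + err y)^2"
     by (rule power2_le_iff_abs_le[THEN iffD2, rotated]) (use M err(2)[of y] in auto)
    also have "... <= 2*(M*\<bar>u y\<bar>)^2 + 2*(err y)^2"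
     using sum_squares_bound[of "M*\<bar>u y\<bar>" "err y"] by (simp add: power2_sum)
    finally show ?thesis by (simp add: power_mult_distrib)
   qed
   finally have 1: "(lap Hu y)^2 <= 4*M^2*(u y)^2 + 4*(err y)^2 + 2*z^2" by simp
   have 2: "E (rh y) <= E r1" using rh r by (intro Emono) auto
   have 3: "E (rh y)*z^2 <= E r1*(ind {y. rh y <= r2} y*g1 y) + E r3*(ind {y. rh y <= r4} y*g2 y)"
   proof -
    consider "rh y <= r2" | "r2 < rh y" "rh y <= r3" | "r3 < rh y" by linarith
    then show ?thesis
    proof cases
     case 1
     then have "f' (rh y) = c1' (rh y)" "f'' (rh y) = c1'' (rh y)" using lo2[of "rh y"] r(3) by (auto simp: f'_def f''_def)
     then have "z^2 <= g1 y" unfolding z_def g1_def using cbound w 1 by (intro ring[of y w1 r2]) (simp_all add: B_def w1_def)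
     then have "E (rh y)*z^2 <= E r1*g1 y" using 2 E0 by (intro mult_mono) (auto simp: less_imp_le)
     then show ?thesis using 1 g0[of y] E0[of r3] by (simp add: indicator_def add_increasing2)
    next
     case 2
     then have "f' (rh y) = 0" "f'' (rh y) = 0" using lo2[of "rh y"] hi[of "rh y"] by (auto simp: f'_def f''_def)
     then have "z = 0" unfolding z_def leh by (simp add: Geh_def)
     then have "E (rh y)*z^2 = 0" by simp
     then show ?thesis using base(3,4) by linarith
    next
     case 3
     then have "f' (rh y) = d1' (rh y)" "f'' (rh y) = d1'' (rh y)" using hi[of "rh y"] r(3) by (auto simp: f'_def f''_def)
     then have "z^2 <= g2 y" unfolding z_def g2_def using cbound w rh by (intro ring[of y w2 r4]) (simp_all add: B'_def w2_def)
     moreover have "E (rh y) <= E r3" using 3 rh r by (intro Emono) auto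
     ultimately have "E (rh y)*z^2 <= E r3*g2 y" using E0 by (intro mult_mono) (auto simp: less_imp_le)
     then show ?thesis using 3 r(3) rh by (simp add: indicator_def)
    qed
   qed
   have "E (rh y)*(lap Hu y)^2 <= E (rh y)*(4*M^2*(u y)^2 + 4*(err y)^2 + 2*z^2)"
    using 1 E0 by (intro mult_left_mono) (auto simp: less_imp_le)
   also have "... = 4*M^2*(E (rh y)*(u y)^2) + 4*(E (rh y)*(err y)^2) + 2*(E (rh y)*z^2)"
    by (simp add: algebra_simps)
   also have "E (rh y)*(err y)^2 <= E r1*(ind {y. rh y <= r4} y*(err y)^2)" using 2 rh by (simp add: mult_right_mono)
   finally show ?thesis using 3 by (simp add: algebra_simps)
  qed
 qed
 note cU = c2_cont[OF U]
 have cg: "cont g1" "cont g2" unfolding g1_def g2_def by (intro continuous_intros cU)+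
 have cerr: "cont (%y. (err y)^2)" by (intro continuous_intros err(1))
 have ie: "integrable lborel (%y. ind (hball y0 r4) y*(err y)^2)" by (rule hball_int_integrable[OF cerr])
 have ig1: "integrable lborel (%y. ind (hball y0 r2) y*g1 y)" by (rule hball_int_integrable[OF cg(1)])
 have ig2: "integrable lborel (%y. ind (hball y0 r4) y*g2 y)" by (rule hball_int_integrable[OF cg(2)])
 define I where "I = (LBINT y. ind halfspace y*(E (rh y)*(u y)^2))"
 have "(LBINT y. ind halfspace y*(E (rh y)*(lap Hu y)^2))
   <= (LBINT y. 4*M^2*(ind halfspace y*(E (rh y)*(u y)^2)) + (4*E r1*(ind (hball y0 r4) y*(err y)^2)
   + (2*E r1*(ind (hball y0 r2) y*g1 y) + 2*E r3*(ind (hball y0 r4) y*g2 y))))"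
 proof (rule integral_mono[OF car(2)])
  show "integrable lborel (%y. 4*M^2*(ind halfspace y*(E (rh y)*(u y)^2)) + (4*E r1*(ind (hball y0 r4) y*(err y)^2)
   + (2*E r1*(ind (hball y0 r2) y*g1 y) + 2*E r3*(ind (hball y0 r4) y*g2 y))))"
   by (intro Lintb_add integrable_mult_right car(1) ie ig1 ig2)
  show "ind halfspace y*(E (rh y)*(lap Hu y)^2)
   <= 4*M^2*(ind halfspace y*(E (rh y)*(u y)^2)) + (4*E r1*(ind (hball y0 r4) y*(err y)^2)
   + (2*E r1*(ind (hball y0 r2) y*g1 y) + 2*E r3*(ind (hball y0 r4) y*g2 y)))" for y
  proof (cases "y : halfspace")
   case True
   then have *: "ind (hball y0 r) y = (ind {y. rh y <= r} y :: real)" for r by (simp add: indicator_def hball_def halfspace_def rh_def)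
   show ?thesis using pw[of y] True unfolding * by simp
  next
   case False
   then have "ind (hball y0 r) y = (0 :: real)" for r by (simp add: indicator_def hball_def halfspace_def)
   then show ?thesis using False by simp
  qed
 qed
 also have "... = 4*M^2*I + (4*E r1*hball_int y0 r4 (%y. (err y)^2)
   + (2*E r1*hball_int y0 r2 g1 + 2*E r3*hball_int y0 r4 g2))" unfolding I_def hball_int_def using car(1) ie ig1 ig2
  by (subst Lint_add Lint_mult_right_zero;
    (intro Lintb_add integrable_mult_right)?)+ auto
 finally have up: "(LBINT y. ind halfspace y*(E (rh y)*(lap Hu y)^2)) <=
   4*M^2*I + (4*E r1*hball_int y0 r4 (%y. (err y)^2) + (2*E r1*hball_int y0 r2 g1 + 2*E r3*hball_int y0 r4 g2))" .
 have I0: "I >= 0" unfolding I_def using E0 by (intro integral_nonneg_AE) (auto simp: less_imp_le)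
 have abs: "4*M^2*I <= 16*ta^3*ka^2*I"
 proof (rule mult_right_mono[OF _ I0])
  show "4*M^2 <= 16*ta^3*ka^2" using M(2) by linarith
 qed
 \<comment> \<open>For squared distances between \<open>r2\<close> and \<open>rs\<close> the cutoff
   is 1 and the weight at least \<open>E rs\<close>. The half-ball of \<open>r2\<close> is
   subtracted because the cutoff is smaller there.\<close>
 have low: "E rs*(hball_int y0 rs (%y. (U y)^2) - hball_int y0 r2 (%y. (U y)^2)) <= I"
 proof -
  have cu2: "cont (%y. (U y)^2)" by (intro continuous_intros cU)
  have "E rs*(hball_int y0 rs (%y. (U y)^2) - hball_int y0 r2 (%y. (U y)^2))
   = (LBINT y. E rs*(ind (hball y0 rs) y*(U y)^2 - ind (hball y0 r2) y*(U y)^2))"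
   unfolding hball_int_def using hball_int_integrable[OF cu2] by simp
  also have "... <= I" unfolding I_def
  proof (rule integral_mono[OF _ car(1)])
   show "integrable lborel (%y. E rs*(ind (hball y0 rs) y*(U y)^2 - ind (hball y0 r2) y*(U y)^2))"
    using hball_int_integrable[OF cu2] by simp
   fix y
   show "E rs*(ind (hball y0 rs) y*(U y)^2 - ind (hball y0 r2) y*(U y)^2)
    <= ind halfspace y*(E (rh y)*(u y)^2)"
   proof (cases "y : halfspace & r2 < rh y & rh y <= rs")
    case True
    then have "eh y = 1" using hi[of "rh y"] lo2[of "rh y"] rs by (simp add: eh_def f_def)
    moreover have "E rs <= E (rh y)" using True rs r by (intro Emono) auto
    ultimately show ?thesis using True by (simp add: u_def hball_def halfspace_def rh_def mult_right_mono)
   next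
    case False
    have "ind (hball y0 rs) y*(U y)^2 - ind (hball y0 r2) y*(U y)^2 = 0"
     using False rs by (auto simp: indicator_def hball_def halfspace_def rh_def)
    moreover have "0 <= ind halfspace y*(E (rh y)*(u y)^2)" using E0[of "rh y"] by simp
    ultimately show ?thesis by (simp only: mult_zero_right)
   qed
  qed
  finally show ?thesis .
 qed
 have bdry: "(LBINT x. (1/rh (x, 0) - ka)*(E (rh (x, 0))*(Gu (x, 0) <.> (0, 1))^2))
   <= (LBINT x. 1/r1*E r1*(ind {x. rh (x, 0) <= r4} x*(G (x, 0) <.> (0, 1))^2))"
 proof (rule integral_mono')
  have "compact {x. rh (x, 0) <= r4}"
  proof -
   have "{x. rh (x, 0) <= r4} = fst ` ({y. rh y <= r4} \<inter> {y. snd y = 0})" by force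
   moreover have "closed {y :: 'a \<times> real. snd y = 0}" by (intro closed_Collect_eq continuous_intros)
   ultimately show ?thesis using compact_rho_ball[of y0 r4] unfolding rh_def
    by (simp only:) (intro compact_continuous_image continuous_intros compact_Int_closed)
  qed
  moreover have "cont (%x. (G (x, 0) <.> (0, 1))^2)" by (intro continuous_intros cont_comp2[OF cU(2)]) auto
  ultimately show "integrable lborel (%x. 1/r1*E r1*(ind {x. rh (x, 0) <= r4} x*(G (x, 0) <.> (0, 1))^2))"
   by (intro integrable_mult_right integrable_compact_cont)
  show "0 <= 1/r1*E r1*(ind {x. rh (x, 0) <= r4} x*(G (x, 0) <.> (0, 1))^2)" for x
   using r(1) E0[of r1] by (intro mult_nonneg_nonneg) auto
  fix x
  show "(1/rh (x, 0) - ka)*(E (rh (x, 0))*(Gu (x, 0) <.> (0, 1))^2)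
   <= 1/r1*E r1*(ind {x. rh (x, 0) <= r4} x*(G (x, 0) <.> (0, 1))^2)"
  proof (cases "rh (x, 0) <= r1 \<or> r4 <= rh (x, 0)")
   case True
   then have "Gu (x, 0) = 0" using ehlo ehhi bd by (auto simp: Gu_def)
   moreover have "0 <= 1/r1*E r1*(ind {x. rh (x, 0) <= r4} x*(G (x, 0) <.> (0, 1))^2)"
    using r(1) E0[of r1] by (intro mult_nonneg_nonneg) auto
   ultimately show ?thesis by simp
  next
   case False
   then have rh: "r1 < rh (x, 0)" "rh (x, 0) < r4" by auto
   have 1: "1/rh (x, 0) - ka <= 1/r1" using rh r(1) pos frac_le[of 1 1 r1 "rh (x, 0)"] by simp
   have 2: "E (rh (x, 0)) <= E r1" using rh r by (intro Emono) auto
   have 3: "(Gu (x, 0) <.> (0, 1))^2 <= (G (x, 0) <.> (0, 1))^2"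
   proof -
    have "(Gu (x, 0) <.> (0, 1))^2 = (eh (x, 0))^2*(G (x, 0) <.> (0, 1))^2"
     using bd by (simp add: Gu_def power_mult_distrib)
    also have "... <= 1*(G (x, 0) <.> (0, 1))^2" using eh01[of "(x, 0)"] by (intro mult_right_mono) (auto simp: power_le_one)
    finally show ?thesis by simp
   qed
   have "(1/rh (x, 0) - ka)*(E (rh (x, 0))*(Gu (x, 0) <.> (0, 1))^2)
     <= 1/r1*(E (rh (x, 0))*(Gu (x, 0) <.> (0, 1))^2)" using 1 E0[of "rh (x, 0)"] by (intro mult_right_mono) auto
   also have "... <= 1/r1*(E r1*(G (x, 0) <.> (0, 1))^2)"
    using 2 3 r(1) E0 by (intro mult_left_mono mult_mono) (auto simp: less_imp_le)
   finally show ?thesis using rh by simp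
  qed
 qed
 have "- (4*ta* snd y0*(LBINT x. (1/rh (x, 0) - ka)*(E (rh (x, 0))*(Gu (x, 0) <.> (0, 1))^2)))
  <= 4*ta*(- snd y0)*(LBINT x. 1/r1*E r1*(ind {x. rh (x, 0) <= r4} x*(G (x, 0) <.> (0, 1))^2))"
  using mult_left_mono[OF bdry, of "4*ta*(- snd y0)"] y0 pos by (simp add: mult_nonneg_nonpos)
 also have "... = 4*ta*(- snd y0)/r1*E r1*(LBINT x. ind {x. rh (x, 0) <= r4} x*(G (x, 0) <.> (0, 1))^2)"
  by (simp only: Lint_mult_right_zero) simp
 finally have bt: "- (4*ta* snd y0*(LBINT x. (1/rh (x, 0) - ka)*(E (rh (x, 0))*(Gu (x, 0) <.> (0, 1))^2)))
  <= 4*ta*(- snd y0)/r1*E r1*(LBINT x. ind {x. rh (x, 0) <= r4} x*(G (x, 0) <.> (0, 1))^2)" .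
 have "16*ta^3*ka^2*(E rs*(hball_int y0 rs (%y. (U y)^2) - hball_int y0 r2 (%y. (U y)^2)))
   <= 16*ta^3*ka^2*I" using low pos by (intro mult_left_mono) auto
 also have "... = 32*ta^3*ka^2*I - 16*ta^3*ka^2*I" by simp
 finally show ?thesis using car(3)[folded I_def] up[unfolded g1_def g2_def] abs bt unfolding rh_def[THEN fun_cong, symmetric] by linarith
qed

text \<open>\<open>X\<close> stands for \<open>16 ta^3 ka^2\<close>. It dominates 4 and
  \<open>4 M2\<close>, so the gradient bounds \<open>g2\<close> and \<open>g4\<close> can be
  inserted and \<open>X\<close> cancelled; the size \<open>M2\<close> of the squared potential
  disappears from the conclusion. \<open>NN2\<close> and \<open>NN4\<close> are integrals over the
  half-balls of doubled squared radius.\<close>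

lemma local_algebra:
 fixes X E1 Es E3 N N2 NN2 N4 NN4 g2 g4 e e2 ee4 B B' K K' b M2 :: real
 assumes X: "4 <= X" "4*M2 <= X" and nn: "0 <= E1" "0 <= E3" "0 <= Es" "0 <= B" "0 <= B'" "0 <= K" "0 <= K'" "0 <= M2"
  "0 <= N2" "0 <= N4" "0 <= e" "0 <= e2" "0 <= b"
  and le: "Es <= E1" "E3 <= E1" "N2 <= NN2" "N4 <= NN4" "e <= ee4" "e2 <= ee4"
  and g2: "g2 <= K*NN2 + (2*M2*NN2 + 2*e2)"
  and g4: "g4 <= K'*NN4 + (2*M2*NN4 + 2*ee4)"
  and main: "X*(Es*(N - N2)) <= 4*E1*e + 2*E1*(2*B^2*N2 + 9*B*g2)
    + 2*E3*(2*B'^2*N4 + 9*B'*g4) + 4*(b*E1)"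
 shows "Es*N <= (1 + B^2 + 5*B*K + 9*B)*E1*NN2 + (1 + B'^2 + 5*B'*K' + 9*B')*E3*NN4
    + (1 + 9*B + 9*B')*E1*ee4 + b*E1"
proof -
 have nn': "0 <= NN2" "0 <= NN4" "0 <= ee4" using nn le by linarith+
 have X4: "4*P <= X*P" if "0 <= P" for P using X that by (intro mult_right_mono) auto
 have XM: "4*M2*P <= X*P" if "0 <= P" for P using X that by (intro mult_right_mono) auto
 have h: "2*E*(2*b1^2*n + 9*b1*g) <= X*((b1^2 + 5*b1*k + 9*b1)*E*nn + 9*b1*E*ee)"
  if "0 <= E" "0 <= b1" "0 <= k" "0 <= nn" "n <= nn" "0 <= ee" "g <= k*nn + (2*M2*nn + 2*e0)" "e0 <= ee"
  for E b1 n g k nn ee e0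
 proof -
  have "2*E*(2*b1^2*n + 9*b1*g) <= 2*E*(2*b1^2*nn + 9*b1*(k*nn + (2*M2*nn + 2*ee)))"
   using that nn by (intro mult_left_mono add_mono order_trans[OF that(7)]) auto
  also have "... = 4*(b1^2*E*nn) + 4*(9/2*(b1*k*E*nn)) + 4*M2*(9*(b1*E*nn)) + 4*(9*(b1*E*ee))"
   by (simp add: algebra_simps)
  also have "... <= X*(b1^2*E*nn) + X*(9/2*(b1*k*E*nn)) + X*(9*(b1*E*nn)) + X*(9*(b1*E*ee))"
   using that by (intro add_mono X4 XM) auto
  also have "... <= X*(b1^2*E*nn) + X*(5*(b1*k*E*nn)) + X*(9*(b1*E*nn)) + X*(9*(b1*E*ee))"
   using that X by (intro add_mono mult_left_mono mult_right_mono) auto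
  also have "... = X*((b1^2 + 5*b1*k + 9*b1)*E*nn + 9*b1*E*ee)" by (simp add: algebra_simps)
  finally show ?thesis .
 qed
 have h1: "2*E1*(2*B^2*N2 + 9*B*g2) <= X*((B^2 + 5*B*K + 9*B)*E1*NN2 + 9*B*E1*ee4)"
  using nn nn' le by (intro h[OF _ _ _ _ _ _ g2]) auto
 have h2: "2*E3*(2*B'^2*N4 + 9*B'*g4) <= X*((B'^2 + 5*B'*K' + 9*B')*E3*NN4 + 9*B'*E3*ee4)"
  using nn nn' le by (intro h[OF _ _ _ _ _ _ g4]) auto
 have h3: "4*(E1*e) <= X*(E1*ee4)" using nn nn' le X by (intro mult_mono) auto
 have h4: "4*(b*E1) <= X*(b*E1)" using nn by (intro X4) auto
 have h5: "Es*N2 <= E1*NN2" using nn le by (intro mult_mono) auto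
 have h6: "9*B'*E3*ee4 <= 9*B'*E1*ee4" using nn nn' le by (intro mult_right_mono mult_left_mono) auto
 have h7: "0 <= E3*NN4" using nn nn' by auto
 have "X*(Es*N - Es*N2) <= X*(E1*ee4 + ((B^2 + 5*B*K + 9*B)*E1*NN2 + 9*B*E1*ee4)
   + ((B'^2 + 5*B'*K' + 9*B')*E3*NN4 + 9*B'*E3*ee4) + b*E1)"
  using main h1 h2 h3 h4 unfolding right_diff_distrib[symmetric] distrib_left by linarith
 then have "Es*N - Es*N2 <= E1*ee4 + ((B^2 + 5*B*K + 9*B)*E1*NN2 + 9*B*E1*ee4)
   + ((B'^2 + 5*B'*K' + 9*B')*E3*NN4 + 9*B'*E3*ee4) + b*E1" using X by (simp add: mult_le_cancel_left)
 then show ?thesis using h5 h6 h7 by (simp add: algebra_simps)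
qed

text \<open>The Caccioppoli inequality trades the gradients on the rings for \<open>U\<close> and
  \<open>err\<close> on larger half-balls. What remains is a comparison of three weights, and the
  two steps below differ only in the choice of the centre and the radii.\<close>

lemma local_estimate:
 fixes U :: "'a::euclidean_space \<times> real => real" and y0 :: "'a \<times> real"
 assumes U: "c2 U G H" and bd: "!!x. U (x, 0) = 0"
  and lapU: "!!y. \<bar>lap H y\<bar> <= M*\<bar>U y\<bar> + err y"
  and err: "cont err" "!!y. err y >= 0" and M: "M >= 0" "M^2 <= 4*ta^3*ka^2" "1 <= 4*ta^3*ka^2"
  and r: "0 < r1" "r1 < r2" "r2 <= r3" "r3 < r4" "ka*r4 <= 1/2" and rs: "r2 <= rs" "rs <= r3"
  and pos: "ta > 0" "ka > 0" and y0: "snd y0 <= 0"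
 defines "E \<equiv> carl_weight ta ka" and "D \<equiv> real DIM('a \<times> real)"
 defines "B \<equiv> 288*r2/(r2 - r1)^2 + 18*D/(r2 - r1)"
  and "B' \<equiv> 288*r4/(r4 - r3)^2 + 18*D/(r4 - r3)"
  and "K \<equiv> (288 + 9*D)/r2 + 1" and "K' \<equiv> (288 + 9*D)/r4 + 1"
 shows "E rs*hball_int y0 rs (%y. (U y)^2)
  <= (1 + B^2 + 5*B*K + 9*B)*E r1*hball_int y0 (2*r2) (%y. (U y)^2)
   + (1 + B'^2 + 5*B'*K' + 9*B')*E r3*hball_int y0 (2*r4) (%y. (U y)^2)
   + (1 + 9*B + 9*B')*E r1*hball_int y0 (2*r4) (%y. (err y)^2) + ta*(- snd y0)/r1 *
     (LBINT x. ind {x. ((x, 0) - y0) <.> ((x, 0) - y0) <= r4} x*(G (x, 0) <.> (0, 1))^2)*E r1"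
proof -
 note cU = c2_cont[OF U]
 define Bd where "Bd = (LBINT x. ind {x. ((x, 0) - y0) <.> ((x, 0) - y0) <= r4} x*(G (x, 0) <.> (0, 1))^2)"
 have Bd0: "Bd >= 0" unfolding Bd_def by (intro integral_nonneg_AE) auto
 have D0: "D >= 0" by (simp add: D_def)
 have cu2: "cont (%y. (U y)^2)" "cont (%y. (err y)^2)" "cont (%y. G y <.> G y)"
  by (intro continuous_intros cU err)+
 have lin: "hball_int y0 r (%y. 2*b^2*(U y)^2 + 9*b*(G y <.> G y))
   = 2*b^2*hball_int y0 r (%y. (U y)^2) + 9*b*hball_int y0 r (%y. G y <.> G y)" for b r
  using cu2 by (subst hball_int_add) (auto intro!: continuous_intros simp: hball_int_scale)
 have E0: "E s > 0" for s by (simp add: E_def carl_weight_def)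
 have Emono: "E t <= E s" if "0 < s" "s <= t" "t <= r4" for s t unfolding E_def
 proof (rule carl_weight_mono)
  show "ka*t <= 1" using mult_left_mono[OF that(3), of ka] pos r(5) by linarith
 qed (use that pos in auto)
 have cac: "hball_int y0 r (%y. G y <.> G y) <= ((288 + 9*D)/r + 1)*hball_int y0 (2*r) (%y. (U y)^2)
   + (2*M^2*hball_int y0 (2*r) (%y. (U y)^2) + 2*hball_int y0 (2*r) (%y. (err y)^2))" if "r > 0" for r
 proof -
  have "(lap H y)^2 <= 2*M^2*(U y)^2 + 2*(err y)^2" for y
  proof -
   have "(lap H y)^2 <= (M*\<bar>U y\<bar> + err y)^2" using lapU[of y] M err(2)[of y] by (intro power2_le_iff_abs_le[THEN iffD2]) auto
   also have "... <= 2*(M*\<bar>U y\<bar>)^2 + 2*(err y)^2"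
    using sum_squares_bound[of "M*\<bar>U y\<bar>" "err y"] by (simp add: power2_sum)
   finally show ?thesis by (simp add: power_mult_distrib)
  qed
  then have "hball_int y0 (2*r) (%y. (lap H y)^2) <= hball_int y0 (2*r) (%y. 2*M^2*(U y)^2 + 2*(err y)^2)"
   by (intro hball_int_mono continuous_intros cU err) auto
  also have "... = 2*M^2*hball_int y0 (2*r) (%y. (U y)^2) + 2*hball_int y0 (2*r) (%y. (err y)^2)"
   using cu2 by (subst hball_int_add) (auto intro!: continuous_intros simp: hball_int_scale)
  finally show ?thesis using caccioppoli_ball[OF U bd that, of y0] unfolding D_def by linarith
 qed
 have main: "16*ta^3*ka^2*(E rs*(hball_int y0 rs (%y. (U y)^2) - hball_int y0 r2 (%y. (U y)^2)))
  <= 4*E r1*hball_int y0 r4 (%y. (err y)^2)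
   + 2*E r1*(2*B^2*hball_int y0 r2 (%y. (U y)^2) + 9*B*hball_int y0 r2 (%y. G y <.> G y))
   + 2*E r3*(2*B'^2*hball_int y0 r4 (%y. (U y)^2) + 9*B'*hball_int y0 r4 (%y. G y <.> G y))
   + 4*(ta*(- snd y0)/r1*Bd*E r1)" using local_carleman[OF U bd lapU err M(1,2) r rs pos y0]
  unfolding lin E_def B_def B'_def D_def Bd_def by (simp add: mult_ac)
 have "r1 < r4" using r by linarith
 have x: "4 <= 16*ta^3*ka^2" "4*M^2 <= 16*ta^3*ka^2" using M by linarith+
 have b0: "0 <= ta*(- snd y0)/r1*Bd" using Bd0 y0 pos r by (intro mult_nonneg_nonneg divide_nonneg_pos) auto
 show ?thesis unfolding Bd_def[symmetric]
  by (rule local_algebra[OF x _ _ _ _ _ _ _ _ _ _ _ _ b0 _ _ _ _ _ _ cac[of r2, folded K_def] cac[of r4, folded K'_def] main]) (use r rs D0 in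
     \<open>auto intro!: Emono hball_int_nonneg hball_int_mono_radius cu2 less_imp_le[OF E0]
      divide_nonneg_pos mult_nonneg_nonneg add_nonneg_nonneg simp: B_def B'_def K_def K'_def mult_nonneg_nonpos\<close>)
qed

text \<open>This is \<open>1 + b0^2 + 5 b0 k0 + 9 b0\<close> for \<open>b0 = 4608 + 72 D\<close> and
  \<open>k0 = 577 + 18 D\<close>. Relative to the scale of the radii, these two numbers bound the
  ring constants wherever \<open>quadratic_const_mono\<close> is applied.\<close>

definition cst :: "real => real" where "cst D = 1 + (4608 + 72*D)^2 + 5*(4608 + 72*D)*(577 + 18*D) + 9*(4608 + 72*D)"

lemma quadratic_const_mono:
 fixes b b0 k k0 c :: real
 assumes "0 <= b" "b <= b0*c" "0 <= k" "k <= k0*c" "1 <= c" "0 <= b0"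
 shows "1 + b^2 + 5*b*k + 9*b <= (1 + b0^2 + 5*b0*k0 + 9*b0)*c^2"
proof -
 have c: "1 <= c^2" "c <= c^2" using assms(5) self_le_power[of c 2] by (auto intro: one_le_power)
 have "b^2 <= (b0*c)^2" using assms by (intro power_mono) auto
 moreover have "b*k <= (b0*c)*(k0*c)" using assms by (intro mult_mono) auto
 moreover have "b <= b0*c^2" using assms(2) mult_left_mono[OF c(2) assms(6)] by linarith
 moreover have "(b0*c)^2 = b0^2*c^2" "(b0*c)*(k0*c) = (b0*k0)*c^2" by (simp_all add: power2_eq_square)
 ultimately show ?thesis using c(1) by (simp add: distrib_right)
qed

lemma carl_weight_quot:
 assumes "0 < s" "0 < t" "ta >= 0" "ln (s/t) + ka*(t - s) <= c"
 shows "carl_weight ta ka t <= exp (2*ta*c)*carl_weight ta ka s"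
proof -
 have "ka*t - ln t <= c + (ka* s - ln s)" using assms by (simp add: ln_div algebra_simps)
 then have "2*ta*(ka*t - ln t) <= 2*ta*(c + (ka* s - ln s))" using assms by (intro mult_left_mono) auto
 then show ?thesis unfolding carl_weight_def exp_add[symmetric] by (simp add: distrib_left)
qed

text \<open>Only its sign and its independence of \<open>U\<close> matter: the error that it
  multiplies tends to 0 while all radii stay fixed.\<close>

definition err_const :: "real => real => real => real => real => real" where
 "err_const D r1 r2 r3 r4 = 1 + 9*(288*r2/(r2 - r1)^2 + 18*D/(r2 - r1)) + 9*(288*r4/(r4 - r3)^2 + 18*D/(r4 - r3))"

text \<open>The centre lies at depth \<open>a\<close> below the boundary, so squared distances on
  the half-space are at least \<open>a^2\<close>, and the inner ring with
  \<open>2 r2 = 2/3 a^2\<close> does not meet it. Hence the large factor multiplies only the error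
  and the normal derivative on the boundary, whereas \<open>U\<close> itself returns with the small
  factor \<open>exp (- ta/4)\<close>.\<close>

lemma boundary_step:
 fixes U :: "'a::euclidean_space \<times> real => real"
 assumes U: "c2 U G H" and bd: "!!x. U (x, 0) = 0"
  and lapU: "!!y. \<bar>lap H y\<bar> <= M*\<bar>U y\<bar> + err y"
  and err: "cont err" "!!y. err y >= 0" and M: "M >= 0" "M^2 <= ta^3" "1 <= ta"
  and a: "0 < a" "a <= 1/8"
 defines "D \<equiv> real DIM('a \<times> real)"
 shows "hball_int (z, - a) (2*a^2) (%y. (U y)^2)
   <= cst D/a^4*exp (- ta/4)*hball_int (z, - a) (8*a^2) (%y. (U y)^2)
    + err_const D (a^2/4) (a^2/3) (3*a^2) (4*a^2)*exp (6*ta)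
     *hball_int (z, - a) (8*a^2) (%y. (err y)^2)
    + 4*ta/a*exp (6*ta)*(LBINT x. ind {x. (x - z) <.> (x - z) <= 3*a^2} x*(G (x, 0) <.> (0, 1))^2)"
proof -
 \<comment> \<open>The largest value with \<open>ka r4 <= 1/2\<close> for
   \<open>r4 = 4 a^2\<close>.\<close>
 define ka where "ka = 1/(8*a^2)"
 define B where "B = 288*(a^2/3)/(a^2/3 - a^2/4)^2 + 18*D/(a^2/3 - a^2/4)"
 define B' where "B' = 288*(4*a^2)/(4*a^2 - 3*a^2)^2 + 18*D/(4*a^2 - 3*a^2)"
 define K' where "K' = (288 + 9*D)/(4*a^2) + 1"
 define E where "E = carl_weight ta ka"
 have D0: "D >= 0" by (simp add: D_def)
 have a2: "0 < a^2" "a^2 <= 1/64" using a power_mono[of a "1/8" 2] by (auto simp: power2_eq_square)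
 have ka8: "ka >= 8" using a2 by (simp add: ka_def field_simps)
 have ta3: "1 <= ta^3" using M(3) by simp
 have kata: "ta^3 <= 4*ta^3*ka^2"
 proof -
  have "1 <= 4*ka^2" using power_mono[of 8 ka 2] ka8 by simp
  then show ?thesis using mult_left_mono[of 1 "4*ka^2" "ta^3"] ta3 M(3) by (simp add: mult_ac)
 qed
 have E0: "E s > 0" for s by (simp add: E_def carl_weight_def)
 \<comment> \<open>The gain \<open>ln (2/3) <= - 1/3\<close> of the logarithm outweighs the loss
   \<open>ka a^2 = 1/8\<close> of the convex term; the sum is below \<open>- 1/8\<close>, and the
   exponent is \<open>2 ta\<close> times it.\<close>
 have E3: "E (3*a^2) <= exp (- ta/4)*E (2*a^2)"
 proof -
  have "ln (2*a^2/(3*a^2)) + ka*(3*a^2 - 2*a^2) <= - 1/8"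
   using ln_le_minus_one[of "2/3"] a2 by (simp add: ka_def)
  from carl_weight_quot[OF _ _ _ this, of ta] show ?thesis using a2 M(3) by (simp add: E_def)
 qed
 have E1: "E (a^2/4) <= exp (6*ta)*E (2*a^2)"
 proof -
  have "ln (8 :: real) = 3*ln 2" using ln_realpow[of 2 3] by simp
  then have "ln (8 :: real) <= 3" using ln_2_less_1 by simp
  moreover have "ka*(a^2/4 - 2*a^2) <= 0" using a2 ka8 by (simp add: mult_le_0_iff)
  moreover have "2*a^2/(a^2/4) = 8" using a2 by simp
  ultimately have "ln (2*a^2/(a^2/4)) + ka*(a^2/4 - 2*a^2) <= 3" by simp
  from carl_weight_quot[OF _ _ _ this, of ta] show ?thesis using a2 M(3) by (simp add: E_def)
 qed
 have Q: "1 + B'^2 + 5*B'*K' + 9*B' <= cst D/a^4"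
 proof -
  have "1 + B'^2 + 5*B'*K' + 9*B' <= cst D*(1/a^2)^2" unfolding cst_def
  proof (rule quadratic_const_mono)
   show "0 <= B'" "0 <= K'" using a2 D0 by (auto simp: B'_def K'_def)
   have "4*a^2 - 3*a^2 = a^2" by simp
   then have "B' = (1152 + 18*D)*(1/a^2)" using a2 unfolding B'_def by (simp add: field_simps power2_eq_square)
   also have "... <= (4608 + 72*D)*(1/a^2)" using a2 D0 by (intro mult_right_mono) auto
   finally show "B' <= (4608 + 72*D)*(1/a^2)" .
   show c: "1 <= 1/a^2" using a2 by simp
   have "K' = (72 + 9/4*D)*(1/a^2) + 1" using a2 unfolding K'_def by (simp add: field_simps)
   also have "... <= (576 + 18*D)*(1/a^2) + 1*(1/a^2)" using a2 D0 c by (intro add_mono mult_right_mono) auto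
   finally show "K' <= (577 + 18*D)*(1/a^2)" by (simp add: algebra_simps add_divide_distrib)
  qed (use D0 in auto)
  then show ?thesis by (simp add: power_divide)
 qed
 have B0: "0 <= B" "0 <= B'" using a2 D0 by (auto simp: B_def B'_def)
 define K where "K = (1 + 9*B + 9*B')*exp (6*ta)"
 have "hball_int (z, - a) (2*a^2) (%y. (U y)^2)
   <= cst D/a^4*exp (- ta/4)*hball_int (z, - a) (8*a^2) (%y. (U y)^2)
    + K*hball_int (z, - a) (8*a^2) (%y. (err y)^2)
    + 4*ta/a*exp (6*ta)*(LBINT x. ind {x. (x - z) <.> (x - z) <= 3*a^2} x*(G (x, 0) <.> (0, 1))^2)" for z
 proof -
  define Bd where "Bd = (LBINT x. ind {x. (x - z) <.> (x - z) <= 3*a^2} x*(G (x, 0) <.> (0, 1))^2)"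
  define N8 where "N8 = hball_int (z, - a) (8*a^2) (%y. (U y)^2)"
  define R8 where "R8 = hball_int (z, - a) (8*a^2) (%y. (err y)^2)"
  have nn: "Bd >= 0" "N8 >= 0" "R8 >= 0" unfolding Bd_def N8_def R8_def by (auto intro!: hball_int_nonneg integral_nonneg_AE)
  have set: "{x. ((x, 0) - (z, - a)) <.> ((x, 0) - (z, - a)) <= 4*a^2} = {x. (x - z) <.> (x - z) <= 3*a^2}"
   by (auto simp: power2_eq_square)
  have empty: "hball_int (z, - a) (2*(a^2/3)) (%y. (U y)^2) = 0"
  proof -
   have "hball (z, - a) (2*(a^2/3)) = {}"
   proof (rule ccontr)
    assume "hball (z, - a) (2*(a^2/3)) ~= {}"
    then obtain y where y: "y : hball (z, - a) (2*(a^2/3))" by blast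
    then have "(snd y + a)*(snd y + a) <= 2*(a^2/3)" "0 <= snd y"
     using inner_ge_zero[of "fst y - z"] by (auto simp: hball_def inner_prod_def simp del: inner_ge_zero)
    moreover have "a*a <= (snd y + a)*(snd y + a)" using a \<open>0 <= snd y\<close> by (intro mult_mono) auto
    ultimately show False using a2 by (simp add: power2_eq_square)
   qed
   then show ?thesis unfolding hball_int_def by simp
  qed
  have c1: "M^2 <= 4*ta^3*ka^2" "1 <= 4*ta^3*ka^2" using kata ta3 M(2) by linarith+
  have c2: "ka*(4*a^2) <= 1/2" using a2 by (simp add: ka_def)
  have "E (2*a^2)*hball_int (z, - a) (2*a^2) (%y. (U y)^2)
   <= (1 + B'^2 + 5*B'*K' + 9*B')*E (3*a^2)*N8
    + (1 + 9*B + 9*B')*E (a^2/4)*R8 + ta*a/(a^2/4)*Bd*E (a^2/4)"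
   using local_estimate[OF U bd lapU err M(1) c1, of "a^2/4" "a^2/3" "3*a^2" "4*a^2" "2*a^2" "(z, - a)"]
    a2 c2 ka8 M(3) a(1) unfolding empty set E_def B'_def B_def K'_def D_def N8_def R8_def Bd_def by simp
  also have "... <= cst D/a^4*(exp (- ta/4)*E (2*a^2))*N8
    + (1 + 9*B + 9*B')*(exp (6*ta)*E (2*a^2))*R8 + ta*a/(a^2/4)*Bd*(exp (6*ta)*E (2*a^2))"
   using Q E3 E1 nn E0 B0 a M(3) by (intro add_mono mult_right_mono mult_mono mult_left_mono)
     (auto intro!: less_imp_le[OF E0] mult_nonneg_nonneg divide_nonneg_nonneg order_trans[OF _ Q] simp: K'_def D0 add_nonneg_nonneg)
  also have "... = E (2*a^2)*(cst D/a^4*exp (- ta/4)*N8 + K*R8 + 4*ta/a*exp (6*ta)*Bd)"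
   using a by (simp add: K_def field_simps power2_eq_square)
  finally show ?thesis unfolding N8_def R8_def Bd_def using E0 by (simp only: mult_le_cancel_left_pos)
 qed
 then show ?thesis unfolding K_def B_def B'_def err_const_def .
qed

text \<open>With the centre on the boundary, \<open>snd y0 = 0\<close> removes the boundary term.
  The price is an inner ring: \<open>U\<close> on a small half-ball has to be known, with a factor
  that is a power of \<open>1/b\<close> of order \<open>ta\<close>. The choice
  \<open>ka = 1/(12 d)\<close> is \<open>1/(2 r4)\<close> for \<open>r4 = 6 d\<close>, and then
  \<open>4 ta^3 ka^2 = ta^3/(36 d^2)\<close>, whence the number 36.\<close>

lemma interior_step:
 fixes U :: "'a::euclidean_space \<times> real => real"
 assumes U: "c2 U G H" and bd: "!!x. U (x, 0) = 0"
  and lapU: "!!y. \<bar>lap H y\<bar> <= M*\<bar>U y\<bar> + err y"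
  and err: "cont err" "!!y. err y >= 0"
  and M: "M >= 0" "36*d^2*M^2 <= ta^3" "36*d^2 <= ta^3" "0 < ta"
  and b: "0 < b" "b <= 1" and d: "1 <= d"
 defines "D \<equiv> real DIM('a \<times> real)"
 shows "hball_int (z, 0) (4*d) (%y. (U y)^2)
   <= cst D/b^4*exp (2*ta*ln (16*d/b^2))*hball_int (z, 0) (b^2) (%y. (U y)^2)
    + cst D*exp (- ta/5)*hball_int (z, 0) (12*d) (%y. (U y)^2)
    + err_const D (b^2/4) (b^2/2) (5*d) (6*d)*exp (2*ta*ln (16*d/b^2))
     *hball_int (z, 0) (12*d) (%y. (err y)^2)"
proof -
 define ka where "ka = 1/(12*d)"
 define B where "B = 288*(b^2/2)/(b^2/2 - b^2/4)^2 + 18*D/(b^2/2 - b^2/4)"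
 define B' where "B' = 288*(6*d)/(6*d - 5*d)^2 + 18*D/(6*d - 5*d)"
 define K where "K = (288 + 9*D)/(b^2/2) + 1"
 define K' where "K' = (288 + 9*D)/(6*d) + 1"
 define E where "E = carl_weight ta ka"
 have D0: "D >= 0" by (simp add: D_def)
 have b2: "0 < b^2" "b^2 <= 1" using b by (auto simp: power_le_one)
 have ka0: "ka > 0" using d by (simp add: ka_def)
 have kata: "4*ta^3*ka^2 = ta^3/(36*d^2)" using d by (simp add: ka_def power2_eq_square)
 have c1: "M^2 <= 4*ta^3*ka^2" "1 <= 4*ta^3*ka^2" unfolding kata using M d by (simp_all add: field_simps)
 have E0: "E s > 0" for s by (simp add: E_def carl_weight_def)
 \<comment> \<open>Again the logarithm wins: \<open>ln (4/5) <= - 1/5\<close> against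
   \<open>ka d = 1/12\<close>.\<close>
 have E3: "E (5*d) <= exp (- ta/5)*E (4*d)"
 proof -
  have "ln (4*d/(5*d)) + ka*(5*d - 4*d) <= - 1/10" using ln_le_minus_one[of "4/5"] d by (simp add: ka_def)
  from carl_weight_quot[OF _ _ _ this, of ta] show ?thesis using d M(4) by (simp add: E_def)
 qed
 define W where "W = exp (2*ta*ln (16*d/b^2))"
 have E1: "E (b^2/4) <= W*E (4*d)"
 proof -
  have "ka*(b^2/4 - 4*d) <= 0" using b2 d ka0 by (simp add: mult_le_0_iff)
  moreover have "4*d/(b^2/4) = 16*d/b^2" by simp
  ultimately have "ln (4*d/(b^2/4)) + ka*(b^2/4 - 4*d) <= ln (16*d/b^2)" by simp
  from carl_weight_quot[OF _ _ _ this, of ta] show ?thesis using b2 d M(4) by (simp add: E_def W_def)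
 qed
 have B0: "0 <= B" "0 <= B'" "0 <= K" "0 <= K'" using b2 D0 d by (auto simp: B_def B'_def K_def K'_def)
 have Q: "1 + B^2 + 5*B*K + 9*B <= cst D/b^4"
 proof -
  have "1 + B^2 + 5*B*K + 9*B <= cst D*(1/b^2)^2" unfolding cst_def
  proof (rule quadratic_const_mono)
   show "0 <= B" "0 <= K" by (fact B0)+
   have "b^2/2 - b^2/4 = b^2/4" by simp
   then have "B = (2304 + 72*D)*(1/b^2)" using b2 unfolding B_def by (simp add: field_simps power2_eq_square)
   also have "... <= (4608 + 72*D)*(1/b^2)" using b2 D0 by (intro mult_right_mono) auto
   finally show "B <= (4608 + 72*D)*(1/b^2)" .
   show c: "1 <= 1/b^2" using b2 by simp
   have "K = (576 + 18*D)*(1/b^2) + 1" using b2 unfolding K_def by (simp add: field_simps)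
   then show "K <= (577 + 18*D)*(1/b^2)" using c by (simp add: algebra_simps add_divide_distrib)
  qed (use D0 in auto)
  then show ?thesis by (simp add: power_divide)
 qed
 have Q': "1 + B'^2 + 5*B'*K' + 9*B' <= cst D"
 proof -
  have "1 + B'^2 + 5*B'*K' + 9*B' <= cst D*1^2" unfolding cst_def
  proof (rule quadratic_const_mono)
   show "0 <= B'" "0 <= K'" by (fact B0)+
   have "6*d - 5*d = d" by simp
   then have "B' = (1728 + 18*D)/d" using d unfolding B'_def by (simp add: field_simps power2_eq_square)
   also have "... <= (1728 + 18*D)/1" using d D0 by (intro divide_left_mono) auto
   also have "... <= (4608 + 72*D)*1" using D0 by simp
   finally show "B' <= (4608 + 72*D)*1" .
   have "(288 + 9*D)/(6*d) <= (288 + 9*D)/1" using d D0 by (intro divide_left_mono) auto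
   then show "K' <= (577 + 18*D)*1" using D0 unfolding K'_def by simp
  qed (use D0 in auto)
  then show ?thesis by simp
 qed
 define L where "L = (1 + 9*B + 9*B')*W"
 have "hball_int (z, 0) (4*d) (%y. (U y)^2) <= cst D/b^4*W*hball_int (z, 0) (b^2) (%y. (U y)^2)
    + cst D*exp (- ta/5)*hball_int (z, 0) (12*d) (%y. (U y)^2) + L*hball_int (z, 0) (12*d) (%y. (err y)^2)" for z
 proof -
  define N1 where "N1 = hball_int (z, 0) (b^2) (%y. (U y)^2)"
  define N12 where "N12 = hball_int (z, 0) (12*d) (%y. (U y)^2)"
  define R12 where "R12 = hball_int (z, 0) (12*d) (%y. (err y)^2)"
  have nn: "N1 >= 0" "N12 >= 0" "R12 >= 0" unfolding N1_def N12_def R12_def by (auto intro!: hball_int_nonneg)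
  have c2: "ka*(6*d) <= 1/2" using d by (simp add: ka_def)
  have c3: "b^2/2 <= 5*d" "b^2/2 <= 4*d" using b2 d by linarith+
  have "E (4*d)*hball_int (z, 0) (4*d) (%y. (U y)^2)
   <= (1 + B^2 + 5*B*K + 9*B)*E (b^2/4)*N1 + (1 + B'^2 + 5*B'*K' + 9*B')*E (5*d)*N12
    + (1 + 9*B + 9*B')*E (b^2/4)*R12"
   using local_estimate[OF U bd lapU err M(1) c1, of "b^2/4" "b^2/2" "5*d" "6*d" "4*d" "(z, 0)"] b2 c2 c3 d ka0 M(4)
   unfolding E_def B'_def B_def K'_def K_def D_def N1_def N12_def R12_def by simp
  also have "... <= cst D/b^4*(W*E (4*d))*N1 + cst D*(exp (- ta/5)*E (4*d))*N12
    + (1 + 9*B + 9*B')*(W*E (4*d))*R12" using Q Q' E3 E1 nn E0 B0 by (intro add_mono mult_right_mono mult_mono mult_left_mono)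
     (auto intro!: less_imp_le[OF E0] order_trans[OF _ Q] order_trans[OF _ Q'] add_nonneg_nonneg)
  also have "... = E (4*d)*(cst D/b^4*W*N1 + cst D*exp (- ta/5)*N12 + L*R12)" by (simp add: L_def algebra_simps)
  finally show ?thesis unfolding N1_def N12_def R12_def using E0 by (simp only: mult_le_cancel_left_pos)
 qed
 then show ?thesis unfolding L_def W_def B_def B'_def err_const_def .
qed

lemma hball_int_mono_set:
 assumes "cont f" "!!y. f y >= 0" "hball y0 r \<subseteq> hball y1 r'"
 shows "hball_int y0 r f <= hball_int y1 r' f" unfolding hball_int_def by (intro integral_mono hball_int_integrable assms(1))
   (use assms(2,3) in \<open>auto simp: indicator_def\<close>)

lemma integrable_ball_cont:
 fixes f :: "'b::euclidean_space => real"
 assumes "cont f"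
 shows "integrable lborel (%x. ind (ball z r) x*f x)"
proof -
 have "integrable lborel (%x. ind (ball z r) x *: (ind (cball z r) x*f x))"
  by (intro Lintb_ind integrable_compact_cont assms) auto
 also have "(%x. ind (ball z r) x *: (ind (cball z r) x*f x)) = (%x. ind (ball z r) x*f x)"
  by (auto simp: indicator_def)
 finally show ?thesis .
qed

text \<open>The price of the interior step at \<open>b = de/16\<close>. In \<open>obs_const\<close>
  it is multiplied by the boundary factor \<open>4 s/a\<close> times \<open>exp (6 s)\<close> at
  \<open>a = de/4\<close>; in \<open>rem_const\<close> the remainder of the boundary step,
  multiplied by it, is added to the remainder of the interior step.\<close>

definition prop_const :: "real => real => real => real => real" where
 "prop_const D d de ta = cst D/(de/16)^4*exp (2*ta*ln (16*d/(de/16)^2))"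

definition obs_const :: "real => real => real => real => real => real" where
 "obs_const D d de ta s = prop_const D d de ta*(16* s/de*exp (6* s))"

definition rem_const :: "real => real => real => real => real => real" where
 "rem_const D d de ta s = cst D*exp (- ta/5) + prop_const D d de ta*(cst D/(de/4)^4*exp (- s/4))"

lemma err_const_nonneg:
 assumes "0 <= D" "0 <= r2" "r1 < r2" "0 <= r4" "r3 < r4"
 shows "0 <= err_const D r1 r2 r3 r4"
proof -
 have "0 <= 288*r2/(r2 - r1)^2" "0 <= 18*D/(r2 - r1)" "0 <= 288*r4/(r4 - r3)^2" "0 <= 18*D/(r4 - r3)"
  using assms by simp_all
 then show ?thesis unfolding err_const_def by (intro add_nonneg_nonneg mult_nonneg_nonneg) simp_all
qed

text \<open>The small half-ball needed by the interior step is supplied by the boundary step, with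
  the separate parameters \<open>ta\<close> and \<open>s\<close>. The constant \<open>K\<close> of
  the error is chosen before \<open>U\<close> and \<open>err\<close>, so it stays fixed when the
  error is sent to 0.\<close>

lemma two_step:
 fixes d D de ta s M :: real
 assumes M: "M >= 0" "M^2 <= s^3" "1 <= s" "36*d^2*M^2 <= ta^3" "36*d^2 <= ta^3" "0 < ta"
  and d: "1 <= d" and de: "0 < de" "de < 1/2" and D: "D = real DIM('a::euclidean_space \<times> real)"
 shows "\<exists>K\<ge>0. \<forall>(U :: 'a \<times> real => real) G H err z. c2 U G H --> (\<forall>x. U (x, 0) = 0) -->
   (\<forall>y. \<bar>lap H y\<bar> <= M*\<bar>U y\<bar> + err y) --> cont err --> (\<forall>y. 0 <= err y) -->
   hball_int (z, 0) (4*d) (%y. (U y)^2)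
   <= obs_const D d de ta s*(LBINT x. ind (ball z de) x*(G (x, 0) <.> (0, 1))^2)
    + rem_const D d de ta s*hball_int (z, 0) (12*d) (%y. (U y)^2) + K*hball_int (z, 0) (12*d) (%y. (err y)^2)"
proof -
 define a where "a = de/4"
 define b where "b = de/16"
 have ab: "b = a/4" "0 < a" "a <= 1/8" "0 < b" "b <= 1" using de by (auto simp: a_def b_def)
 define e1 where "e1 = err_const D (a^2/4) (a^2/3) (3*a^2) (4*a^2)*exp (6* s)"
 define e2 where "e2 = err_const D (b^2/4) (b^2/2) (5*d) (6*d)*exp (2*ta*ln (16*d/b^2))"
 define P where "P = prop_const D d de ta"
 have P: "P = cst D/b^4*exp (2*ta*ln (16*d/b^2))" by (simp add: P_def prop_const_def b_def)
 have D0: "D >= 0" unfolding D by simp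
 have cst0: "cst D >= 0" using D0 unfolding cst_def by (intro add_nonneg_nonneg mult_nonneg_nonneg) auto
 have P0: "P >= 0" unfolding P using cst0 ab by (intro mult_nonneg_nonneg divide_nonneg_nonneg) auto
 have a2: "0 < a^2" "a^2 <= 1" using ab by (auto simp: power_le_one)
 have b2: "0 < b^2" "b^2 <= 1" using ab by (auto simp: power_le_one)
 have e0: "e1 >= 0" "e2 >= 0" unfolding e1_def e2_def using D0 a2 b2 d by (simp_all add: err_const_nonneg)
 define K where "K = P*e1 + e2"
 have "hball_int (z, 0) (4*d) (%y. (U y)^2)
   <= obs_const D d de ta s*(LBINT x. ind (ball z de) x*(G (x, 0) <.> (0, 1))^2)
    + rem_const D d de ta s*hball_int (z, 0) (12*d) (%y. (U y)^2) + K*hball_int (z, 0) (12*d) (%y. (err y)^2)"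
  if U: "c2 U G H" and bd: "\<forall>x. U (x, 0) = 0" and lapU: "\<forall>y. \<bar>lap H y\<bar> <= M*\<bar>U y\<bar> + err y"
   and err: "cont err" "\<forall>y. 0 <= err y"
  for U :: "'a \<times> real => real" and G H err z
 proof -
  note cU = c2_cont[OF U]
  have cu2: "cont (%y. (U y)^2)" "cont (%y. (err y)^2)" by (intro continuous_intros cU err)+
  have cG: "cont (%x. (G (x, 0) <.> (0, 1))^2)" by (intro continuous_intros cont_comp2[OF cU(2)]) auto
  have bd': "!!x. U (x, 0) = 0" and lapU': "!!y. \<bar>lap H y\<bar> <= M*\<bar>U y\<bar> + err y"
   and err': "!!y. 0 <= err y" using bd lapU err by blast+
  define N where "N = hball_int (z, 0) (12*d) (%y. (U y)^2)"
  define R where "R = hball_int (z, 0) (12*d) (%y. (err y)^2)"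
  define O' where "O' = (LBINT x. ind (ball z de) x*(G (x, 0) <.> (0, 1))^2)"
  have i: "hball_int (z, 0) (4*d) (%y. (U y)^2)
    <= P*hball_int (z, 0) (b^2) (%y. (U y)^2) + cst D*exp (- ta/5)*N + e2*R"
   using interior_step[OF U bd' lapU' err(1) err' M(1) M(4-6) ab(4,5) d, of z] unfolding D[symmetric] P[symmetric] e2_def[symmetric] N_def R_def .
  have ii: "hball_int (z, - a) (2*a^2) (%y. (U y)^2)
    <= cst D/a^4*exp (- s/4)*hball_int (z, - a) (8*a^2) (%y. (U y)^2)
    + e1*hball_int (z, - a) (8*a^2) (%y. (err y)^2)
    + 4* s/a*exp (6* s)*(LBINT x. ind {x. (x - z) <.> (x - z) <= 3*a^2} x*(G (x, 0) <.> (0, 1))^2)"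
   using boundary_step[OF U bd' lapU' err(1) err' M(1-3) ab(2,3), of z] unfolding D[symmetric] e1_def[symmetric] .
  \<comment> \<open>Since \<open>a = 4 b\<close>, the squared distance to the lower centre is at
    most \<open>(a + b)^2 = 25/16 a^2\<close>, which is below \<open>2 a^2\<close>.\<close>
  have s1: "hball (z, 0) (b^2) \<subseteq> hball (z, - a) (2*a^2)"
  proof
   fix y assume y: "y : hball (z, 0) (b^2)"
   have t: "0 <= snd y" "(snd y)^2 + (fst y - z) <.> (fst y - z) <= b^2"
    using y by (auto simp: hball_def inner_prod_def power2_eq_square)
   then have "(snd y)^2 <= b^2" using inner_ge_zero[of "fst y - z"] by linarith
   then have "snd y <= b" by (rule power2_le_imp_le) (use ab in simp)
   then have "2*a* snd y <= 2*a*b" using ab by simp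
   moreover have "(snd y + a)^2 = (snd y)^2 + 2*a* snd y + a^2" by (simp add: power2_sum)
   moreover have "b^2 + 2*a*b + a^2 <= 2*a^2" using a2 unfolding ab(1) by (simp add: power2_eq_square)
   ultimately show "y : hball (z, - a) (2*a^2)" using t by (simp add: hball_def inner_prod_def power2_eq_square)
  qed
  have s2: "hball (z, - a) (8*a^2) \<subseteq> hball (z, 0) (12*d)"
  proof
   fix y assume y: "y : hball (z, - a) (8*a^2)"
   have t: "0 <= snd y" "(snd y + a)^2 + (fst y - z) <.> (fst y - z) <= 8*a^2"
    using y by (auto simp: hball_def inner_prod_def power2_eq_square)
   have "(snd y)^2 <= (snd y + a)^2" using t ab by (intro power_mono) auto
   then have "(snd y)^2 + (fst y - z) <.> (fst y - z) <= 12*d" using t a2 d by linarith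
   then show "y : hball (z, 0) (12*d)" using t by (simp add: hball_def inner_prod_def power2_eq_square)
  qed
  have m1: "hball_int (z, 0) (b^2) (%y. (U y)^2) <= hball_int (z, - a) (2*a^2) (%y. (U y)^2)"
   by (rule hball_int_mono_set[OF cu2(1) _ s1]) simp
  have m2: "hball_int (z, - a) (8*a^2) (%y. (U y)^2) <= N" unfolding N_def by (rule hball_int_mono_set[OF cu2(1) _ s2]) simp
  have m3: "hball_int (z, - a) (8*a^2) (%y. (err y)^2) <= R" unfolding R_def by (rule hball_int_mono_set[OF cu2(2) _ s2]) simp
  \<comment> \<open>The boundary data live on squared distances up to
    \<open>3 a^2 = 3/16 de^2\<close>, inside the observed ball.\<close>
  have m4: "(LBINT x. ind {x. (x - z) <.> (x - z) <= 3*a^2} x*(G (x, 0) <.> (0, 1))^2) <= O'"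
   unfolding O'_def
  proof (rule integral_mono)
   show "integrable lborel (%x. ind {x. (x - z) <.> (x - z) <= 3*a^2} x*(G (x, 0) <.> (0, 1))^2)"
    by (rule integrable_compact_cont[OF cG compact_rho_ball])
   show "integrable lborel (%x. ind (ball z de) x*(G (x, 0) <.> (0, 1))^2)" by (rule integrable_ball_cont[OF cG])
   have "x : ball z de" if "(x - z) <.> (x - z) <= 3*a^2" for x
   proof -
    have "(norm (x - z))^2 <= 3*a^2" using that by (simp add: power2_norm_eq_inner)
    also have "... < de^2" using de by (simp add: a_def power_divide)
    finally have "norm (x - z) < de" by (rule power2_less_imp_less) (use de in simp)
    then show ?thesis by (simp add: dist_norm norm_minus_commute)
   qed
   then show "ind {x. (x - z) <.> (x - z) <= 3*a^2} x*(G (x, 0) <.> (0, 1))^2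
     <= ind (ball z de) x*(G (x, 0) <.> (0, 1))^2" for x by (auto simp: indicator_def)
  qed
  have "P*hball_int (z, 0) (b^2) (%y. (U y)^2) <= P*(cst D/a^4*exp (- s/4)*N + e1*R + 4* s/a*exp (6* s)*O')"
  proof (intro mult_left_mono P0)
   have "cst D/a^4*exp (- s/4)*hball_int (z, - a) (8*a^2) (%y. (U y)^2) <= cst D/a^4*exp (- s/4)*N"
    using m2 cst0 ab by (intro mult_left_mono) auto
   moreover have "e1*hball_int (z, - a) (8*a^2) (%y. (err y)^2) <= e1*R" using m3 e0 by (intro mult_left_mono) auto
   moreover have "4* s/a*exp (6* s)*(LBINT x. ind {x. (x - z) <.> (x - z) <= 3*a^2} x*(G (x, 0) <.> (0, 1))^2)
     <= 4* s/a*exp (6* s)*O'" using m4 M(3) ab by (intro mult_left_mono) auto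
   ultimately show "hball_int (z, 0) (b^2) (%y. (U y)^2) <= cst D/a^4*exp (- s/4)*N + e1*R + 4* s/a*exp (6* s)*O'"
    using m1 ii by linarith
  qed
  then have "hball_int (z, 0) (4*d) (%y. (U y)^2)
   <= P*(cst D/a^4*exp (- s/4)*N + e1*R + 4* s/a*exp (6* s)*O') + cst D*exp (- ta/5)*N + e2*R" using i by linarith
  also have "... = obs_const D d de ta s*O' + rem_const D d de ta s*N + K*R"
   unfolding obs_const_def rem_const_def K_def P_def[symmetric] a_def by (simp add: algebra_simps)
  finally show ?thesis unfolding O'_def N_def R_def .
 qed
 moreover have "K >= 0" using P0 e0 by (simp add: K_def)
 ultimately show ?thesis by blast
qed

section \<open>Covering the cube\<close>

lemma card_int_vec_le:
 fixes A :: "'n::finite => int set"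
 assumes "!!i. finite (A i)" "!!i. card (A i) <= K"
 shows "finite {j::int^'n. \<forall>i. j $ i : A i}" "card {j::int^'n. \<forall>i. j $ i : A i} <= K ^ CARD('n)"
proof -
 let ?S = "{j::int^'n. \<forall>i. j $ i : A i}"
 have sub: "?S \<subseteq> (%f. \<chi> i. f i) ` (PiE UNIV A)"
 proof
  fix j assume "j : ?S"
  then have p: "(%i. j $ i) : PiE UNIV A" by (simp add: PiE_def)
  show "j : (%f. \<chi> i. f i) ` (PiE UNIV A)" by (rule image_eqI[OF _ p]) (simp add: vec_eq_iff)
 qed
 have fin: "finite (PiE UNIV A)" using assms(1) by (intro finite_PiE) auto
 show "finite ?S" using sub fin by (meson finite_imageI finite_subset)
 have "card ?S <= card ((%f. (\<chi> i. f i) :: int^'n) ` (PiE UNIV A))" using sub fin by (intro card_mono finite_imageI) auto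
 also have "... <= card (PiE UNIV A)" using fin by (rule card_image_le)
 also have "... = (\<Prod>i\<in>UNIV. card (A i))" by (rule card_PiE) simp
 also have "... <= (\<Prod>i\<in>(UNIV::'n set). K)" using assms(2) by (intro prod_mono) auto
 also have "... = K ^ CARD('n)" by (rule prod_constant)
 finally show "card ?S <= K ^ CARD('n)" .
qed

definition slab :: "real => real => int^'n => ((real^'n::finite) \<times> real) set" where
 "slab L T m = {y. (\<forall>i. \<bar>fst y $ i - of_int (m $ i)*L\<bar> <= L/2) & 0 <= snd y & snd y <= T}"

lemma slab_eq: "slab L T m = cbox (\<chi> i. of_int (m $ i)*L - L/2) (\<chi> i. of_int (m $ i)*L + L/2) \<times> {0..T}"
proof -
 have "\<bar>x - c\<bar> <= L/2 \<longleftrightarrow> c - L/2 <= x & x <= c + L/2" for x c :: real by linarith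
 then show ?thesis unfolding slab_def by (auto simp: mem_box_cart)
qed

lemma compact_slab: "compact (slab L T m)" unfolding slab_eq by (intro compact_Times) auto

lemma slab_borel [measurable]: "slab L T m : sets borel" by (intro borel_compact compact_slab)

text \<open>It carries the base cell to the copy with index \<open>m\<close>: a translation by
  \<open>m L\<close>, combined in coordinate \<open>i\<close> with a reflection if
  \<open>sg (m $ i) = -1\<close>. The ghost variable is left alone.\<close>

definition tile_map :: "(int => real) => real => int^'n => (real^'n::finite) \<times> real => (real^'n) \<times> real" where
 "tile_map sg L m y = (\<chi> i. of_int (m $ i)*L + sg (m $ i)*fst y $ i, snd y)"

text \<open>The map is affine and diagonal with entries of modulus 1, so it preserves Lebesgue
  measure. The entries are listed by \<open>c\<close>, indexed by basis vectors as the affine change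
  of variables requires.\<close>

lemma integral_tile_map:
 fixes f :: "(real^'n::finite) \<times> real => real"
 assumes sg: "!!k. \<bar>sg k\<bar> = 1" and f: "f : bmeas borel"
 shows "(LBINT y. f y) = (LBINT y. f (tile_map sg L m y))"
proof -
 define c :: "(real^'n) \<times> real => real" where "c = (%b. if snd b = 0 then sg (m $ (THE i. fst b = axis i 1)) else 1)"
 define t0 :: "(real^'n) \<times> real" where "t0 = (\<chi> i. of_int (m $ i)*L, 0)"
 have cb: "c (axis i 1, 0) = sg (m $ i)" for i unfolding c_def by (simp add: axis_eq_axis)
 have c1: "c (0, 1) = 1" by (simp add: c_def)
 have B: "(Basis :: ((real^'n) \<times> real) set) = (%i. (axis i 1, 0)) ` UNIV \<union> {(0, 1)}"
  unfolding Basis_prod_def Basis_vec_def by auto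
 have cne: "\<bar>c j\<bar> = 1" if "j : Basis" for j using that sg cb c1 unfolding B by auto
 have sumB: "(\<Sum>j\<in>(Basis :: ((real^'n) \<times> real) set). g j) = (\<Sum>i\<in>UNIV. g (axis i 1, 0)) + g (0, 1)"
  for g :: "(real^'n) \<times> real => (real^'n) \<times> real"
  unfolding B by (subst sum.union_disjoint) (auto simp: sum.reindex inj_on_def axis_eq_axis)
 have T: "t0 + (\<Sum>j\<in>Basis. (c j*(y <.> j)) *: j) = tile_map sg L m y" for y
 proof -
  have "(\<Sum>i\<in>UNIV. (sg (m $ i)*fst y $ i) *: axis i (1::real)) $ k = sg (m $ k)*fst y $ k" for k
  proof -
   have "(\<Sum>i\<in>UNIV. (sg (m $ i)*fst y $ i) *: axis i (1::real)) $ k = (\<Sum>i\<in>UNIV. if i = k then sg (m $ i)*fst y $ i else 0)"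
    unfolding sum_component by (intro sum.cong) (auto simp: axis_def)
   then show ?thesis by simp
  qed
  then have 1: "(\<Sum>i\<in>UNIV. (sg (m $ i)*fst y $ i) *: axis i (1::real)) = (\<chi> i. sg (m $ i)*fst y $ i)" by (simp add: vec_eq_iff)
  have 2: "y <.> (axis i 1, 0) = fst y $ i" "y <.> (0, 1) = snd y" for i by (auto simp: inner_prod_def inner_axis)
  have "(\<Sum>j\<in>Basis. (c j*(y <.> j)) *: j) = (\<Sum>i\<in>UNIV. ((sg (m $ i)*fst y $ i) *: axis i (1::real), 0)) + (0, snd y)"
   unfolding sumB by (simp add: cb c1 2)
  also have "(\<Sum>i\<in>UNIV. ((sg (m $ i)*fst y $ i) *: axis i (1::real), 0::real)) = (\<chi> i. sg (m $ i)*fst y $ i, 0)"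
   by (simp add: prod_eq_iff fst_sum snd_sum 1)
  finally show ?thesis by (simp add: t0_def tile_map_def vec_eq_iff)
 qed
 have "lborel = density (distr lborel borel (tile_map sg L m)) (%_. (\<Prod>j\<in>(Basis :: ((real^'n) \<times> real) set). \<bar>c j\<bar>))"
  using lborel_affine_euclidean[of c t0] cne unfolding T by fastforce
 also have "(\<Prod>j\<in>(Basis :: ((real^'n) \<times> real) set). \<bar>c j\<bar>) = 1" using cne by (simp cong: prod.cong)
 finally have l: "lborel = distr lborel borel (tile_map sg L m)" by (simp add: density_1)
 have mt: "tile_map sg L m : bmeas borel" unfolding T[symmetric, abs_def] by measurable
 have "(LBINT y. f y) = (LINT y|distr lborel borel (tile_map sg L m). f y)" using l by simp
 also have "... = (LBINT y. f (tile_map sg L m y))" using mt f by (subst integral_distr) auto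
 finally show ?thesis .
qed

lemma slab_tile_int:
 fixes f :: "(real^'n::finite) \<times> real => real"
 assumes sg: "!!k. \<bar>sg k\<bar> = 1" and f: "cont f" "!!m y. f (tile_map sg L m y) = f y"
 shows "(LBINT y. ind (slab L T m) y*f y) = (LBINT y. ind (slab L T 0) y*f y)"
proof -
 have [measurable]: "f : bmeas borel" using f(1) by (rule bmeas_contI)
 have "(LBINT y. ind (slab L T m) y*f y) = (LBINT y. ind (slab L T m) (tile_map sg L m y)*f (tile_map sg L m y))"
  by (rule integral_tile_map[OF sg]) measurable
 also have "... = (LBINT y. ind (slab L T 0) y*f y)"
 proof (rule Lint_cong)
  fix y
  have "tile_map sg L m y : slab L T m \<longleftrightarrow> y : slab L T 0" using sg by (simp add: slab_def tile_map_def abs_mult)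
  then show "ind (slab L T m) (tile_map sg L m y)*f (tile_map sg L m y) = ind (slab L T 0) y*f y" by (simp add: f(2) indicator_def)
 qed simp
 finally show ?thesis .
qed

text \<open>The condition \<open>2 |j| + 1 <= L\<close> says that the unit cell at \<open>j\<close>
  lies in the cube of side \<open>L\<close>.\<close>

definition inner_cells :: "nat => (int^'n::finite) set" where "inner_cells L = {j. \<forall>i. 2*\<bar>j $ i\<bar> + 1 <= int L}"

lemma finite_inner_cells: "finite (inner_cells L :: (int^'n::finite) set)"
proof -
 have "(inner_cells L :: (int^'n) set) \<subseteq> {j. \<forall>i. j $ i : {- int L..int L}}"
 proof
  fix j :: "int^'n" assume "j : inner_cells L"
  then have *: "2*\<bar>j $ i\<bar> + 1 <= int L" for i by (simp add: inner_cells_def)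
  have "\<bar>j $ i\<bar> <= int L" for i using *[of i] by linarith
  then have "j $ i : {- int L..int L}" for i by (auto simp: abs_le_iff minus_le_iff)
  then show "j : {j. \<forall>i. j $ i : {- int L..int L}}" by simp
 qed
 moreover have "finite {j :: int^'n. \<forall>i. j $ i : {- int L..int L}}" by (rule card_int_vec_le(1)[of _ "card {- int L..int L}"]) auto
 ultimately show ?thesis by (rule finite_subset)
qed

text \<open>For even \<open>L\<close> the unit cells at the integer points contained in the cube do
  not fill it: a layer of width 1/2 is left along every face. Rounding towards zero still leads to
  an inner cell, at distance below 1 in every coordinate.\<close>

lemma inner_cells_nearest:
 fixes x :: "real^'n::finite"
 assumes "x : cube (real L)"
 shows "\<exists>j\<in>inner_cells L. \<forall>i. \<bar>x $ i - of_int (j $ i)\<bar> < 1"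
proof -
 define j :: "int^'n" where "j = (\<chi> i. if x $ i >= 0 then \<lfloor>x $ i\<rfloor> else \<lceil>x $ i\<rceil>)"
 have "2*\<bar>j $ i\<bar> + 1 <= int L" "\<bar>x $ i - of_int (j $ i)\<bar> < 1" for i
 proof -
  have x: "- real L/2 < x $ i" "x $ i < real L/2" using assms by (auto simp: cube_def)
  show "\<bar>x $ i - of_int (j $ i)\<bar> < 1" unfolding j_def by (simp, linarith)
  show "2*\<bar>j $ i\<bar> + 1 <= int L"
  proof (cases "x $ i >= 0")
   case True
   have "of_int (2*\<lfloor>x $ i\<rfloor>) < (of_int (int L) :: real)" using x(2) of_int_floor_le[of "x $ i"] by simp linarith
   then have "2*\<lfloor>x $ i\<rfloor> < int L" by (simp only: of_int_less_iff)
   then show ?thesis using True by (simp add: j_def)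
  next
   case False
   have "of_int (- int L) < (of_int (2*\<lceil>x $ i\<rceil>) :: real)" using x(1) le_of_int_ceiling[of "x $ i"] by simp linarith
   then have "- int L < 2*\<lceil>x $ i\<rceil>" by (simp only: of_int_less_iff)
   moreover have "\<lceil>x $ i\<rceil> <= 0" using False by linarith
   ultimately show ?thesis using False by (simp add: j_def)
  qed
 qed
 then show ?thesis unfolding inner_cells_def by blast
qed

lemma cell_center:
 fixes c :: "real^'n::finite"
 assumes "ball c de \<subseteq> (%x. x + lattice_point j) ` cube 1" "x : ball c de"
 shows "\<bar>x $ i - of_int (j $ i)\<bar> < 1/2"
proof -
 obtain w where w: "x = w + lattice_point j" "w : cube 1" using assms by blast
 have "- 1/2 < w $ i" "w $ i < 1/2" using w(2) by (auto simp: cube_def)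
 then show ?thesis using w(1) by (simp add: lattice_point_def abs_less_iff)
qed

lemma cube_eq_box: "cube L = box (\<chi> i. - L/2) (\<chi> i. L/2)" by (auto simp: cube_def mem_box_cart)

text \<open>Distance below 1 to the integer point and below 1/2 from there to \<open>z j\<close>
  give squared distance at most \<open>9/4 d\<close>, and \<open>9/4 d + 1 <= 4 d\<close> covers
  heights up to 1. In the second claim one power of \<open>8 d + 4\<close> counts the half-balls
  through a point and the other one the copies of the slab that half-balls can meet. The third claim
  holds because the balls are disjoint, lying in different unit cells.\<close>

theorem covering_estimate:
 fixes z :: "int^'n::finite => real^'n" and f g :: "(real^'n) \<times> real => real" and w :: "real^'n => real"
 assumes L: "1 <= L" and de: "0 < de"
  and z: "!!j. ball (z j) de \<subseteq> (%x. x + lattice_point j) ` cube 1"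
 defines "d \<equiv> real CARD('n)"
 shows "cont f ==> (!!y. 0 <= f y) ==>
   (LBINT y. ind (cube (real L) \<times> {0..1}) y*f y) <= (\<Sum>j\<in>inner_cells L. hball_int (z j, 0) (4*d) f)"
  and "cont f ==> (!!y. 0 <= f y) ==> (!!k. \<bar>sg k\<bar> = 1) ==>
   (!!m y. f (tile_map sg (real L) m y) = f y) ==> (\<Sum>j\<in>inner_cells L. hball_int (z j, 0) (12*d) f)
    <= (8*d + 4) ^ CARD('n)*(8*d + 4) ^ CARD('n)*(LBINT y. ind (slab (real L) (4*d) 0) y*f y)"
  and "cont w ==> (!!y. 0 <= w y) ==>
   (\<Sum>j\<in>inner_cells L. LBINT x. ind (ball (z j) de) x*w x) <= (LBINT x. ind (S_set (real L) de z) x*w x)"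
proof -
 have d1: "1 <= d" unfolding d_def using zero_less_card_finite[where 'a='n] by linarith
 have fin: "finite (inner_cells L :: (int^'n) set)" by (rule finite_inner_cells)
 have zc: "\<bar>z j $ i - of_int (j $ i)\<bar> < 1/2" for j i using cell_center[OF z[of j], of "z j" i] de by simp
 have inner_norm: "(v <.> v) <= d*c^2" if "!!i. \<bar>v $ i\<bar> <= c" for v :: "real^'n" and c
 proof -
  have "v $ i* v $ i <= c^2" for i using that[of i] power_mono[of "\<bar>v $ i\<bar>" c 2] by (simp add: power2_eq_square)
  then have "(\<Sum>i\<in>UNIV. v $ i* v $ i) <= (\<Sum>i\<in>(UNIV::'n set). c^2)" by (intro sum_mono) auto
  then show ?thesis by (simp add: inner_vec_def d_def)
 qed
 \<comment> \<open>A squared radius of \<open>12 d\<close> confines all coordinates, and the height,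
   to \<open>4 d\<close>; hence the height \<open>4 d\<close> of the slab.\<close>
 have d12: "12*d <= (4*d)^2"
 proof -
  have "1*d <= d*d" using d1 by (intro mult_right_mono) auto
  then show ?thesis using d1 unfolding power2_eq_square by linarith
 qed
 have comp: "\<bar>v $ i\<bar> <= 4*d" if "v <.> v <= 12*d" for v :: "real^'n" and i
 proof -
  have "(v $ i)^2 <= v <.> v"
  proof -
   have "v $ i* v $ i <= (\<Sum>i\<in>UNIV. v $ i* v $ i)" by (rule member_le_sum) auto
   then show ?thesis by (simp add: inner_vec_def power2_eq_square)
  qed
  also have "... <= (4*d)^2" using that d12 by linarith
  finally show ?thesis using d1 by (intro power2_le_iff_abs_le[THEN iffD1]) auto
 qed
 {
  assume f: "cont f" "!!y. 0 <= f y"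
  have nnf: "0 <= ind A y*f y" for A and y using f(2)[of y] by (simp add: indicator_def)
  have ih: "integrable lborel (%y. ind (hball (z j, 0) r) y*f y)" for j r by (rule hball_int_integrable[OF f(1)])
  show "(LBINT y. ind (cube (real L) \<times> {0..1}) y*f y) <= (\<Sum>j\<in>inner_cells L. hball_int (z j, 0) (4*d) f)"
  proof -
   have "(LBINT y. ind (cube (real L) \<times> {0..1}) y*f y)
     <= (LBINT y. (\<Sum>j\<in>inner_cells L. ind (hball (z j, 0) (4*d)) y*f y))"
   proof (rule integral_mono')
    show "integrable lborel (%y. \<Sum>j\<in>inner_cells L. ind (hball (z j, 0) (4*d)) y*f y)" using ih by auto
    show "0 <= (\<Sum>j\<in>inner_cells L. ind (hball (z j, 0) (4*d)) y*f y)" for y by (intro sum_nonneg nnf)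
    fix y
    show "ind (cube (real L) \<times> {0..1}) y*f y <= (\<Sum>j\<in>inner_cells L. ind (hball (z j, 0) (4*d)) y*f y)"
    proof (cases "y : cube (real L) \<times> {0..1}")
     case True
     then obtain j where j: "j : inner_cells L" "!!i. \<bar>fst y $ i - of_int (j $ i)\<bar> < 1"
      using inner_cells_nearest[of "fst y" L] by (auto simp: mem_Times_iff)
     have "\<bar>(fst y - z j) $ i\<bar> <= 3/2" for i using j(2)[of i] zc[of j i] unfolding vector_minus_component by linarith
     then have "(fst y - z j) <.> (fst y - z j) <= d*(3/2)^2" by (rule inner_norm)
     moreover have t: "0 <= snd y" "snd y <= 1" using True by (simp_all add: mem_Times_iff)
     moreover have "snd y* snd y <= 1" using t by (intro mult_le_one) simp_all
     ultimately have "y : hball (z j, 0) (4*d)" using d1 by (simp add: hball_def inner_prod_def power2_eq_square)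
     then have "ind (cube (real L) \<times> {0..1}) y*f y = ind (hball (z j, 0) (4*d)) y*f y" using True by simp
     also have "... <= (\<Sum>j\<in>inner_cells L. ind (hball (z j, 0) (4*d)) y*f y)" by (intro member_le_sum[OF j(1)] fin nnf)
     finally show ?thesis .
    next
     case False
     then have "ind (cube (real L) \<times> {0..1}) y*f y = 0" by simp
     also have "0 <= (\<Sum>j\<in>inner_cells L. ind (hball (z j, 0) (4*d)) y*f y)" by (intro sum_nonneg nnf)
     finally show ?thesis .
    qed
   qed
   also have "... = (\<Sum>j\<in>inner_cells L. hball_int (z j, 0) (4*d) f)"
    unfolding hball_int_def using ih by (rule Lint_sum)
   finally show ?thesis .
  qed
  assume sg: "!!k. \<bar>sg k\<bar> = 1" and sym: "!!m y. f (tile_map sg (real L) m y) = f y"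
  define n0 where "n0 = (8*CARD('n) + 4) ^ CARD('n)"
  have n0r: "real n0 = (8*d + 4) ^ CARD('n)" unfolding n0_def d_def by simp
  \<comment> \<open>A point of such a half-ball has coordinates at most \<open>L/2 + 4 d\<close>, so
    the index of its copy times \<open>L\<close> is at most \<open>L + 4 d\<close>; as
    \<open>L >= 1\<close>, the index is at most \<open>4 d + 1\<close> independently of
    \<open>L\<close>.\<close>
  define Ms where "Ms = {m :: int^'n. \<forall>i. m $ i : {- int (4*CARD('n) + 1)..int (4*CARD('n) + 1)}}"
  have Ms: "finite Ms" "card Ms <= n0"
  proof -
   have "card {- int (4*CARD('n) + 1)..int (4*CARD('n) + 1)} <= 8*CARD('n) + 4" by simp
   then show "finite Ms" "card Ms <= n0"
    using card_int_vec_le[of "%i::'n. {- int (4*CARD('n) + 1)..int (4*CARD('n) + 1)}" "8*CARD('n) + 4"] unfolding Ms_def n0_def by auto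
  qed
  define I where "I = (LBINT y. ind (slab (real L) (4*d) 0) y*f y)"
  have I0: "I >= 0" unfolding I_def by (intro integral_nonneg_AE AE_I2 nnf)
  have isl: "integrable lborel (%y. ind (slab (real L) (4*d) m) y*f y)" for m by (rule integrable_compact_cont[OF f(1) compact_slab])
  have tile: "(LBINT y. ind (slab (real L) (4*d) m) y*f y) = I" for m unfolding I_def by (rule slab_tile_int[OF sg f(1) sym])
  have pw: "(\<Sum>j\<in>inner_cells L. ind (hball (z j, 0) (12*d)) y*f y)
    <= real n0*(\<Sum>m\<in>Ms. ind (slab (real L) (4*d) m) y*f y)" for y
  proof (cases "\<exists>j\<in>inner_cells L. y : hball (z j, 0) (12*d)")
   case False
   then have "(\<Sum>j\<in>inner_cells L. ind (hball (z j, 0) (12*d)) y*f y) = 0" by (intro sum.neutral) auto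
   moreover have "0 <= real n0*(\<Sum>m\<in>Ms. ind (slab (real L) (4*d) m) y*f y)" by (intro mult_nonneg_nonneg sum_nonneg nnf) simp
   ultimately show ?thesis by (simp only:)
  next
   case True
   have near: "\<bar>fst y $ i - z j $ i\<bar> <= 4*d" "0 <= snd y" "snd y <= 4*d" if "y : hball (z j, 0) (12*d)" for i j
   proof -
    have h: "(fst y - z j) <.> (fst y - z j) + snd y* snd y <= 12*d" "0 <= snd y" using that by (auto simp: hball_def inner_prod_def)
    have "(fst y - z j) <.> (fst y - z j) <= 12*d" using h(1) zero_le_square[of "snd y"] by linarith
    from comp[OF this, of i] show "\<bar>fst y $ i - z j $ i\<bar> <= 4*d" unfolding vector_minus_component .
    show "0 <= snd y" by (rule h(2))
    have "snd y* snd y <= 12*d" using h(1) inner_ge_zero[of "fst y - z j"] by linarith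
    also have "12*d <= (4*d)^2" by (rule d12)
    finally have sq: "(snd y)^2 <= (4*d)^2" unfolding power2_eq_square[of "snd y"] .
    show "snd y <= 4*d" by (rule power2_le_imp_le[OF sq]) (use d1 in linarith)
   qed
   let ?J = "{j : inner_cells L. y : hball (z j, 0) (12*d)}"
   have cJ: "card ?J <= n0"
   proof -
    define A where "A = (%i. {\<lceil>fst y $ i - 4*d - 1\<rceil>..\<lfloor>fst y $ i + 4*d + 1\<rfloor>})"
    have sub: "?J \<subseteq> {j. \<forall>i. j $ i : A i}"
    proof (safe)
     fix j i assume "y : hball (z j, 0) (12*d)"
     then have "\<bar>fst y $ i - of_int (j $ i)\<bar> <= 4*d + 1" using near(1)[of j i] zc[of j i] by linarith
     then show "j $ i : A i" unfolding A_def atLeastAtMost_iff ceiling_le_iff le_floor_iff by linarith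
    qed
    have "card (A i) <= 8*CARD('n) + 4" for i
    proof -
     have "\<lfloor>fst y $ i + 4*d + 1\<rfloor> - \<lceil>fst y $ i - 4*d - 1\<rceil> + 1 <= int (8*CARD('n) + 4)"
     proof -
      have "of_int (\<lfloor>fst y $ i + 4*d + 1\<rfloor> - \<lceil>fst y $ i - 4*d - 1\<rceil> + 1) <= 8*d + 4"
       using of_int_floor_le[of "fst y $ i + 4*d + 1"] le_of_int_ceiling[of "fst y $ i - 4*d - 1"] unfolding of_int_add of_int_diff of_int_1 by linarith
      also have "8*d + 4 = of_int (int (8*CARD('n) + 4))" by (simp add: d_def)
      finally show ?thesis by (simp only: of_int_le_iff)
     qed
     then show ?thesis unfolding A_def card_atLeastAtMost_int by linarith
    qed
    then have "card {j. \<forall>i. j $ i : A i} <= n0" "finite {j. \<forall>i. j $ i : A i}"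
     using card_int_vec_le[of A "8*CARD('n) + 4"] unfolding n0_def by (auto simp: A_def)
    then show ?thesis using card_mono[OF _ sub] by linarith
   qed
   obtain m where m: "m : Ms" "y : slab (real L) (4*d) m"
   proof -
    obtain j where j: "j : inner_cells L" "y : hball (z j, 0) (12*d)" using True by blast
    define m :: "int^'n" where "m = (\<chi> i. round (fst y $ i/real L))"
    have Lp: "real L >= 1" using L by simp
    have mi: "\<bar>fst y $ i - of_int (m $ i)*real L\<bar> <= real L/2" for i
    proof -
     have "\<bar>of_int (m $ i) - fst y $ i/real L\<bar> <= 1/2" unfolding m_def using of_int_round_abs_le[of "fst y $ i/real L"] by simp
     then have "\<bar>of_int (m $ i) - fst y $ i/real L\<bar>*real L <= 1/2*real L" using Lp by (intro mult_right_mono) auto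
     moreover have "\<bar>of_int (m $ i) - fst y $ i/real L\<bar>*real L = \<bar>fst y $ i - of_int (m $ i)*real L\<bar>"
     proof -
      have "\<bar>of_int (m $ i) - fst y $ i/real L\<bar>*real L = \<bar>(of_int (m $ i) - fst y $ i/real L)*real L\<bar>"
       using Lp by (simp add: abs_mult)
      also have "(of_int (m $ i) - fst y $ i/real L)*real L = - (fst y $ i - of_int (m $ i)*real L)" using Lp by (simp add: field_simps)
      finally show ?thesis by simp
     qed
     ultimately show ?thesis by simp
    qed
    have "m $ i : {- int (4*CARD('n) + 1)..int (4*CARD('n) + 1)}" for i
    proof -
     have "2*\<bar>j $ i\<bar> + 1 <= int L" using j(1) by (auto simp: inner_cells_def)
     then have "of_int (2*\<bar>j $ i\<bar> + 1) <= (of_int (int L) :: real)" by (simp only: of_int_le_iff)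
     then have "2*\<bar>of_int (j $ i)\<bar> + 1 <= real L" by simp
     then have "\<bar>fst y $ i\<bar> <= real L/2 + 4*d" using near(1)[OF j(2), of i] zc[of j i] by linarith
     moreover have "\<bar>of_int (m $ i)*real L\<bar> <= \<bar>fst y $ i\<bar> + real L/2" using mi[of i] by linarith
     ultimately have "\<bar>of_int (m $ i)\<bar>*real L <= real L + 4*d" by (simp add: abs_mult)
     also have "... <= (4*d + 1)*real L" using Lp d1 by (simp add: algebra_simps)
     finally have "\<bar>of_int (m $ i)\<bar> <= 4*d + 1" using Lp by simp
     then have "\<bar>of_int (m $ i)\<bar> <= (of_int (int (4*CARD('n) + 1)) :: real)" unfolding d_def by simp
     then have "\<bar>m $ i\<bar> <= int (4*CARD('n) + 1)" by (simp only: of_int_abs[symmetric] of_int_le_iff)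
     then show ?thesis by auto
    qed
    then have "m : Ms" by (simp add: Ms_def)
    moreover have "y : slab (real L) (4*d) m" using mi near(2,3)[OF j(2)] by (simp add: slab_def)
    ultimately show ?thesis using that by blast
   qed
   have 1: "(\<Sum>j\<in>inner_cells L. ind (hball (z j, 0) (12*d)) y*f y) = (\<Sum>j\<in>?J. f y)"
    by (rule sum.mono_neutral_cong_right[OF fin]) auto
   have 2: "(\<Sum>j\<in>?J. f y) <= real n0*f y" using cJ f(2)[of y] by (simp add: mult_right_mono)
   have "ind (slab (real L) (4*d) m) y*f y <= (\<Sum>m\<in>Ms. ind (slab (real L) (4*d) m) y*f y)"
    by (intro member_le_sum[OF m(1)] Ms(1) nnf)
   moreover have "ind (slab (real L) (4*d) m) y*f y = f y" using m(2) by simp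
   ultimately have 3: "real n0*f y <= real n0*(\<Sum>m\<in>Ms. ind (slab (real L) (4*d) m) y*f y)" by (intro mult_left_mono) auto
   show ?thesis using 1 2 3 by linarith
  qed
  have "(\<Sum>j\<in>inner_cells L. hball_int (z j, 0) (12*d) f)
    = (LBINT y. (\<Sum>j\<in>inner_cells L. ind (hball (z j, 0) (12*d)) y*f y))"
   unfolding hball_int_def using ih by (rule Lint_sum[symmetric])
  also have "... <= (LBINT y. real n0*(\<Sum>m\<in>Ms. ind (slab (real L) (4*d) m) y*f y))"
   by (intro integral_mono pw Lintb_sum integrable_mult_right ih isl)
  also have "... = real n0*(\<Sum>m\<in>Ms. LBINT y. ind (slab (real L) (4*d) m) y*f y)"
   by (simp only: Lint_mult_right_zero Lint_sum[OF isl])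
  also have "... = real n0*(real (card Ms)*I)" by (simp only: tile sum_constant)
  also have "... <= real n0*(real n0*I)" by (intro mult_left_mono mult_right_mono I0 of_nat_mono Ms(2) of_nat_0_le_iff)
  finally show "(\<Sum>j\<in>inner_cells L. hball_int (z j, 0) (12*d) f)
    <= (8*d + 4) ^ CARD('n)*(8*d + 4) ^ CARD('n)*(LBINT y. ind (slab (real L) (4*d) 0) y*f y)" unfolding I_def n0r mult.assoc .
 }
 assume w: "cont w" "!!y. 0 <= w y"
 have ib: "integrable lborel (%x. ind (ball (z j) de) x*w x)" for j by (rule integrable_ball_cont[OF w(1)])
 have sb: "ball (z j) de \<subseteq> cube (real L)" if "j : inner_cells L" for j
 proof
  fix x assume x: "x : ball (z j) de"
  have "- real L/2 < x $ i & x $ i < real L/2" for i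
  proof -
   have "2*\<bar>j $ i\<bar> + 1 <= int L" using that by (auto simp: inner_cells_def)
   then have "of_int (2*\<bar>j $ i\<bar> + 1) <= (of_int (int L) :: real)" by (simp only: of_int_le_iff)
   then have "2*\<bar>of_int (j $ i)\<bar> + 1 <= real L" by simp
   then show ?thesis using cell_center[OF z[of j] x, of i] by linarith
  qed
  then show "x : cube (real L)" by (simp add: cube_def)
 qed
 have disj: "j = k" if "x : ball (z j) de" "x : ball (z k) de" for x j k
 proof -
  have "j $ i = k $ i" for i using cell_center[OF z[of j] that(1), of i] cell_center[OF z[of k] that(2), of i] by linarith
  then show ?thesis by (simp add: vec_eq_iff)
 qed
 have "(\<Sum>j\<in>inner_cells L. LBINT x. ind (ball (z j) de) x*w x)
   = (LBINT x. (\<Sum>j\<in>inner_cells L. ind (ball (z j) de) x*w x))" using ib by (rule Lint_sum[symmetric])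
 also have "... <= (LBINT x. ind (S_set (real L) de z) x*w x)"
 proof (rule integral_mono)
  show "integrable lborel (%x. \<Sum>j\<in>inner_cells L. ind (ball (z j) de) x*w x)" using ib by auto
  have "open (S_set (real L) de z)" unfolding S_set_def cube_eq_box by (intro open_Int open_UN ballI open_ball open_box)
  then have m: "S_set (real L) de z : sets lborel" by simp
  have "integrable lborel (%x. ind (S_set (real L) de z) x *: (ind (cbox (\<chi> i. - real L/2) (\<chi> i. real L/2)) x*w x))"
   by (intro Lintb_ind m integrable_compact_cont w) auto
  also have "(%x. ind (S_set (real L) de z) x *: (ind (cbox (\<chi> i. - real L/2) (\<chi> i. real L/2)) x*w x))
    = (%x. ind (S_set (real L) de z) x*w x)" by (auto simp: fun_eq_iff indicator_def S_set_def cube_def mem_box_cart less_imp_le)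
  finally show "integrable lborel (%x. ind (S_set (real L) de z) x*w x)" .
  fix x
  show "(\<Sum>j\<in>inner_cells L. ind (ball (z j) de) x*w x) <= ind (S_set (real L) de z) x*w x"
  proof (cases "\<exists>j\<in>inner_cells L. x : ball (z j) de")
   case True
   then obtain j where j: "j : inner_cells L" "x : ball (z j) de" by blast
   have "(\<Sum>k\<in>inner_cells L. ind (ball (z k) de) x*w x) = (\<Sum>k\<in>{j}. w x)"
    using j disj by (intro sum.mono_neutral_cong_right[OF fin]) (auto simp: indicator_def)
   moreover have "x : S_set (real L) de z" using j sb unfolding S_set_def by blast
   ultimately show ?thesis by simp
  next
   case False
   then have "(\<Sum>j\<in>inner_cells L. ind (ball (z j) de) x*w x) = 0" by (intro sum.neutral) auto
   then show ?thesis using w(2) by simp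
  qed
 qed
 finally show "(\<Sum>j\<in>inner_cells L. LBINT x. ind (ball (z j) de) x*w x)
    <= (LBINT x. ind (S_set (real L) de z) x*w x)" .
qed

text \<open>Summing \<open>two_step\<close> over the inner cells. The half-balls may leave the cube;
  the symmetry of \<open>U\<close> and \<open>err\<close> under the tile maps brings those parts
  back to the slab over the base cell, where the remainder can be compared with the left
  side.\<close>

theorem core_estimate:
 fixes z :: "int^'n::finite => real^'n" and de ta s M :: real
 defines "d \<equiv> real CARD('n)"
 assumes L: "1 <= L" and de: "0 < de" "de < 1/2"
  and z: "!!j. ball (z j) de \<subseteq> (%x. x + lattice_point j) ` cube 1"
  and M: "M >= 0" "M^2 <= s^3" "1 <= s" "36*d^2*M^2 <= ta^3" "36*d^2 <= ta^3" "0 < ta"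
  and sg: "!!k. \<bar>sg k\<bar> = 1"
 shows "\<exists>K\<ge>0. \<forall>(U :: (real^'n) \<times> real => real) G H err. c2 U G H --> (\<forall>x. U (x, 0) = 0) -->
   (\<forall>y. \<bar>lap H y\<bar> <= M*\<bar>U y\<bar> + err y) --> cont err --> (\<forall>y. 0 <= err y) -->
   (\<forall>m y. \<bar>U (tile_map sg (real L) m y)\<bar> = \<bar>U y\<bar>) --> (\<forall>m y. err (tile_map sg (real L) m y) = err y) -->
   (LBINT y. ind (cube (real L) \<times> {0..1}) y*(U y)^2)
   <= obs_const (d + 1) d de ta s*(LBINT x. ind (S_set (real L) de z) x*(G (x, 0) <.> (0, 1))^2)
    + rem_const (d + 1) d de ta s*(8*d + 4) ^ (2*CARD('n))*(LBINT y. ind (slab (real L) (4*d) 0) y*(U y)^2)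
    + K*(LBINT y. ind (slab (real L) (4*d) 0) y*(err y)^2)"
proof -
 have d1: "1 <= d" unfolding d_def using zero_less_card_finite[where 'a='n] by linarith
 have D: "d + 1 = real DIM((real^'n) \<times> real)" by (simp add: d_def)
 obtain K where K: "K >= 0" and two: "!!(U :: (real^'n) \<times> real => real) G H err z. c2 U G H ==> (\<forall>x. U (x, 0) = 0) ==>
   (\<forall>y. \<bar>lap H y\<bar> <= M*\<bar>U y\<bar> + err y) ==> cont err ==> (\<forall>y. 0 <= err y) ==>
   hball_int (z, 0) (4*d) (%y. (U y)^2)
   <= obs_const (d + 1) d de ta s*(LBINT x. ind (ball z de) x*(G (x, 0) <.> (0, 1))^2)
    + rem_const (d + 1) d de ta s*hball_int (z, 0) (12*d) (%y. (U y)^2) + K*hball_int (z, 0) (12*d) (%y. (err y)^2)"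
  using two_step[OF M d1 de D] by blast
 define c where "c = (8*d + 4) ^ CARD('n)*(8*d + 4) ^ CARD('n)"
 have c2n: "(8*d + 4) ^ (2*CARD('n)) = c" unfolding c_def by (simp add: power_add[symmetric] mult_2)
 have c0: "c >= 0" unfolding c_def using d1 by simp
 have cst0: "cst (d + 1) >= 0" unfolding cst_def using d1 by (intro add_nonneg_nonneg mult_nonneg_nonneg) auto
 have p0: "prop_const (d + 1) d de ta >= 0" unfolding prop_const_def using cst0 de by simp
 have o0: "obs_const (d + 1) d de ta s >= 0" unfolding obs_const_def using p0 de M(3) by simp
 have r0: "rem_const (d + 1) d de ta s >= 0" unfolding rem_const_def using p0 cst0 de by simp
 have "(LBINT y. ind (cube (real L) \<times> {0..1}) y*(U y)^2)
   <= obs_const (d + 1) d de ta s*(LBINT x. ind (S_set (real L) de z) x*(G (x, 0) <.> (0, 1))^2)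
    + rem_const (d + 1) d de ta s*c*(LBINT y. ind (slab (real L) (4*d) 0) y*(U y)^2)
    + (K*c)*(LBINT y. ind (slab (real L) (4*d) 0) y*(err y)^2)"
  if U: "c2 U G H" and bd: "\<forall>x. U (x, 0) = 0" and lapU: "\<forall>y. \<bar>lap H y\<bar> <= M*\<bar>U y\<bar> + err y"
   and err: "cont err" "\<forall>y. 0 <= err y"
   and sym: "\<forall>m y. \<bar>U (tile_map sg (real L) m y)\<bar> = \<bar>U y\<bar>" "\<forall>m y. err (tile_map sg (real L) m y) = err y"
  for U :: "(real^'n) \<times> real => real" and G H err
 proof -
  note cU = c2_cont[OF U]
  have cu2: "cont (%y. (U y)^2)" "cont (%y. (err y)^2)" by (intro continuous_intros cU err)+
  have cG: "cont (%x. (G (x, 0) <.> (0, 1))^2)" by (intro continuous_intros cont_comp2[OF cU(2)]) auto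
  have sy: "(U (tile_map sg (real L) m y))^2 = (U y)^2" "(err (tile_map sg (real L) m y))^2 = (err y)^2" for m y
  proof -
   have "(U (tile_map sg (real L) m y))^2 = \<bar>U (tile_map sg (real L) m y)\<bar>^2" by simp
   also have "... = (U y)^2" unfolding sym(1)[rule_format] by simp
   finally show "(U (tile_map sg (real L) m y))^2 = (U y)^2" .
   show "(err (tile_map sg (real L) m y))^2 = (err y)^2" unfolding sym(2)[rule_format] ..
  qed
  let ?J = "inner_cells L :: (int^'n) set"
  define X where "X = (\<Sum>j\<in>?J. LBINT x. ind (ball (z j) de) x*(G (x, 0) <.> (0, 1))^2)"
  define Y where "Y = (\<Sum>j\<in>?J. hball_int (z j, 0) (12*d) (%y. (U y)^2))"
  define R where "R = (\<Sum>j\<in>?J. hball_int (z j, 0) (12*d) (%y. (err y)^2))"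
  note cov = covering_estimate[OF L de(1) z, folded d_def]
  have 1: "(LBINT y. ind (cube (real L) \<times> {0..1}) y*(U y)^2) <= (\<Sum>j\<in>?J. hball_int (z j, 0) (4*d) (%y. (U y)^2))"
   by (rule cov(1)[OF cu2(1)]) simp
  have 2: "(\<Sum>j\<in>?J. hball_int (z j, 0) (4*d) (%y. (U y)^2)) <= (\<Sum>j\<in>?J. obs_const (d + 1) d de ta s*(LBINT x. ind (ball (z j) de) x*(G (x, 0) <.> (0, 1))^2)
    + rem_const (d + 1) d de ta s*hball_int (z j, 0) (12*d) (%y. (U y)^2)
    + K*hball_int (z j, 0) (12*d) (%y. (err y)^2))" by (intro sum_mono two[OF U bd lapU err])
  have 3: "(\<Sum>j\<in>?J. obs_const (d + 1) d de ta s*(LBINT x. ind (ball (z j) de) x*(G (x, 0) <.> (0, 1))^2)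
    + rem_const (d + 1) d de ta s*hball_int (z j, 0) (12*d) (%y. (U y)^2)
    + K*hball_int (z j, 0) (12*d) (%y. (err y)^2)) = obs_const (d + 1) d de ta s*X + rem_const (d + 1) d de ta s*Y + K*R"
   unfolding X_def Y_def R_def by (simp add: sum.distrib sum_distrib_left)
  have 4: "X <= (LBINT x. ind (S_set (real L) de z) x*(G (x, 0) <.> (0, 1))^2)" unfolding X_def by (rule cov(3)[OF cG]) simp
  have 5: "Y <= c*(LBINT y. ind (slab (real L) (4*d) 0) y*(U y)^2)"
   unfolding Y_def c_def by (rule cov(2)[OF cu2(1) _ sg sy(1)]) simp
  have 6: "R <= c*(LBINT y. ind (slab (real L) (4*d) 0) y*(err y)^2)"
   unfolding R_def c_def by (rule cov(2)[OF cu2(2) _ sg sy(2)]) simp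
  show ?thesis using 1 2 3 mult_left_mono[OF 4 o0] mult_left_mono[OF 5 r0] mult_left_mono[OF 6 K] by (simp only: mult.assoc)
 qed
 then show ?thesis unfolding c2n using K c0 by (intro exI[of _ "K*c"]) auto
qed

section \<open>Integrals over slabs through their slices of fixed height\<close>

lemma slab_iterated:
 fixes f :: "(real^'n::finite) \<times> real => real"
 assumes f: "cont f" and A: "A : sets borel" "bounded A"
 shows "integrable lborel (%t. ind {0..T} t*(LBINT x. ind A x*f (x, t)))"
  and "(LBINT y. ind (A \<times> {0..T}) y*f y) = (LBINT t. ind {0..T} t*(LBINT x. ind A x*f (x, t)))"
proof -
 obtain R where R: "A \<subseteq> cball 0 R" using A(2) by (auto simp: bounded_iff subset_eq dist_norm)
 have m: "A \<times> {0..T} : sets borel" using A(1) by (simp add: borel_Times)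
 have "integrable lborel (%y. ind (A \<times> {0..T}) y *: (ind (cball 0 R \<times> {0..T}) y*f y))"
  using m by (intro Lintb_ind integrable_compact_cont[OF f] compact_Times) auto
 also have "(%y. ind (A \<times> {0..T}) y *: (ind (cball 0 R \<times> {0..T}) y*f y)) = (%y. ind (A \<times> {0..T}) y*f y)"
  using R by (auto simp: fun_eq_iff indicator_def)
 finally have i: "integrable lborel (%y. ind (A \<times> {0..T}) y*f y)" .
 have i': "integrable (lborel \<Otimes>\<^sub>M lborel) (%(x, t). ind (A \<times> {0..T}) (x, t)*f (x, t))"
  using i by (simp add: lborel_prod case_prod_beta')
 have e: "(LBINT x. ind (A \<times> {0..T}) (x, t)*f (x, t)) = ind {0..T} t*(LBINT x. ind A x*f (x, t))" for t
 proof (cases "t : {0..T}")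
  case True
  then show ?thesis by (auto intro!: Lint_cong simp: indicator_def)
 next
  case False
  then show ?thesis by simp
 qed
 show "integrable lborel (%t. ind {0..T} t*(LBINT x. ind A x*f (x, t)))"
  using lborel_pair.integrable_snd[OF i'] unfolding e .
 show "(LBINT y. ind (A \<times> {0..T}) y*f y) = (LBINT t. ind {0..T} t*(LBINT x. ind A x*f (x, t)))"
  using lborel_pair.integral_snd[OF i'] unfolding e by (simp add: lborel_prod case_prod_beta')
qed

lemma AE_cbox_box:
 fixes a b :: "'a::euclidean_space"
 shows "AE x in lborel. x : cbox a b \<longleftrightarrow> x : box a b"
proof (rule AE_I)
 show "{x : space lborel. \<not> (x : cbox a b \<longleftrightarrow> x : box a b)} \<subseteq> cbox a b - box a b"
  using box_subset_cbox by auto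
 have "negligible (cbox a b - box a b)" by (rule negligible_frontier_interval)
 then have "cbox a b - box a b : null_sets lebesgue" by (simp add: negligible_iff_null_sets)
 then show "emeasure lborel (cbox a b - box a b) = 0" by (simp add: null_sets_def)
qed simp

lemma slab_upper:
 fixes f :: "(real^'n::finite) \<times> real => real"
 assumes f: "cont f" and T: "0 <= T"
  and B: "!!t. 0 <= t ==> t <= T ==> (LBINT x. ind (cube L) x*f (x, t)) <= B"
 shows "(LBINT y. ind (slab L T 0) y*f y) <= T*B"
proof -
 define C :: "(real^'n) set" where "C = cbox (\<chi> i. - L/2) (\<chi> i. L/2)"
 have s: "slab L T 0 = C \<times> {0..T}" unfolding slab_eq C_def by simp
 have C: "C : sets borel" "bounded C" by (auto simp: C_def)
 note it = slab_iterated[OF f C, of T]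
 have eq: "(LBINT x. ind C x*f (x, t)) = (LBINT x. ind (cube L) x*f (x, t))" for t
 proof (rule integral_cong_AE)
  have [measurable]: "(%x. f (x, t)) : bmeas borel"
   by (intro bmeas_contI cont_comp2[OF f] continuous_intros) auto
  show "(%x. ind C x*f (x, t)) : bmeas lborel" using C(1) by measurable
  show "(%x. ind (cube L) x*f (x, t)) : bmeas lborel" unfolding cube_eq_box by measurable
  show "AE x in lborel. ind C x*f (x, t) = ind (cube L) x*f (x, t)"
   using AE_cbox_box[of "\<chi> i. - L/2" "\<chi> i. L/2 :: real^'n"] unfolding C_def cube_eq_box by eventually_elim (simp add: indicator_def)
 qed
 have "(LBINT y. ind (slab L T 0) y*f y) = (LBINT t. ind {0..T} t*(LBINT x. ind C x*f (x, t)))"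
  unfolding s by (rule it(2))
 also have "... <= (LBINT t. ind {0..T} t*B)"
 proof (rule integral_mono[OF it(1)])
  show "ind {0..T} t*(LBINT x. ind C x*f (x, t)) <= ind {0..T} t*B" for t
   using B[of t] unfolding eq by (simp add: indicator_def)
 qed (use T in \<open>auto intro!: integrable_mult_left integrable_real_indicator\<close>)
 also have "... = T*B" using T by simp
 finally show ?thesis .
qed

text \<open>The slices are bounded below by \<open>t^2 A\<close> up to an error, and integrating
  \<open>t^2\<close> over unit height gives \<open>A/3\<close>.\<close>

lemma slab_lower:
 fixes f :: "(real^'n::finite) \<times> real => real"
 assumes f: "cont f"
  and B: "!!t. 0 <= t ==> t <= 1 ==> t^2*A - eh <= (LBINT x. ind (cube L) x*f (x, t))"
 shows "A/3 - eh <= (LBINT y. ind (cube L \<times> {0..1}) y*f y)"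
proof -
 have C: "cube L : sets borel" "bounded (cube L :: (real^'n) set)" by (auto simp: cube_eq_box bounded_box)
 note it = slab_iterated[OF f C, of 1]
 have q: "(LBINT t. (t^2*A - eh)*ind {0..1} t) = (1^3/3*A - eh*1) - (0^3/3*A - eh*0)"
  by (rule integral_FTC_Icc_real) (auto intro!: derivative_eq_intros continuous_intros)
 have "A/3 - eh = (LBINT t. ind {0..1} t*(t^2*A - eh))" using q by (simp add: mult.commute)
 also have "... <= (LBINT t. ind {0..1} t*(LBINT x. ind (cube L) x*f (x, t)))"
 proof (rule integral_mono[OF _ it(1)])
  show "integrable lborel (%t. ind {0..1} t*(t^2*A - eh))" by (rule integrable_compact_cont) (auto intro!: continuous_intros)
  show "ind {0..1} t*(t^2*A - eh) <= ind {0..1} t*(LBINT x. ind (cube L) x*f (x, t))" for t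
   using B[of t] by (simp add: indicator_def)
 qed
 also have "... = (LBINT y. ind (cube L \<times> {0..1}) y*f y)" by (rule it(2)[symmetric])
 finally show ?thesis .
qed

section \<open>Square integrable real functions\<close>

text \<open>Square integrability at the level of functions, matching the space \<open>L2\<close> of
  the statement, which is not quotiented by null sets; \<open>nsq\<close> and \<open>ipr\<close> are
  the squared norm and the inner product.\<close>

definition sqi :: "'a measure => ('a => real) => bool" where
 "sqi M f \<longleftrightarrow> f : bmeas M & integrable M (%x. (f x)^2)"

definition nsq :: "'a measure => ('a => real) => real" where "nsq M f = (LINT x|M. (f x)^2)"

definition ipr :: "'a measure => ('a => real) => ('a => real) => real" where
 "ipr M f g = (LINT x|M. f x*g x)"

lemma sqi_measurable: "sqi M f ==> f : bmeas M" by (simp add: sqi_def)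

lemma sqi_integrable_mult:
 assumes "sqi M f" "sqi M g"
 shows "integrable M (%x. f x*g x)"
proof (rule Lintb_bound)
 show "integrable M (%x. (f x)^2 + (g x)^2)" using assms by (auto simp: sqi_def)
 show "(%x. f x*g x) : bmeas M" using assms by (auto simp: sqi_def)
 show "AE x in M. norm (f x*g x) <= norm ((f x)^2 + (g x)^2)"
 proof (rule AE_I2)
  fix x
  have "2*\<bar>f x\<bar>*\<bar>g x\<bar> <= (f x)^2 + (g x)^2" using sum_squares_bound[of "\<bar>f x\<bar>" "\<bar>g x\<bar>"] by simp
  moreover have "0 <= \<bar>f x\<bar>*\<bar>g x\<bar>" by simp
  ultimately have "\<bar>f x\<bar>*\<bar>g x\<bar> <= (f x)^2 + (g x)^2" by linarith
  then show "norm (f x*g x) <= norm ((f x)^2 + (g x)^2)" by (simp add: abs_mult)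
 qed
qed

lemma sqi_add: "sqi M f ==> sqi M g ==> sqi M (%x. f x + g x)" using sqi_integrable_mult[of M f g]
 by (auto simp: sqi_def power2_sum mult.assoc)

lemma sqi_scale: "sqi M f ==> sqi M (%x. c*f x)" by (auto simp: sqi_def power_mult_distrib)

lemma sqi_diff: "sqi M f ==> sqi M g ==> sqi M (%x. f x - g x)"
 using sqi_add[of M f "%x. - 1*g x"] sqi_scale[of M g "- 1"] by simp

lemma sqi_zero: "sqi M (%x. 0)" by (simp add: sqi_def)

lemma sqi_sum: "(!!i. i : I ==> sqi M (f i)) ==> sqi M (%x. \<Sum>i\<in>I. f i x)"
 by (induction I rule: infinite_finite_induct) (auto intro: sqi_zero sqi_add)

lemma nsq_nonneg: "0 <= nsq M f" unfolding nsq_def by (intro integral_nonneg_AE) auto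

lemma nsq_scale: "nsq M (%x. c*f x) = c^2*nsq M f" unfolding nsq_def by (simp add: power_mult_distrib)

lemma nsq_add:
 assumes "sqi M f" "sqi M g"
 shows "nsq M (%x. f x + g x) = nsq M f + 2*ipr M f g + nsq M g"
proof -
 have "nsq M (%x. f x + g x) = (LINT x|M. (f x)^2 + (2*(f x*g x) + (g x)^2))"
  unfolding nsq_def by (simp add: power2_sum algebra_simps)
 also have "... = (LINT x|M. (f x)^2) + ((LINT x|M. 2*(f x*g x)) + (LINT x|M. (g x)^2))"
  using assms sqi_integrable_mult[OF assms] unfolding sqi_def by simp
 finally show ?thesis unfolding nsq_def ipr_def by simp
qed

lemma nsq_triangle:
 assumes "sqi M f" "sqi M g"
 shows "nsq M (%x. f x + g x) <= 2*nsq M f + 2*nsq M g"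
proof -
 have "0 <= nsq M (%x. f x - g x)" by (rule nsq_nonneg)
 also have "... = nsq M f + 2*ipr M f (%x. - 1*g x) + nsq M (%x. - 1*g x)"
  using nsq_add[OF assms(1) sqi_scale[OF assms(2), of "- 1"]] by simp
 also have "nsq M (%x. - 1*g x) = nsq M g" unfolding nsq_scale by simp
 also have "ipr M f (%x. - 1*g x) = - ipr M f g" unfolding ipr_def by simp
 finally show ?thesis using nsq_add[OF assms] by linarith
qed

lemma ipr_Cauchy_Schwarz:
 assumes "sqi M f" "sqi M g"
 shows "(ipr M f g)^2 <= nsq M f*nsq M g"
proof -
 have q: "0 <= nsq M f + 2*t*ipr M f g + t^2*nsq M g" for t
 proof -
  have "0 <= nsq M (%x. f x + t*g x)" by (rule nsq_nonneg)
  also have "... = nsq M f + 2*ipr M f (%x. t*g x) + nsq M (%x. t*g x)" by (rule nsq_add[OF assms(1) sqi_scale[OF assms(2)]])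
  also have "ipr M f (%x. t*g x) = t*ipr M f g" unfolding ipr_def by (simp add: mult.left_commute)
  finally show ?thesis unfolding nsq_scale by simp
 qed
 show ?thesis
 proof (cases "nsq M g = 0")
  case True
  have "ipr M f g = 0"
  proof (rule ccontr)
   assume n: "ipr M f g ~= 0"
   have "0 <= nsq M f + 2*(- (nsq M f + 1)/(2*ipr M f g))*ipr M f g" using q[of "- (nsq M f + 1)/(2*ipr M f g)"] True by simp
   then show False using n by (simp add: field_simps)
  qed
  then show ?thesis using True by simp
 next
  case False
  then have g: "nsq M g > 0" using nsq_nonneg[of M g] by linarith
  have "0 <= nsq M f - (ipr M f g)^2/nsq M g" using q[of "- ipr M f g/nsq M g"] g by (simp add: power2_eq_square field_simps)
  then show ?thesis using g by (simp add: field_simps)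
 qed
qed

lemma ipr_add_right: "sqi M f ==> sqi M g ==> sqi M h ==> ipr M f (%x. g x + h x) = ipr M f g + ipr M f h"
 unfolding ipr_def by (simp add: distrib_left sqi_integrable_mult)

lemma ipr_scale_right: "ipr M f (%x. c*g x) = c*ipr M f g" unfolding ipr_def by (simp add: mult.left_commute)

lemma ipr_sum_right:
 assumes "sqi M f" "!!i. i : I ==> sqi M (g i)"
 shows "ipr M f (%x. \<Sum>i\<in>I. g i x) = (\<Sum>i\<in>I. ipr M f (g i))" using assms(2)
proof (induction I rule: infinite_finite_induct)
 case (insert i I)
 then show ?case using assms(1) by (simp add: ipr_add_right sqi_sum)
qed (auto simp: ipr_def)

lemma ipr_commute: "ipr M f g = ipr M g f" unfolding ipr_def by (simp add: mult.commute)

lemma ipr_diff_right: "sqi M f ==> sqi M g ==> sqi M h ==> ipr M f (%x. g x - h x) = ipr M f g - ipr M f h"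
 unfolding ipr_def by (simp add: right_diff_distrib sqi_integrable_mult)

lemma nsq_sum_le:
 assumes "!!i. i : I ==> sqi M (f i)" "finite I"
 shows "nsq M (%x. \<Sum>i\<in>I. f i x) <= real (card I)*(\<Sum>i\<in>I. nsq M (f i))"
proof -
 have "(\<Sum>i\<in>I. f i x)^2 <= real (card I)*(\<Sum>i\<in>I. (f i x)^2)" for x
  using sum_squared_le_sum_of_squares[of "%i. f i x" I] by (simp add: mult.commute)
 then have "nsq M (%x. \<Sum>i\<in>I. f i x) <= (LINT x|M. real (card I)*(\<Sum>i\<in>I. (f i x)^2))"
  unfolding nsq_def using sqi_sum[OF assms(1), of I] assms by (intro integral_mono) (auto simp: sqi_def)
 also have "... = real (card I)*(\<Sum>i\<in>I. nsq M (f i))" unfolding nsq_def using assms by (simp add: sqi_def)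
 finally show ?thesis .
qed

definition proj :: "'a measure => ('k => 'a => real) => 'k set => ('a => real) => 'a => real" where
 "proj M e K f x = (\<Sum>k\<in>K. ipr M (e k) f/nsq M (e k)*e k x)"

text \<open>The system is orthogonal but not normalised, so \<open>proj\<close> divides by
  \<open>nsq\<close>. The third claim, best approximation in the span, is what turns density of the
  span into convergence of the projections.\<close>

lemma orthogonal_projection:
 assumes e: "!!k. sqi M (e k)" "!!k l. k ~= l ==> ipr M (e k) (e l) = 0" "!!k. nsq M (e k) > 0"
  and f: "sqi M f" and K: "finite K"
 shows "sqi M (proj M e K f)"
  and "nsq M (proj M e K f) <= nsq M f"
  and "nsq M (%x. f x - proj M e K f x) <= nsq M (%x. f x - (\<Sum>k\<in>K. a k*e k x))"
  and "nsq M (%x. f x - proj M e K f x) = nsq M f - nsq M (proj M e K f)"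
proof -
 have s: "sqi M (%x. \<Sum>k\<in>K. c k*e k x)" for c by (intro sqi_sum sqi_scale e(1))
 show P: "sqi M (proj M e K f)" unfolding proj_def[abs_def] by (rule s)
 have iP: "ipr M (e l) (proj M e K f) = ipr M (e l) f" if "l : K" for l
 proof -
  have "ipr M (e l) (proj M e K f) = (\<Sum>k\<in>K. ipr M (e k) f/nsq M (e k)*ipr M (e l) (e k))"
   unfolding proj_def[abs_def] by (simp only: ipr_sum_right[OF e(1) sqi_scale[OF e(1)]] ipr_scale_right)
  also have "... = (\<Sum>k\<in>K. if k = l then ipr M (e l) f else 0)"
  proof (rule sum.cong[OF refl])
   fix k
   have "ipr M (e l) (e l) = nsq M (e l)" by (simp add: ipr_def nsq_def power2_eq_square)
   then show "ipr M (e k) f/nsq M (e k)*ipr M (e l) (e k) = (if k = l then ipr M (e l) f else 0)" using e(2)[of l k] e(3)[of l] by auto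
  qed
  also have "... = ipr M (e l) f" using K that by simp
  finally show ?thesis .
 qed
 have orth: "ipr M (%x. f x - proj M e K f x) (%x. \<Sum>k\<in>K. c k*e k x) = 0" for c
 proof -
  have "ipr M (%x. f x - proj M e K f x) (%x. \<Sum>k\<in>K. c k*e k x) = (\<Sum>k\<in>K. c k*ipr M (%x. f x - proj M e K f x) (e k))"
   by (simp only: ipr_sum_right[OF sqi_diff[OF f P] sqi_scale[OF e(1)]] ipr_scale_right)
  also have "... = (\<Sum>k\<in>K. c k*(ipr M (e k) f - ipr M (e k) (proj M e K f)))"
   by (simp only: ipr_commute[of M "%x. f x - proj M e K f x"] ipr_diff_right[OF e(1) f P])
  also have "... = 0" using iP by simp
  finally show ?thesis .
 qed
 have pyth: "nsq M (%x. f x - (\<Sum>k\<in>K. c k*e k x)) = nsq M (%x. f x - proj M e K f x)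
   + nsq M (%x. proj M e K f x - (\<Sum>k\<in>K. c k*e k x))" for c
 proof -
  have "(%x. proj M e K f x - (\<Sum>k\<in>K. c k*e k x)) = (%x. \<Sum>k\<in>K. (ipr M (e k) f/nsq M (e k) - c k)*e k x)"
   by (simp add: proj_def fun_eq_iff sum_subtractf left_diff_distrib)
  then have "ipr M (%x. f x - proj M e K f x) (%x. proj M e K f x - (\<Sum>k\<in>K. c k*e k x)) = 0" using orth by simp
  then show ?thesis using nsq_add[OF sqi_diff[OF f P] sqi_diff[OF P s[of c]]] by simp
 qed
 show "nsq M (%x. f x - proj M e K f x) <= nsq M (%x. f x - (\<Sum>k\<in>K. a k*e k x))"
  unfolding pyth[of a] using nsq_nonneg by simp
 have "nsq M f = nsq M (%x. f x - proj M e K f x) + nsq M (proj M e K f)" using pyth[of "%_. 0"] by simp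
 then show "nsq M (%x. f x - proj M e K f x) = nsq M f - nsq M (proj M e K f)" "nsq M (proj M e K f) <= nsq M f"
  using nsq_nonneg[of M "%x. f x - proj M e K f x"] by linarith+
qed

section \<open>Density of products in the square integrable functions on a cube\<close>

definition prodf :: "('i => real => real) => real^'i::finite => real" where
 "prodf f x = (\<Prod>i\<in>UNIV. f i (x $ i))"

definition freqs :: "nat => ('n::finite => nat) set" where "freqs N = PiE UNIV (%_. {..N})"

lemma finite_freqs: "finite (freqs N)" unfolding freqs_def by (intro finite_PiE) auto

lemma freqs_mono: "N <= N' ==> freqs N \<subseteq> freqs N'" unfolding freqs_def by (intro PiE_mono) auto

text \<open>Density is recorded function by function, so that it can be carried through an induction
  over the Borel sets and through dominated limits.\<close>

definition approximable :: "(nat => real => real) => real => (real^'n::finite => real) => bool" where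
 "approximable b L f \<longleftrightarrow> sqi (cm L) f &
   (\<forall>ep>0. \<exists>N a. nsq (cm L) (%x. f x - (\<Sum>k\<in>freqs N. a k*prodf (%i. b (k i)) x)) < ep)"

lemma cube_sets [measurable, simp]: "cube L : sets lebesgue" "cube L : sets borel" by (simp_all add: cube_eq_box)

lemma finite_measure_cube: "finite_measure (lebesgue_on (cube L :: (real^'n::finite) set))"
proof (rule finite_measureI)
 have "cube L : lmeasurable" unfolding cube_eq_box by simp
 then have "emeasure lebesgue (cube L :: (real^'n) set) < \<infinity>" by (simp add: fmeasurable_def)
 then show "emeasure (cm L) (space (lebesgue_on (cube L :: (real^'n) set))) ~= \<infinity>" by (simp add: emeasure_restrict_space)
qed

lemma sqi_bounded_cube:
 assumes "f : bmeas (lebesgue_on (cube L :: (real^'n::finite) set))" "!!x. x : cube L ==> \<bar>f x\<bar> <= B"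
 shows "sqi (cm L) f" "nsq (cm L) f <= B^2*measure lebesgue (cube L :: (real^'n) set)"
proof -
 interpret finite_measure "lebesgue_on (cube L :: (real^'n) set)" by (rule finite_measure_cube)
 have B: "(f x)^2 <= B^2" if "x : cube L" for x using assms(2)[OF that] power_mono[of "\<bar>f x\<bar>" B 2] by simp
 show s: "sqi (cm L) f" unfolding sqi_def using assms(1) B by (auto intro!: integrable_const_bound[where B="B^2"])
 have "nsq (cm L) f <= (LINT x|lebesgue_on (cube L :: (real^'n) set). B^2)"
  unfolding nsq_def using s B by (intro integral_mono) (auto simp: sqi_def)
 also have "... = B^2*measure lebesgue (cube L :: (real^'n) set)" by (simp add: measure_restrict_space)
 finally show "nsq (cm L) f <= B^2*measure lebesgue (cube L :: (real^'n) set)" .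
qed

lemma borel_measurable_on_cube:
 "f : bmeas borel ==> f : bmeas (lebesgue_on S)" for f :: "'a::euclidean_space => 'b::topological_space"
 by (intro measurable_restrict_space1 measurable_completion) simp

lemma nsq_cong_cube: "(!!x. x : cube L ==> f x = g x) ==> nsq (cm L) f = nsq (cm L) g"
 unfolding nsq_def by (intro Lint_cong) auto

lemma sqi_cong_cube: "(!!x. x : cube L ==> f x = g x) ==> sqi (cm L) f = sqi (cm L) g"
 unfolding sqi_def by (intro arg_cong2[of _ _ _ _ "(&)"] measurable_cong Lintb_cong) auto

lemma approximable_cong:
 assumes "!!x. x : cube L ==> f x = g x" "approximable b L f"
 shows "approximable b L g"
proof -
 have "nsq (cm L) (%x. f x - h x) = nsq (cm L) (%x. g x - h x)" for h
  using assms(1) by (intro nsq_cong_cube) auto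
 moreover have "sqi (cm L) f = sqi (cm L) g" using assms(1) by (rule sqi_cong_cube)
 ultimately show ?thesis using assms(2) unfolding approximable_def by simp
qed

text \<open>What the three families of boundary conditions have in common in one dimension.
  \<open>dense1\<close> concerns functions that vanish near 0 and near both ends, a class that each
  of the families approximates uniformly and that is still large enough to reach indicators of
  boxes.\<close>

locale trig_family =
 fixes b :: "nat => real => real" and L :: real
 assumes L: "L > 0" and bcont: "!!j. cont (b j)" and bbound: "!!j x. \<bar>b j x\<bar> <= 1"
  and dense1: "!!h eh ep. cont h ==> 0 < eh ==> (!!x. \<bar>x\<bar> <= eh \<or> L/2 - eh <= \<bar>x\<bar> ==> h x = 0) ==> 0 < ep ==>
   \<exists>N a. \<forall>x. - L/2 < x & x < L/2 --> \<bar>h x - (\<Sum>j\<le>N. a j*b j x)\<bar> <= ep"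
begin

abbreviation (input) "e k \<equiv> prodf (%i. b (k i))"

lemma e_cont: "cont (e k)" unfolding prodf_def by (intro continuous_intros cont_comp2[OF bcont]) auto

lemma e_measurable [measurable]: "e k : bmeas (lebesgue_on S)"
 using e_cont by (intro borel_measurable_on_cube bmeas_contI)

lemma e_bound: "\<bar>e k x\<bar> <= 1" unfolding prodf_def abs_prod by (intro prod_le_1) (auto intro: bbound)

lemma e_sqi: "sqi (lebesgue_on (cube L :: (real^'n::finite) set)) (e k)" using e_bound by (intro sqi_bounded_cube(1)) auto

lemma span_sqi: "sqi (lebesgue_on (cube L :: (real^'n::finite) set)) (%x. \<Sum>k\<in>K. a k*e k x)" by (intro sqi_sum sqi_scale e_sqi)

lemma approximable_add:
 fixes f g :: "real^'n::finite => real"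
 assumes "approximable b L f" "approximable b L g"
 shows "approximable b L (%x. f x + g x)" unfolding approximable_def
proof (intro conjI allI impI)
 let ?M = "lebesgue_on (cube L :: (real^'n) set)"
 have s: "sqi ?M f" "sqi ?M g" using assms by (auto simp: approximable_def)
 then show "sqi ?M (%x. f x + g x)" by (rule sqi_add)
 fix ep :: real assume "ep > 0"
 then obtain N1 a1 N2 a2 where
  n: "nsq ?M (%x. f x - (\<Sum>k\<in>freqs N1. a1 k*e k x)) < ep/4" "nsq ?M (%x. g x - (\<Sum>k\<in>freqs N2. a2 k*e k x)) < ep/4"
  using assms unfolding approximable_def by (meson divide_pos_pos zero_less_numeral)
 define N where "N = max N1 N2"
 define a where "a k = (if k : freqs N1 then a1 k else 0) + (if k : freqs N2 then a2 k else 0)" for k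
 have ext: "(\<Sum>k\<in>freqs N. (if k : freqs N' then c k else 0)*e k x) = (\<Sum>k\<in>freqs N'. c k*e k x)" if "N' <= N" for N' c and x :: "real^'n"
 proof -
  have "freqs N' \<subseteq> (freqs N :: ('n => nat) set)" using that by (rule freqs_mono)
  then show ?thesis by (intro sum.mono_neutral_cong_right finite_freqs) auto
 qed
 have "(\<Sum>k\<in>freqs N. a k*e k x) = (\<Sum>k\<in>freqs N1. a1 k*e k x) + (\<Sum>k\<in>freqs N2. a2 k*e k x)" for x :: "real^'n"
  unfolding a_def distrib_right sum.distrib by (subst (1 2) ext) (auto simp: N_def)
 then have "nsq ?M (%x. f x + g x - (\<Sum>k\<in>freqs N. a k*e k x))
   = nsq ?M (%x. (f x - (\<Sum>k\<in>freqs N1. a1 k*e k x)) + (g x - (\<Sum>k\<in>freqs N2. a2 k*e k x)))" by (simp add: algebra_simps)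
 also have "... <= 2*nsq ?M (%x. f x - (\<Sum>k\<in>freqs N1. a1 k*e k x)) + 2*nsq ?M (%x. g x - (\<Sum>k\<in>freqs N2. a2 k*e k x))"
  by (intro nsq_triangle sqi_diff s span_sqi)
 also have "... < ep" using n by linarith
 finally show "\<exists>N a. nsq ?M (%x. f x + g x - (\<Sum>k\<in>freqs N. a k*e k x)) < ep" by (intro exI[of _ N] exI[of _ a])
qed

lemma approximable_scale:
 fixes f :: "real^'n::finite => real"
 assumes "approximable b L f"
 shows "approximable b L (%x. c*f x)" unfolding approximable_def
proof (intro conjI allI impI)
 let ?M = "lebesgue_on (cube L :: (real^'n) set)"
 have "sqi ?M f" using assms by (auto simp: approximable_def)
 then show "sqi ?M (%x. c*f x)" by (rule sqi_scale)
 fix ep :: real assume "ep > 0"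
 then have "ep/(c^2 + 1) > 0" by (simp add: add_nonneg_pos)
 then obtain N a where n: "nsq ?M (%x. f x - (\<Sum>k\<in>freqs N. a k*e k x)) < ep/(c^2 + 1)"
  using assms unfolding approximable_def by blast
 have "nsq ?M (%x. c*f x - (\<Sum>k\<in>freqs N. (c*a k)*e k x)) = nsq ?M (%x. c*(f x - (\<Sum>k\<in>freqs N. a k*e k x)))"
  by (simp add: right_diff_distrib sum_distrib_left mult.assoc)
 also have "... = c^2*nsq ?M (%x. f x - (\<Sum>k\<in>freqs N. a k*e k x))" by (rule nsq_scale)
 also have "... <= c^2*(ep/(c^2 + 1))" using n by (intro mult_left_mono) auto
 also have "... < ep"
 proof -
  have c: "0 < c^2 + 1" by (simp add: add_nonneg_pos)
  have "c^2*ep < (c^2 + 1)*ep" using \<open>ep > 0\<close> by simp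
  then show ?thesis using c by (simp add: pos_divide_less_eq mult.commute)
 qed
 finally show "\<exists>N a. nsq ?M (%x. c*f x - (\<Sum>k\<in>freqs N. a k*e k x)) < ep"
  by (intro exI[of _ N] exI[of _ "%k. c*a k"])
qed

lemma approximable_zero: "approximable b L (%x. 0 :: real)" unfolding approximable_def nsq_def using sqi_zero
 by (auto intro!: exI[of _ 0] exI[of _ "%_. 0"])

lemma approximable_sum:
 fixes f :: "'j => real^'n::finite => real"
 shows "(!!i. i : I ==> approximable b L (f i)) ==> approximable b L (%x. \<Sum>i\<in>I. f i x)"
 by (induction I rule: infinite_finite_induct) (auto intro: approximable_zero approximable_add)

lemma approximable_limit:
 fixes f :: "real^'n::finite => real"
 assumes F: "!!m. approximable b L (F m)" and f: "sqi (cm L) f"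
  and lim: "(%m. nsq (cm L) (%x. f x - F m x)) ~~> 0"
 shows "approximable b L f" unfolding approximable_def
proof (intro conjI allI impI f)
 let ?M = "lebesgue_on (cube L :: (real^'n) set)"
 fix ep :: real assume "ep > 0"
 then have "eventually (%m. nsq ?M (%x. f x - F m x) < ep/4) sequentially" using order_tendstoD(2)[OF lim, of "ep/4"] by simp
 then obtain m where m: "nsq ?M (%x. f x - F m x) < ep/4" using eventually_happens'[OF sequentially_bot] by blast
 obtain N a where n: "nsq ?M (%x. F m x - (\<Sum>k\<in>freqs N. a k*e k x)) < ep/4"
  using F[of m] \<open>ep > 0\<close> unfolding approximable_def by (meson divide_pos_pos zero_less_numeral)
 have s: "sqi ?M (F m)" using F by (auto simp: approximable_def)
 have "nsq ?M (%x. f x - (\<Sum>k\<in>freqs N. a k*e k x)) = nsq ?M (%x. (f x - F m x) + (F m x - (\<Sum>k\<in>freqs N. a k*e k x)))"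
  by simp
 also have "... <= 2*nsq ?M (%x. f x - F m x) + 2*nsq ?M (%x. F m x - (\<Sum>k\<in>freqs N. a k*e k x))"
  by (intro nsq_triangle sqi_diff s f span_sqi)
 also have "... < ep" using m n by linarith
 finally show "\<exists>N a. nsq ?M (%x. f x - (\<Sum>k\<in>freqs N. a k*e k x)) < ep" by (intro exI[of _ N] exI[of _ a])
qed

lemma approximable_dominated:
 fixes f :: "real^'n::finite => real"
 assumes F: "!!m. approximable b L (F m)" and f: "f : bmeas (cm L)"
  and w: "sqi (cm L) w"
  and lim: "AE x in cm L. (%m. F m x) ~~> f x"
  and dom: "!!m. AE x in cm L. \<bar>F m x\<bar> <= w x"
 shows "approximable b L f"
proof (rule approximable_limit[OF F])
 let ?M = "lebesgue_on (cube L :: (real^'n) set)"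
 have domf: "AE x in ?M. \<bar>f x\<bar> <= w x"
 proof -
  have "AE x in ?M. \<forall>m. \<bar>F m x\<bar> <= w x" using dom by (simp add: AE_all_countable)
  with lim show ?thesis
  proof eventually_elim
   case (elim x)
   have "(%m. \<bar>F m x\<bar>) ~~> \<bar>f x\<bar>" using elim(1) by (rule tendsto_rabs)
   then show ?case using elim(2) by (intro LIMSEQ_le_const2) auto
  qed
 qed
 have wm: "w : bmeas ?M" "integrable ?M (%x. (w x)^2)" using w by (auto simp: sqi_def)
 show "sqi ?M f" unfolding sqi_def
 proof (intro conjI f Lintb_bound[OF wm(2)])
  show "(%x. (f x)^2) : bmeas ?M" using f by measurable
  show "AE x in ?M. norm ((f x)^2) <= norm ((w x)^2)" using domf
  proof eventually_elim
   case (elim x)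
   then have "\<bar>f x\<bar>^2 <= (w x)^2" by (intro power_mono) auto
   then show ?case by simp
  qed
 qed
 have Fm: "F m : bmeas ?M" for m using F by (auto simp: approximable_def sqi_def)
 have "(%m. LINT x|?M. (f x - F m x)^2) ~~> (LINT x|?M. 0)"
 proof (rule integral_dominated_convergence[where w="%x. 4*(w x)^2"])
  show "(%x. (f x - F m x)^2) : bmeas ?M" for m using f Fm by measurable
  show "integrable ?M (%x. 4*(w x)^2)" using wm by simp
  show "AE x in ?M. (%m. (f x - F m x)^2) ~~> 0" using lim
  proof eventually_elim
   case (elim x)
   have "(%m. (f x - F m x)^2) ~~> (f x - f x)^2" by (intro tendsto_intros elim)
   then show ?case by simp
  qed
  show "AE x in ?M. norm ((f x - F m x)^2) <= 4*(w x)^2" for m using domf dom[of m]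
  proof eventually_elim
   case (elim x)
   have "\<bar>f x - F m x\<bar> <= 2*w x" using elim by linarith
   then have "\<bar>f x - F m x\<bar>^2 <= (2*w x)^2" by (intro power_mono) auto
   then show ?case by (simp add: power_mult_distrib)
  qed
 qed simp
 then show "(%m. nsq ?M (%x. f x - F m x)) ~~> 0" unfolding nsq_def by simp
qed

lemma approximable_prodf:
 fixes h :: "'n::finite => real => real"
 assumes h: "!!i. cont (h i)" "!!i x. \<bar>h i x\<bar> <= 1" and eh: "eh > 0"
  and supp: "!!i x. \<bar>x\<bar> <= eh \<or> L/2 - eh <= \<bar>x\<bar> ==> h i x = 0"
 shows "approximable b L (prodf h)" unfolding approximable_def
proof (intro conjI allI impI)
 let ?M = "lebesgue_on (cube L :: (real^'n) set)"
 have hm: "prodf h : bmeas ?M" unfolding prodf_def[abs_def]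
  by (intro borel_measurable_on_cube bmeas_contI continuous_intros cont_comp2[OF h(1)]) auto
 show s: "sqi ?M (prodf h)"
 proof (rule sqi_bounded_cube(1)[OF hm, of 1])
  show "\<bar>prodf h x\<bar> <= 1" for x unfolding prodf_def abs_prod by (intro prod_le_1) (auto intro: h(2))
 qed
 fix ep :: real assume ep: "ep > 0"
 define V where "V = measure lebesgue (cube L :: (real^'n) set)"
 have V: "V >= 0" by (simp add: V_def)
 define n where "n = real CARD('n)"
 obtain th where th: "0 < th" "(n*(2*th))^2*V < ep"
 proof -
  have "((%th. (n*(2*th))^2*V) \<longlongrightarrow> (n*(2*0))^2*V) (at_right 0)" by (intro tendsto_intros)
  then have "eventually (%th. (n*(2*th))^2*V < ep) (at_right 0)" using ep by (intro order_tendstoD(2)) auto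
  then have "eventually (%th. (n*(2*th))^2*V < ep & 0 < th) (at_right 0)"
   using eventually_at_right_less[of "0::real"] by eventually_elim auto
  then show ?thesis using that eventually_happens'[OF trivial_limit_at_right_real] by blast
 qed
 have "\<forall>i. \<exists>N a. \<forall>x. - L/2 < x & x < L/2 --> \<bar>h i x - (\<Sum>j\<le>N. a j*b j x)\<bar> <= th"
  using dense1[OF h(1) eh supp th(1)] by blast
 then obtain N a where Na: "!!i x. - L/2 < x ==> x < L/2 ==> \<bar>h i x - (\<Sum>j\<le>N i. a i j*b j x)\<bar> <= th"
  by metis
 define N0 where "N0 = Max (range N)"
 \<comment> \<open>Dividing by \<open>1 + th\<close> brings the approximants below 1 in modulus and
   raises the error to at most \<open>2 th\<close>. With all factors bounded by 1, two products
   differ by at most the sum of the differences of their factors.\<close>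
 define c where "c i j = (if j <= N i then a i j else 0)/(1 + th)" for i j
 define g where "g i x = (\<Sum>j\<le>N0. c i j*b j x)" for i x
 have geq: "g i x = (\<Sum>j\<le>N i. a i j*b j x)/(1 + th)" for i x
 proof -
  have "N i <= N0" unfolding N0_def by (intro Max_ge) auto
  then have "(\<Sum>j\<le>N0. (if j <= N i then a i j else 0)*b j x) = (\<Sum>j\<le>N i. a i j*b j x)" by (intro sum.mono_neutral_cong_right) auto
  then show ?thesis unfolding g_def c_def by (simp only: times_divide_eq_left sum_divide_distrib[symmetric])
 qed
 have close: "\<bar>g i x\<bar> <= 1" "\<bar>h i x - g i x\<bar> <= 2*th" if x: "- L/2 < x" "x < L/2" for i x
 proof -
  define q where "q = (\<Sum>j\<le>N i. a i j*b j x)"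
  have 1: "\<bar>h i x - q\<bar> <= th" unfolding q_def by (rule Na[OF x])
  then have "\<bar>q\<bar> <= 1 + th" using h(2)[of i x] by linarith
  then show "\<bar>g i x\<bar> <= 1" unfolding geq q_def[symmetric] using th(1) by (simp add: abs_divide)
  have "h i x - g i x = (h i x - q + h i x*th)/(1 + th)" unfolding geq q_def[symmetric] using th(1) by (simp add: field_simps)
  moreover have "\<bar>h i x - q + h i x*th\<bar> <= 2*th"
  proof -
   have "\<bar>h i x*th\<bar> <= 1*th" unfolding abs_mult using h(2)[of i x] th(1) by (intro mult_mono) auto
   then show ?thesis using 1 by linarith
  qed
  moreover have "2*th/(1 + th) <= 2*th" using th(1) by (simp add: divide_le_eq)
  moreover have "\<bar>(h i x - q + h i x*th)/(1 + th)\<bar> <= 2*th/(1 + th)" if "\<bar>h i x - q + h i x*th\<bar> <= 2*th"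
   using that th(1) unfolding abs_divide by (simp add: divide_right_mono)
  ultimately show "\<bar>h i x - g i x\<bar> <= 2*th" by linarith
 qed
 define A where "A k = (\<Prod>i\<in>(UNIV :: 'n set). c i (k i))" for k
 have G: "prodf g x = (\<Sum>k\<in>freqs N0. A k*e k x)" for x :: "real^'n" unfolding prodf_def g_def freqs_def A_def
  by (subst prod_sum_PiE) (auto simp: prod.distrib)
 have "\<bar>prodf h x - prodf g x\<bar> <= n*(2*th)" if "x : cube L" for x :: "real^'n"
 proof -
  have x: "- L/2 < x $ i" "x $ i < L/2" for i using that by (auto simp: cube_def)
  have "\<bar>prodf h x - prodf g x\<bar> <= (\<Sum>i\<in>(UNIV :: 'n set). \<bar>h i (x $ i) - g i (x $ i)\<bar>)" unfolding prodf_def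
   using norm_prod_diff[of UNIV "%i. h i (x $ i)" "%i. g i (x $ i)"] h(2) close(1)[OF x] by simp
  also have "... <= (\<Sum>i\<in>(UNIV :: 'n set). 2*th)" by (intro sum_mono close(2) x)
  finally show ?thesis by (simp add: n_def)
 qed
 then have "nsq ?M (%x. prodf h x - (\<Sum>k\<in>freqs N0. A k*e k x)) <= (n*(2*th))^2*V" unfolding V_def G[symmetric]
 proof (rule sqi_bounded_cube(2)[rotated])
  show "(%x. prodf h x - prodf g x) : bmeas ?M" unfolding G using hm by measurable
 qed auto
 then have "nsq ?M (%x. prodf h x - (\<Sum>k\<in>freqs N0. A k*e k x)) < ep" using th(2) by linarith
 then show "\<exists>N a. nsq ?M (%x. prodf h x - (\<Sum>k\<in>freqs N. a k*e k x)) < ep" by (intro exI[of _ N0] exI[of _ A])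
qed

end

text \<open>Dynkin's pi-lambda theorem, with the boxes as a generator closed under intersection; the
  empty set is itself a box.\<close>

lemma borel_box_induct [consumes 1, case_names box compl union]:
 fixes A :: "'a::euclidean_space set"
 assumes "A : sets borel"
  and "!!a b. P (box a b)"
  and "!!A. A : sets borel ==> P A ==> P (- A)"
  and "!!F. disjoint_family F ==> (!!i::nat. F i : sets borel) ==> (!!i. P (F i)) ==> P (\<Union>i. F i)"
 shows "P A"
proof -
 let ?E = "range (%(a, b). box a b :: 'a set)"
 have i: "Int_stable ?E" by (auto simp: Int_stable_def box_Int_box)
 have s: "?E \<subseteq> Pow UNIV" by auto
 have A: "A : sigma_sets UNIV ?E" using assms(1) unfolding borel_eq_box by simp
 from i s A show ?thesis
 proof (induction rule: sigma_sets_induct_disjoint)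
  case (basic A)
  then show ?case using assms(2) by auto
 next
  case empty
  have "box 0 0 = ({} :: 'a set)" by (simp add: box_eq_empty)
  then show ?case using assms(2)[of 0 0] by simp
 next
  case (compl A)
  then have "A : sets borel" unfolding borel_eq_box by simp
  then show ?case using assms(3) compl by (simp add: Compl_eq_Diff_UNIV)
 next
  case (union F)
  then have "F i : sets borel" for i unfolding borel_eq_box by auto
  then show ?case using assms(4)[of F] union by simp
 qed
qed

text \<open>The bump vanishes near the origin as well: for periodic boundary conditions the odd part of a
 function is divided by a sine that vanishes there.\<close>

definition bump :: "nat => real => real => real => real" where
 "bump n c d s = max 0 (min 1 (real (Suc n)*min (min (s - c) (d - s)) \<bar>s\<bar> - 1))"

lemma bump_props: "cont (bump n c d)" "\<bar>bump n c d s\<bar> <= 1" "0 <= bump n c d s"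
 "min (min (s - c) (d - s)) \<bar>s\<bar> <= 1/real (Suc n) ==> bump n c d s = 0"
 "s ~= 0 ==> c < s ==> s < d ==> (%n. bump n c d s) ~~> 1"
proof -
 show "cont (bump n c d)" unfolding bump_def[abs_def] by (intro continuous_intros)
 show "\<bar>bump n c d s\<bar> <= 1" "0 <= bump n c d s" unfolding bump_def by auto
 show "bump n c d s = 0" if "min (min (s - c) (d - s)) \<bar>s\<bar> <= 1/real (Suc n)"
 proof -
  have "real (Suc n)*min (min (s - c) (d - s)) \<bar>s\<bar> <= real (Suc n)*(1/real (Suc n))" using that by (rule mult_left_mono) simp
  also have "... = 1" by simp
  finally show ?thesis unfolding bump_def by linarith
 qed
 assume s: "s ~= 0" "c < s" "s < d"
 define m where "m = min (min (s - c) (d - s)) \<bar>s\<bar>"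
 have m: "m > 0" using s by (auto simp: m_def)
 obtain N :: nat where N: "real N >= 2/m" using real_arch_simple by blast
 have "bump n c d s = 1" if "n >= N" for n
 proof -
  have "real (Suc n) >= 2/m" using N that by linarith
  then have "real (Suc n)*m >= 2" using m by (simp add: divide_le_eq)
  then show ?thesis unfolding bump_def m_def[symmetric] by simp
 qed
 then have "eventually (%n. bump n c d s = 1) sequentially" by (auto simp: eventually_sequentially)
 then show "(%n. bump n c d s) ~~> 1" by (rule tendsto_eventually)
qed

lemma AE_component_ne_0: "AE x in lebesgue_on S. \<forall>i. x $ i ~= (0::real)" if "S : sets lebesgue" for S :: "(real^'n::finite) set"
proof -
 have "AE x in lebesgue. x $ i ~= (0::real)" for i :: 'n
 proof -
  have "negligible {x :: real^'n. x $ i = 0}" by (rule negligible_standard_hyperplane_cart)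
  then have "{x :: real^'n. x $ i = 0} : null_sets lebesgue" by (simp add: negligible_iff_null_sets)
  then show ?thesis by (rule AE_I') auto
 qed
 then have "AE x in lebesgue. \<forall>i::'n. x $ i ~= (0::real)" by (simp add: AE_all_countable)
 then show ?thesis using that by (subst AE_restrict_space_iff) auto
qed

context trig_family
begin

text \<open>The products of bumps converge to the indicator except possibly where some coordinate is
  0, which is a null set.\<close>

lemma approximable_box:
 fixes a c :: "real^'n::finite"
 shows "approximable b L (ind (box a c))"
proof (rule approximable_dominated[where w="%_. 1"])
 let ?M = "lebesgue_on (cube L :: (real^'n) set)"
 define l where "l i = max (a $ i) (- L/2)" for i
 define u where "u i = min (c $ i) (L/2)" for i
 define h where "h n i = bump n (l i) (u i)" for n i
 show "approximable b L (prodf (h n))" for n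
 proof (rule approximable_prodf[where eh="1/real (Suc n)"])
  show "cont (h n i)" "\<bar>h n i x\<bar> <= 1" for i x unfolding h_def by (rule bump_props)+
  show "0 < 1/real (Suc n)" by simp
  fix i x assume x: "\<bar>x\<bar> <= 1/real (Suc n) \<or> L/2 - 1/real (Suc n) <= \<bar>x\<bar>"
  have "l i >= - L/2" "u i <= L/2" by (auto simp: l_def u_def)
  then have "min (min (x - l i) (u i - x)) \<bar>x\<bar> <= 1/real (Suc n)" using x by linarith
  then show "h n i x = 0" unfolding h_def by (rule bump_props(4))
 qed
 show "ind (box a c) : bmeas ?M" by (intro borel_measurable_on_cube) simp
 show "sqi ?M (%_. 1)" by (rule sqi_bounded_cube(1)[of _ _ 1]) auto
 show "AE x in ?M. \<bar>prodf (h n) x\<bar> <= 1" for n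
 proof (rule AE_I2)
  show "\<bar>prodf (h n) x\<bar> <= 1" for x unfolding prodf_def abs_prod h_def by (intro prod_le_1) (auto intro: bump_props)
 qed
 have "AE x in ?M. x : cube L" by (rule AE_I2) auto
 with AE_component_ne_0[OF cube_sets(1), of L]
 show "AE x in ?M. (%n. prodf (h n) x) ~~> ind (box a c) x"
 proof eventually_elim
  case (elim x)
  have x: "- L/2 < x $ i" "x $ i < L/2" for i using elim(2) by (auto simp: cube_def)
  show ?case
  proof (cases "x : box a c")
   case True
   then have "a $ i < x $ i" "x $ i < c $ i" for i by (auto simp: mem_box_cart)
   then have "(%n. h n i (x $ i)) ~~> 1" for i
    unfolding h_def using x elim(1) by (intro bump_props(5)) (auto simp: l_def u_def)
   then have "(%n. \<Prod>i\<in>(UNIV :: 'n set). h n i (x $ i)) ~~> (\<Prod>i\<in>(UNIV :: 'n set). 1)"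
    by (intro tendsto_prod)
   then show ?thesis using True by (simp add: prodf_def)
  next
   case False
   then obtain i where i: "x $ i <= a $ i \<or> c $ i <= x $ i" by (auto simp: mem_box_cart not_less)
   have "h n i (x $ i) = 0" for n
   proof -
    have "min (min (x $ i - l i) (u i - x $ i)) \<bar>x $ i\<bar> <= 0" using i by (auto simp: l_def u_def)
    also have "0 <= 1/real (Suc n)" by simp
    finally show ?thesis unfolding h_def by (rule bump_props(4))
   qed
   then have "prodf (h n) x = 0" for n unfolding prodf_def by (intro prod_zero) auto
   then show ?thesis using False by simp
  qed
 qed
qed

lemma approximable_one: "approximable b L (%x :: real^'n::finite. 1)"
proof (rule approximable_cong[OF _ approximable_box[of "\<chi> i. - L/2" "\<chi> i. L/2"]])
 show "ind (box (\<chi> i. - L/2) (\<chi> i. L/2)) x = (1 :: real)" if "x : cube L" for x :: "real^'n"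
  using that unfolding cube_eq_box by simp
qed

lemma approximable_borel:
 fixes A :: "(real^'n::finite) set"
 assumes "A : sets borel"
 shows "approximable b L (ind A)" using assms
proof (induction rule: borel_box_induct)
 case (box a c)
 show ?case by (rule approximable_box)
next
 case (compl A)
 have "approximable b L (%x. 1 + (- 1)*ind A x)" by (intro approximable_add approximable_scale approximable_one compl)
 moreover have "(%x. 1 + (- 1)*ind A x) = (ind (- A) :: _ => real)" by (auto simp: fun_eq_iff indicator_def)
 ultimately show ?case by simp
next
 case (union F)
 let ?M = "lebesgue_on (cube L :: (real^'n) set)"
 show ?case
 proof (rule approximable_dominated[where w="%_. 1"])
  show "approximable b L (%x. \<Sum>i<n. ind (F i) x)" for n by (intro approximable_sum union)
  have "(\<Union>i. F i) : sets borel" using union by auto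
  then show "ind (\<Union>i. F i) : bmeas ?M" by (intro borel_measurable_on_cube) simp
  show "sqi ?M (%_. 1)" by (rule sqi_bounded_cube(1)[of _ _ 1]) auto
  have s: "(\<Sum>i<n. ind (F i) x) = (ind (\<Union>i<n. F i) x :: real)" for n x
   using union(1) by (intro indicator_UN_disjoint[symmetric]) (auto simp: disjoint_family_on_def)
  show "AE x in ?M. \<bar>\<Sum>i<n. ind (F i) x\<bar> <= (1 :: real)" for n
  proof (rule AE_I2)
   have "\<bar>ind (\<Union>i<n. F i) x :: real\<bar> <= 1" for x by (simp add: indicator_def)
   then show "\<bar>\<Sum>i<n. ind (F i) x\<bar> <= (1 :: real)" for x by (simp only: s)
  qed
  show "AE x in ?M. (%n. \<Sum>i<n. ind (F i) x) ~~> (ind (\<Union>i. F i) x :: real)"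
   unfolding s by (intro AE_I2 LIMSEQ_indicator_UN)
 qed
qed

theorem approximable_sqi:
 fixes f :: "real^'n::finite => real"
 assumes f: "sqi (cm L) f"
 shows "approximable b L f"
proof -
 let ?M = "lebesgue_on (cube L :: (real^'n) set)"
 \<comment> \<open>\<open>f\<close> is only Lebesgue measurable. A Borel function that agrees with
   it almost everywhere supplies simple functions with Borel level sets, dominated by
   \<open>2 |f|\<close> almost everywhere.\<close>
 have "(%x. if x : cube L then f x else 0) : bmeas lebesgue" using f by (simp add: borel_measurable_if sqi_def)
 then obtain g where g: "g : bmeas lborel" and fg: "AE x in lborel. (if x : cube L then f x else 0) = g x"
  using completion_ex_borel_measurable_real by blast
 have ae: "AE x in ?M. f x = g x"
 proof -
  have "AE x in lebesgue. x : cube L --> f x = g x" using AE_completion[OF fg] by eventually_elim auto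
  then show ?thesis by (subst AE_restrict_space_iff) auto
 qed
 obtain F where F: "!!i. simple_function lborel (F i)" "!!x. (%i. F i x) ~~> g x"
  "!!i x. dist (F i x) 0 <= 2*dist (g x) 0" using borel_measurable_implies_sequence_metric[OF g, of 0] by auto
 have apF: "approximable b L (F i)" for i
 proof -
  have fin: "finite (range (F i))" using simple_functionD(1)[OF F(1)[of i]] by simp
  have eq: "F i x = (\<Sum>y\<in>range (F i). y*ind (F i -` {y}) x)" for x
  proof -
   have "(\<Sum>y\<in>range (F i). y*ind (F i -` {y}) x) = (\<Sum>y\<in>{F i x}. y)"
    by (rule sum.mono_neutral_cong_right[OF fin]) (auto simp: indicator_def)
   then show ?thesis by simp
  qed
  have "F i -` {y} : sets borel" for y using simple_functionD(2)[OF F(1)[of i], of "{y}"] by simp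
  then have "approximable b L (%x. \<Sum>y\<in>range (F i). y*ind (F i -` {y}) x)"
   by (intro approximable_sum approximable_scale approximable_borel)
  then show ?thesis unfolding eq[symmetric] .
 qed
 show ?thesis
 proof (rule approximable_dominated[OF apF])
  show "f : bmeas ?M" using f by (simp add: sqi_def)
  show "sqi ?M (%x. 2*\<bar>f x\<bar>)" using f by (auto simp: sqi_def power_mult_distrib)
  show "AE x in ?M. (%m. F m x) ~~> f x" using ae by eventually_elim (simp add: F(2))
  show "AE x in ?M. \<bar>F m x\<bar> <= 2*\<bar>f x\<bar>" for m using ae by eventually_elim (use F(3)[of m] in \<open>simp add: dist_norm\<close>)
 qed
qed

text \<open>The projections are best approximations and the sets \<open>freqs N\<close> increase, so
  one good approximant at stage \<open>N\<close> bounds the error at every later stage.\<close>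

lemma proj_limit:
 fixes f :: "real^'n::finite => real"
 defines "M \<equiv> lebesgue_on (cube L :: (real^'n) set)"
 assumes e: "!!k l. k ~= l ==> ipr M (e k) (e l) = 0" "!!k. nsq M (e k) > 0"
  and f: "sqi M f"
 shows "(%N. nsq M (%x. f x - proj M e (freqs N) f x)) ~~> 0"
proof (rule LIMSEQ_I)
 have es: "sqi M (e k)" for k unfolding M_def by (rule e_sqi)
 fix ep :: real assume "ep > 0"
 then obtain N a where N: "nsq M (%x. f x - (\<Sum>k\<in>freqs N. a k*e k x)) < ep"
  using approximable_sqi[of f] f unfolding approximable_def M_def by blast
 have "norm (nsq M (%x. f x - proj M e (freqs n) f x) - 0) < ep" if "n >= N" for n
 proof -
  define a' where "a' k = (if k : freqs N then a k else 0)" for k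
  have "(\<Sum>k\<in>freqs n. a' k*e k x) = (\<Sum>k\<in>freqs N. a k*e k x)" for x :: "real^'n"
  proof -
   have "freqs N \<subseteq> (freqs n :: ('n => nat) set)" using that by (rule freqs_mono)
   then show ?thesis unfolding a'_def by (intro sum.mono_neutral_cong_right finite_freqs) auto
  qed
  then have "nsq M (%x. f x - proj M e (freqs n) f x) <= nsq M (%x. f x - (\<Sum>k\<in>freqs N. a k*e k x))"
   using orthogonal_projection(3)[of M e f "freqs n" a', OF es e f finite_freqs] by simp
  then show ?thesis using N nsq_nonneg[of M "%x. f x - proj M e (freqs n) f x"] by simp
 qed
 then show "\<exists>N. \<forall>n\<ge>N. norm (nsq M (%x. f x - proj M e (freqs n) f x) - 0) < ep" by blast
qed

end

section \<open>Trigonometric bases adapted to the boundary conditions\<close>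

definition spn :: "(nat => real => real) => (real => real) => bool" where
 "spn b g \<longleftrightarrow> (\<exists>N a. \<forall>x. g x = (\<Sum>j\<le>N. a j*b j x))"

lemma spn_basis: "spn b (b j)" unfolding spn_def
 by (rule exI[of _ j], rule exI[of _ "%i. if i = j then 1 else 0"]) (simp add: if_distrib[of "%c. c*_"] cong: if_cong)

lemma spn_zero: "spn b (%x. 0)" unfolding spn_def by (rule exI[of _ 0], rule exI[of _ "%_. 0"]) simp

lemma spn_scale:
 assumes "spn b g"
 shows "spn b (%x. c*g x)"
proof -
 obtain N a where "!!x. g x = (\<Sum>j\<le>N. a j*b j x)" using assms unfolding spn_def by blast
 then show ?thesis unfolding spn_def by (intro exI[of _ N] exI[of _ "%j. c*a j"]) (simp add: sum_distrib_left mult.assoc)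
qed

lemma spn_add:
 assumes "spn b f" "spn b g"
 shows "spn b (%x. f x + g x)"
proof -
 obtain N a N' a' where f: "!!x. f x = (\<Sum>j\<le>N. a j*b j x)" and g: "!!x. g x = (\<Sum>j\<le>N'. a' j*b j x)"
  using assms unfolding spn_def by blast
 define K where "K = max N N'"
 have ext: "(\<Sum>j\<le>K. (if j <= n then c j else 0)*b j x) = (\<Sum>j\<le>n. c j*b j x)" if "n <= K" for n c x
  using that by (intro sum.mono_neutral_cong_right) auto
 have "f x + g x = (\<Sum>j\<le>K. ((if j <= N then a j else 0) + (if j <= N' then a' j else 0))*b j x)" for x
  unfolding distrib_right sum.distrib f g by (subst (1 2) ext) (auto simp: K_def)
 then show ?thesis unfolding spn_def
  by (intro exI[of _ K] exI[of _ "%j. (if j <= N then a j else 0) + (if j <= N' then a' j else 0)"]) simp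
qed

lemma spn_sum: "(!!i. i : I ==> spn b (f i)) ==> spn b (%x. \<Sum>i\<in>I. f i x)"
 by (induction I rule: infinite_finite_induct) (auto intro: spn_zero spn_add)

lemma spn_comp:
 assumes "spn b g" "!!j. spn b' (%x. b j (th x))"
 shows "spn b' (%x. g (th x))"
proof -
 obtain N a where "!!x. g x = (\<Sum>j\<le>N. a j*b j x)" using assms unfolding spn_def by blast
 then show ?thesis using assms(2) by (simp add: spn_sum spn_scale)
qed

abbreviation cos_fam :: "nat => real => real" where "cos_fam j th \<equiv> cos (real j*th)"
abbreviation sin_fam :: "nat => real => real" where "sin_fam j th \<equiv> sin ((real j + 1)*th)"

lemma spn_mult_cos:
 assumes "!!j. spn b (%th. b j th*cos th)" "spn b g"
 shows "spn b (%th. g th*cos th)"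
proof -
 obtain N a where "!!x. g x = (\<Sum>j\<le>N. a j*b j x)" using assms(2) unfolding spn_def by blast
 then have "(%th. g th*cos th) = (%th. \<Sum>j\<le>N. a j*(b j th*cos th))" by (simp add: sum_distrib_right mult.assoc)
 moreover have "spn b (%th. \<Sum>j\<le>N. a j*(b j th*cos th))" by (intro spn_sum spn_scale assms(1))
 ultimately show ?thesis by simp
qed

lemma spn_cos_step: "spn cos_fam (%th. cos_fam j th*cos th)"
proof (cases j)
 case 0
 then show ?thesis using spn_basis[of cos_fam 1] by simp
next
 case (Suc m)
 have "cos_fam j th*cos th = 1/2*cos_fam (Suc j) th + 1/2*cos_fam m th" for th
 proof -
  have "cos (real j*th + th) + cos (real j*th - th) = 2*(cos (real j*th)*cos th)" by (simp add: cos_add cos_diff)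
  moreover have "real (Suc j)*th = real j*th + th" "real m*th = real j*th - th" by (simp_all add: Suc algebra_simps)
  ultimately show ?thesis by simp
 qed
 then show ?thesis by (simp only:) (intro spn_add spn_scale spn_basis)
qed

lemma spn_sin_step: "spn sin_fam (%th. sin_fam j th*cos th)"
proof -
 have 1: "sin_fam j th*cos th = 1/2* sin_fam (Suc j) th + 1/2* sin (real j*th)" for th
 proof -
  have "sin ((real j + 1)*th + th) + sin ((real j + 1)*th - th) = 2*(sin ((real j + 1)*th)*cos th)" by (simp add: sin_add sin_diff)
  moreover have "(real (Suc j) + 1)*th = (real j + 1)*th + th" "real j*th = (real j + 1)*th - th" by (simp_all add: algebra_simps)
  ultimately show ?thesis by simp
 qed
 have 2: "spn sin_fam (%th. sin (real j*th))"
 proof (cases j)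
  case 0
  then show ?thesis using spn_zero by simp
 next
  case (Suc m)
  then show ?thesis using spn_basis[of sin_fam m] by (simp add: add.commute)
 qed
 show ?thesis unfolding 1 by (intro spn_add spn_scale spn_basis 2)
qed

lemma spn_cos_power: "spn cos_fam (%th. cos th ^ i)"
proof (induction i)
 case 0
 then show ?case using spn_basis[of cos_fam 0] by simp
next
 case (Suc i)
 from spn_mult_cos[OF spn_cos_step this] show ?case by (simp add: mult.commute)
qed

lemma spn_sin_cos_power: "spn sin_fam (%th. sin th*cos th ^ i)"
proof (induction i)
 case 0
 then show ?case using spn_basis[of sin_fam 0] by simp
next
 case (Suc i)
 from spn_mult_cos[OF spn_sin_step this] show ?case by (simp add: mult_ac)
qed

text \<open>Stone-Weierstrass in the variable \<open>cos th\<close>, which is injective on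
  \<open>{0..pi}\<close>.\<close>

lemma cos_polynomial_approx:
 fixes g :: "real => real"
 assumes g: "cont g" and ep: "ep > 0"
 shows "\<exists>N a. \<forall>th. 0 <= th & th <= pi --> \<bar>g th - (\<Sum>i\<le>N. a i*cos th ^ i)\<bar> <= ep"
proof -
 have "continuous_on {-1..1} (%s. g (arccos s))" by (intro cont_comp2[OF g] continuous_on_arccos') auto
 then obtain p where p: "real_polynomial_function p" "!!s. s : {-1..1} ==> \<bar>g (arccos s) - p s\<bar> < ep"
  using Stone_Weierstrass_real_polynomial_function[of "{-1..1::real}" "%s. g (arccos s)" ep] ep by auto
 obtain a N where a: "p = (%x. \<Sum>i\<le>N. a i*x ^ i)" using p(1) unfolding real_polynomial_function_iff_sum by blast
 have "\<bar>g th - (\<Sum>i\<le>N. a i*cos th ^ i)\<bar> <= ep" if "0 <= th" "th <= pi" for th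
  using p(2)[of "cos th"] that by (simp add: a arccos_cos)
 then show ?thesis by blast
qed

lemma cos_span_dense:
 fixes g :: "real => real"
 assumes g: "cont g" and ep: "ep > 0"
 shows "\<exists>G. spn cos_fam G & (\<forall>th. 0 <= th & th <= pi --> \<bar>g th - G th\<bar> <= ep)"
proof -
 obtain N a where a: "!!th. 0 <= th & th <= pi ==> \<bar>g th - (\<Sum>i\<le>N. a i*cos th ^ i)\<bar> <= ep"
  using cos_polynomial_approx[OF assms] by blast
 have "spn cos_fam (%th. \<Sum>i\<le>N. a i*cos th ^ i)" by (intro spn_sum spn_scale spn_cos_power)
 then show ?thesis using a by blast
qed

text \<open>\<open>g\<close> vanishes near 0 and \<open>pi\<close>, so \<open>g / sin\<close> is
  continuous and is approximated by polynomials in \<open>cos\<close>; multiplying back by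
  \<open>sin\<close> does not increase the error.\<close>

lemma sin_span_dense:
 fixes g :: "real => real"
 assumes g: "cont g" and ep: "ep > 0" and al: "al > 0" and z: "!!th. th <= al \<or> pi - al <= th ==> g th = 0"
 shows "\<exists>G. spn sin_fam G & (\<forall>th. 0 <= th & th <= pi --> \<bar>g th - G th\<bar> <= ep)"
proof -
 obtain c where c: "c > 0" "!!th. al <= th ==> th <= pi - al ==> c <= sin th"
 proof (cases "al <= pi - al")
  case True
  have "continuous_on {al..pi - al} sin" by (intro continuous_intros)
  then obtain th0 where t: "th0 : {al..pi - al}" "!!th. th : {al..pi - al} ==> sin th0 <= sin th"
   using continuous_attains_inf[of "{al..pi - al}" sin] True by auto
  have "sin th0 > 0" using t(1) al by (intro sin_gt_zero) auto
  then show ?thesis using that[of "sin th0"] t(2) by auto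
 next
  case False
  then show ?thesis using that[of 1] by auto
 qed
 \<comment> \<open>The maximum with \<open>c\<close> alters the denominator only where
   \<open>g\<close> is 0, and keeps it away from 0.\<close>
 define f where "f th = g th/max (sin th) c" for th
 have gf: "g th = sin th*f th" for th
 proof (cases "th <= al \<or> pi - al <= th")
  case True
  then show ?thesis using z unfolding f_def by simp
 next
  case False
  then have "c <= sin th" by (intro c(2)) auto
  then show ?thesis unfolding f_def using c(1) by (simp add: max_def)
 qed
 have "cont f" unfolding f_def[abs_def] using c(1) by (intro continuous_intros g) (auto simp: max_def)
 from cos_polynomial_approx[OF this ep] obtain N a
  where a: "!!th. 0 <= th & th <= pi ==> \<bar>f th - (\<Sum>i\<le>N. a i*cos th ^ i)\<bar> <= ep" by blast
 define G where "G th = (\<Sum>i\<le>N. a i*(sin th*cos th ^ i))" for th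
 have "\<bar>g th - G th\<bar> <= ep" if "0 <= th & th <= pi" for th
 proof -
  have "g th - G th = sin th*(f th - (\<Sum>i\<le>N. a i*cos th ^ i))" unfolding gf G_def by (simp add: right_diff_distrib sum_distrib_left mult_ac)
  then have "\<bar>g th - G th\<bar> = \<bar>sin th\<bar>*\<bar>f th - (\<Sum>i\<le>N. a i*cos th ^ i)\<bar>" by (simp add: abs_mult)
  also have "... <= 1*ep" using a[OF that] by (intro mult_mono) auto
  finally show ?thesis by simp
 qed
 moreover have "spn sin_fam G" unfolding G_def by (intro spn_sum spn_scale spn_sin_cos_power)
 ultimately show ?thesis by blast
qed

text \<open>Every basis function is written as a sine with a frequency and a phase, the phase
  \<open>pi/2\<close> giving a cosine, so that derivatives, bounds and orthogonality are treated
  uniformly. In the periodic case even indices are cosines and odd ones sines; the shift to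
  \<open>j + 1\<close> leaves out the zero sine.\<close>

fun bfreq :: "boundary_condition => real => nat => real" where "bfreq Dirichlet L j = (real j + 1)*pi/L"
| "bfreq Neumann L j = real j*pi/L"
| "bfreq Periodic L j = (if even j then real j else real j + 1)*pi/L"

fun bphase :: "boundary_condition => nat => real" where "bphase Dirichlet j = (real j + 1)*pi/2"
| "bphase Neumann j = (real j + 1)*pi/2"
| "bphase Periodic j = (if even j then pi/2 else 0)"

definition bf :: "boundary_condition => real => nat => real => real" where
 "bf bc L j x = sin (bfreq bc L j*x + bphase bc j)"

definition bf' :: "boundary_condition => real => nat => real => real" where
 "bf' bc L j x = bfreq bc L j*cos (bfreq bc L j*x + bphase bc j)"

lemma bf_DERIV: "(bf bc L j hrd bf' bc L j x) (at x)" "(bf' bc L j hrd - (bfreq bc L j)\<^sup>2*bf bc L j x) (at x)"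
 unfolding bf_def[abs_def] bf'_def[abs_def] by (auto intro!: derivative_eq_intros simp: power2_eq_square)

lemma bf_cont: "cont (bf bc L j)" unfolding bf_def[abs_def] by (intro continuous_intros)

lemma sin_cos_plus_int_period:
 fixes x :: real
 shows "sin (x + of_int n*(2*pi)) = sin x" "cos (x + of_int n*(2*pi)) = cos x"
 using sin_int_2pin[of n] cos_int_2pin[of n] by (simp_all add: sin_add cos_add mult_ac)

lemma sin_plus_half_pi: "sin (x + pi/2) = cos x" for x :: real by (simp add: sin_add)

lemma bf_Dirichlet: "L > 0 ==> bf Dirichlet L j x = sin_fam j (pi*(x/L + 1/2))" unfolding bf_def by (simp add: field_simps)

lemma bf_Neumann:
 assumes "L > 0"
 shows "bf Neumann L j x = cos_fam j (pi*(x/L + 1/2))"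
proof -
 have "bfreq Neumann L j*x + bphase Neumann j = real j*(pi*(x/L + 1/2)) + pi/2" using assms by (simp add: field_simps)
 then show ?thesis unfolding bf_def by (simp only: sin_plus_half_pi)
qed

lemma bf_Periodic:
 assumes "L > 0"
 shows "bf Periodic L (2*j) x = cos_fam j (2*pi*x/L)" "bf Periodic L (2*j + 1) x = sin_fam j (2*pi*x/L)"
proof -
 have "bfreq Periodic L (2*j)*x + bphase Periodic (2*j) = real j*(2*pi*x/L) + pi/2" using assms by (simp add: field_simps)
 then show "bf Periodic L (2*j) x = cos_fam j (2*pi*x/L)" unfolding bf_def by (simp only: sin_plus_half_pi)
 show "bf Periodic L (2*j + 1) x = sin_fam j (2*pi*x/L)" unfolding bf_def using assms by (simp add: field_simps)
qed

text \<open>The Dirichlet and Neumann families become sines and cosines on \<open>{0..pi}\<close>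
  through \<open>th = pi (x/L + 1/2)\<close>. In the periodic case \<open>h\<close> is split into
  its even and odd parts, which are approximated on half a period by cosines and sines.\<close>

lemma bf_trig_family:
 assumes L: "L > 0"
 shows "trig_family (bf bc L) L"
proof
 show "L > 0" by (rule L)
 show "cont (bf bc L j)" for j by (rule bf_cont)
 show "\<bar>bf bc L j x\<bar> <= 1" for j x unfolding bf_def by simp
 fix h :: "real => real" and eh ep :: real
 assume h: "cont h" and eh: "0 < eh" and ep: "0 < ep"
  and supp: "!!x. \<bar>x\<bar> <= eh \<or> L/2 - eh <= \<bar>x\<bar> ==> h x = 0"
 have "\<exists>G. spn (bf bc L) G & (\<forall>x. - L/2 < x & x < L/2 --> \<bar>h x - G x\<bar> <= ep)"
 proof (cases bc)
  case Dirichlet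
  define g where "g th = h (L*(th/pi - 1/2))" for th
  have gc: "cont g" unfolding g_def[abs_def] by (intro cont_comp2[OF h] continuous_intros) auto
  have gz: "g th = 0" if "th <= pi*eh/L \<or> pi - pi*eh/L <= th" for th
  proof -
   have "L*(th/pi - 1/2) <= - (L/2 - eh) \<or> L/2 - eh <= L*(th/pi - 1/2)" using that L by (auto simp: field_simps)
   then have "L/2 - eh <= \<bar>L*(th/pi - 1/2)\<bar>" by linarith
   then show ?thesis unfolding g_def by (intro supp) simp
  qed
  obtain G where G: "spn sin_fam G" "!!th. 0 <= th & th <= pi ==> \<bar>g th - G th\<bar> <= ep"
   using sin_span_dense[OF gc ep, of "pi*eh/L"] gz L eh by auto
  have "spn (bf bc L) (%x. G (pi*(x/L + 1/2)))" using spn_basis[of "bf Dirichlet L"] unfolding Dirichlet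
   by (intro spn_comp[OF G(1)]) (simp add: bf_Dirichlet[OF L, abs_def])
  moreover have "\<bar>h x - G (pi*(x/L + 1/2))\<bar> <= ep" if "- L/2 < x" "x < L/2" for x
  proof -
   have "0 <= x/L + 1/2" "x/L + 1/2 <= 1" using that L by (simp_all add: field_simps)
   then have "0 <= pi*(x/L + 1/2) & pi*(x/L + 1/2) <= pi" by simp
   moreover have "g (pi*(x/L + 1/2)) = h x" unfolding g_def using L by (simp add: field_simps)
   ultimately show ?thesis using G(2) by metis
  qed
  ultimately show ?thesis by blast
 next
  case Neumann
  define g where "g th = h (L*(th/pi - 1/2))" for th
  have gc: "cont g" unfolding g_def[abs_def] by (intro cont_comp2[OF h] continuous_intros) auto
  obtain G where G: "spn cos_fam G" "!!th. 0 <= th & th <= pi ==> \<bar>g th - G th\<bar> <= ep"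
   using cos_span_dense[OF gc ep] by auto
  have "spn (bf bc L) (%x. G (pi*(x/L + 1/2)))" using spn_basis[of "bf Neumann L"] unfolding Neumann
   by (intro spn_comp[OF G(1)]) (simp add: bf_Neumann[OF L, abs_def])
  moreover have "\<bar>h x - G (pi*(x/L + 1/2))\<bar> <= ep" if "- L/2 < x" "x < L/2" for x
  proof -
   have "0 <= x/L + 1/2" "x/L + 1/2 <= 1" using that L by (simp_all add: field_simps)
   then have "0 <= pi*(x/L + 1/2) & pi*(x/L + 1/2) <= pi" by simp
   moreover have "g (pi*(x/L + 1/2)) = h x" unfolding g_def using L by (simp add: field_simps)
   ultimately show ?thesis using G(2) by metis
  qed
  ultimately show ?thesis by blast
 next
  case Periodic
  define ge where "ge th = (h (L*th/(2*pi)) + h (- (L*th/(2*pi))))/2" for th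
  \<comment> \<open>The odd part extended by zero; this is continuous because \<open>h\<close>
    vanishes at 0 and at both ends of the interval.\<close>
  define go where "go th = (if th <= 0 \<or> pi <= th then 0 else (h (L*th/(2*pi)) - h (- (L*th/(2*pi))))/2)" for th
  have gec: "cont ge" unfolding ge_def[abs_def] by (intro continuous_intros cont_comp2[OF h]) auto
  have go2: "go = (%th. (h (L*max 0 (min pi th)/(2*pi)) - h (- (L*max 0 (min pi th)/(2*pi))))/2)"
   using supp[of 0] supp[of "L/2"] supp[of "- (L/2)"] L eh by (auto simp: fun_eq_iff go_def max_def min_def)
  have goc: "cont go" unfolding go2 by (intro continuous_intros cont_comp2[OF h]) auto
  have goz: "go th = 0" if "th <= 2*pi*eh/L \<or> pi - 2*pi*eh/L <= th" for th
  proof (cases "th <= 0 \<or> pi <= th")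
   case True
   then show ?thesis by (simp add: go_def)
  next
   case False
   have "L*th/(2*pi) <= eh \<or> L/2 - eh <= L*th/(2*pi)" using that L by (auto simp: field_simps)
   moreover have "0 < L*th/(2*pi)" using False L by simp
   ultimately have a: "\<bar>L*th/(2*pi)\<bar> <= eh \<or> L/2 - eh <= \<bar>L*th/(2*pi)\<bar>" by linarith
   then have "h (L*th/(2*pi)) = 0" "h (- (L*th/(2*pi))) = 0" by (auto intro!: supp)
   then show ?thesis by (simp add: go_def)
  qed
  obtain G where G: "spn cos_fam G" "!!th. 0 <= th & th <= pi ==> \<bar>ge th - G th\<bar> <= ep/2"
   using cos_span_dense[OF gec, of "ep/2"] ep by auto
  obtain G' where G': "spn sin_fam G'" "!!th. 0 <= th & th <= pi ==> \<bar>go th - G' th\<bar> <= ep/2"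
   using sin_span_dense[OF goc, of "ep/2" "2*pi*eh/L"] goz L eh ep by auto
  have even: "G (- th) = G th" for th using G(1) unfolding spn_def by auto
  have odd: "G' (- th) = - G' th" for th using G'(1) unfolding spn_def by (auto simp: sum_negf)
  have s1: "spn (bf bc L) (%x. G (2*pi*x/L))"
  proof (rule spn_comp[OF G(1)])
   show "spn (bf bc L) (%x. cos_fam j (2*pi*x/L))" for j
    using spn_basis[of "bf bc L" "2*j"] unfolding Periodic by (simp only: bf_Periodic(1)[OF L, abs_def])
  qed
  have s2: "spn (bf bc L) (%x. G' (2*pi*x/L))"
  proof (rule spn_comp[OF G'(1)])
   show "spn (bf bc L) (%x. sin_fam j (2*pi*x/L))" for j
    using spn_basis[of "bf bc L" "2*j + 1"] unfolding Periodic by (simp only: bf_Periodic(2)[OF L, abs_def])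
  qed
  have "\<bar>h x - (G (2*pi*x/L) + G' (2*pi*x/L))\<bar> <= ep" if x: "- L/2 < x" "x < L/2" for x
  proof -
   define th where "th = 2*pi*x/L"
   have xt: "L*th/(2*pi) = x" using L by (simp add: th_def)
   have "- 1 < 2*x/L" "2*x/L < 1" using x L by (auto simp: field_simps)
   then have "pi*(- 1) < pi*(2*x/L)" "pi*(2*x/L) < pi*1" by (intro mult_strict_left_mono; simp)+
   then have t: "- pi < th" "th < pi" unfolding th_def by (simp_all add: mult_ac)
   show ?thesis
   proof (cases "0 <= th")
    case True
    have "ge th + go th = h x" using True t supp[of 0] eh xt unfolding ge_def go_def by (cases "th = 0") (auto simp: field_simps)
    moreover have "\<bar>ge th - G th\<bar> <= ep/2" "\<bar>go th - G' th\<bar> <= ep/2" using G(2)[of th] G'(2)[of th] True t by auto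
    ultimately show ?thesis unfolding th_def[symmetric] by linarith
   next
    case False
    have "L*(- th)/(2*pi) = - x" using xt by simp
    then have "ge (- th) - go (- th) = h x" using False t unfolding ge_def go_def by (simp add: field_simps)
    moreover have "\<bar>ge (- th) - G (- th)\<bar> <= ep/2" "\<bar>go (- th) - G' (- th)\<bar> <= ep/2"
     using G(2)[of "- th"] G'(2)[of "- th"] False t by auto
    ultimately show ?thesis unfolding th_def[symmetric] even odd by linarith
   qed
  qed
  then show ?thesis using spn_add[OF s1 s2] by blast
 qed
 then show "\<exists>N a. \<forall>x. - L/2 < x & x < L/2 --> \<bar>h x - (\<Sum>j\<le>N. a j*bf bc L j x)\<bar> <= ep"
  unfolding spn_def by metis
qed

subsection \<open>Orthogonality and reflection symmetry\<close>

lemma bfreq_L: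
 assumes "L > 0"
 shows "\<exists>n::nat. bfreq bc L j*L = real n*pi" by (cases bc) (use assms in \<open>auto intro: exI[of _ "Suc j"] exI[of _ j]\<close>)

text \<open>A frequency is repeated only by a sine and a cosine of the periodic family, and these
  pairs need a separate argument for orthogonality.\<close>

lemma bf_inj:
 assumes "L > 0" "j ~= k"
 shows "bfreq bc L j ~= bfreq bc L k \<or> (bc = Periodic & bfreq bc L j = bfreq bc L k & bfreq bc L j ~= 0 &
   {bphase bc j, bphase bc k} = {0, pi/2})"
proof (cases bc)
 case Periodic
 show ?thesis
 proof (cases "even j = even k")
  case True
  then show ?thesis using assms Periodic by auto
 next
  case False
  show ?thesis
  proof (cases "bfreq bc L j = bfreq bc L k")
   case eq: True
   have "bfreq bc L j ~= 0" using False eq assms Periodic by (auto split: if_splits)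
   then show ?thesis using eq False Periodic by auto
  qed simp
 qed
qed (use assms in auto)

lemma bf_ends:
 assumes L: "L > 0"
 shows "bf' bc L j (L/2)*bf bc L k (L/2) = bf' bc L j (- (L/2))*bf bc L k (- (L/2))"
proof (cases bc)
 case Dirichlet
 have "bf Dirichlet L k (L/2) = 0" "bf Dirichlet L k (- (L/2)) = 0" using L sin_npi[of "Suc k"] by (simp_all add: bf_Dirichlet add.commute)
 then show ?thesis by (simp add: Dirichlet)
next
 case Neumann
 have "bfreq Neumann L j*(L/2) + bphase Neumann j = real j*pi + pi/2" "bfreq Neumann L j*(- (L/2)) + bphase Neumann j = pi/2"
  using L by (simp_all add: field_simps)
 note p = this
 have "bf' Neumann L j (L/2) = 0" "bf' Neumann L j (- (L/2)) = 0" unfolding bf'_def p by (simp_all add: cos_add)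
 then show ?thesis by (simp add: Neumann)
next
 case Periodic
 have p: "\<exists>m::int. bfreq Periodic L i*(L/2) + bphase Periodic i = (bfreq Periodic L i*(- (L/2)) + bphase Periodic i) + of_int m*(2*pi)" for i
 proof -
  obtain m where m: "(if even i then real i else real i + 1) = 2*real m"
  proof (cases "even i")
   case True
   then show ?thesis using that by (auto elim!: evenE)
  next
   case False
   then obtain q where "i = 2*q + 1" by (rule oddE)
   then show ?thesis using that[of "q + 1"] False by auto
  qed
  have "bfreq Periodic L i*L = real m*(2*pi)" using L unfolding bfreq.simps m by simp
  moreover have "a*(L/2) + c = a*(- (L/2)) + c + a*L" for a c :: real by (simp add: algebra_simps)
  ultimately show ?thesis by (intro exI[of _ "int m"]) (simp del: bfreq.simps bphase.simps)
 qed
 have "bf Periodic L i (L/2) = bf Periodic L i (- (L/2))" "bf' Periodic L i (L/2) = bf' Periodic L i (- (L/2))" for i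
 proof -
  obtain m where m: "bfreq Periodic L i*(L/2) + bphase Periodic i = (bfreq Periodic L i*(- (L/2)) + bphase Periodic i) + of_int m*(2*pi)"
   using p by blast
  show "bf Periodic L i (L/2) = bf Periodic L i (- (L/2))" "bf' Periodic L i (L/2) = bf' Periodic L i (- (L/2))"
   unfolding bf_def bf'_def m sin_cos_plus_int_period sin_cos_plus_int_period by simp_all
 qed
 then show ?thesis by (simp add: Periodic)
qed

text \<open>For different frequencies the integrand is the derivative of the Wronskian divided by
  the difference of the squared frequencies, and by \<open>bf_ends\<close> the end values cancel
  under each boundary condition. For equal frequencies it is sine times cosine, whose antiderivative
  is even.\<close>

lemma bf_orthogonal:
 assumes L: "L > 0" and jk: "j ~= k"
 shows "(LBINT x. (bf bc L j x*bf bc L k x)*ind {- (L/2)..L/2} x) = 0"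
proof (cases "bfreq bc L j = bfreq bc L k")
 case False
 define \<Delta> where "\<Delta> = (bfreq bc L k)^2 - (bfreq bc L j)^2"
 have nn: "bfreq bc L i >= 0" for i by (cases bc) (use L in auto)
 have \<Delta>: "\<Delta> ~= 0"
 proof
  assume "\<Delta> = 0"
  then have "bfreq bc L k = bfreq bc L j" using nn by (simp add: \<Delta>_def power2_eq_iff_nonneg)
  then show False using False by simp
 qed
 define W where "W x = (bf' bc L j x*bf bc L k x - bf' bc L k x*bf bc L j x)/\<Delta>" for x
 have "(LBINT x. (bf bc L j x*bf bc L k x)*ind {- (L/2)..L/2} x) = W (L/2) - W (- (L/2))"
 proof (rule integral_FTC_Icc_real)
  show "- (L/2) <= L/2" using L by simp
  show "(W hrd bf bc L j x*bf bc L k x) (at x)" for x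
  proof -
   have "(W hrd ((- (bfreq bc L j)\<^sup>2*bf bc L j x)*bf bc L k x + bf' bc L k x*bf' bc L j x
     - ((- (bfreq bc L k)\<^sup>2*bf bc L k x)*bf bc L j x + bf' bc L j x*bf' bc L k x))/\<Delta>) (at x)"
    unfolding W_def by (intro DERIV_cdivide DERIV_diff DERIV_mult bf_DERIV)
   moreover have "((- (bfreq bc L j)\<^sup>2*bf bc L j x)*bf bc L k x + bf' bc L k x*bf' bc L j x
     - ((- (bfreq bc L k)\<^sup>2*bf bc L k x)*bf bc L j x + bf' bc L j x*bf' bc L k x)) = \<Delta>*(bf bc L j x*bf bc L k x)"
    unfolding \<Delta>_def by (simp add: algebra_simps)
   ultimately show ?thesis using \<Delta> by simp
  qed
  have "cont (%x. bf bc L j x*bf bc L k x)" by (intro continuous_intros bf_cont)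
  then show "isCont (%x. bf bc L j x*bf bc L k x) x" for x by (simp add: continuous_on_eq_continuous_at)
 qed
 also have "... = 0" unfolding W_def bf_ends[OF L] by simp
 finally show ?thesis .
next
 case True
 define om where "om = bfreq bc L j"
 have w: "om ~= 0" "{bphase bc j, bphase bc k} = {0, pi/2}" "bfreq bc L k = om" using bf_inj[OF L jk, of bc] True unfolding om_def by metis+
 have e: "bf bc L j x*bf bc L k x = sin (om*x)*cos (om*x)" for x
 proof -
  have "bphase bc j = 0 & bphase bc k = pi/2 \<or> bphase bc j = pi/2 & bphase bc k = 0" using w(2) by (auto simp: doubleton_eq_iff)
  then show ?thesis unfolding bf_def w(3) om_def[symmetric]
  proof
   assume "bphase bc j = 0 & bphase bc k = pi/2"
   then have p: "bphase bc j = 0" "bphase bc k = pi/2" by simp_all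
   show "sin (om*x + bphase bc j)* sin (om*x + bphase bc k) = sin (om*x)*cos (om*x)" unfolding p sin_plus_half_pi by simp
  next
   assume "bphase bc j = pi/2 & bphase bc k = 0"
   then have p: "bphase bc j = pi/2" "bphase bc k = 0" by simp_all
   show "sin (om*x + bphase bc j)* sin (om*x + bphase bc k) = sin (om*x)*cos (om*x)" unfolding p sin_plus_half_pi by simp
  qed
 qed
 have "(LBINT x. (sin (om*x)*cos (om*x))*ind {- (L/2)..L/2} x)
   = (sin (om*(L/2)))^2/(2* om) - (sin (om*(- (L/2))))^2/(2* om)" by (rule integral_FTC_Icc_real)
    (use L w in \<open>auto intro!: derivative_eq_intros continuous_intros simp: power2_eq_square\<close>)
 then show ?thesis unfolding e by simp
qed

lemma bf_norm_pos:
 assumes L: "L > 0"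
 shows "(LBINT x. (bf bc L j x*bf bc L j x)*ind {- (L/2)..L/2} x) > 0"
proof (cases "bfreq bc L j = 0")
 case True
 have "j = 0" using True L by (cases bc) (auto split: if_splits)
 then have p: "bphase bc j = pi/2" using True L by (cases bc) auto
 have "bf bc L j x = 1" for x unfolding bf_def True p by simp
 then show ?thesis using L by simp
next
 case False
 define om where "om = bfreq bc L j"
 define p where "p = bphase bc j"
 have "(LBINT x. (bf bc L j x*bf bc L j x)*ind {- (L/2)..L/2} x)
   = (L/2/2 - sin (2*(om*(L/2) + p))/(4* om)) - (- (L/2)/2 - sin (2*(om*(- (L/2)) + p))/(4* om))"
 proof (rule integral_FTC_Icc_real)
  show "- (L/2) <= L/2" using L by simp
  show "((%x. x/2 - sin (2*(om*x + p))/(4* om)) hrd bf bc L j x*bf bc L j x) (at x)" for x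
  proof -
   have "((%x. x/2 - sin (2*(om*x + p))/(4* om)) hrd 1/2 - cos (2*(om*x + p))/2) (at x)"
    using False unfolding om_def[symmetric] by (auto intro!: derivative_eq_intros)
   moreover have "1/2 - cos (2*(om*x + p))/2 = bf bc L j x*bf bc L j x"
    unfolding bf_def om_def[symmetric] p_def[symmetric] cos_double_sin by (simp add: power2_eq_square diff_divide_distrib)
   ultimately show ?thesis by simp
  qed
  have "cont (%x. bf bc L j x*bf bc L j x)" by (intro continuous_intros bf_cont)
  then show "isCont (%x. bf bc L j x*bf bc L j x) x" for x by (simp add: continuous_on_eq_continuous_at)
 qed
 moreover have "sin (2*(om*(L/2) + p)) = sin (2*(om*(- (L/2)) + p))"
 proof -
  obtain n where n: "om*L = real n*pi" using bfreq_L[OF L] unfolding om_def by blast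
  have "2*(om*(L/2) + p) = 2*(om*(- (L/2)) + p) + of_int (int n)*(2*pi)" using n by (simp add: algebra_simps)
  then show ?thesis by (simp only: sin_cos_plus_int_period)
 qed
 ultimately show ?thesis using L by simp
qed

text \<open>The orientation in which the base interval is copied to position \<open>m\<close>: odd
  copies are reflected unless the condition is periodic. \<open>val_sign\<close> is the sign that
  the function picks up, odd reflection for Dirichlet and even reflection for Neumann.\<close>

fun refl_sign :: "boundary_condition => int => real" where "refl_sign Periodic m = 1"
| "refl_sign bc m = (if even m then 1 else - 1)"

fun val_sign :: "boundary_condition => int => real" where "val_sign Dirichlet m = (if even m then 1 else - 1)"
| "val_sign bc m = 1"

lemma bf_reflect:
 assumes L: "L > 0"
 shows "bf bc L j (of_int m*L + refl_sign bc m*x) = val_sign bc m*bf bc L j x"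
proof -
 have Ln: "L ~= 0" using L by simp
 show ?thesis
 proof (cases bc)
  case Dirichlet
  define th where "th = (real j + 1)*(pi*(x/L + 1/2))"
  have b: "bf bc L j x = sin th" unfolding Dirichlet bf_Dirichlet[OF L] th_def ..
  show ?thesis
  proof (cases "even m")
   case True
   then obtain q where q: "m = 2*q" by (rule evenE)
   have eq: "(real j + 1)*(pi*((of_int m*L + x)/L + 1/2)) = th + of_int ((int j + 1)*q)*(2*pi)"
    using Ln by (simp add: th_def q field_simps)
   have "bf bc L j (of_int m*L + x) = sin th" unfolding Dirichlet bf_Dirichlet[OF L] eq by (simp only: sin_cos_plus_int_period)
   then show ?thesis using True b Dirichlet by simp
  next
   case False
   then obtain q where q: "m = 2*q + 1" by (rule oddE)
   have eq: "(real j + 1)*(pi*((of_int m*L - x)/L + 1/2)) = - th + of_int ((int j + 1)*(q + 1))*(2*pi)"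
    using Ln by (simp add: th_def q field_simps)
   have "bf bc L j (of_int m*L - x) = sin (- th)" unfolding Dirichlet bf_Dirichlet[OF L] eq by (simp only: sin_cos_plus_int_period)
   then show ?thesis using False b Dirichlet by simp
  qed
 next
  case Neumann
  define th where "th = real j*(pi*(x/L + 1/2))"
  have b: "bf bc L j x = cos th" unfolding Neumann bf_Neumann[OF L] th_def ..
  show ?thesis
  proof (cases "even m")
   case True
   then obtain q where q: "m = 2*q" by (rule evenE)
   have eq: "real j*(pi*((of_int m*L + x)/L + 1/2)) = th + of_int (int j*q)*(2*pi)" using Ln by (simp add: th_def q field_simps)
   have "bf bc L j (of_int m*L + x) = cos th" unfolding Neumann bf_Neumann[OF L] eq by (simp only: sin_cos_plus_int_period)
   then show ?thesis using True b Neumann by simp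
  next
   case False
   then obtain q where q: "m = 2*q + 1" by (rule oddE)
   have eq: "real j*(pi*((of_int m*L - x)/L + 1/2)) = - th + of_int (int j*(q + 1))*(2*pi)" using Ln by (simp add: th_def q field_simps)
   have "bf bc L j (of_int m*L - x) = cos (- th)" unfolding Neumann bf_Neumann[OF L] eq by (simp only: sin_cos_plus_int_period)
   then show ?thesis using False b Neumann by simp
  qed
 next
  case Periodic
  obtain q :: int where q: "(if even j then real j else real j + 1) = 2* of_int q"
  proof (cases "even j")
   case True
   then show ?thesis using that[of "int (j div 2)"] by auto
  next
   case False
   then have "2*((j + 1) div 2) = j + 1" by simp
   then have "2*real ((j + 1) div 2) = real j + 1" by (metis of_nat_1 of_nat_add of_nat_mult of_nat_numeral)
   then show ?thesis using that[of "int ((j + 1) div 2)"] False by simp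
  qed
  have eq: "bfreq Periodic L j*(of_int m*L + x) + bphase Periodic j = (bfreq Periodic L j*x + bphase Periodic j) + of_int (q*m)*(2*pi)"
   unfolding bfreq.simps q using Ln by (simp add: field_simps)
  have "bf bc L j (of_int m*L + x) = bf bc L j x" unfolding Periodic bf_def eq by (simp only: sin_cos_plus_int_period)
  then show ?thesis unfolding Periodic by simp
 qed
qed

lemma refl_sign_abs: "\<bar>refl_sign bc m\<bar> = 1" "\<bar>val_sign bc m\<bar> = 1" by (cases bc; simp)+

section \<open>Integrals of product functions over the cube\<close>

lemma integral_product_lborel:
 fixes f :: "'n::finite => real => real"
 assumes "!!i. integrable lborel (f i)"
 shows "(LBINT x. (\<Prod>i\<in>UNIV. f i ((x :: real^'n) $ i))) = (\<Prod>i\<in>UNIV. LBINT s. f i s)"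
proof -
 interpret product_sigma_finite "%_::real^'n. lborel :: real measure" ..
 define g :: "real^'n => real => real" where "g b = f (THE i. b = axis i 1)" for b
 have ga: "g (axis i 1) = f i" for i unfolding g_def by (simp add: axis_eq_axis)
 have B: "(Basis :: (real^'n) set) = (%i. axis i 1) ` UNIV" unfolding Basis_vec_def by auto
 have inj: "inj (%i::'n. axis i (1::real))" by (auto simp: inj_on_def axis_eq_axis)
 have gi: "integrable lborel (g b)" if "b : Basis" for b using that assms unfolding B by (auto simp: ga)
 have fm: "f i : bmeas borel" for i using borel_measurable_integrable[OF assms[of i]] by simp
 have R: "(\<Prod>b\<in>(Basis :: (real^'n) set). h b) = (\<Prod>i\<in>UNIV. h (axis i 1))" for h :: "real^'n => real"
  unfolding B using inj by (subst prod.reindex) auto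
 have "(LBINT x. (\<Prod>i\<in>UNIV. f i ((x :: real^'n) $ i)))
   = (LINT x|distr (\<Pi>\<^sub>M b\<in>Basis. lborel) borel (%f. \<Sum>b\<in>Basis. f b *: b). (\<Prod>i\<in>UNIV. f i ((x :: real^'n) $ i)))"
  by (simp only: lborel_eq[symmetric])
 also have "... = (LINT x|(\<Pi>\<^sub>M b\<in>(Basis :: (real^'n) set). lborel). (\<Prod>i\<in>UNIV. f i ((\<Sum>b\<in>Basis. x b *: b) $ i)))"
 proof (rule integral_distr)
  show "(%f. \<Sum>b\<in>(Basis :: (real^'n) set). f b *: b) : (\<Pi>\<^sub>M b\<in>Basis. lborel) \<rightarrow>\<^sub>M borel" by measurable
  have "(%x :: real^'n. f i (x $ i)) : bmeas borel" for i
   by (intro measurable_compose[OF _ fm] bmeas_contI continuous_intros)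
  then show "(%x. \<Prod>i\<in>UNIV. f i ((x :: real^'n) $ i)) : bmeas borel" by measurable
 qed
 also have "... = (LINT x|(\<Pi>\<^sub>M b\<in>(Basis :: (real^'n) set). lborel). (\<Prod>b\<in>Basis. g b (x b)))"
 proof (rule Lint_cong[OF refl])
  fix x :: "real^'n => real"
  have "(\<Sum>b\<in>Basis. x b *: b) $ i = x (axis i 1)" for i
  proof -
   have "(\<Sum>b\<in>Basis. x b *: b) $ i = (\<Sum>b\<in>Basis. x b *: b) <.> axis i 1" by (simp add: inner_axis)
   also have "... = x (axis i 1)" by (rule inner_sum_left_Basis) (simp add: B)
   finally show ?thesis .
  qed
  then show "(\<Prod>i\<in>UNIV. f i ((\<Sum>b\<in>Basis. x b *: b) $ i)) = (\<Prod>b\<in>Basis. g b (x b))" unfolding R ga by simp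
 qed
 also have "... = (\<Prod>b\<in>(Basis :: (real^'n) set). LBINT s. g b s)" using gi by (intro product_integral_prod) auto
 also have "... = (\<Prod>i\<in>UNIV. LBINT s. f i s)" unfolding R ga ..
 finally show ?thesis .
qed

lemma LINT_cube_lborel:
 fixes f :: "real^'n::finite => real"
 assumes "f : bmeas borel"
 shows "(LINT x|cm L. f x) = (LBINT x. ind (cube L) x*f x)"
proof -
 have "(LINT x|cm L. f x) = (LINT x|lebesgue. ind (cube L) x *: f x)" by (rule integral_restrict_space) simp
 also have "... = (LBINT x. ind (cube L) x*f x)" using assms by (subst integral_completion) auto
 finally show ?thesis .
qed

lemma prodf_ipr:
 fixes f g :: "'n::finite => real => real"
 assumes "!!i. cont (f i)" "!!i. cont (g i)"
 shows "ipr (cm L) (prodf f) (prodf g) = (\<Prod>i\<in>UNIV. LBINT s. (f i s*g i s)*ind {- (L/2)..L/2} s)"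
proof -
 have pc: "cont (prodf f)" "cont (prodf g)" unfolding prodf_def[abs_def]
  by (intro continuous_intros cont_comp2[OF assms(1)] cont_comp2[OF assms(2)]; auto)+
 have m: "(%x. prodf f x*prodf g x) : bmeas borel" by (intro bmeas_contI continuous_intros pc)
 define C :: "(real^'n) set" where "C = cbox (\<chi> i. - L/2) (\<chi> i. L/2)"
 have "ipr (cm L) (prodf f) (prodf g) = (LBINT x. ind (cube L) x*(prodf f x*prodf g x))"
  unfolding ipr_def by (rule LINT_cube_lborel[OF m])
 also have "... = (LBINT x. ind C x*(prodf f x*prodf g x))"
 proof (rule integral_cong_AE)
  show "(%x. ind (cube L) x*(prodf f x*prodf g x)) : bmeas lborel"
   "(%x. ind C x*(prodf f x*prodf g x)) : bmeas lborel" using m by (auto simp: C_def)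
  show "AE x in lborel. ind (cube L) x*(prodf f x*prodf g x) = ind C x*(prodf f x*prodf g x)"
   using AE_cbox_box[of "\<chi> i. - L/2" "\<chi> i. L/2 :: real^'n"] unfolding C_def cube_eq_box by eventually_elim (simp add: indicator_def)
 qed
 also have "... = (LBINT x. (\<Prod>i\<in>UNIV. (f i (x $ i)*g i (x $ i))*ind {- (L/2)..L/2} (x $ i)))"
 proof (rule Lint_cong[OF refl])
  fix x :: "real^'n"
  have "ind C x = (\<Prod>i\<in>(UNIV::'n set). ind {- (L/2)..L/2} (x $ i) :: real)"
  proof (cases "x : C")
   case True
   then show ?thesis unfolding C_def by (simp add: mem_box_cart)
  next
   case False
   then obtain i where "\<not> (- L/2 <= x $ i & x $ i <= L/2)" unfolding C_def by (auto simp: mem_box_cart)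
   then have "ind {- (L/2)..L/2} (x $ i) = (0 :: real)" by auto
   then have "(\<Prod>i\<in>(UNIV::'n set). ind {- (L/2)..L/2} (x $ i) :: real) = 0" by (intro prod_zero) auto
   then show ?thesis using False by simp
  qed
  then show "ind C x*(prodf f x*prodf g x) = (\<Prod>i\<in>UNIV. (f i (x $ i)*g i (x $ i))*ind {- (L/2)..L/2} (x $ i))"
   unfolding prodf_def prod.distrib by (simp add: mult.commute)
 qed
 also have "... = (\<Prod>i\<in>UNIV. LBINT s. (f i s*g i s)*ind {- (L/2)..L/2} s)"
 proof (rule integral_product_lborel)
  fix i
  have "integrable lborel (%s. ind {- (L/2)..L/2} s*(f i s*g i s))" by (intro integrable_compact_cont continuous_intros assms) auto
  then show "integrable lborel (%s. (f i s*g i s)*ind {- (L/2)..L/2} s)" by (simp add: mult.commute)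
 qed
 finally show ?thesis .
qed

lemma bf_prod_orthogonal:
 fixes k l :: "'n::finite => nat"
 assumes L: "L > 0"
 defines "M \<equiv> lebesgue_on (cube L :: (real^'n) set)"
 shows "k ~= l ==> ipr M (prodf (%i. bf bc L (k i))) (prodf (%i. bf bc L (l i))) = 0"
  and "nsq M (prodf (%i. bf bc L (k i))) > 0"
proof -
 assume "k ~= l"
 then obtain i where "k i ~= l i" by blast
 then show "ipr M (prodf (%i. bf bc L (k i))) (prodf (%i. bf bc L (l i))) = 0"
  unfolding M_def prodf_ipr[OF bf_cont bf_cont] using bf_orthogonal[OF L] by (intro prod_zero) auto
next
 have "nsq M (prodf (%i. bf bc L (k i))) = ipr M (prodf (%i. bf bc L (k i))) (prodf (%i. bf bc L (k i)))"
  by (simp add: nsq_def ipr_def power2_eq_square)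
 also have "... > 0" unfolding M_def prodf_ipr[OF bf_cont bf_cont] using bf_norm_pos[OF L] by (intro prod_pos) auto
 finally show "nsq M (prodf (%i. bf bc L (k i))) > 0" .
qed

section \<open>Smooth product functions\<close>

text \<open>The counterpart of \<open>C_k\<close> in one variable: smoothness of product functions
  is obtained factor by factor.\<close>

primrec Ck1 :: "nat => (real => real) => bool" where "Ck1 0 f = cont f"
| "Ck1 (Suc k) f = ((\<forall>x. (f hrd deriv f x) (at x)) & Ck1 k (deriv f))"

lemma Ck1_SucI: "(!!x. (f hrd f' x) (at x)) ==> Ck1 k f' ==> Ck1 (Suc k) f"
proof -
 assume f: "!!x. (f hrd f' x) (at x)" and "Ck1 k f'"
 moreover have "deriv f = f'" using f by (intro ext DERIV_imp_deriv)
 ultimately show ?thesis by simp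
qed

lemma Ck1_cont: "Ck1 k f ==> cont f" by (cases k) (auto intro: DERIV_continuous_on)

lemma Ck1_Suc_imp: "Ck1 (Suc k) f ==> Ck1 k f" by (induction k arbitrary: f) (auto intro: DERIV_continuous_on)

lemma Ck1_const: "Ck1 k (%_. c)"
proof (induction k arbitrary: c)
 case (Suc k)
 show ?case by (rule Ck1_SucI[of _ "%_. 0"]) (auto intro: Suc)
qed simp

lemma Ck1_add: "Ck1 k f ==> Ck1 k g ==> Ck1 k (%x. f x + g x)"
proof (induction k arbitrary: f g)
 case (Suc k)
 show ?case
 proof (rule Ck1_SucI)
  show "((%x. f x + g x) hrd deriv f x + deriv g x) (at x)" for x using Suc.prems by (intro DERIV_add) auto
  show "Ck1 k (%x. deriv f x + deriv g x)" using Suc by simp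
 qed
qed (auto intro: continuous_intros)

lemma Ck1_mult: "Ck1 k f ==> Ck1 k g ==> Ck1 k (%x. f x*g x)"
proof (induction k arbitrary: f g)
 case (Suc k)
 show ?case
 proof (rule Ck1_SucI)
  show "((%x. f x*g x) hrd deriv f x*g x + deriv g x*f x) (at x)" for x using Suc.prems by (intro DERIV_mult) auto
  show "Ck1 k (%x. deriv f x*g x + deriv g x*f x)" using Suc.prems Ck1_Suc_imp[of k f] Ck1_Suc_imp[of k g] by (intro Ck1_add Suc.IH) auto
 qed
qed (auto intro: continuous_intros)

lemma Ck1_inverse: "Ck1 k f ==> (!!x. f x ~= 0) ==> Ck1 k (%x. inverse (f x))"
proof (induction k)
 case (Suc k)
 show ?case
 proof (rule Ck1_SucI)
  show "((%x. inverse (f x)) hrd (- 1)*(inverse (f x)*(deriv f x*inverse (f x)))) (at x)" for x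
   using DERIV_inverse'[of f "deriv f x" x UNIV] Suc.prems by (simp add: mult.assoc)
  show "Ck1 k (%x. (- 1)*(inverse (f x)*(deriv f x*inverse (f x))))"
   using Suc.prems Ck1_Suc_imp[of k f] Suc.IH by (intro Ck1_mult Ck1_const) auto
 qed
qed (auto intro: continuous_intros)

lemma Ck1_affine: "Ck1 k f ==> Ck1 k (%x. f (a*x + b))"
proof (induction k arbitrary: f)
 case 0
 then show ?case by (auto intro!: continuous_intros cont_comp2[of UNIV f])
next
 case (Suc k)
 show ?case
 proof (rule Ck1_SucI)
  show "((%x. f (a*x + b)) hrd deriv f (a*x + b)*a) (at x)" for x
  proof -
   have "(f hrd deriv f (a*x + b)) (at (a*x + b))" using Suc.prems by simp
   moreover have "((%x. a*x + b) hrd a) (at x)" by (auto intro!: derivative_eq_intros)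
   ultimately show ?thesis by (rule DERIV_chain2)
  qed
  show "Ck1 k (%x. deriv f (a*x + b)*a)" using Suc by (intro Ck1_mult Ck1_const) auto
 qed
qed

definition sm1 :: "(real => real) => bool" where "sm1 f \<longleftrightarrow> (\<forall>k. Ck1 k f)"

lemma sm1_const: "sm1 (%_. c)" and sm1_add: "sm1 f ==> sm1 g ==> sm1 (%x. f x + g x)"
 and sm1_mult: "sm1 f ==> sm1 g ==> sm1 (%x. f x*g x)"
 and sm1_inverse: "sm1 f ==> (!!x. f x ~= 0) ==> sm1 (%x. inverse (f x))"
 and sm1_affine: "sm1 f ==> sm1 (%x. f (a*x + b))"
 unfolding sm1_def using Ck1_const Ck1_add Ck1_mult Ck1_inverse Ck1_affine by blast+

lemma sm1_deriv: "sm1 f ==> sm1 (deriv f)" "sm1 f ==> (f hrd deriv f x) (at x)"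
 "sm1 f ==> cont f"
proof -
 assume f: "sm1 f"
 have *: "Ck1 (Suc k) f" for k using f unfolding sm1_def by blast
 show "sm1 (deriv f)" unfolding sm1_def using * by simp
 show "(f hrd deriv f x) (at x)" using *[of 0] by simp
 show "cont f" using *[of 0] by (rule Ck1_cont)
qed

lemma sm1_sin: "sm1 (%x. c* sin (om*x + p))"
proof -
 have "Ck1 k (%x. c* sin (om*x + p))" for k
 proof (induction k arbitrary: c p)
  case (Suc k)
  show ?case
  proof (rule Ck1_SucI)
   show "((%x. c* sin (om*x + p)) hrd (c* om)* sin (om*x + (p + pi/2))) (at x)" for x
    by (auto intro!: derivative_eq_intros simp: sin_plus_half_pi[symmetric] add.assoc)
  qed (rule Suc)
 qed (auto intro!: continuous_intros)
 then show ?thesis unfolding sm1_def by blast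
qed

section \<open>Flat functions and smooth cutoffs in one variable\<close>

definition flat_exp :: "real poly => real => real" where
 "flat_exp p x = (if x <= 0 then 0 else poly p (inverse x)*exp (- inverse x))"

lemma poly_exp_decay: "((%y. poly p y*exp (- y)) \<longlongrightarrow> 0) at_top" for p :: "real poly"
proof -
 have "((%y. \<Sum>i\<le>degree p. coeff p i*(y ^ i/exp y)) \<longlongrightarrow> (\<Sum>i\<le>degree p. coeff p i*0)) at_top"
  by (intro tendsto_sum tendsto_mult_left tendsto_power_div_exp_0)
 then show ?thesis by (simp add: poly_altdef exp_minus sum_distrib_right divide_inverse mult.assoc)
qed

text \<open>In terms of \<open>y = 1/x\<close> the derivative is
  \<open>y^2 (p - p')(y) exp (- y)\<close>, and \<open>[:0, 0, 1:]\<close> is \<open>y^2\<close>; so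
  the class is closed under differentiation. At 0 the additional factor \<open>1/x\<close> of the
  difference quotient is absorbed into the polynomial, and exponential decay does the rest.\<close>

lemma flat_exp_DERIV: "(flat_exp p hrd flat_exp ([:0, 0, 1:]*(p - pderiv p)) x) (at x)"
proof -
 consider "x < 0" | "x > 0" | "x = 0" by linarith
 then show ?thesis
 proof cases
  case 1
  have "((%_. 0) hrd 0) (at x)" by simp
  from hrd_transform[OF this, of "{..<0}" "flat_exp p"] 1
  show ?thesis by (simp add: flat_exp_def)
 next
  case 2
  have "((%x. poly p (inverse x)*exp (- inverse x)) hrd flat_exp ([:0, 0, 1:]*(p - pderiv p)) x) (at x)"
  proof -
   have i: "(inverse hrd - (inverse x*inverse x)) (at x)" using DERIV_inverse[of x UNIV] 2 by (simp add: power2_eq_square)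
   have "((%x. poly p (inverse x)) hrd poly (pderiv p) (inverse x)*- (inverse x*inverse x)) (at x)"
    by (rule DERIV_chain2[OF poly_DERIV i])
   moreover have "((%x. exp (- inverse x)) hrd exp (- inverse x)*- (- (inverse x*inverse x))) (at x)"
    by (rule DERIV_chain2[OF DERIV_exp DERIV_minus[OF i]])
   ultimately have "((%x. poly p (inverse x)*exp (- inverse x)) has_real_derivative
     (poly (pderiv p) (inverse x)*- (inverse x*inverse x))*exp (- inverse x)
     + (exp (- inverse x)*- (- (inverse x*inverse x)))*poly p (inverse x)) (at x)" by (rule DERIV_mult)
   then show ?thesis using 2 by (simp add: flat_exp_def algebra_simps)
  qed
  from hrd_transform[OF this, of "{0<..}" "flat_exp p"] 2
  show ?thesis by (simp add: flat_exp_def)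
 next
  case 3
  have "((%y. flat_exp p y/y) \<longlongrightarrow> 0) (at 0)"
  proof (rule filterlim_split_at)
   show "((%y. flat_exp p y/y) \<longlongrightarrow> 0) (at_left 0)"
   proof (rule tendsto_eventually)
    show "\<forall>\<^sub>F y in at_left 0. flat_exp p y/y = 0" unfolding eventually_at_filter by (rule always_eventually) (simp add: flat_exp_def)
   qed
   have "((%y. poly ([:0, 1:]*p) (inverse y)*exp (- inverse y)) \<longlongrightarrow> 0) (at_right 0)"
    by (rule filterlim_compose[OF poly_exp_decay filterlim_inverse_at_top_right])
   moreover have "\<forall>\<^sub>F y in at_right 0. poly ([:0, 1:]*p) (inverse y)*exp (- inverse y) = flat_exp p y/y"
    unfolding eventually_at_filter by (rule always_eventually) (simp add: flat_exp_def divide_inverse)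
   ultimately show "((%y. flat_exp p y/y) \<longlongrightarrow> 0) (at_right 0)" by (rule Lim_transform_eventually)
  qed
  then show ?thesis unfolding 3 has_field_derivative_iff by (simp add: flat_exp_def)
 qed
qed

lemma sm1_flat_exp: "sm1 (flat_exp p)"
proof -
 have "Ck1 k (flat_exp p)" for k
 proof (induction k arbitrary: p)
  case 0
  show ?case using flat_exp_DERIV by (auto intro: DERIV_continuous_on)
 next
  case (Suc k)
  show ?case by (rule Ck1_SucI[OF flat_exp_DERIV Suc])
 qed
 then show ?thesis unfolding sm1_def by blast
qed

lemma smooth_step_exists:
 "\<exists>h. sm1 h & (\<forall>t\<le>1. h t = 0) & (\<forall>t\<ge>2. h t = 1) & (\<forall>t. 0 <= h t & h t <= 1) &
   (\<forall>t. t < 1 \<or> 2 < t --> deriv h t = 0) & (\<exists>C. \<forall>t. \<bar>deriv h t\<bar> <= C)"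
proof -
 define a where "a = flat_exp [:1:]"
 have a0: "a t = 0" if "t <= 0" for t using that by (simp add: a_def flat_exp_def)
 have a1: "a t > 0" if "t > 0" for t using that by (simp add: a_def flat_exp_def)
 have age: "a t >= 0" for t using a0[of t] a1[of t] by (cases "t <= 0") auto
 define h where "h t = a (1*t + (- 1))*inverse (a (1*t + (- 1)) + a ((- 1)*t + 2))" for t
 have p: "a (1*t + (- 1)) + a ((- 1)*t + 2) > 0" for t
  using a1[of "1*t + (- 1)"] a1[of "(- 1)*t + 2"] age[of "1*t + (- 1)"] age[of "(- 1)*t + 2"] by (cases "t > 1") auto
 have hs: "sm1 h" unfolding h_def[abs_def]
 proof (intro sm1_mult sm1_inverse sm1_add)
  show "sm1 (%x. a (1*x + - 1))" "sm1 (%x. a (1*x + - 1))" "sm1 (%x. a (- 1*x + 2))"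
   unfolding a_def by (intro sm1_affine sm1_flat_exp)+
  show "a (1*x + - 1) + a (- 1*x + 2) ~= 0" for x using p[of x] by linarith
 qed
 have h0: "h t = 0" if "t <= 1" for t using a0[of "t - 1"] that by (simp add: h_def)
 have h1: "h t = 1" if "t >= 2" for t using a0[of "2 - t"] a1[of "t - 1"] that by (simp add: h_def)
 have h01: "0 <= h t" "h t <= 1" for t
  using p[of t] age[of "t - 1"] age[of "2 - t"] by (simp_all add: h_def divide_inverse[symmetric] field_simps)
 have d0: "deriv h t = 0" if "t < 1 \<or> 2 < t" for t using that
 proof
  assume "t < 1"
  have "((%_. 0) hrd 0) (at t)" by simp
  from hrd_transform[OF this, of "{..<1}" h] \<open>t < 1\<close>
  show ?thesis by (intro DERIV_imp_deriv) (simp add: h0)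
 next
  assume "2 < t"
  have "((%_. 1) hrd 0) (at t)" by simp
  from hrd_transform[OF this, of "{2<..}" h] \<open>2 < t\<close>
  show ?thesis by (intro DERIV_imp_deriv) (simp add: h1)
 qed
 have "continuous_on {1..2} (deriv h)" using sm1_deriv(3)[OF sm1_deriv(1)[OF hs]] by (rule continuous_on_subset) simp
 then have "bounded (deriv h ` {1..2})" by (intro compact_imp_bounded compact_continuous_image) auto
 then obtain C where C: "!!t. t : {1..2} ==> \<bar>deriv h t\<bar> <= C" unfolding bounded_iff by force
 have "\<bar>deriv h t\<bar> <= max C 0" for t using C[of t] d0[of t] by (cases "t < 1 \<or> 2 < t") auto
 then show ?thesis using hs h0 h1 h01 d0 by (intro exI[of _ h]) blast
qed

definition sstep :: "real => real" where
 "sstep = (SOME h. sm1 h & (\<forall>t\<le>1. h t = 0) & (\<forall>t\<ge>2. h t = 1) & (\<forall>t. 0 <= h t & h t <= 1) &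
   (\<forall>t. t < 1 \<or> 2 < t --> deriv h t = 0) & (\<exists>C. \<forall>t. \<bar>deriv h t\<bar> <= C))"

lemma sstep_props: "sm1 sstep" "t <= 1 ==> sstep t = 0" "t >= 2 ==> sstep t = 1" "0 <= sstep t" "sstep t <= 1"
 "t < 1 \<or> 2 < t ==> deriv sstep t = 0" "\<exists>C. \<forall>t. \<bar>deriv sstep t\<bar> <= C"
 using someI_ex[OF smooth_step_exists, folded sstep_def] by blast+

text \<open>Equal to \<open>1\<close> at distance at least \<open>2 / m\<close> from the end points of \<open>{a..b}\<close>.\<close>

definition plateau :: "real => real => real => real => real" where
 "plateau a b m x = sstep (m*x + - m*a)* sstep (- m*x + m*b)"

lemma plateau_sm1: "sm1 (plateau a b m)" unfolding plateau_def[abs_def] by (intro sm1_mult sm1_affine sstep_props)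

lemma plateau_bounds: "0 <= plateau a b m x" "plateau a b m x <= 1"
proof -
 show "0 <= plateau a b m x" unfolding plateau_def using sstep_props by (intro mult_nonneg_nonneg) auto
 have "plateau a b m x <= 1*1" unfolding plateau_def using sstep_props by (intro mult_mono) auto
 then show "plateau a b m x <= 1" by simp
qed

lemma plateau_eq_0:
 assumes "m > 0" "x < a + 1/m \<or> b - 1/m < x"
 shows "plateau a b m x = 0" using assms(2)
proof
 assume "x < a + 1/m"
 then have "m*x + - m*a <= 1" using assms(1) by (simp add: field_simps)
 then show ?thesis unfolding plateau_def using sstep_props(2) by simp
next
 assume "b - 1/m < x"
 then have "- m*x + m*b <= 1" using assms(1) by (simp add: field_simps)
 then show ?thesis unfolding plateau_def using sstep_props(2) by simp
qed

lemma plateau_eq_1: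
 assumes "m > 0" "a + 2/m <= x" "x <= b - 2/m"
 shows "plateau a b m x = 1"
proof -
 have "m*x + - m*a >= 2" "- m*x + m*b >= 2" using assms by (simp_all add: field_simps)
 then show ?thesis unfolding plateau_def using sstep_props(3) by simp
qed

lemma plateau_eventually_1:
 assumes "a < x" "x < b"
 shows "eventually (%n. \<forall>\<^sub>F y in nhds x. plateau a b (real (Suc n)) y = 1) sequentially"
proof -
 define r where "r = min (x - a) (b - x)"
 have r: "r > 0" using assms by (simp add: r_def)
 have r_le: "r <= x - a" "r <= b - x" by (simp_all add: r_def)
 obtain N :: nat where N: "real N >= 4/r" using real_arch_simple by blast
 have "\<forall>\<^sub>F y in nhds x. plateau a b (real (Suc n)) y = 1" if "n >= N" for n
 proof -
  have n: "2/real (Suc n) <= r/2"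
  proof -
   have "real (Suc n) >= 4/r" using N that by linarith
   then show ?thesis using r by (simp add: field_simps)
  qed
  have "eventually (%y. y : ball x (r/2)) (nhds x)" using r by (intro eventually_nhds_in_open) auto
  then show ?thesis
  proof eventually_elim
   case (elim y)
   then have "\<bar>x - y\<bar> < r/2" by (simp add: dist_real_def)
   then have "x - y < r/2 & - (x - y) < r/2" by (simp only: abs_less_iff)
   then have "a + r/2 <= y" "y <= b - r/2" using r_le by linarith+
   then show ?case using n by (intro plateau_eq_1) auto
  qed
 qed
 then show ?thesis by (auto simp: eventually_sequentially)
qed

lemma plateau_mult_deriv_eventually:
 assumes "sm1 s" "a < x" "x < b"
 shows "\<forall>\<^sub>F n in sequentially. deriv (%y. plateau a b (real (Suc n)) y* s y) x = deriv s x"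
 using plateau_eventually_1[OF assms(2,3)]
proof eventually_elim
 case (elim n)
 then have "\<forall>\<^sub>F y in nhds x. plateau a b (real (Suc n)) y* s y = s y" by eventually_elim simp
 then show ?case by (rule deriv_cong_ev) simp
qed

text \<open>The derivative of the plateau grows like \<open>m = Suc n\<close>, but it lives within
  \<open>2/m\<close> of the end points, where \<open>|s|\<close> is at most \<open>2/m\<close> times
  a bound \<open>Om\<close> on its derivative. Each end contributes at most
  \<open>2 C Om\<close>.\<close>

lemma plateau_mult_deriv_bounded:
 assumes s: "sm1 s" "s a = 0" "s b = 0"
 shows "\<exists>B. \<forall>n x. a < x & x < b --> \<bar>deriv (%y. plateau a b (real (Suc n)) y* s y) x\<bar> <= B"
proof -
 obtain C where C: "!!t. \<bar>deriv sstep t\<bar> <= C" using sstep_props(7) by blast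
 have C0: "C >= 0" using C[of 0] by linarith
 have "continuous_on {a..b} (deriv s)" using sm1_deriv(3)[OF sm1_deriv(1)[OF s(1)]] by (rule continuous_on_subset) simp
 then have "bounded (deriv s ` {a..b})" by (intro compact_imp_bounded compact_continuous_image) auto
 then obtain Om where Om: "!!t. t : {a..b} ==> \<bar>deriv s t\<bar> <= Om" unfolding bounded_iff by force
 have mv: "\<bar>s x\<bar> <= Om*\<bar>x - c\<bar>" if "x : {a..b}" "c : {a..b}" "s c = 0" for x c
 proof -
  have "norm (s x - s c) <= Om*norm (x - c)"
  proof (rule field_differentiable_bound[of "{a..b}" s "deriv s"])
   show "(s has_field_derivative deriv s z) (at z within {a..b})" for z using sm1_deriv(2)[OF s(1)] by (rule DERIV_subset) simp
  qed (use Om that in auto)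
  then show ?thesis using that by simp
 qed
 have "\<bar>deriv (%y. plateau a b (real (Suc n)) y* s y) x\<bar> <= 4*C*Om + Om" if x: "a < x" "x < b" for n x
 proof -
  define m where "m = real (Suc n)"
  have m: "m > 0" by (simp add: m_def)
  have Om0: "Om >= 0" using Om[of x] x by force
  define u v where "u = sstep (m*x + - m*a)" and "v = sstep (- m*x + m*b)"
  define u' v' where "u' = deriv sstep (m*x + - m*a)" and "v' = deriv sstep (- m*x + m*b)"
  have uv: "\<bar>u\<bar> <= 1" "\<bar>v\<bar> <= 1" unfolding u_def v_def using sstep_props(4,5) by simp_all
  have "((%y. sstep (m*y + - m*a)) hrd u'*m) (at x)"
   unfolding u'_def by (rule DERIV_chain2[OF sm1_deriv(2)[OF sstep_props(1)]]) (auto intro!: derivative_eq_intros)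
  moreover have "((%y. sstep (- m*y + m*b)) hrd v'*- m) (at x)"
   unfolding v'_def by (rule DERIV_chain2[OF sm1_deriv(2)[OF sstep_props(1)]]) (auto intro!: derivative_eq_intros)
  ultimately have "((%y. plateau a b m y* s y) hrd ((u'*m)* v + (v'*- m)*u)* s x + deriv s x*plateau a b m x) (at x)"
   unfolding plateau_def u_def v_def by (intro DERIV_mult sm1_deriv(2) s)
  then have d: "deriv (%y. plateau a b m y* s y) x = (m*u'* s x)* v - (m* v'* s x)*u + deriv s x*plateau a b m x"
   by (simp add: DERIV_imp_deriv algebra_simps)
  have b1: "\<bar>m*u'* s x\<bar> <= 2*C*Om"
  proof (cases "u' = 0")
   case False
   then have "m*x + - m*a <= 2" using sstep_props(6)[of "m*x + - m*a"] unfolding u'_def by linarith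
   then have "m*(x - a) <= 2" by (simp add: algebra_simps)
   then have "Om*(m*(x - a)) <= Om*2" using Om0 by (rule mult_left_mono)
   moreover have "\<bar>s x\<bar> <= Om*(x - a)" using mv[of x a] x s by simp
   then have "m*\<bar>s x\<bar> <= m*(Om*(x - a))" using m by (intro mult_left_mono) auto
   ultimately have "m*\<bar>s x\<bar> <= Om*2" by (simp only: mult.left_commute[of m])
   then have "C*(m*\<bar>s x\<bar>) <= C*(Om*2)" using C0 by (rule mult_left_mono)
   moreover have "\<bar>u'\<bar>*(m*\<bar>s x\<bar>) <= C*(m*\<bar>s x\<bar>)" using C m unfolding u'_def by (intro mult_right_mono) auto
   ultimately have "\<bar>u'\<bar>*(m*\<bar>s x\<bar>) <= 2*C*Om" by linarith
   moreover have "\<bar>m*u'* s x\<bar> = \<bar>u'\<bar>*(m*\<bar>s x\<bar>)" using m by (simp add: abs_mult mult_ac)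
   ultimately show ?thesis by linarith
  qed (use C0 Om0 in simp)
  have b2: "\<bar>m* v'* s x\<bar> <= 2*C*Om"
  proof (cases "v' = 0")
   case False
   then have "- m*x + m*b <= 2" using sstep_props(6)[of "- m*x + m*b"] unfolding v'_def by linarith
   then have "m*(b - x) <= 2" by (simp add: algebra_simps)
   then have "Om*(m*(b - x)) <= Om*2" using Om0 by (rule mult_left_mono)
   moreover have "\<bar>s x\<bar> <= Om*(b - x)" using mv[of x b] x s by simp
   then have "m*\<bar>s x\<bar> <= m*(Om*(b - x))" using m by (intro mult_left_mono) auto
   ultimately have "m*\<bar>s x\<bar> <= Om*2" by (simp only: mult.left_commute[of m])
   then have "C*(m*\<bar>s x\<bar>) <= C*(Om*2)" using C0 by (rule mult_left_mono)
   moreover have "\<bar>v'\<bar>*(m*\<bar>s x\<bar>) <= C*(m*\<bar>s x\<bar>)" using C m unfolding v'_def by (intro mult_right_mono) auto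
   ultimately have "\<bar>v'\<bar>*(m*\<bar>s x\<bar>) <= 2*C*Om" by linarith
   moreover have "\<bar>m* v'* s x\<bar> = \<bar>v'\<bar>*(m*\<bar>s x\<bar>)" using m by (simp add: abs_mult mult_ac)
   ultimately show ?thesis by linarith
  qed (use C0 Om0 in simp)
  have "\<bar>(m*u'* s x)* v\<bar> <= (2*C*Om)*1" unfolding abs_mult[of _ v] using b1 uv C0 Om0 by (intro mult_mono) auto
  moreover have "\<bar>(m* v'* s x)*u\<bar> <= (2*C*Om)*1" unfolding abs_mult[of _ u] using b2 uv C0 Om0 by (intro mult_mono) auto
  moreover have "\<bar>deriv s x*plateau a b m x\<bar> <= Om*1"
   unfolding abs_mult using Om[of x] x plateau_bounds[of a b m x] Om0 by (intro mult_mono) auto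
  ultimately show ?thesis unfolding m_def[symmetric] d by linarith
 qed
 then show ?thesis by blast
qed

lemma prodf_has_derivative:
 fixes f :: "'n::finite => real => real"
 assumes f: "!!i. sm1 (f i)"
 shows "(prodf f has_derivative (%h. \<Sum>i\<in>UNIV. h $ i*prodf (f(i := deriv (f i))) x)) (at x)"
proof -
 have d: "((%x :: real^'n. f i (x $ i)) has_derivative (%h. deriv (f i) (x $ i)*h $ i)) (at x)" for i
 proof -
  have "((%x :: real^'n. x $ i) has_derivative (%h. h $ i)) (at x)" by (intro bounded_linear_imp_has_derivative bounded_linear_vec_nth)
  from has_derivative_compose[OF this sm1_deriv(2)[OF f, unfolded has_field_derivative_def]]
  show ?thesis .
 qed
 have "(prodf f has_derivative (%h. \<Sum>i\<in>UNIV. (deriv (f i) (x $ i)*h $ i)*(\<Prod>j\<in>UNIV - {i}. f j (x $ j)))) (at x)"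
  unfolding prodf_def[abs_def] by (intro has_derivative_prod d)
 moreover have "(deriv (f i) (x $ i)*h $ i)*(\<Prod>j\<in>UNIV - {i}. f j (x $ j)) = h $ i*prodf (f(i := deriv (f i))) x" for h i
 proof -
  have "prodf (f(i := deriv (f i))) x = deriv (f i) (x $ i)*(\<Prod>j\<in>UNIV - {i}. f j (x $ j))"
   unfolding prodf_def by (subst prod.remove[of _ i]) auto
  then show ?thesis by simp
 qed
 ultimately show ?thesis by simp
qed

lemma pderiv_at_eq: "(f has_derivative f') (at x) ==> pderiv_at i f x = f' (axis i 1)"
 unfolding pderiv_at_def by (simp add: frechet_derivative_at[symmetric])

abbreviation cprod :: "('n => real => real) => real^'n::finite => complex" where
 "cprod f \<equiv> (%x. cr (prodf f x))"

lemma cprod_has_derivative: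
 fixes f :: "'n::finite => real => real"
 assumes "!!i. sm1 (f i)"
 shows "(cprod f has_derivative (%h. cr (\<Sum>i\<in>UNIV. h $ i*prodf (f(i := deriv (f i))) x))) (at x)"
 by (rule has_derivative_of_real prodf_has_derivative assms)+

lemma pderiv_cprod:
 fixes f :: "'n::finite => real => real"
 assumes f: "!!i. sm1 (f i)"
 shows "pderiv_at i (cprod f) = cprod (f(i := deriv (f i)))"
proof
 fix x :: "real^'n"
 have "pderiv_at i (cprod f) x = cr (\<Sum>j\<in>UNIV. axis i 1 $ j*prodf (f(j := deriv (f j))) x)"
  by (rule pderiv_at_eq[OF cprod_has_derivative[OF f]])
 also have "(\<Sum>j\<in>UNIV. axis i 1 $ j*prodf (f(j := deriv (f j))) x) = (\<Sum>j\<in>UNIV. if j = i then prodf (f(j := deriv (f j))) x else 0)"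
  by (intro sum.cong) (auto simp: axis_def)
 finally show "pderiv_at i (cprod f) x = cprod (f(i := deriv (f i))) x" by simp
qed

lemma cprod_smooth:
 fixes f :: "'n::finite => real => real"
 assumes "!!i. sm1 (f i)"
 shows "cprod f : smooth"
proof -
 have "C_k k (cprod f)" for k using assms
 proof (induction k arbitrary: f)
  case 0
  have "prodf f differentiable at x" for x using prodf_has_derivative[of f, OF 0] unfolding differentiable_def by blast
  then have "cont (prodf f)" by (intro cont_atI ballI differentiable_imp_continuous_within)
  then show ?case by (simp add: continuous_on_of_real)
 next
  case (Suc k)
  have "cprod f differentiable at x" for x using cprod_has_derivative[of f, OF Suc.prems] unfolding differentiable_def by blast
  moreover have "C_k k (pderiv_at i (cprod f))" for i unfolding pderiv_cprod[OF Suc.prems] using Suc.prems by (intro Suc.IH) (simp add: sm1_deriv)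
  ultimately show ?case by simp
 qed
 then show ?thesis unfolding smooth_def by blast
qed

section \<open>Weak derivatives on the cube\<close>

lemma cube_props: "open (cube L :: (real^'n::finite) set)" "bounded (cube L :: (real^'n::finite) set)"
 unfolding cube_eq_box by (rule open_box bounded_box)+

lemma smoothD:
 assumes "f : smooth"
 shows "f differentiable at x" "pderiv_at i f : smooth" "cont f" "cont (pderiv_at i f)"
  "(f has_derivative frechet_derivative f (at x)) (at x)"
proof -
 have C: "C_k k f" for k using assms unfolding smooth_def by blast
 show d: "f differentiable at x" for x using C[of "Suc 0"] by simp
 have "C_k k (pderiv_at i f)" for k using C[of "Suc k"] by simp
 then show "pderiv_at i f : smooth" unfolding smooth_def by blast
 show "cont f" using C[of 0] by simp
 show "cont (pderiv_at i f)" using C[of "Suc 0"] by simp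
 show "(f has_derivative frechet_derivative f (at x)) (at x)" using d unfolding frechet_derivative_works .
qed

lemma pderiv_at_diff:
 assumes "f differentiable at x" "g differentiable at x"
 shows "pderiv_at i (%x. f x - g x) x = pderiv_at i f x - pderiv_at i g x"
proof -
 have "((%x. f x - g x) has_derivative (%h. frechet_derivative f (at x) h - frechet_derivative g (at x) h)) (at x)"
  using assms unfolding frechet_derivative_works by (rule has_derivative_diff)
 from pderiv_at_eq[OF this] show ?thesis unfolding pderiv_at_def .
qed

lemma smooth_diff:
 assumes "f : smooth" "g : smooth"
 shows "(%x. f x - g x) : smooth"
proof -
 have "C_k k (%x. f x - g x)" for k using assms
 proof (induction k arbitrary: f g)
  case (0 f g)
  show ?case unfolding C_k.simps(1) by (intro continuous_on_diff smoothD(3) 0)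
 next
  case (Suc k f g)
  have p: "pderiv_at i (%x. f x - g x) = (%x. pderiv_at i f x - pderiv_at i g x)" for i
   by (intro ext pderiv_at_diff smoothD(1) Suc.prems)
  show ?case unfolding C_k.simps(2) p
  proof (intro conjI allI)
   show "(%x. f x - g x) differentiable at x" for x by (intro differentiable_diff smoothD(1) Suc.prems)
   show "C_k k (%x. pderiv_at i f x - pderiv_at i g x)" for i by (rule Suc.IH[OF smoothD(2)[OF Suc.prems(1)] smoothD(2)[OF Suc.prems(2)]])
  qed
 qed
 then show ?thesis unfolding smooth_def mem_Collect_eq ..
qed

lemma test_function_support:
 fixes ph :: "real^'n::finite => complex"
 assumes "ph : test_functions Om"
 obtains K where "compact K" "K \<subseteq> Om" "!!x. x \<notin> K ==> ph x = 0" "!!x i. x \<notin> K ==> pderiv_at i ph x = 0"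
proof
 let ?K = "closure {x. ph x ~= 0}"
 have "compact ?K & ?K \<subseteq> Om" using assms unfolding test_functions_def mem_Collect_eq by (rule conjunct2)
 then show "compact ?K" "?K \<subseteq> Om" by (rule conjunct1, rule conjunct2)
 show z: "ph x = 0" if "x \<notin> ?K" for x
 proof (rule ccontr)
  assume "ph x ~= 0"
  then have "x : {x. ph x ~= 0}" by simp
  then show False using that by (meson closure_subset subsetD)
 qed
 show "pderiv_at i ph x = 0" if "x \<notin> ?K" for x i
 proof -
  have "((%_. 0) has_derivative (%_. 0)) (at x)" by simp
  then have "(ph has_derivative (%_. 0)) (at x)"
  proof (rule has_derivative_transform_within_open[of _ _ _ _ "- ?K"])
   show "open (- ?K)" by (rule open_Compl[OF closed_closure])
   show "x : - ?K" using that by (simp only: Compl_iff not_False_eq_True)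
   show "0 = ph y" if "y : - ?K" for y using z[OF that[unfolded Compl_iff]] by (rule sym)
  qed
  then show ?thesis by (rule pderiv_at_eq)
 qed
qed

lemma test_functionD:
 assumes "ph : test_functions Om"
 shows "ph : smooth" "cont ph" "cont (pderiv_at i ph)"
proof -
 show s: "ph : smooth" using assms unfolding test_functions_def by simp
 show "cont ph" "cont (pderiv_at i ph)" by (rule smoothD[OF s])+
qed

lemma cprod_test_function:
 fixes f :: "'n::finite => real => real"
 assumes f: "!!i. sm1 (f i)" and z: "!!i s. s < a i \<or> b i < s ==> f i s = 0"
  and ab: "!!i. - L/2 < a i" "!!i. b i < L/2"
 shows "cprod f : test_functions (cube L)"
proof -
 define C where "C = cbox (\<chi> i. a i) (\<chi> i. b i)"
 have C: "x : C \<longleftrightarrow> (\<forall>i. a i <= x $ i & x $ i <= b i)" for x by (simp add: C_def mem_box_cart)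
 have "prodf f x = 0" if "x \<notin> C" for x
 proof -
  obtain i where "\<not> (a i <= x $ i & x $ i <= b i)" using \<open>x \<notin> C\<close> unfolding C by blast
  then have "x $ i < a i \<or> b i < x $ i" by linarith
  from z[OF this] show ?thesis unfolding prodf_def by (intro prod_zero) auto
 qed
 note out = this
 have "{x. cprod f x ~= 0} \<subseteq> C"
 proof
  fix x assume "x : {x. cprod f x ~= 0}"
  then have "prodf f x ~= 0" by simp
  then show "x : C" using out[of x] by blast
 qed
 then have c: "closure {x. cprod f x ~= 0} \<subseteq> C" unfolding C_def by (rule closure_minimal) (rule closed_cbox)
 have CQ: "C \<subseteq> cube L"
 proof
  fix x assume "x : C"
  then have x: "a i <= x $ i" "x $ i <= b i" for i unfolding C by blast+
  show "x : cube L" unfolding cube_def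
  proof (rule CollectI, intro allI conjI)
   fix i
   show "- L/2 < x $ i" using x(1)[of i] ab(1)[of i] by linarith
   show "x $ i < L/2" using x(2)[of i] ab(2)[of i] by linarith
  qed
 qed
 have "bounded C" unfolding C_def by (rule bounded_cbox)
 then have "bounded (closure {x. cprod f x ~= 0})" using c by (rule bounded_subset)
 then have k: "compact (closure {x. cprod f x ~= 0})" unfolding compact_eq_bounded_closed by (simp only: closed_closure)
 show ?thesis unfolding test_functions_def by (rule CollectI) (intro conjI cprod_smooth f k order_trans[OF c CQ])
qed

lemma integrable_loc_mult:
 fixes u w :: "real^'n::finite => complex"
 assumes u: "locally_integrable Om u" and Om: "Om : sets lebesgue"
  and w: "cont w" and K: "compact K" "K \<subseteq> Om" "!!x. x \<notin> K ==> w x = 0"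
 shows "integrable (lebesgue_on Om) (%x. u x*w x)"
proof -
 have uK: "integrable lebesgue (%x. ind K x *: u x)" using u K unfolding locally_integrable_def set_integrable_def by blast
 have "bounded (w ` K)" using w K by (intro compact_imp_bounded compact_continuous_image) (auto intro: continuous_on_subset)
 then obtain C where C: "!!x. x : K ==> cmod (w x) <= C" unfolding bounded_iff by blast
 have wm: "w : bmeas lebesgue" using w by (intro measurable_completion) (simp add: bmeas_contI)
 have e: "ind Om x *: (u x*w x) = (ind K x *: u x)*w x" for x using K by (auto simp: indicator_def)
 have "integrable lebesgue (%x. (ind K x *: u x)*w x)"
 proof (rule Lintb_bound)
  show "integrable lebesgue (%x. (ind K x *: u x)*cr C)" by (rule integrable_mult_left) (use uK in simp)
  show "(%x. ind K x *: u x*w x) : bmeas lebesgue" using borel_measurable_integrable[OF uK] wm by measurable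
  show "AE x in lebesgue. norm (ind K x *: u x*w x) <= norm (ind K x *: u x*cr C)"
  proof (rule AE_I2)
   fix x
   show "norm (ind K x *: u x*w x) <= norm (ind K x *: u x*cr C)"
    using C[of x] by (cases "x : K") (auto simp: norm_mult intro!: mult_left_mono)
  qed
 qed
 then show ?thesis using Om by (subst integrable_restrict_space) (auto simp: e)
qed

text \<open>Products of plateaus are test functions supported in the box that converge to its
  indicator; \<open>h\<close> is integrable on the closed box, which lies in the cube, and
  dominates.\<close>

lemma du_Bois_Reymond_box:
 fixes h :: "real^'n::finite => complex"
 assumes h: "locally_integrable (cube L) h"
  and z: "!!ph. ph : test_functions (cube L) ==> (LINT x|cm L. h x*ph x) = 0"
  and ab: "!!i. - L/2 < a $ i" "!!i. b $ i < L/2"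
 shows "(LINT x|lebesgue. ind (box a b) x *: h x) = 0"
proof -
 define f where "f m = (%i. plateau (a $ i) (b $ i) (real (Suc m)))" for m
 have p0: "f m i s = 0" if "s <= a $ i \<or> b $ i <= s" for m i s
 proof -
  have "1/real (Suc m) > 0" by simp
  then have "s < a $ i + 1/real (Suc m) \<or> b $ i - 1/real (Suc m) < s" using that by linarith
  then show ?thesis unfolding f_def by (intro plateau_eq_0) auto
 qed
 have fs: "sm1 (f m i)" for m i unfolding f_def by (rule plateau_sm1)
 have T: "cprod (f m) : test_functions (cube L)" for m
 proof (rule cprod_test_function[where a = "%i. a $ i" and b = "%i. b $ i"])
  show "f m i s = 0" if "s < a $ i \<or> b $ i < s" for i s using that by (intro p0) linarith
 qed (rule fs ab)+
 have fb: "\<bar>prodf (f m) x\<bar> <= 1" for m x unfolding prodf_def f_def abs_prod using plateau_bounds by (intro prod_le_1) simp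
 have out: "prodf (f m) x = 0" if "x \<notin> box a b" for m x
 proof -
  obtain i where "\<not> (a $ i < x $ i & x $ i < b $ i)" using \<open>x \<notin> box a b\<close> unfolding mem_box_cart by blast
  then have "f m i (x $ i) = 0" by (intro p0) linarith
  then show ?thesis unfolding prodf_def by (intro prod_zero) auto
 qed
 let ?K = "cbox a b"
 have Ksub: "?K \<subseteq> cube L"
 proof
  fix x assume "x : ?K"
  then have x: "a $ i <= x $ i" "x $ i <= b $ i" for i by (auto simp: mem_box_cart)
  show "x : cube L" unfolding cube_def
  proof (clarify, intro conjI)
   fix i
   show "- L/2 < x $ i" using x(1)[of i] ab(1)[of i] by linarith
   show "x $ i < L/2" using x(2)[of i] ab(2)[of i] by linarith
  qed
 qed
 have hK: "integrable lebesgue (%x. ind ?K x *: h x)"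
  using h Ksub compact_cbox[of a b] unfolding locally_integrable_def set_integrable_def by blast
 have lim: "(%m. prodf (f m) x) ~~> ind (box a b) x" for x
 proof (cases "x : box a b")
  case True
  have "(%m. f m i (x $ i)) ~~> 1" for i
  proof (rule tendsto_eventually)
   have "a $ i < x $ i" "x $ i < b $ i" using True by (auto simp: mem_box_cart)
   from plateau_eventually_1[OF this] show "\<forall>\<^sub>F m in sequentially. f m i (x $ i) = 1"
    unfolding f_def by eventually_elim (rule eventually_nhds_x_imp_x)
  qed
  then have "(%m. \<Prod>i\<in>UNIV. f m i (x $ i)) ~~> (\<Prod>i\<in>(UNIV::'n set). 1)" by (intro tendsto_prod)
  then show ?thesis using True by (simp add: prodf_def)
 qed (simp add: out)
 have "(%m. LINT x|lebesgue. prodf (f m) x *: (ind ?K x *: h x)) ~~> (LINT x|lebesgue. ind (box a b) x *: (ind ?K x *: h x))"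
 proof (rule integral_dominated_convergence[where w = "%x. norm (ind ?K x *: h x)"])
  have pm: "prodf (f m) : bmeas lebesgue" for m unfolding prodf_def[abs_def]
   by (intro measurable_completion, simp, intro bmeas_contI continuous_intros cont_comp2[OF sm1_deriv(3)[OF fs]]) auto
  note [measurable] = borel_measurable_integrable[OF hK]
  show "(%x. ind (box a b) x *: (ind ?K x *: h x)) : bmeas lebesgue" by (intro borel_measurable_scaleR borel_measurable_indicator borel_measurable_integrable[OF hK]) auto
  show "(%x. prodf (f m) x *: (ind ?K x *: h x)) : bmeas lebesgue" for m
   by (intro borel_measurable_scaleR pm borel_measurable_integrable[OF hK])
  show "integrable lebesgue (%x. norm (ind ?K x *: h x))" using hK by (rule integrable_norm)
  show "AE x in lebesgue. (%m. prodf (f m) x *: (ind ?K x *: h x)) ~~> ind (box a b) x *: (ind ?K x *: h x)"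
   by (intro AE_I2 tendsto_scaleR lim tendsto_const)
  show "AE x in lebesgue. norm (prodf (f m) x *: (ind ?K x *: h x)) <= norm (ind ?K x *: h x)" for m
  proof (rule AE_I2)
   fix x
   have "\<bar>prodf (f m) x\<bar>*norm (ind ?K x *: h x) <= 1*norm (ind ?K x *: h x)"
    using fb by (intro mult_right_mono) auto
   then show "norm (prodf (f m) x *: (ind ?K x *: h x)) <= norm (ind ?K x *: h x)"
    unfolding norm_scaleR[of "prodf (f m) x"] by simp
  qed
 qed
 moreover have "(LINT x|lebesgue. prodf (f m) x *: (ind ?K x *: h x)) = 0" for m
 proof -
  have "(LINT x|cm L. h x*cprod (f m) x) = (LINT x|lebesgue. ind (cube L) x *: (h x*cprod (f m) x))"
   by (rule integral_restrict_space) simp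
  also have "... = (LINT x|lebesgue. prodf (f m) x *: (ind ?K x *: h x))"
  proof (rule Lint_cong[OF refl])
   fix x
   show "ind (cube L) x *: (h x*cprod (f m) x) = prodf (f m) x *: (ind ?K x *: h x)"
    using out[of x m] Ksub box_subset_cbox[of a b] by (cases "x : box a b") (auto simp: indicator_def scaleR_conv_of_real)
  qed
  finally show ?thesis using z[OF T[of m]] by simp
 qed
 moreover have "ind (box a b) x *: (ind ?K x *: h x) = ind (box a b) x *: h x" for x
  using box_subset_cbox[of a b] by (auto simp: indicator_def)
 ultimately show ?thesis by (simp only: LIMSEQ_const_iff)
qed

lemma sigma_finite_lebesgue: "sigma_finite_measure (lebesgue :: 'a::euclidean_space measure)"
proof
 obtain A where A: "countable A" "A \<subseteq> sets (lborel :: 'a measure)" "\<Union>A = space (lborel :: 'a measure)"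
   "\<forall>a\<in>A. emeasure (lborel :: 'a measure) a ~= \<infinity>" using lborel.sigma_finite_countable by blast
 have "emeasure lebesgue a = emeasure (lborel :: 'a measure) a" if "a : A" for a using A(2) that by auto
 then show "\<exists>A. countable A & A \<subseteq> sets (lebesgue :: 'a measure) & \<Union>A = space (lebesgue :: 'a measure) &
   (\<forall>a\<in>A. emeasure (lebesgue :: 'a measure) a ~= \<infinity>)" using A by (intro exI[of _ A]) auto
qed

text \<open>\<open>h\<close> is integrable only on compact parts, so the argument runs on cubes of
  side \<open>L' < L\<close>, countably many of which exhaust the cube. The integral vanishes over
  boxes, then over Borel sets by \<open>borel_box_induct\<close>, then over Lebesgue sets, since
  these differ from F-sigma sets by null sets.\<close>

lemma du_Bois_Reymond:
 fixes h :: "real^'n::finite => complex"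
 assumes h: "locally_integrable (cube L) h"
  and z: "!!ph. ph : test_functions (cube L) ==> (LINT x|cm L. h x*ph x) = 0"
 shows "AE x in cm L. h x = 0"
proof -
 have "AE x in lebesgue. x : cube L' --> h x = 0" if L': "L' < L" for L'
 proof -
  define a b :: "real^'n" where "a = (\<chi> i. - L'/2)" and "b = (\<chi> i. L'/2)"
  have Q': "cube L' = box a b" unfolding cube_eq_box a_def b_def ..
  have "integrable lebesgue (%x. ind (cbox a b) x *: h x)"
  proof -
   have "cbox a b \<subseteq> cube L"
   proof
    fix x assume "x : cbox a b"
    then have x: "- L'/2 <= x $ i" "x $ i <= L'/2" for i by (auto simp: mem_box_cart a_def b_def)
    show "x : cube L" unfolding cube_def
    proof (clarify, intro conjI)
     fix i
     show "- L/2 < x $ i" "x $ i < L/2" using x[of i] L' by linarith+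
    qed
   qed
   then show ?thesis using h compact_cbox[of a b] unfolding locally_integrable_def set_integrable_def by blast
  qed
  from Lintb_ind[OF _ this, of "box a b"]
  have hi: "integrable lebesgue (%x. ind (box a b) x *: h x)"
  proof (rule Lintb_cong[THEN iffD1, rotated -1])
   show "ind (box a b) x *: ind (cbox a b) x *: h x = ind (box a b) x *: h x" for x
    using box_subset_cbox[of a b] by (auto simp: indicator_def)
  qed auto
  let ?g = "%x. ind (box a b) x *: h x"
  have box: "(LINT x:box c d|lebesgue. ?g x) = 0" for c d
  proof -
   define c' d' :: "real^'n" where "c' = (\<chi> i. max (c $ i) (a $ i))" and "d' = (\<chi> i. min (d $ i) (b $ i))"
   have "(LINT x|lebesgue. ind (box c' d') x *: h x) = 0"
   proof (rule du_Bois_Reymond_box[OF h z])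
    show "- L/2 < c' $ i" "d' $ i < L/2" for i using L' by (simp_all add: c'_def d'_def a_def b_def)
   qed
   moreover have "ind (box c' d') x *: h x = ind (box c d) x *: ?g x" for x
    by (auto simp: indicator_def mem_box_cart c'_def d'_def)
   ultimately show ?thesis unfolding set_lebesgue_integral_def by simp
  qed
  have sint: "set_integrable lebesgue A ?g" if "A : sets lebesgue" for A
   unfolding set_integrable_def using that hi by (rule Lintb_ind)
  have total: "(LINT x|lebesgue. ?g x) = 0" using box[of a b] unfolding set_lebesgue_integral_def by (simp add: indicator_inter_arith[symmetric])
  have bor: "(LINT x:A|lebesgue. ?g x) = 0" if "A : sets borel" for A using that
  proof (induction rule: borel_box_induct)
   case (box c d)
   show ?case by (rule \<open>!!d c. (LINT x:box c d|lebesgue. ?g x) = 0\<close>)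
  next
   case (compl A)
   have "(LINT x:A \<union> - A|lebesgue. ?g x) = (LINT x:A|lebesgue. ?g x) + (LINT x:- A|lebesgue. ?g x)"
    using compl(1) by (intro set_integral_Un sint) (simp_all add: borel_comp)
   then show ?case using compl(2) total by (simp add: set_lebesgue_integral_def)
  next
   case (union F)
   have "(LINT x:(\<Union>i. F i)|lebesgue. ?g x) = (\<Sum>i. LINT x:F i|lebesgue. ?g x)"
    
   proof (rule lebesgue_integral_countable_add)
    show Fl: "F i : sets lebesgue" for i using union(2) by simp
    show "F i \<inter> F j = {}" if "i ~= j" for i j using union(1) that unfolding disjoint_family_on_def by blast
    show "set_integrable lebesgue (\<Union>i. F i) ?g" using Fl by (intro sint sets.countable_UN) blast
   qed
   then show ?case using union(3) by simp
  qed
  have "AE x in lebesgue. ?g x = 0"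
  proof (rule sigma_finite_measure.density_zero[OF sigma_finite_lebesgue hi])
   fix A :: "(real^'n) set" assume "A : sets lebesgue"
   obtain C T where CT: "fsigma C" "T : null_sets lebesgue" "C \<union> T = A" "disjnt C T"
    by (rule lebesgue_set_almost_fsigma[OF \<open>A : sets lebesgue\<close>])
   have Cb: "C : sets borel" using CT(1)
   proof cases
    case (1 F)
    then have "F n : sets borel" for n :: nat by (intro borel_closed) auto
    then show ?thesis unfolding 1(1) by (intro sets.countable_UN) auto
   qed
   have "(LINT x:A|lebesgue. ?g x) = (LINT x:C|lebesgue. ?g x)" unfolding set_lebesgue_integral_def
   proof (rule integral_cong_AE)
    show "(%x. ind A x *: ?g x) : bmeas lebesgue" "(%x. ind C x *: ?g x) : bmeas lebesgue"
     by (rule borel_measurable_integrable[OF sint[unfolded set_integrable_def]]; use Cb \<open>A : sets lebesgue\<close> in simp)+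
    show "AE x in lebesgue. ind A x *: ?g x = ind C x *: ?g x"
     by (rule AE_I'[OF CT(2)]) (use CT(3) in \<open>auto simp: indicator_def\<close>)
   qed
   then show "(LINT x:A|lebesgue. ?g x) = 0" using bor[OF Cb] by simp
  qed
  then show ?thesis unfolding Q' by eventually_elim (simp add: indicator_def split: if_splits)
 qed
 moreover have "L - 1/real (Suc n) < L" for n by simp
 ultimately have "AE x in lebesgue. x : cube (L - 1/real (Suc n)) --> h x = 0" for n by blast
 then have "AE x in lebesgue. \<forall>n. x : cube (L - 1/real (Suc n)) --> h x = 0" unfolding AE_all_countable by blast
 then have "AE x in lebesgue. x : cube L --> h x = 0"
 proof eventually_elim
  case (elim x)
  show ?case
  proof
   assume x: "x : cube L"
   define r where "r = Min ((%i. min (L/2 - x $ i) (x $ i + L/2)) ` UNIV)"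
   have "0 < L/2 - x $ i & 0 < x $ i + L/2" for i
   proof -
    have "- L/2 < x $ i" "x $ i < L/2" using x unfolding cube_def by blast+
    then show ?thesis by linarith
   qed
   then have r: "r > 0" unfolding r_def by (subst Min_gr_iff) auto
   obtain n where "1/real (Suc n) < r" using reals_Archimedean[OF r] unfolding inverse_eq_divide by blast
   moreover define q where "q = 1/real (Suc n)"
   moreover have "0 < 1/real (Suc n)" by simp
   ultimately have q: "0 < q" "q < r" by simp_all
   have rle: "r <= min (L/2 - x $ i) (x $ i + L/2)" for i unfolding r_def by (rule Min_le) auto
   have "- (L - q)/2 < x $ i & x $ i < (L - q)/2" for i
   proof -
    have "r <= L/2 - x $ i" "r <= x $ i + L/2" using rle[of i] by simp_all
    then show ?thesis using q by (simp add: field_simps)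
   qed
   then have "x : cube (L - q)" unfolding cube_def by blast
   then have "x : cube (L - 1/real (Suc n))" unfolding q_def .
   then show "h x = 0" using elim by blast
  qed
 qed
 then show ?thesis by (subst AE_restrict_space_iff) auto
qed

subsection \<open>Square integrable functions and Sobolev spaces\<close>

lemma cmod_measurable: "f : bmeas M ==> (%x. cmod (f x)) : bmeas M"
 by (rule measurable_compose[OF _ borel_measurable_norm])

text \<open>By completeness of Lebesgue measure. It is needed because weak derivatives and the
  eigenvalue equation determine functions only almost everywhere.\<close>

lemma measurable_AE_cube:
 fixes f g :: "real^'n::finite => complex"
 assumes f: "f : bmeas (cm L)" and ae: "AE x in cm L. f x = g x"
 shows "g : bmeas (cm L)"
proof -
 have "(%x. if x : cube L then f x else 0) : bmeas lebesgue" using f by (simp add: borel_measurable_if)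
 moreover have "AE x in lebesgue. (if x : cube L then f x else 0) = (if x : cube L then g x else 0)"
 proof -
  have "AE x in lebesgue. x : cube L --> f x = g x" using ae by (subst (asm) AE_restrict_space_iff) simp_all
  then show ?thesis by eventually_elim simp
 qed
 ultimately have "(%x. if x : cube L then g x else 0) : bmeas lebesgue" by (rule borel_measurable_AE)
 then show ?thesis by (simp add: borel_measurable_if)
qed

lemma L2_iff: "f : L2 Om \<longleftrightarrow> f : bmeas (lebesgue_on Om) & sqi (lebesgue_on Om) (%x. cmod (f x))"
 unfolding L2_def sqi_def by auto

lemma L2_norm_sq_nsq: "L2_norm_sq Om f = nsq (lebesgue_on Om) (%x. cmod (f x))" unfolding L2_norm_sq_def nsq_def ..

lemma L2_norm_sq_nonneg: "0 <= L2_norm_sq Om f" unfolding L2_norm_sq_nsq by (rule nsq_nonneg)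

lemma L2_measurable: "f : L2 Om ==> f : bmeas (lebesgue_on Om)" by (simp add: L2_iff)

lemma L2_sqi: "f : L2 Om ==> sqi (lebesgue_on Om) (%x. cmod (f x))" by (simp add: L2_iff)

lemma sqi_bound:
 assumes "sqi M g" "f : bmeas M" "AE x in M. \<bar>f x\<bar> <= \<bar>g x\<bar>"
 shows "sqi M f" unfolding sqi_def
proof
 show "integrable M (%x. (f x)^2)"
 proof (rule Lintb_bound)
  show "integrable M (%x. (g x)^2)" using assms(1) by (simp add: sqi_def)
  show "AE x in M. norm ((f x)^2) <= norm ((g x)^2)" using assms(3) by eventually_elim (simp add: abs_le_square_iff)
 qed (use assms(2) in measurable)
qed (rule assms(2))

lemma L2_diff:
 assumes "f : L2 Om" "g : L2 Om"
 shows "(%x. f x - g x) : L2 Om" unfolding L2_iff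
proof
 note m = L2_measurable[OF assms(1)] L2_measurable[OF assms(2)]
 show "(%x. f x - g x) : bmeas (lebesgue_on Om)" by (intro borel_measurable_diff m)
 show "sqi (lebesgue_on Om) (%x. cmod (f x - g x))"
 proof (rule sqi_bound[OF sqi_add[OF L2_sqi[OF assms(1)] L2_sqi[OF assms(2)]]])
  show "(%x. cmod (f x - g x)) : bmeas (lebesgue_on Om)" by (intro cmod_measurable borel_measurable_diff m)
  show "AE x in lebesgue_on Om. \<bar>cmod (f x - g x)\<bar> <= \<bar>cmod (f x) + cmod (g x)\<bar>" by (rule AE_I2) (simp add: norm_triangle_ineq4)
 qed
qed

lemma L2_AE_cong:
 fixes f g :: "real^'n::finite => complex"
 assumes "f : L2 (cube L)" "AE x in cm L. f x = g x"
 shows "g : L2 (cube L)" unfolding L2_iff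
proof
 show m: "g : bmeas (cm L)" by (rule measurable_AE_cube[OF L2_measurable[OF assms(1)] assms(2)])
 show "sqi (cm L) (%x. cmod (g x))"
 proof (rule sqi_bound[OF L2_sqi[OF assms(1)]])
  show "(%x. cmod (g x)) : bmeas (cm L)" using m by (rule cmod_measurable)
  show "AE x in cm L. \<bar>cmod (g x)\<bar> <= \<bar>cmod (f x)\<bar>" using assms(2) by eventually_elim simp
 qed
qed

lemma L2_norm_sq_AE_cong:
 fixes f g :: "real^'n::finite => complex"
 assumes "f : bmeas (cm L)" "AE x in cm L. f x = g x"
 shows "L2_norm_sq (cube L) f = L2_norm_sq (cube L) g"
proof -
 note m [measurable] = assms(1) measurable_AE_cube[OF assms]
 show ?thesis unfolding L2_norm_sq_def
 proof (rule integral_cong_AE)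
  show "AE x in cm L. (cmod (f x))^2 = (cmod (g x))^2" using assms(2) by eventually_elim simp
 qed measurable
qed

lemma L2_integrable_mult:
 assumes "f : L2 Om" "g : L2 Om"
 shows "integrable (lebesgue_on Om) (%x. f x*g x)"
proof (rule Lintb_bound)
 show "integrable (lebesgue_on Om) (%x. cmod (f x)*cmod (g x))" by (rule sqi_integrable_mult[OF L2_sqi[OF assms(1)] L2_sqi[OF assms(2)]])
 show "(%x. f x*g x) : bmeas (lebesgue_on Om)"
  using L2_measurable[OF assms(1)] L2_measurable[OF assms(2)] by (rule borel_measurable_times)
qed (simp add: norm_mult)

lemma L2_Cauchy_Schwarz:
 assumes "f : L2 Om" "g : L2 Om"
 shows "(cmod (LINT x|lebesgue_on Om. f x*g x))^2 <= L2_norm_sq Om f*L2_norm_sq Om g"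
proof -
 have "cmod (LINT x|lebesgue_on Om. f x*g x) <= (LINT x|lebesgue_on Om. cmod (f x*g x))" by (rule integral_norm_bound)
 also have "... = ipr (lebesgue_on Om) (%x. cmod (f x)) (%x. cmod (g x))" unfolding ipr_def by (simp add: norm_mult)
 finally have "(cmod (LINT x|lebesgue_on Om. f x*g x))^2 <= (ipr (lebesgue_on Om) (%x. cmod (f x)) (%x. cmod (g x)))^2"
  by (rule power_mono) simp
 also have "... <= L2_norm_sq Om f*L2_norm_sq Om g"
  unfolding L2_norm_sq_nsq by (rule ipr_Cauchy_Schwarz[OF L2_sqi[OF assms(1)] L2_sqi[OF assms(2)]])
 finally show ?thesis .
qed

lemma L2_mult_tendsto:
 assumes f: "f : L2 Om" and g: "g : L2 Om" "!!m. g' m : L2 Om"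
  and lim: "(%m. L2_norm_sq Om (%x. g' m x - g x)) ~~> 0"
 shows "(%m. LINT x|lebesgue_on Om. f x*g' m x) ~~> (LINT x|lebesgue_on Om. f x*g x)"
proof -
 let ?d = "%m. (LINT x|lebesgue_on Om. f x*g' m x) - (LINT x|lebesgue_on Om. f x*g x)"
 have d: "?d m = (LINT x|lebesgue_on Om. f x*(g' m x - g x))" for m
  unfolding right_diff_distrib by (rule Lint_diff[symmetric]) (intro L2_integrable_mult f g)+
 have "(%m. L2_norm_sq Om f*L2_norm_sq Om (%x. g' m x - g x)) ~~> L2_norm_sq Om f*0"
  by (intro tendsto_mult_left lim)
 then have lim0: "(%m. L2_norm_sq Om f*L2_norm_sq Om (%x. g' m x - g x)) ~~> 0" by simp
 have "(%m. (cmod (?d m))^2) ~~> 0"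
 proof (rule tendsto_sandwich[OF _ _ tendsto_const lim0])
  show "\<forall>\<^sub>F m in sequentially. (cmod (?d m))^2 <= L2_norm_sq Om f*L2_norm_sq Om (%x. g' m x - g x)"
   unfolding d by (intro always_eventually allI L2_Cauchy_Schwarz L2_diff f g)
 qed simp
 then have "(%m. sqrt ((cmod (?d m))^2)) ~~> sqrt 0" by (rule tendsto_real_sqrt)
 then have "(%m. cmod (?d m)) ~~> 0" by simp
 then have "?d ~~> 0" by (rule tendsto_norm_zero_cancel)
 then show ?thesis by (simp add: LIM_zero_iff)
qed

lemma continuous_L2_cube:
 fixes f :: "real^'n::finite => complex"
 assumes "cont f"
 shows "f : L2 (cube L)" unfolding L2_iff
proof
 show m: "f : bmeas (cm L)" by (intro borel_measurable_on_cube bmeas_contI assms)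
 let ?C = "cbox (\<chi> i. - L/2) (\<chi> i. L/2) :: (real^'n) set"
 have "bounded (f ` ?C)" by (intro compact_imp_bounded compact_continuous_image compact_cbox continuous_on_subset[OF assms]) simp
 then obtain B where B: "!!x. x : ?C ==> cmod (f x) <= B" unfolding bounded_iff by blast
 have "cube L \<subseteq> ?C" unfolding cube_eq_box by (rule box_subset_cbox)
 then have "cmod (f x) <= B" if "x : cube L" for x using that B by blast
 then show "sqi (cm L) (%x. cmod (f x))" by (intro sqi_bounded_cube(1)[where B = B] cmod_measurable m) simp
qed

lemma L2_locally_integrable:
 fixes f :: "real^'n::finite => complex"
 assumes "f : L2 (cube L)"
 shows "locally_integrable (cube L) f"
proof -
 have "integrable (cm L) (%x. f x*1)" by (rule L2_integrable_mult[OF assms continuous_L2_cube]) simp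
 then have *: "set_integrable lebesgue (cube L) f" unfolding set_integrable_def by (subst (asm) integrable_restrict_space) simp_all
 have "f absolutely_integrable_on K" if "compact K" "K \<subseteq> cube L" for K
 proof (rule set_integrable_subset[OF * _ that(2)])
  have "K : sets borel" using compact_imp_closed[OF that(1)] by (rule borel_closed)
  then show "K : sets lebesgue" by simp
 qed
 then show ?thesis unfolding locally_integrable_def by blast
qed

lemma has_weak_pderivD: "has_weak_pderiv Om i u g ==> ph : test_functions Om ==>
   (LINT x|lebesgue_on Om. u x*pderiv_at i ph x) = - (LINT x|lebesgue_on Om. g x*ph x)"
 "has_weak_pderiv Om i u g ==> locally_integrable Om u" "has_weak_pderiv Om i u g ==> locally_integrable Om g"
 unfolding has_weak_pderiv_def by simp_all

lemma locally_integrable_diff: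
 "locally_integrable Om f ==> locally_integrable Om f' ==> locally_integrable Om (%x. f x - f' x)"
 unfolding locally_integrable_def by (simp add: set_integral_diff)

lemma weak_pderiv_unique:
 fixes u :: "real^'n::finite => complex"
 assumes g: "hwpd L i u g" and g': "hwpd L i u g'"
 shows "AE x in cm L. g x = g' x"
proof -
 have l: "locally_integrable (cube L) g" "locally_integrable (cube L) g'" by (rule has_weak_pderivD(3)[OF g] has_weak_pderivD(3)[OF g'])+
 have "AE x in cm L. g x - g' x = 0"
 proof (rule du_Bois_Reymond)
  show "locally_integrable (cube L) (%x. g x - g' x)" by (rule locally_integrable_diff[OF l])
  fix ph :: "real^'n => complex" assume ph: "ph : test_functions (cube L)"
  from ph obtain K where K: "compact K" "K \<subseteq> cube L" "!!x. x \<notin> K ==> ph x = 0" by (rule test_function_support) (rule that)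
  have int: "integrable (cm L) (%x. g x*ph x)" "integrable (cm L) (%x. g' x*ph x)"
   by (rule integrable_loc_mult[OF l(1) _ test_functionD(2)[OF ph] K] integrable_loc_mult[OF l(2) _ test_functionD(2)[OF ph] K]; simp)+
  have "(LINT x|cm L. (g x - g' x)*ph x) = (LINT x|cm L. g x*ph x) - (LINT x|cm L. g' x*ph x)"
   unfolding left_diff_distrib by (rule Lint_diff[OF int])
  also have "... = 0" using has_weak_pderivD(1)[OF g ph] has_weak_pderivD(1)[OF g' ph] by simp
  finally show "(LINT x|cm L. (g x - g' x)*ph x) = 0" .
 qed
 then show ?thesis by eventually_elim simp
qed

lemma weak_pderiv_AE:
 assumes "hwpd L i u g"
 shows "AE x in cm L. wpd L i u x = g x" "hwpd L i u (wpd L i u)"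
proof -
 show h: "hwpd L i u (wpd L i u)"
  unfolding weak_pderiv_def by (rule someI[of "hwpd L i u" g, OF assms])
 show "AE x in cm L. wpd L i u x = g x" by (rule weak_pderiv_unique[OF h assms])
qed

lemma W12D:
 assumes "u : W12 (cube L)"
 shows "u : L2 (cube L)" "hwpd L i u (wpd L i u)" "wpd L i u : L2 (cube L)"
proof -
 show "u : L2 (cube L)" using assms unfolding W12_def by simp
 obtain g where g: "g : L2 (cube L)" "hwpd L i u g" using assms unfolding W12_def by blast
 show "hwpd L i u (wpd L i u)" by (rule weak_pderiv_AE(2)[OF g(2)])
 have "AE x in cm L. g x = wpd L i u x" using weak_pderiv_AE(1)[OF g(2)] by eventually_elim simp
 then show "wpd L i u : L2 (cube L)" by (rule L2_AE_cong[OF g(1)])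
qed

lemma has_weak_pderiv_diff:
 fixes u :: "real^'n::finite => complex"
 assumes g: "hwpd L i u g" and g': "hwpd L i u' g'"
 shows "hwpd L i (%x. u x - u' x) (%x. g x - g' x)"
proof -
 have l: "locally_integrable (cube L) g" "locally_integrable (cube L) g'"
  "locally_integrable (cube L) u" "locally_integrable (cube L) u'" by (rule has_weak_pderivD(2,3)[OF g] has_weak_pderivD(2,3)[OF g'])+
 show ?thesis unfolding has_weak_pderiv_def
 proof (intro conjI ballI locally_integrable_diff l)
  fix ph :: "real^'n => complex" assume ph: "ph : test_functions (cube L)"
  from ph obtain K where K: "compact K" "K \<subseteq> cube L" "!!x. x \<notin> K ==> ph x = 0" "!!x i. x \<notin> K ==> pderiv_at i ph x = 0"
   by (rule test_function_support) (rule that)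
  have c: "cube L : sets lebesgue" by simp
  have "(LINT x|cm L. (u x - u' x)*pderiv_at i ph x)
   = (LINT x|cm L. u x*pderiv_at i ph x) - (LINT x|cm L. u' x*pderiv_at i ph x)" unfolding left_diff_distrib
   by (rule Lint_diff) (rule integrable_loc_mult[OF _ c test_functionD(3)[OF ph] K(1,2,4)], rule l, assumption)+
  also have "... = - ((LINT x|cm L. g x*ph x) - (LINT x|cm L. g' x*ph x))"
   unfolding has_weak_pderivD(1)[OF g ph] has_weak_pderivD(1)[OF g' ph] by simp
  also have "(LINT x|cm L. g x*ph x) - (LINT x|cm L. g' x*ph x) = (LINT x|cm L. (g x - g' x)*ph x)"
   unfolding left_diff_distrib
   by (rule Lint_diff[symmetric]) (rule integrable_loc_mult[OF _ c test_functionD(2)[OF ph] K(1,2,3)], rule l, assumption)+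
  finally show "(LINT x|cm L. (u x - u' x)*pderiv_at i ph x) = - (LINT x|cm L. (g x - g' x)*ph x)" .
 qed
qed

lemma W12_diff:
 assumes "u : W12 (cube L)" "v : W12 (cube L)"
 shows "(%x. u x - v x) : W12 (cube L)"
  "AE x in cm L. wpd L i (%x. u x - v x) x = wpd L i u x - wpd L i v x"
proof -
 note d = has_weak_pderiv_diff[OF W12D(2)[OF assms(1)] W12D(2)[OF assms(2)]]
 show "(%x. u x - v x) : W12 (cube L)" unfolding W12_def
  by (rule CollectI, intro conjI allI, rule L2_diff[OF W12D(1)[OF assms(1)] W12D(1)[OF assms(2)]],
    rule bexI, rule d, rule L2_diff[OF W12D(3)[OF assms(1)] W12D(3)[OF assms(2)]])
 show "AE x in cm L. wpd L i (%x. u x - v x) x = wpd L i u x - wpd L i v x"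
  by (rule weak_pderiv_AE(1)[OF d])
qed

lemma W12_tendsto:
 assumes u: "u : W12 (cube L)" "!!m. ph m : W12 (cube L)"
  and lim: "(%m. W12_norm_sq (cube L) (%x. ph m x - u x)) ~~> 0"
 shows "f : L2 (cube L) ==> (%m. LINT x|cm L. f x*ph m x) ~~> (LINT x|cm L. f x*u x)"
  "f : L2 (cube L) ==> (%m. LINT x|cm L. f x*wpd L i (ph m) x) ~~> (LINT x|cm L. f x*wpd L i u x)"
proof -
 assume f: "f : L2 (cube L)"
 have s: "L2_norm_sq (cube L) (wpd L i w) <= W12_norm_sq (cube L) w" "L2_norm_sq (cube L) w <= W12_norm_sq (cube L) w" for w i
 proof -
  have "L2_norm_sq (cube L) (wpd L i w) <= (\<Sum>i\<in>UNIV. L2_norm_sq (cube L) (wpd L i w))"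
   by (rule member_le_sum) (auto simp: L2_norm_sq_nonneg)
  then show "L2_norm_sq (cube L) (wpd L i w) <= W12_norm_sq (cube L) w"
   unfolding W12_norm_sq_def using L2_norm_sq_nonneg[of "cube L" w] by linarith
  show "L2_norm_sq (cube L) w <= W12_norm_sq (cube L) w" unfolding W12_norm_sq_def by (simp add: sum_nonneg L2_norm_sq_nonneg)
 qed
 show "(%m. LINT x|cm L. f x*ph m x) ~~> (LINT x|cm L. f x*u x)"
 proof (rule L2_mult_tendsto[OF f W12D(1)[OF u(1)] W12D(1)[OF u(2)]])
  show "(%m. L2_norm_sq (cube L) (%x. ph m x - u x)) ~~> 0"
   by (rule tendsto_sandwich[OF _ _ tendsto_const lim]) (auto simp: L2_norm_sq_nonneg s(2))
 qed
 show "(%m. LINT x|cm L. f x*wpd L i (ph m) x) ~~> (LINT x|cm L. f x*wpd L i u x)"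
 proof (rule L2_mult_tendsto[OF f W12D(3)[OF u(1)] W12D(3)[OF u(2)]])
  have "L2_norm_sq (cube L) (%x. wpd L i (ph m) x - wpd L i u x) <= W12_norm_sq (cube L) (%x. ph m x - u x)" for m
   using s(1)[of i "%x. ph m x - u x"]
    L2_norm_sq_AE_cong[OF L2_measurable[OF W12D(3)[OF W12_diff(1)[OF u(2)[of m] u(1)]]] W12_diff(2)[OF u(2)[of m] u(1)]] by simp
  then show "(%m. L2_norm_sq (cube L) (%x. wpd L i (ph m) x - wpd L i u x)) ~~> 0"
   by (intro tendsto_sandwich[OF _ _ tendsto_const lim]) (auto simp: L2_norm_sq_nonneg)
 qed
qed

subsection \<open>Classical derivatives are weak derivatives\<close>

lemma pderiv_at_mult:
 assumes "f differentiable at x" "g differentiable at x"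
 shows "(%x. f x*g x) differentiable at x" "pderiv_at i (%x. f x*g x) x = f x*pderiv_at i g x + pderiv_at i f x*g x"
proof -
 have d: "((%x. f x*g x) has_derivative (%h. f x*frechet_derivative g (at x) h + frechet_derivative f (at x) h*g x)) (at x)"
  using assms unfolding frechet_derivative_works by (rule has_derivative_mult)
 show "(%x. f x*g x) differentiable at x" using d by (rule differentiableI)
 show "pderiv_at i (%x. f x*g x) x = f x*pderiv_at i g x + pderiv_at i f x*g x"
  using pderiv_at_eq[OF d, of i] by (simp only: pderiv_at_def)
qed

lemma integral_pderiv_eq_0:
 fixes f :: "real^'n::finite => complex"
 assumes f: "!!x. f differentiable at x" and c: "cont (pderiv_at i f)"
  and R: "!!x. norm x > R ==> f x = 0"
 shows "(LBINT x. pderiv_at i f x) = 0"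
proof -
 have d: "(f has_derivative frechet_derivative f (at x)) (at x)" for x using f unfolding frechet_derivative_works .
 have R': "pderiv_at i f x = 0" if "norm x > R" for x unfolding pderiv_at_def by (rule derivative_zero_outside[OF _ d that]) (rule R)
 have int: "integrable lborel (pderiv_at i f)" by (rule integrable_bounded_support[OF c R'])
 have "(LBINT x. Re (pderiv_at i f x)) = 0" unfolding pderiv_at_def
 proof (rule integral_directional_derivative_eq_0[where R = R])
  show "((%x. Re (f x)) has_derivative (%h. Re (frechet_derivative f (at x) h))) (at x)" for x
   by (rule bounded_linear.has_derivative[OF bounded_linear_Re d])
  show "cont (%x. Re (frechet_derivative f (at x) (axis i 1)))" using continuous_on_Re[OF c] unfolding pderiv_at_def .
 qed (simp add: R)
 moreover have "(LBINT x. Im (pderiv_at i f x)) = 0" unfolding pderiv_at_def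
 proof (rule integral_directional_derivative_eq_0[where R = R])
  show "((%x. Im (f x)) has_derivative (%h. Im (frechet_derivative f (at x) h))) (at x)" for x
   by (rule bounded_linear.has_derivative[OF bounded_linear_Im d])
  show "cont (%x. Im (frechet_derivative f (at x) (axis i 1)))" using continuous_on_Im[OF c] unfolding pderiv_at_def .
 qed (simp add: R)
 ultimately show ?thesis using int by (intro complex_eqI) simp_all
qed

lemma LINT_cube_eq_lborel:
 fixes w :: "real^'n::finite => complex"
 assumes w: "cont w"
 shows "(LINT x|cm L. w x) = (LBINT x. ind (cube L) x *: w x)"
proof -
 have m: "w : bmeas borel" using w by (rule bmeas_contI)
 have "(LINT x|cm L. w x) = (LINT x|lebesgue. ind (cube L) x *: w x)" by (rule integral_restrict_space) simp
 also have "... = (LBINT x. ind (cube L) x *: w x)"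
  by (rule integral_completion) (intro borel_measurable_scaleR borel_measurable_indicator; use m in simp)
 finally show ?thesis .
qed

text \<open>The product of \<open>f\<close> and the test function has compact support in the cube,
  so its derivative can be integrated over the whole space, where the integral is zero.\<close>

lemma smooth_has_weak_pderiv:
 fixes f :: "real^'n::finite => complex"
 assumes f: "f : smooth"
 shows "hwpd L i f (pderiv_at i f)" unfolding has_weak_pderiv_def
proof (intro conjI ballI)
 show lf: "locally_integrable (cube L) f" "locally_integrable (cube L) (pderiv_at i f)"
  by (intro L2_locally_integrable continuous_L2_cube smoothD[OF f])+
 fix ph :: "real^'n => complex" assume ph: "ph : test_functions (cube L)"
 note phs = test_functionD[OF ph]
 from ph obtain K where K: "compact K" "K \<subseteq> cube L" "!!x. x \<notin> K ==> ph x = 0" "!!x i. x \<notin> K ==> pderiv_at i ph x = 0"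
  by (rule test_function_support) (rule that)
 obtain R where R: "!!x. x : K ==> norm x <= R" using compact_imp_bounded[OF K(1)] unfolding bounded_iff by blast
 have p: "pderiv_at i (%x. f x*ph x) = (%x. f x*pderiv_at i ph x + pderiv_at i f x*ph x)"
  by (rule ext) (rule pderiv_at_mult[OF smoothD(1)[OF f] smoothD(1)[OF phs(1)]])
 have pc: "cont (%x. f x*pderiv_at i ph x + pderiv_at i f x*ph x)"
  by (intro continuous_on_add continuous_on_mult smoothD(3,4)[OF f] phs)
 have "(LBINT x. pderiv_at i (%x. f x*ph x) x) = 0"
 proof (rule integral_pderiv_eq_0)
  show "(%x. f x*ph x) differentiable at x" for x by (rule pderiv_at_mult[OF smoothD(1)[OF f] smoothD(1)[OF phs(1)]])
  show "cont (pderiv_at i (%x. f x*ph x))" unfolding p by (rule pc)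
  show "f x*ph x = 0" if "R < norm x" for x
  proof -
   have "x \<notin> K" using R[of x] that by linarith
   from K(3)[OF this] show ?thesis by simp
  qed
 qed
 then have "(LBINT x. f x*pderiv_at i ph x + pderiv_at i f x*ph x) = 0" unfolding p .
 moreover have "ind (cube L) x *: (f x*pderiv_at i ph x + pderiv_at i f x*ph x) = f x*pderiv_at i ph x + pderiv_at i f x*ph x" for x
 proof (cases "x : cube L")
  case False
  then have "x \<notin> K" using K(2) by (rule contra_subsetD[rotated])
  from K(3)[OF this] K(4)[OF this, of i] show ?thesis by simp
 qed simp
 ultimately have "(LINT x|cm L. f x*pderiv_at i ph x + pderiv_at i f x*ph x) = 0" unfolding LINT_cube_eq_lborel[OF pc] by simp
 moreover have "(LINT x|cm L. f x*pderiv_at i ph x + pderiv_at i f x*ph x)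
   = (LINT x|cm L. f x*pderiv_at i ph x) + (LINT x|cm L. pderiv_at i f x*ph x)"
  by (intro Lint_add L2_integrable_mult continuous_L2_cube smoothD(3,4)[OF f] phs)
 ultimately show "(LINT x|cm L. f x*pderiv_at i ph x) = - (LINT x|cm L. pderiv_at i f x*ph x)"
  by (simp add: eq_neg_iff_add_eq_0)
qed

lemma smooth_W12:
 fixes f :: "real^'n::finite => complex"
 assumes f: "f : smooth"
 shows "f : W12 (cube L)" "AE x in cm L. wpd L i f x = pderiv_at i f x"
proof -
 show "f : W12 (cube L)" unfolding W12_def
 proof (rule CollectI, intro conjI allI)
  show "f : L2 (cube L)" by (rule continuous_L2_cube[OF smoothD(3)[OF f]])
  show "\<exists>g\<in>L2 (cube L). hwpd L i f g" for i
   by (rule bexI, rule smooth_has_weak_pderiv[OF f], rule continuous_L2_cube[OF smoothD(4)[OF f]])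
 qed
 show "AE x in cm L. wpd L i f x = pderiv_at i f x" by (rule weak_pderiv_AE(1)[OF smooth_has_weak_pderiv[OF f]])
qed

subsection \<open>Limits of products\<close>

lemma cprod_L2_tendsto:
 fixes g :: "'n::finite => real => real"
 assumes c: "!!m i. cont (f m i)" "!!i. cont (g i)"
  and b: "!!i. \<exists>B. \<forall>m s. - L/2 < s & s < L/2 --> \<bar>f m i s\<bar> <= B"
  and lim: "!!i s. - L/2 < s ==> s < L/2 ==> (%m. f m i s) ~~> g i s"
 shows "(%m. L2_norm_sq (cube L) (%x. cprod (f m) x - cprod g x)) ~~> 0"
proof -
 interpret finite_measure "lebesgue_on (cube L :: (real^'n) set)" by (rule finite_measure_cube)
 obtain B where B: "!!i m s. - L/2 < s ==> s < L/2 ==> \<bar>f m i s\<bar> <= B i" using b by metis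
 have Q: "- L/2 < x $ i" "x $ i < L/2" if "x : cube L" for x :: "real^'n" and i using that unfolding cube_def by simp_all
 have pc: "cont (prodf h)" if "!!i. cont (h i)" for h :: "'n => real => real"
  unfolding prodf_def[abs_def] by (intro continuous_on_prod cont_comp2[OF that] continuous_intros) simp_all
 define P where "P = (\<Prod>i\<in>(UNIV::'n set). B i)"
 have fP: "\<bar>prodf (f m) x\<bar> <= P" if "x : cube L" for m x
  unfolding prodf_def abs_prod P_def using B[OF Q[OF that]] by (intro prod_mono) simp
 have l: "(%m. prodf (f m) x) ~~> prodf g x" if "x : cube L" for x
  unfolding prodf_def by (intro tendsto_prod lim Q that)
 have gP: "\<bar>prodf g x\<bar> <= P" if "x : cube L" for x
  by (rule LIMSEQ_le_const2[OF tendsto_rabs[OF l[OF that]]]) (use fP[OF that] in blast)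
 have "(%m. LINT x|cm L. (prodf (f m) x - prodf g x)^2) ~~> (LINT x|lebesgue_on (cube L :: (real^'n) set). 0)"
 proof (rule integral_dominated_convergence[where w = "%_. (2*P)^2"])
  show "integrable (cm L) (%_ :: real^'n. (2*P)^2)" by simp
  show "(%x. (prodf (f m) x - prodf g x)^2) : bmeas (cm L)" for m
   by (intro borel_measurable_on_cube bmeas_contI continuous_intros pc c)
  show "AE x in cm L. (%m. (prodf (f m) x - prodf g x)^2) ~~> 0"
  proof (rule AE_I2)
   fix x :: "real^'n" assume "x : space (cm L)"
   then have "(%m. (prodf (f m) x - prodf g x)^2) ~~> (prodf g x - prodf g x)^2"
    by (intro tendsto_power tendsto_diff l tendsto_const) simp
   then show "(%m. (prodf (f m) x - prodf g x)^2) ~~> 0" by simp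
  qed
  show "AE x in cm L. norm ((prodf (f m) x - prodf g x)^2) <= (2*P)^2" for m
  proof (rule AE_I2)
   fix x :: "real^'n" assume "x : space (cm L)"
   then have x: "x : cube L" by simp
   have "\<bar>prodf (f m) x - prodf g x\<bar> <= 2*P" using fP[OF x, of m] gP[OF x] by linarith
   then have "\<bar>prodf (f m) x - prodf g x\<bar>^2 <= (2*P)^2" by (rule power_mono) simp
   then show "norm ((prodf (f m) x - prodf g x)^2) <= (2*P)^2" by simp
  qed
 qed simp
 moreover have "(cmod (cprod (f m) x - cprod g x))^2 = (prodf (f m) x - prodf g x)^2" for m and x :: "real^'n"
  unfolding of_real_diff[symmetric] norm_of_real by simp
 ultimately show ?thesis unfolding L2_norm_sq_def by simp
qed

lemma cprod_plateau_test_function: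
 fixes f :: "'n::finite => real => real"
 assumes "!!i. sm1 (f i)"
 shows "cprod (%i s. plateau (- L/2) (L/2) (real (Suc m)) s*f i s) : test_functions (cube L)"
proof (rule cprod_test_function[where a = "%_. - L/2 + 1/real (Suc m)" and b = "%_. L/2 - 1/real (Suc m)"])
 show "sm1 (%s. plateau (- L/2) (L/2) (real (Suc m)) s*f i s)" for i by (intro sm1_mult plateau_sm1 assms)
 show "plateau (- L/2) (L/2) (real (Suc m)) s*f i s = 0" if "s < - L/2 + 1/real (Suc m) \<or> L/2 - 1/real (Suc m) < s" for i s
  using plateau_eq_0[OF _ that] by simp
qed simp_all

lemma plateau_mult_tendsto:
 assumes "- L/2 < s" "s < L/2"
 shows "(%m. plateau (- L/2) (L/2) (real (Suc m)) s*c) ~~> c"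
proof (rule tendsto_eventually)
 show "\<forall>\<^sub>F m in sequentially. plateau (- L/2) (L/2) (real (Suc m)) s*c = c" using plateau_eventually_1[OF assms]
 proof eventually_elim
  case (elim m)
  from eventually_nhds_x_imp_x[OF this] show ?case by simp
 qed
qed

lemma plateau_mult_le: "\<bar>plateau a b m s*c\<bar> <= \<bar>c\<bar>"
 using mult_right_mono[of "\<bar>plateau a b m s\<bar>" 1 "\<bar>c\<bar>"] plateau_bounds[of a b m s] by (simp add: abs_mult)

subsection \<open>The trigonometric basis in the form domain\<close>

definition ebas :: "boundary_condition => real => ('n => nat) => 'n => real => real" where
 "ebas bc L k = (%i. bf bc L (k i))"

definition ebas' :: "boundary_condition => real => ('n => nat) => 'n => 'n => real => real" where
 "ebas' bc L k i = (ebas bc L k)(i := bf' bc L (k i))"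

lemma sm1_bf: "sm1 (bf bc L j)" and deriv_bf: "deriv (bf bc L j) = bf' bc L j"
 and sm1_bf': "sm1 (bf' bc L j)" and deriv_bf': "deriv (bf' bc L j) = (%x. - (bfreq bc L j)\<^sup>2*bf bc L j x)"
proof -
 have "bf bc L j = (%x. 1* sin (bfreq bc L j*x + bphase bc j))" by (simp add: bf_def fun_eq_iff)
 then show s: "sm1 (bf bc L j)" by (simp only: sm1_sin)
 show d: "deriv (bf bc L j) = bf' bc L j" by (rule ext) (rule DERIV_imp_deriv[OF bf_DERIV(1)])
 show "sm1 (bf' bc L j)" using sm1_deriv(1)[OF s] unfolding d .
 show "deriv (bf' bc L j) = (%x. - (bfreq bc L j)\<^sup>2*bf bc L j x)" by (rule ext) (rule DERIV_imp_deriv[OF bf_DERIV(2)])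
qed

lemma sm1_ebas: "sm1 (ebas bc L k i)" "sm1 (ebas' bc L k j i)" by (simp_all add: ebas_def ebas'_def sm1_bf sm1_bf')

lemma ebas_smooth: "cprod (ebas bc L k) : smooth" "cprod (ebas' bc L k i) : smooth" by (intro cprod_smooth sm1_ebas)+

lemma pderiv_ebas: "pderiv_at i (cprod (ebas bc L k)) = cprod (ebas' bc L k i)"
 "pderiv_at i (cprod (ebas' bc L k i)) = (%x. - cr ((bfreq bc L (k i))^2)*cprod (ebas bc L k) x)"
proof -
 show "pderiv_at i (cprod (ebas bc L k)) = cprod (ebas' bc L k i)" unfolding pderiv_cprod[OF sm1_ebas(1)] by (simp add: ebas_def ebas'_def deriv_bf)
 have "prodf ((ebas' bc L k i)(i := %x. - (bfreq bc L (k i))\<^sup>2*bf bc L (k i) x)) x = - (bfreq bc L (k i))\<^sup>2*prodf (ebas bc L k) x" for x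
  unfolding prodf_def by (subst (1 2) prod.remove[of _ i]) (auto simp: ebas_def ebas'_def)
 note * = this
 have d: "deriv (ebas' bc L k i i) = (%x. - (bfreq bc L (k i))\<^sup>2*bf bc L (k i) x)" by (simp add: ebas'_def deriv_bf')
 show "pderiv_at i (cprod (ebas' bc L k i)) = (%x. - cr ((bfreq bc L (k i))^2)*cprod (ebas bc L k) x)"
  unfolding pderiv_cprod[OF sm1_ebas(2)] d * by (simp add: fun_eq_iff)
qed

lemma bf_bounds: "\<bar>bf bc L j x\<bar> <= 1" "\<bar>bf' bc L j x\<bar> <= \<bar>bfreq bc L j\<bar>"
 unfolding bf_def bf'_def by (simp_all add: abs_mult mult_left_le)

lemma bf_boundary:
 assumes L: "L > 0"
 shows "bf Dirichlet L k (L/2) = 0" "bf Dirichlet L k (- L/2) = 0" "bf' Neumann L k (L/2) = 0" "bf' Neumann L k (- L/2) = 0"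
proof -
 show "bf Dirichlet L k (L/2) = 0" "bf Dirichlet L k (- L/2) = 0" using L sin_npi[of "Suc k"] by (simp_all add: bf_Dirichlet add.commute)
 have p: "bfreq Neumann L k*(L/2) + bphase Neumann k = real k*pi + pi/2" "bfreq Neumann L k*(- L/2) + bphase Neumann k = pi/2"
  using L by (simp_all add: field_simps)
 show "bf' Neumann L k (L/2) = 0" "bf' Neumann L k (- L/2) = 0" unfolding bf'_def p by (simp_all add: cos_add)
qed

text \<open>Cutting off a factor that vanishes at the end points changes its derivative only boundedly.\<close>

lemma plateau_L2_tendsto:
 fixes f :: "'n::finite => real => real" and L :: real
 assumes f: "!!j. sm1 (f j)"
 defines "p \<equiv> %m j s. plateau (- L/2) (L/2) (real (Suc m)) s*f j s"
 shows "(%m. L2_norm_sq (cube L) (%x. cprod (p m) x - cprod f x)) ~~> 0"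
  and "f i (- L/2) = 0 ==> f i (L/2) = 0 ==>
   (%m. L2_norm_sq (cube L) (%x. pderiv_at i (cprod (p m)) x - pderiv_at i (cprod f) x)) ~~> 0"
  and "cprod (p m) : test_functions (cube L)"
proof -
 have ps: "sm1 (p m j)" for m j unfolding p_def by (intro sm1_mult plateau_sm1 f)
 have bd: "\<exists>B. \<forall>m s. - L/2 < s & s < L/2 --> \<bar>p m j s\<bar> <= B" for j
 proof -
  have "bounded (f j ` {- L/2..L/2})" by (intro compact_imp_bounded compact_continuous_image continuous_on_subset[OF sm1_deriv(3)[OF f]]) auto
  then obtain B where B: "!!s. s : {- L/2..L/2} ==> \<bar>f j s\<bar> <= B" unfolding bounded_iff by force
  have "\<bar>p m j s\<bar> <= B" if "- L/2 < s & s < L/2" for m s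
   using plateau_mult_le[of "- L/2" "L/2" "real (Suc m)" s "f j s"] B[of s] that unfolding p_def by simp
  then show ?thesis by blast
 qed
 have pt: "(%m. p m j s) ~~> f j s" if "- L/2 < s" "s < L/2" for j s
  unfolding p_def by (rule plateau_mult_tendsto[OF that])
 show "(%m. L2_norm_sq (cube L) (%x. cprod (p m) x - cprod f x)) ~~> 0"
  by (rule cprod_L2_tendsto[OF sm1_deriv(3)[OF ps] sm1_deriv(3)[OF f] bd pt])
 show "cprod (p m) : test_functions (cube L)" unfolding p_def by (rule cprod_plateau_test_function[OF f])
 assume z: "f i (- L/2) = 0" "f i (L/2) = 0"
 have c: "cont ((h(i := deriv (h i))) j)" if "!!j. sm1 (h j)" for h :: "'n => real => real" and j
  using that by (simp add: sm1_deriv(3) sm1_deriv(3)[OF sm1_deriv(1)])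
 have pi: "p m i = (%s. plateau (- L/2) (L/2) (real (Suc m)) s*f i s)" for m by (simp add: p_def)
 show "(%m. L2_norm_sq (cube L) (%x. pderiv_at i (cprod (p m)) x - pderiv_at i (cprod f) x)) ~~> 0"
  unfolding pderiv_cprod[OF ps] pderiv_cprod[OF f]
 proof (rule cprod_L2_tendsto[OF c[OF ps] c[OF f]])
  fix j
  show "\<exists>B. \<forall>m s. - L/2 < s & s < L/2 --> \<bar>((p m)(i := deriv (p m i))) j s\<bar> <= B"
   using plateau_mult_deriv_bounded[OF f z] bd[of j] unfolding pi by (cases "j = i") simp_all
  show "(%m. ((p m)(i := deriv (p m i))) j s) ~~> (f(i := deriv (f i))) j s" if "- L/2 < s" "s < L/2" for s
   using tendsto_eventually[OF plateau_mult_deriv_eventually[OF f that, of i]] pt[OF that, of j] unfolding pi by (cases "j = i") simp_all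
 qed
qed

text \<open>Here \<open>u\<close> is an arbitrary element of \<open>W12\<close>, in general no limit
  of test functions, so the cutoff is put on the other factor. \<open>bf'\<close> vanishes on the
  two faces normal to direction \<open>i\<close>; therefore the cut-off products converge together
  with their \<open>i\<close>-th derivative, and the identity involves no other derivative.\<close>

lemma Neumann_ibp:
 fixes u :: "real^'n::finite => complex"
 assumes L: "L > 0" and u: "u : W12 (cube L)"
 shows "(LINT x|cm L. cprod (ebas' Neumann L k i) x*wpd L i u x)
   = cr ((bfreq Neumann L (k i))^2)*(LINT x|cm L. cprod (ebas Neumann L k) x*u x)"
proof -
 let ?e = "ebas Neumann L k" and ?e' = "ebas' Neumann L k i"
 define f where "f m = (%j s. plateau (- L/2) (L/2) (real (Suc m)) s*?e' j s)" for m
 have z: "?e' i (- L/2) = 0" "?e' i (L/2) = 0" using bf_boundary(3,4)[OF L] by (simp_all add: ebas'_def)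
 note pl = plateau_L2_tendsto[where f = ?e' and L = L, OF sm1_ebas(2), folded f_def]
 note T = test_functionD[OF pl(3)]
 have c: "cprod ?e' : L2 (cube L)" "pderiv_at i (cprod ?e') : L2 (cube L)" "cprod (f m) : L2 (cube L)" "pderiv_at i (cprod (f m)) : L2 (cube L)" for m
  by (intro continuous_L2_cube smoothD(3,4) ebas_smooth T)+
 have "(%m. LINT x|cm L. u x*pderiv_at i (cprod (f m)) x) ~~> (LINT x|cm L. u x*pderiv_at i (cprod ?e') x)"
  by (rule L2_mult_tendsto[OF W12D(1)[OF u] c(2) c(4) pl(2)[OF z]])
 moreover have "(%m. LINT x|cm L. wpd L i u x*cprod (f m) x) ~~> (LINT x|cm L. wpd L i u x*cprod ?e' x)"
  by (rule L2_mult_tendsto[OF W12D(3)[OF u] c(1) c(3) pl(1)])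
 ultimately have "(LINT x|cm L. u x*pderiv_at i (cprod ?e') x) = - (LINT x|cm L. wpd L i u x*cprod ?e' x)"
  unfolding has_weak_pderivD(1)[OF W12D(2)[OF u] pl(3)] by (intro LIMSEQ_unique) (assumption, rule tendsto_minus)
 moreover define c where "c = cr ((bfreq Neumann L (k i))^2)"
 have "u x*pderiv_at i (cprod ?e') x = - c*(cprod ?e x*u x)" for x unfolding pderiv_ebas c_def by simp
 ultimately have "- c*(LINT x|cm L. cprod ?e x*u x) = - (LINT x|cm L. wpd L i u x*cprod ?e' x)"
  by (simp only: Lint_mult_right_zero)
 then show ?thesis unfolding c_def[symmetric] by (simp add: mult.commute)
qed

text \<open>Both sides are continuous in \<open>u\<close> for the norm of \<open>W12\<close>, so the
  identity passes from \<open>S\<close> to its closure.\<close>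

lemma W12_closure_ibp:
 fixes u :: "real^'n::finite => complex"
 assumes u: "u : W12_closure (cube L) S" and S: "S \<subseteq> smooth" and e: "e : L2 (cube L)" "e' : L2 (cube L)"
  and eq: "!!ph. ph : S ==> (LINT x|cm L. e' x*pderiv_at i ph x) = c*(LINT x|cm L. e x*ph x)"
 shows "(LINT x|cm L. e' x*wpd L i u x) = c*(LINT x|cm L. e x*u x)"
proof -
 obtain ph where uW: "u : W12 (cube L)" and ph: "!!m. ph m : S"
  and lim: "(%m. W12_norm_sq (cube L) (%x. ph m x - u x)) ~~> 0" using u unfolding W12_closure_def by blast
 have s: "ph m : smooth" for m using ph S by (rule subsetD[rotated])
 note W = smooth_W12(1)[OF s]
 have "(LINT x|cm L. e' x*wpd L i (ph m) x) = (LINT x|cm L. e' x*pderiv_at i (ph m) x)" for m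
 proof (rule integral_cong_AE)
  show "(%x. e' x*wpd L i (ph m) x) : bmeas (cm L)"
   "(%x. e' x*pderiv_at i (ph m) x) : bmeas (cm L)"
   by (intro borel_measurable_times L2_measurable e W12D(3)[OF W] continuous_L2_cube smoothD(4) s)+
  show "AE x in cm L. e' x*wpd L i (ph m) x = e' x*pderiv_at i (ph m) x"
   using smooth_W12(2)[OF s, of L i m] by eventually_elim simp
 qed
 then have "(%m. c*(LINT x|cm L. e x*ph m x)) ~~> (LINT x|cm L. e' x*wpd L i u x)"
  using W12_tendsto(2)[OF uW W lim e(2), of i] unfolding eq[OF ph, symmetric] by simp
 moreover have "(%m. c*(LINT x|cm L. e x*ph m x)) ~~> c*(LINT x|cm L. e x*u x)"
  by (rule tendsto_mult_left[OF W12_tendsto(1)[OF uW W lim e(1)]])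
 ultimately show ?thesis by (rule LIMSEQ_unique)
qed

text \<open>The factors vanish at both end points, so the plateau cutoffs converge in all first
  derivatives, that is, in \<open>W12\<close>.\<close>

lemma Dirichlet_form_domain:
 assumes L: "L > 0"
 shows "cprod (ebas Dirichlet L k :: 'n::finite => real => real) : form_domain Dirichlet L"
proof -
 let ?e = "ebas Dirichlet L k :: 'n => real => real"
 define f where "f m = (%j s. plateau (- L/2) (L/2) (real (Suc m)) s*?e j s)" for m
 note pl = plateau_L2_tendsto[where f = ?e and L = L, OF sm1_ebas(1), folded f_def]
 have z: "?e i (- L/2) = 0" "?e i (L/2) = 0" for i using bf_boundary(1,2)[OF L] by (simp_all add: ebas_def)
 have fs: "cprod (f m) : smooth" for m by (rule test_functionD(1)[OF pl(3)])
 have "L2_norm_sq (cube L) (wpd L i (%x. cprod (f m) x - cprod ?e x))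
   = L2_norm_sq (cube L) (%x. pderiv_at i (cprod (f m)) x - pderiv_at i (cprod ?e) x)" for i m
 proof (rule L2_norm_sq_AE_cong)
  have s: "(%x. cprod (f m) x - cprod ?e x) : smooth" by (intro smooth_diff fs ebas_smooth)
  show "wpd L i (%x. cprod (f m) x - cprod ?e x) : bmeas (cm L)"
   by (rule L2_measurable[OF W12D(3)[OF smooth_W12(1)[OF s]]])
  have "pderiv_at i (%x. cprod (f m) x - cprod ?e x) x = pderiv_at i (cprod (f m)) x - pderiv_at i (cprod ?e) x" for x
   by (intro pderiv_at_diff smoothD(1) fs ebas_smooth)
  then show "AE x in cm L. wpd L i (%x. cprod (f m) x - cprod ?e x) x = pderiv_at i (cprod (f m)) x - pderiv_at i (cprod ?e) x"
   using smooth_W12(2)[OF s, of L i] by simp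
 qed
 then have "(%m. W12_norm_sq (cube L) (%x. cprod (f m) x - cprod ?e x)) ~~> 0 + (\<Sum>i\<in>(UNIV::'n set). 0)"
  unfolding W12_norm_sq_def by (intro tendsto_add tendsto_sum pl(1)) (simp only: pl(2)[OF z])
 then have "(%m. W12_norm_sq (cube L) (%x. cprod (f m) x - cprod ?e x)) ~~> 0" by simp
 then show ?thesis unfolding form_domain.simps W12_closure_def
  by (intro CollectI conjI exI[of _ "%m. cprod (f m)"] allI pl(3) smooth_W12(1)[OF ebas_smooth(1)])
qed

subsection \<open>Periodic boundary conditions\<close>

lemma integrable_subcube:
 fixes g :: "real^'n::finite => real"
 assumes "cont g" "S : sets borel" "S \<subseteq> cube L"
 shows "integrable lborel (%x. ind S x*g x)"
proof (rule Lintb_bound)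
 let ?C = "cbox (\<chi> i. - L/2) (\<chi> i. L/2) :: (real^'n) set"
 show "integrable lborel (%x. ind ?C x*g x)" by (intro integrable_compact_cont compact_cbox assms)
 show "(%x. ind S x*g x) : bmeas lborel" using assms(2) bmeas_contI[OF assms(1)] by simp
 have "S \<subseteq> ?C" using assms(3) unfolding cube_eq_box by (rule order_trans) (rule box_subset_cbox)
 then show "AE x in lborel. norm (ind S x*g x) <= norm (ind ?C x*g x)" by (intro AE_I2) (auto simp: indicator_def)
qed

text \<open>The cube is cut by a hyperplane into two pieces. One is translated by \<open>h\<close>,
  the other by \<open>h - L\<close>, and by periodicity the latter translation has the same effect
  on \<open>F\<close> as one by \<open>h\<close>.\<close>

lemma integral_periodic_shift:
 fixes F :: "real^'n::finite => real"
 assumes h: "0 <= h" "h <= L" and F: "cont F" and per: "!!x. F (x + axis i L) = F x"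
 shows "(LBINT x. ind (cube L) x*F (x + axis i h)) = (LBINT x. ind (cube L) x*F x)"
proof -
 let ?Q = "cube L :: (real^'n) set"
 let ?A = "%c. ?Q \<inter> {x. x $ i < c}" and ?B = "%c. ?Q \<inter> {x. c < x $ i}"
 have Ab: "?A c : sets borel" "?B c : sets borel" for c by (intro sets.Int cube_sets borel_open open_Collect_less continuous_intros)+
 have split: "(LBINT x. ind ?Q x*g x) = (LBINT x. ind (?A c) x*g x) + (LBINT x. ind (?B c) x*g x)"
  if g: "cont g" for c and g :: "real^'n => real"
 proof -
  note gm = bmeas_contI[OF g]
  have "AE x in lborel. x \<notin> {x :: real^'n. x $ i = c}"
  proof (rule AE_not_in)
   have "negligible {x :: real^'n. x <.> axis i 1 = c}" by (rule negligible_standard_hyperplane) simp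
   then have "negligible {x :: real^'n. x $ i = c}" by (simp add: inner_axis)
   moreover have "{x :: real^'n. x $ i = c} : sets borel" by (intro borel_closed closed_Collect_eq continuous_intros)
   ultimately show "{x :: real^'n. x $ i = c} : null_sets lborel" by (simp add: negligible_iff_null_sets null_sets_def)
  qed
  then have "AE x in lborel. ind ?Q x*g x = ind (?A c) x*g x + ind (?B c) x*g x" by eventually_elim (auto simp: indicator_def)
  then have "(LBINT x. ind ?Q x*g x) = (LBINT x. ind (?A c) x*g x + ind (?B c) x*g x)"
   using Ab gm by (intro integral_cong_AE) simp_all
  also have "... = (LBINT x. ind (?A c) x*g x) + (LBINT x. ind (?B c) x*g x)"
   by (intro Lint_add integrable_subcube Ab g) auto
  finally show ?thesis .
 qed
 have Fh: "cont (%x. F (x + c))" for c by (intro cont_comp2[OF F] continuous_intros) auto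
 have tr: "(LBINT x. ind S x*F x) = (LBINT x. ind S (x + c)*F (x + c))" if "S : sets borel" for S c
  by (rule integral_translate[symmetric]) (use that bmeas_contI[OF F] in simp)
 have Q: "x : ?Q \<longleftrightarrow> (\<forall>j. j ~= i --> - L/2 < x $ j & x $ j < L/2) & - L/2 < x $ i & x $ i < L/2" for x
  unfolding cube_def by auto
 have 1: "ind (?B (h - L/2)) (x + axis i h) = (ind (?A (L/2 - h)) x :: real)" for x using h by (auto simp: indicator_def Q axis_def)
 have 2: "ind (?A (h - L/2)) (x + axis i (h - L)) = (ind (?B (L/2 - h)) x :: real)" for x
  using h by (auto simp: indicator_def Q axis_def)
 have 3: "F (x + axis i (h - L)) = F (x + axis i h)" for x
 proof -
  have "x + axis i (h - L) + axis i L = x + axis i h" by (simp add: vec_eq_iff axis_def)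
  then show ?thesis using per[of "x + axis i (h - L)"] by (simp only:)
 qed
 show ?thesis unfolding split[OF F, of "h - L/2"] split[OF Fh, of "axis i h" "L/2 - h"]
   tr[OF Ab(1), of _ "axis i (h - L)"] tr[OF Ab(2), of _ "axis i h"] 1 2 3 by (rule add.commute)
qed

text \<open>Difference quotients again, with periodicity in place of compact support. The derivative
  is bounded on a box enlarged by \<open>L\<close>, because the shifted points leave the
  cube.\<close>

lemma integral_periodic_derivative_eq_0:
 fixes F :: "real^'n::finite => real"
 assumes L: "L > 0" and F: "cont F" "cont F'" and per: "!!x. F (x + axis i L) = F x"
  and d: "!!x t. ((%t. F (x + axis i t)) hrd F' (x + axis i t)) (at t)"
 shows "(LBINT x. ind (cube L) x*F' x) = 0"
proof -
 let ?Q = "cube L :: (real^'n) set" and ?C = "cbox (\<chi> i. - L/2) (\<chi> i. L/2 + L) :: (real^'n) set"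
 define h where "h m = L/real (Suc m)" for m
 have h: "0 < h m" "h m <= L" for m using L by (simp_all add: h_def field_simps)
 have h0: "h ~~> 0" unfolding h_def[abs_def] using LIMSEQ_Suc[OF lim_const_over_n[of L]] by simp
 have "bounded (F' ` ?C)" by (intro compact_imp_bounded compact_continuous_image compact_cbox continuous_on_subset[OF F(2)]) simp
 then obtain B where B: "!!x. x : ?C ==> \<bar>F' x\<bar> <= B" unfolding bounded_iff by auto
 have Fh: "cont (%x. F (x + c))" for c by (intro cont_comp2[OF F(1)] continuous_intros) auto
 define q where "q m x = (F (x + axis i (h m)) - F x)/h m" for m x
 have z: "(LBINT x. ind ?Q x*q m x) = 0" for m
 proof -
  note i = integrable_subcube[OF _ cube_sets(2) order_refl]
  have "(LBINT x. ind ?Q x*q m x) = (LBINT x. (ind ?Q x*F (x + axis i (h m)) - ind ?Q x*F x)/h m)"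
   unfolding q_def by (simp add: right_diff_distrib)
  also have "... = ((LBINT x. ind ?Q x*F (x + axis i (h m))) - (LBINT x. ind ?Q x*F x))/h m"
   using i[OF Fh] i[OF F(1)] by simp
  also have "... = 0" using integral_periodic_shift[OF _ h(2) F(1) per, of m] h(1)[of m] by simp
  finally show ?thesis .
 qed
 have mv: "\<exists>t. 0 < t & t < h m & q m x = F' (x + axis i t)" for m x
 proof -
  have "\<exists>t. 0 < t & t < h m & F (x + axis i (h m)) - F (x + axis i 0) = (h m - 0)*F' (x + axis i t)" using h(1) by (intro MVT2 d)
  moreover have "x + axis i 0 = x" by (simp add: vec_eq_iff axis_def)
  ultimately show ?thesis using h(1)[of m] unfolding q_def by (auto simp: field_simps)
 qed
 have "(%m. LBINT x. ind ?Q x*q m x) ~~> (LBINT x. ind ?Q x*F' x)"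
 proof (rule integral_dominated_convergence[where w = "%x. ind ?Q x*B"])
  show "(%x. ind ?Q x*F' x) : bmeas lborel" using bmeas_contI[OF F(2)] by simp
  show "(%x. ind ?Q x*q m x) : bmeas lborel" for m
   unfolding q_def using bmeas_contI[OF F(1)] bmeas_contI[OF Fh] by simp
  show "integrable lborel (%x. ind ?Q x*B)" by (rule integrable_subcube[OF continuous_on_const cube_sets(2) order_refl])
  have "(%m. q m x) ~~> F' x" for x
  proof -
   obtain t where t: "!!m. 0 < t m & t m < h m & q m x = F' (x + axis i (t m))" using mv[of _ x] by metis
   have "t ~~> 0" by (rule tendsto_sandwich[OF _ _ tendsto_const h0]) (use t less_imp_le in \<open>blast intro!: always_eventually\<close>)+
   then have "(%m. x + t m *: axis i 1) ~~> x + 0 *: axis i 1" by (intro tendsto_intros)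
   moreover have "axis i (t m) = t m *: axis i 1" for m by (simp add: vec_eq_iff axis_def)
   ultimately have "(%m. x + axis i (t m)) ~~> x" by simp
   then have "(%m. F' (x + axis i (t m))) ~~> F' x" by (rule continuous_on_tendsto_compose[OF F(2)]) simp_all
   then show ?thesis using t by simp
  qed
  then show "AE x in lborel. (%m. ind ?Q x*q m x) ~~> ind ?Q x*F' x" by (intro AE_I2 tendsto_mult_left)
  have "\<bar>q m x\<bar> <= B" if x: "x : ?Q" for x m
  proof -
   obtain t where t: "0 < t" "t < h m" "q m x = F' (x + axis i t)" using mv by blast
   have "- L/2 <= (x + axis i t) $ j & (x + axis i t) $ j <= L/2 + L" for j
   proof -
    have "- L/2 < x $ j" "x $ j < L/2" using x unfolding cube_def by blast+
    then show ?thesis using t h(2)[of m] L by (cases "j = i") (simp_all add: axis_def)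
   qed
   then show ?thesis unfolding t(3) by (intro B) (simp add: mem_box_cart)
  qed
  then show "AE x in lborel. norm (ind ?Q x*q m x) <= ind ?Q x*B" for m by (intro AE_I2) (simp add: indicator_def)
 qed
 then show ?thesis unfolding z by (simp add: LIMSEQ_const_iff)
qed

lemma integral_periodic_pderiv_eq_0:
 fixes F :: "real^'n::finite => complex"
 assumes L: "L > 0" and F: "!!x. F differentiable at x" and DF: "cont (pderiv_at i F)" and per: "!!x. F (x + axis i L) = F x"
 shows "(LINT x|cm L. pderiv_at i F x) = 0"
proof -
 have Fc: "cont F" using F by (intro cont_atI ballI differentiable_imp_continuous_within)
 have d: "((%t. F (x + axis i t)) has_derivative (%s. s *: pderiv_at i F (x + axis i t))) (at t)" for x t
 proof -
  have a: "axis i s = s *: axis i (1::real)" for s by (simp add: vec_eq_iff axis_def)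
  have "((%t. x + t *: axis i 1) has_derivative (%s. s *: axis i 1)) (at t)" by (auto intro!: derivative_eq_intros)
  from has_derivative_compose[OF this F[unfolded frechet_derivative_works]]
  have "((%t. F (x + t *: axis i 1)) has_derivative (%s. frechet_derivative F (at (x + t *: axis i 1)) (s *: axis i 1))) (at t)" .
  then show ?thesis unfolding linear_scale[OF linear_frechet_derivative[OF F]] unfolding a[symmetric] pderiv_at_def .
 qed
 have "(LBINT x. ind (cube L) x*Re (pderiv_at i F x)) = 0"
 proof (rule integral_periodic_derivative_eq_0[OF L continuous_on_Re[OF Fc] continuous_on_Re[OF DF]])
  show "((%t. Re (F (x + axis i t))) hrd Re (pderiv_at i F (x + axis i t))) (at t)" for x t
   using bounded_linear.has_derivative[OF bounded_linear_Re d[of x t]] unfolding has_field_derivative_def by (simp add: mult_commute_abs)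
 qed (simp add: per)
 moreover have "(LBINT x. ind (cube L) x*Im (pderiv_at i F x)) = 0"
 proof (rule integral_periodic_derivative_eq_0[OF L continuous_on_Im[OF Fc] continuous_on_Im[OF DF]])
  show "((%t. Im (F (x + axis i t))) hrd Im (pderiv_at i F (x + axis i t))) (at t)" for x t
   using bounded_linear.has_derivative[OF bounded_linear_Im d[of x t]] unfolding has_field_derivative_def by (simp add: mult_commute_abs)
 qed (simp add: per)
 moreover have "integrable (cm L) (pderiv_at i F)"
  using L2_integrable_mult[OF continuous_L2_cube[OF DF] continuous_L2_cube[OF continuous_on_const[of _ 1]], of L] by simp
 ultimately show ?thesis using LINT_cube_lborel[OF bmeas_contI[OF continuous_on_Re[OF DF]], of L]
   LINT_cube_lborel[OF bmeas_contI[OF continuous_on_Im[OF DF]], of L] by (intro complex_eqI) simp_all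
qed

lemma bf_Periodic_shift:
 assumes L: "L > 0"
 shows "bf Periodic L j (x + L) = bf Periodic L j x" "bf' Periodic L j (x + L) = bf' Periodic L j x"
proof -
 have b: "bf Periodic L j (x + L) = bf Periodic L j x" for x using bf_reflect[OF L, of Periodic j 1 x] by (simp add: add.commute)
 then show "bf Periodic L j (x + L) = bf Periodic L j x" .
 have "((%x. bf Periodic L j (x + L)) hrd bf' Periodic L j (x + L)*1) (at x)"
  by (rule DERIV_chain2[OF bf_DERIV(1)]) (auto intro!: derivative_eq_intros)
 then have "(bf Periodic L j hrd bf' Periodic L j (x + L)) (at x)" unfolding b by simp
 then show "bf' Periodic L j (x + L) = bf' Periodic L j x" by (rule DERIV_unique[OF _ bf_DERIV(1)])
qed

lemma cprod_periodic:
 fixes f :: "'n::finite => real => real"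
 assumes "!!j s. f j (s + L) = f j s"
 shows "cprod f (x + axis i L) = cprod f x"
proof -
 have "f j ((x + axis i L) $ j) = f j (x $ j)" for j by (cases "j = i") (simp_all add: assms axis_def)
 then show ?thesis unfolding prodf_def by simp
qed

lemma ebas_periodic:
 assumes "L > 0"
 shows "cprod (ebas Periodic L k) (x + axis i L) = cprod (ebas Periodic L k) x"
  "cprod (ebas' Periodic L k j) (x + axis i L) = cprod (ebas' Periodic L k j) x"
 by (intro cprod_periodic; simp add: ebas_def ebas'_def bf_Periodic_shift[OF assms])+

lemma ebas_ibp_smooth:
 fixes ph :: "real^'n::finite => complex"
 assumes L: "L > 0" and ph: "ph : periodic_smooth L"
 shows "(LINT x|cm L. cprod (ebas' Periodic L k i) x*pderiv_at i ph x)
   = cr ((bfreq Periodic L (k i))^2)*(LINT x|cm L. cprod (ebas Periodic L k) x*ph x)"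
proof -
 let ?e' = "ebas' Periodic L k i"
 have ps: "ph : smooth" and pp: "ph (x + axis j L) = ph x" for x j using ph unfolding periodic_smooth_def by simp_all
 note sd = smoothD(1)[OF ebas_smooth(2)] smoothD(1)[OF ps]
 have pd: "pderiv_at i (%x. cprod ?e' x*ph x) = (%x. cprod ?e' x*pderiv_at i ph x + pderiv_at i (cprod ?e') x*ph x)"
  by (rule ext) (rule pderiv_at_mult(2)[OF sd])
 have "(LINT x|cm L. pderiv_at i (%x. cprod ?e' x*ph x) x) = 0"
 proof (rule integral_periodic_pderiv_eq_0[OF L pderiv_at_mult(1)[OF sd]])
  show "cprod ?e' (x + axis i L)*ph (x + axis i L) = cprod ?e' x*ph x" for x unfolding ebas_periodic[OF L] pp ..
  show "cont (pderiv_at i (%x. cprod ?e' x*ph x))" unfolding pd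
   by (intro continuous_on_add continuous_on_mult smoothD(3,4) ps ebas_smooth)
 qed
 moreover have "(LINT x|cm L. cprod ?e' x*pderiv_at i ph x + pderiv_at i (cprod ?e') x*ph x)
   = (LINT x|cm L. cprod ?e' x*pderiv_at i ph x) + (LINT x|cm L. pderiv_at i (cprod ?e') x*ph x)"
  by (intro Lint_add L2_integrable_mult continuous_L2_cube smoothD(3,4) ps ebas_smooth)
 ultimately show ?thesis unfolding pd pderiv_ebas by (simp add: mult.assoc)
qed

lemma Periodic_form_domain:
 assumes L: "L > 0"
 shows "cprod (ebas Periodic L k :: 'n::finite => real => real) : form_domain Periodic L"
proof -
 let ?e = "ebas Periodic L k :: 'n => real => real"
 have p: "cprod ?e : periodic_smooth L" unfolding periodic_smooth_def by (rule CollectI, intro conjI allI ebas_smooth ebas_periodic L)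
 \<comment> \<open>The difference is the zero function, but \<open>weak_pderiv\<close> is a choice
   of representative and vanishes only almost everywhere.\<close>
 have "W12_norm_sq (cube L) (%x. cprod ?e x - cprod ?e x) = 0"
 proof -
  have s: "(%x. cprod ?e x - cprod ?e x) : smooth" by (intro smooth_diff ebas_smooth)
  have "L2_norm_sq (cube L) (wpd L i (%x. cprod ?e x - cprod ?e x)) = L2_norm_sq (cube L) (%x :: real^'n. 0)" for i
  proof (rule L2_norm_sq_AE_cong)
   show "wpd L i (%x. cprod ?e x - cprod ?e x) : bmeas (cm L)"
    by (rule L2_measurable[OF W12D(3)[OF smooth_W12(1)[OF s]]])
   have "pderiv_at i (%x. cprod ?e x - cprod ?e x) x = 0" for x
   proof -
    have "pderiv_at i (%x. cprod ?e x - cprod ?e x) x = pderiv_at i (cprod ?e) x - pderiv_at i (cprod ?e) x"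
     by (rule pderiv_at_diff) (rule smoothD(1)[OF ebas_smooth(1)])+
    then show ?thesis by (simp only: diff_self)
   qed
   then show "AE x in cm L. wpd L i (%x. cprod ?e x - cprod ?e x) x = 0" using smooth_W12(2)[OF s, of L i] by simp
  qed
  then show ?thesis unfolding W12_norm_sq_def by (simp add: L2_norm_sq_def)
 qed
 then have "(%m. W12_norm_sq (cube L) (%x. cprod ?e x - cprod ?e x)) ~~> 0" by simp
 then show ?thesis unfolding form_domain.simps W12_closure_def
  by (intro CollectI conjI exI[of _ "%m. cprod ?e"] allI p smooth_W12(1)[OF ebas_smooth(1)])
qed

lemma form_domain_W12: "form_domain bc L \<subseteq> W12 (cube L)" by (cases bc) (auto simp: W12_closure_def)

text \<open>Green's identity between a basis function and the whole form domain. The boundary terms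
  disappear for three different reasons: approximation of \<open>u\<close> by test functions,
  vanishing of \<open>bf'\<close> at the ends, or periodicity.\<close>

lemma ebas_ibp:
 fixes u :: "real^'n::finite => complex"
 assumes L: "L > 0"
 shows "cprod (ebas bc L k :: 'n => real => real) : form_domain bc L"
  and "u : form_domain bc L ==> (LINT x|cm L. cprod (ebas' bc L k i) x*wpd L i u x)
   = cr ((bfreq bc L (k i))^2)*(LINT x|cm L. cprod (ebas bc L k) x*u x)"
proof -
 show "cprod (ebas bc L k :: 'n => real => real) : form_domain bc L"
  using Dirichlet_form_domain[OF L, of k] Periodic_form_domain[OF L, of k] smooth_W12(1)[OF ebas_smooth(1)[of Neumann L k]] by (cases bc) simp_all
 assume u: "u : form_domain bc L"
 then have uW: "u : W12 (cube L)" using form_domain_W12 by (rule subsetD[rotated])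
 show "(LINT x|cm L. cprod (ebas' bc L k i) x*wpd L i u x)
   = cr ((bfreq bc L (k i))^2)*(LINT x|cm L. cprod (ebas bc L k) x*u x)"
 proof (cases bc)
  case Dirichlet
  have "(LINT x|cm L. cprod (ebas' Dirichlet L k i) x*pderiv_at i ph x)
    = cr ((bfreq Dirichlet L (k i))^2)*(LINT x|cm L. cprod (ebas Dirichlet L k) x*ph x)"
   if "ph : test_functions (cube L)" for ph
   using has_weak_pderivD(1)[OF smooth_has_weak_pderiv[OF ebas_smooth(2)[of Dirichlet L k i], where i = i] that] unfolding pderiv_ebas by (simp add: mult.assoc)
  then show ?thesis using u unfolding Dirichlet form_domain.simps
   by (intro W12_closure_ibp[where S = "test_functions (cube L)"] continuous_L2_cube smoothD(3) ebas_smooth subsetI test_functionD(1))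
 next
  case Neumann
  show ?thesis using Neumann_ibp[OF L uW, of k i] unfolding Neumann .
 next
  case Periodic
  have "periodic_smooth L \<subseteq> smooth" unfolding periodic_smooth_def by (rule Collect_subset)
  then show ?thesis using u unfolding Periodic form_domain.simps
   by (intro W12_closure_ibp[where S = "periodic_smooth L"] continuous_L2_cube smoothD(3) ebas_smooth ebas_ibp_smooth[OF L])
 qed
qed

subsection \<open>The eigenvalue equation\<close>

text \<open>Green's identity is part of \<open>H_domain\<close>; the eigenvalue equation then
  replaces the weak Laplacian by \<open>(mu - V) u\<close>, which contains no derivatives.\<close>

lemma eigen_weak:
 fixes u :: "real^'n::finite => complex" and V :: "real^'n => real"
 assumes L: "L > 0" and e: "H_eigen_eq bc V L mu u" and ph: "ph : form_domain bc L"
 shows "(\<Sum>i\<in>UNIV. L2_inner (cube L) (wpd L i ph) (wpd L i u))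
   = (LINT x|cm L. cnj (ph x)*(cr (mu - V x)*u x))"
  and "u : form_domain bc L"
proof -
 have d: "u : H_domain bc L" and ae: "AE x in cm L. H_op V L u x = cr mu*u x"
  using e unfolding H_eigen_eq_def by simp_all
 show "u : form_domain bc L" using d unfolding H_domain_def by simp
 have "u : W22 (cube L)" using d unfolding H_domain_def by simp
 then have wL: "wpd L i (wpd L i u) : L2 (cube L)" for i unfolding W22_def by (intro W12D(3)) simp
 have lm: "(%x. - weak_laplacian (cube L) u x) : bmeas (cm L)"
  unfolding weak_laplacian_def[abs_def] by (intro borel_measurable_uminus borel_measurable_sum L2_measurable wL)
 have ae': "AE x in cm L. - weak_laplacian (cube L) u x = cr (mu - V x)*u x"
  using ae unfolding H_op_def by eventually_elim (simp add: algebra_simps)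
 have pm: "ph : bmeas (cm L)" using ph form_domain_W12[of bc L] by (intro L2_measurable W12D(1)) blast
 have "(\<Sum>i\<in>UNIV. L2_inner (cube L) (wpd L i ph) (wpd L i u))
   = L2_inner (cube L) ph (%x. - weak_laplacian (cube L) u x)" using d ph unfolding H_domain_def by simp
 also have "... = (LINT x|cm L. cnj (ph x)*(cr (mu - V x)*u x))" unfolding L2_inner_def
 proof (rule integral_cong_AE)
  have cm: "(%x. cnj (ph x)) : bmeas (cm L)"
   by (rule measurable_compose[OF pm bmeas_contI]) (intro continuous_intros)
  show "(%x. cnj (ph x)*- weak_laplacian (cube L) u x) : bmeas (cm L)" by (intro borel_measurable_times cm lm)
  show "(%x. cnj (ph x)*(cr (mu - V x)*u x)) : bmeas (cm L)"
   by (intro borel_measurable_times cm measurable_AE_cube[OF lm ae'])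
  show "AE x in cm L. cnj (ph x)*- weak_laplacian (cube L) u x = cnj (ph x)*(cr (mu - V x)*u x)"
   using ae' by eventually_elim simp
 qed
 finally show "(\<Sum>i\<in>UNIV. L2_inner (cube L) (wpd L i ph) (wpd L i u))
   = (LINT x|cm L. cnj (ph x)*(cr (mu - V x)*u x))" .
qed

text \<open>The Laplacian is moved from the eigenfunction to the basis function, where it is
  multiplication by a number. On the level of coefficients this says that projecting commutes with
  the Laplacian, although the eigenfunction is not smooth.\<close>

lemma eigen_coeff:
 fixes v :: "real^'n::finite => real" and V :: "real^'n => real"
 assumes L: "L > 0" and e: "H_eigen_eq bc V L mu (%x. cr (v x))"
 shows "(\<Sum>i\<in>UNIV. (bfreq bc L (k i))^2)*ipr (cm L) (prodf (ebas bc L k)) v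
   = ipr (cm L) (prodf (ebas bc L k)) (%x. (mu - V x)* v x)"
proof -
 let ?Q = "cube L :: (real^'n) set" and ?u = "%x. cr (v x)"
 note w = eigen_weak[OF L e]
 have uW: "?u : W12 ?Q" using w(2)[OF ebas_ibp(1)[OF L]] form_domain_W12[of bc L] by blast
 have "L2_inner ?Q (weak_pderiv ?Q i (cprod (ebas bc L k))) (weak_pderiv ?Q i ?u)
   = cr ((bfreq bc L (k i))^2)*(LINT x|lebesgue_on ?Q. cprod (ebas bc L k) x*?u x)" for i
 proof -
  have "L2_inner ?Q (weak_pderiv ?Q i (cprod (ebas bc L k))) (weak_pderiv ?Q i ?u)
    = (LINT x|lebesgue_on ?Q. cprod (ebas' bc L k i) x*weak_pderiv ?Q i ?u x)" unfolding L2_inner_def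
  proof (rule integral_cong_AE)
   have cm: "(%x. cnj (weak_pderiv ?Q i (cprod (ebas bc L k)) x)) : bmeas (lebesgue_on ?Q)"
    by (rule measurable_compose[OF L2_measurable[OF W12D(3)[OF smooth_W12(1)[OF ebas_smooth(1)]]] bmeas_contI]) (intro continuous_intros)
   show "(%x. cnj (weak_pderiv ?Q i (cprod (ebas bc L k)) x)*weak_pderiv ?Q i ?u x) : bmeas (lebesgue_on ?Q)"
    by (intro borel_measurable_times cm L2_measurable W12D(3)[OF uW])
   show "(%x. cprod (ebas' bc L k i) x*weak_pderiv ?Q i ?u x) : bmeas (lebesgue_on ?Q)"
    by (intro borel_measurable_times L2_measurable W12D(3)[OF uW] continuous_L2_cube smoothD(3) ebas_smooth)
   show "AE x in lebesgue_on ?Q. cnj (weak_pderiv ?Q i (cprod (ebas bc L k)) x)*weak_pderiv ?Q i ?u x = cprod (ebas' bc L k i) x*weak_pderiv ?Q i ?u x"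
    using smooth_W12(2)[OF ebas_smooth(1)[of bc L k], of L i] unfolding pderiv_ebas(1) by eventually_elim simp
  qed
  also have "... = cr ((bfreq bc L (k i))^2)*(LINT x|lebesgue_on ?Q. cprod (ebas bc L k) x*?u x)"
   by (rule ebas_ibp(2)[OF L w(2)[OF ebas_ibp(1)[OF L]]])
  finally show ?thesis .
 qed
 then have "(\<Sum>i\<in>UNIV. cr ((bfreq bc L (k i))^2)*(LINT x|lebesgue_on ?Q. cprod (ebas bc L k) x*?u x))
   = (LINT x|lebesgue_on ?Q. cnj (cprod (ebas bc L k) x)*(cr (mu - V x)*?u x))" using w(1)[OF ebas_ibp(1)[OF L, of bc k]] by simp
 moreover have "(LINT x|lebesgue_on ?Q. cprod (ebas bc L k) x*?u x) = cr (ipr (lebesgue_on ?Q) (prodf (ebas bc L k)) v)"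
  unfolding ipr_def of_real_mult[symmetric] by (rule integral_complex_of_real)
 moreover have "(LINT x|lebesgue_on ?Q. cnj (cprod (ebas bc L k) x)*(cr (mu - V x)*?u x))
   = cr (ipr (lebesgue_on ?Q) (prodf (ebas bc L k)) (%x. (mu - V x)* v x))"
  unfolding ipr_def complex_cnj_complex_of_real of_real_mult[symmetric] by (rule integral_complex_of_real)
 ultimately have "cr ((\<Sum>i\<in>UNIV. (bfreq bc L (k i))^2)*ipr (lebesgue_on ?Q) (prodf (ebas bc L k)) v)
   = cr (ipr (lebesgue_on ?Q) (prodf (ebas bc L k)) (%x. (mu - V x)* v x))"
  unfolding of_real_mult of_real_sum sum_distrib_right by simp
 then show ?thesis unfolding of_real_eq_iff .
qed

text \<open>The weak equation tested with \<open>u\<close> itself, whose left side is the Dirichlet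
  energy. It yields the lower bound for the eigenvalues that makes the shifted ones
  nonnegative.\<close>

lemma eigen_nonneg:
 fixes v :: "real^'n::finite => real" and V :: "real^'n => real"
 assumes L: "L > 0" and e: "H_eigen_eq bc V L mu (%x. cr (v x))"
 shows "0 <= (LINT x|cm L. (mu - V x)*(v x)^2)"
proof -
 let ?Q = "cube L :: (real^'n) set" and ?u = "%x. cr (v x)"
 note w = eigen_weak[OF L e]
 have u: "?u : form_domain bc L" by (rule w(2)[OF ebas_ibp(1)[OF L]])
 have "cr (LINT x|lebesgue_on ?Q. (mu - V x)*(v x)^2) = (LINT x|lebesgue_on ?Q. cr ((mu - V x)*(v x)^2))"
  by (rule integral_complex_of_real[symmetric])
 also have "... = (LINT x|lebesgue_on ?Q. cnj (?u x)*(cr (mu - V x)*?u x))"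
  by (rule Lint_cong[OF refl]) (simp add: power2_eq_square)
 also have "... = (\<Sum>i\<in>UNIV. L2_inner ?Q (weak_pderiv ?Q i ?u) (weak_pderiv ?Q i ?u))" by (rule w(1)[OF u, symmetric])
 also have "... = (\<Sum>i\<in>UNIV. cr (LINT x|lebesgue_on ?Q. (cmod (weak_pderiv ?Q i ?u x))^2))"
 proof (rule sum.cong[OF refl])
  fix i
  have "cnj z*z = cr ((cmod z)^2)" for z by (simp only: complex_norm_square mult.commute[of z])
  then show "L2_inner ?Q (weak_pderiv ?Q i ?u) (weak_pderiv ?Q i ?u) = cr (LINT x|lebesgue_on ?Q. (cmod (weak_pderiv ?Q i ?u x))^2)"
   unfolding L2_inner_def by (simp only: integral_complex_of_real)
 qed
 also have "... = cr (\<Sum>i\<in>UNIV. LINT x|lebesgue_on ?Q. (cmod (weak_pderiv ?Q i ?u x))^2)" by simp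
 finally have "(LINT x|lebesgue_on ?Q. (mu - V x)*(v x)^2) = (\<Sum>i\<in>UNIV. LINT x|lebesgue_on ?Q. (cmod (weak_pderiv ?Q i ?u x))^2)"
  unfolding of_real_eq_iff .
 also have "... >= 0" by (intro sum_nonneg integral_nonneg_AE) simp
 finally show ?thesis .
qed

section \<open>Harmonic extension of spectral projections\<close>

text \<open>The solution of \<open>y'' = c y\<close> with value 0 and derivative 1 at the origin;
  the case distinction is the limit as \<open>c\<close> tends to 0.\<close>

definition gh :: "real => real => real" where "gh c t = (if c = 0 then t else sinh (sqrt c*t)/sqrt c)"

definition gh' :: "real => real => real" where "gh' c t = cosh (sqrt c*t)"

lemma gh_DERIV:
 assumes "c >= 0"
 shows "(gh c hrd gh' c t) (at t)" "(gh' c hrd c*gh c t) (at t)"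
proof -
 show "(gh c hrd gh' c t) (at t)"
 proof (cases "c = 0")
  case False
  have "((%t. sinh (sqrt c*t)) hrd cosh (sqrt c*t)* sqrt c) (at t)" by (auto intro!: derivative_eq_intros)
  from DERIV_cdivide[OF this, of "sqrt c"] show ?thesis using False by (simp add: gh_def[abs_def] gh'_def)
 qed (simp add: gh_def[abs_def] gh'_def)
 show "(gh' c hrd c*gh c t) (at t)"
 proof (cases "c = 0")
  case False
  have "(gh' c hrd sinh (sqrt c*t)* sqrt c) (at t)" unfolding gh'_def[abs_def] by (auto intro!: derivative_eq_intros)
  moreover have "sinh (sqrt c*t)* sqrt c = c*gh c t"
  proof -
   have "c = sqrt c* sqrt c" using assms by simp
   then show ?thesis using False assms by (simp add: gh_def field_simps)
  qed
  ultimately show ?thesis by simp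
 qed (simp add: gh'_def[abs_def])
qed

lemma gh_0: "gh c 0 = 0" "gh' c 0 = 1" by (simp_all add: gh_def gh'_def)

lemma gh_cont: "cont (gh c)" unfolding gh_def[abs_def] sinh_def by (cases "c = 0") (auto intro!: continuous_intros)

text \<open>By the mean value theorem, since \<open>cosh\<close> lies between 1 and the exponential.
  The lower bound does not depend on \<open>c\<close>, so slices of the extension dominate
  \<open>t\<close> times the norm of the combination whatever the eigenvalues are.\<close>

lemma gh_bounds:
 assumes c: "0 <= c" "c <= c'" and t: "0 <= t" "t <= T"
 shows "t <= gh c t" "gh c t <= T*exp (sqrt c'*T)"
proof -
 have 0: "t <= gh c t & gh c t <= T*exp (sqrt c'*T)"
 proof (cases "t = 0")
  case False
  then have "\<exists>z. 0 < z & z < t & gh c t - gh c 0 = (t - 0)*gh' c z" using t by (intro MVT2 gh_DERIV c) auto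
  then obtain z where z: "0 < z" "z < t" "gh c t = t*gh' c z" by (auto simp: gh_0)
  have "1 <= gh' c z" unfolding gh'_def by (rule cosh_real_ge_1)
  moreover have "gh' c z <= exp (sqrt c'*T)"
  proof -
   have "0 <= sqrt c*z" using c z by simp
   then have "exp (- (sqrt c*z)) <= exp (sqrt c*z)" by simp
   then have "gh' c z <= exp (sqrt c*z)" unfolding gh'_def cosh_def by simp
   also have "sqrt c*z <= sqrt c'*T" using c z t by (intro mult_mono) auto
   finally show ?thesis by simp
  qed
  ultimately show ?thesis unfolding z(3) using t mult_left_mono[of 1 "gh' c z" t] mult_mono[of t T "gh' c z" "exp (sqrt c'*T)"] by simp
 qed (use t in \<open>simp add: gh_0\<close>)
 show "t <= gh c t" "gh c t <= T*exp (sqrt c'*T)" using 0 by blast+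
qed

text \<open>Induction over the factors, using that the \<open>e i\<close> are orthonormal. The last
  conjunct keeps the gradient of the product built so far orthogonal to the next direction, and thus
  the mixed term of \<open>lap_mult\<close> vanishes.\<close>

lemma c2_prod_inner:
 fixes b :: "'i => real => real" and e :: "'i => 'b::euclidean_space"
 assumes I: "finite I" and b: "!!i s. (b i hrd b' i s) (at s)" "!!i s. (b' i hrd - w i*b i s) (at s)"
  and e: "!!i j. e i <.> e j = (if i = j then 1 else 0)"
 shows "\<exists>G H. c2 (%y. \<Prod>i\<in>I. b i (y <.> e i)) G H & (\<forall>y. lap H y = - (\<Sum>i\<in>I. w i)*(\<Prod>i\<in>I. b i (y <.> e i))) &
  (\<forall>y v. (\<forall>i\<in>I. e i <.> v = 0) --> G y <.> v = 0)" using I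
proof (induction I)
 case empty
 have "lap (%_ _. 0 :: 'b) y = 0" for y :: 'b by (simp add: lap_def)
 then show ?case using c2_const[of 1] by (intro exI[of _ "%_. 0"] exI[of _ "%_ _. 0"]) simp
next
 case (insert i I)
 then obtain G H where G: "c2 (%y. \<Prod>i\<in>I. b i (y <.> e i)) G H"
  "!!y. lap H y = - (\<Sum>i\<in>I. w i)*(\<Prod>i\<in>I. b i (y <.> e i))"
  "!!y v. (\<forall>i\<in>I. e i <.> v = 0) ==> G y <.> v = 0" by blast
 have "cont (b i)" by (rule DERIV_continuous_on) (rule b)
 then have bc: "cont (%s. - w i*b i s)" by (intro continuous_intros)
 note ci = c2_inner_comp[OF b bc, of "e i"]
 note cm = c2_mult[OF ci G(1)]
 have Gi: "G y <.> e i = 0" for y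
 proof (rule G(3), rule ballI)
  fix j assume "j : I"
  then have "j ~= i" using insert.hyps by auto
  then show "e j <.> e i = 0" by (simp add: e)
 qed
 let ?P = "%y. \<Prod>i\<in>I. b i (y <.> e i)"
 show ?case
 proof (intro exI conjI)
  show "c2 (%y. \<Prod>i\<in>insert i I. b i (y <.> e i)) (%y. b i (y <.> e i) *: G y + ?P y *: (b' i (y <.> e i) *: e i))
    (%y h. b i (y <.> e i) *: H y h + ((b' i (y <.> e i) *: e i) <.> h) *: G y +
      (?P y *: ((- w i*b i (y <.> e i)*(h <.> e i)) *: e i) + (G y <.> h) *: (b' i (y <.> e i) *: e i)))"
   using cm insert.hyps by simp
  show "\<forall>y. lap (%y h. b i (y <.> e i) *: H y h + ((b' i (y <.> e i) *: e i) <.> h) *: G y +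
      (?P y *: ((- w i*b i (y <.> e i)*(h <.> e i)) *: e i) + (G y <.> h) *: (b' i (y <.> e i) *: e i))) y
    = - (\<Sum>i\<in>insert i I. w i)*(\<Prod>i\<in>insert i I. b i (y <.> e i))"
  proof
   fix y
   have "(b' i (y <.> e i) *: e i) <.> G y = 0" using Gi[of y] by (simp add: inner_commute)
   then show "lap (%y h. b i (y <.> e i) *: H y h + ((b' i (y <.> e i) *: e i) <.> h) *: G y +
      (?P y *: ((- w i*b i (y <.> e i)*(h <.> e i)) *: e i) + (G y <.> h) *: (b' i (y <.> e i) *: e i))) y
    = - (\<Sum>i\<in>insert i I. w i)*(\<Prod>i\<in>insert i I. b i (y <.> e i))"
    unfolding lap_mult lap_inner_comp G(2) using insert.hyps by (simp add: e algebra_simps)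
  qed
  show "\<forall>y v. (\<forall>j\<in>insert i I. e j <.> v = 0) --> (b i (y <.> e i) *: G y + ?P y *: (b' i (y <.> e i) *: e i)) <.> v = 0"
   using G(3) by (simp add: inner_simps)
 qed
qed

abbreviation bas :: "boundary_condition => real => ('n => nat) => real^'n::finite => real" where
 "bas bc L k \<equiv> prodf (ebas bc L k)"

definition freq2 :: "boundary_condition => real => ('n::finite => nat) => real" where
 "freq2 bc L k = (\<Sum>i\<in>UNIV. (bfreq bc L (k i))^2)"

text \<open>Separation of variables: the ghost direction \<open>e0\<close> is orthogonal to every
  \<open>e i\<close>, so the two second-order contributions just add up. On the boundary
  \<open>gh\<close> is 0 and its derivative is 1, which gives the normal derivative.\<close>

lemma c2_separated:
 fixes k :: "'n::finite => nat"
 assumes c: "c >= 0"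
 shows "\<exists>G H. c2 (%y :: (real^'n) \<times> real. bas bc L k (fst y)*gh c (snd y)) G H &
  (\<forall>y. lap H y = (c - freq2 bc L k)*(bas bc L k (fst y)*gh c (snd y))) & (\<forall>x. G (x, 0) <.> (0, 1) = bas bc L k x)"
proof -
 define e :: "'n => (real^'n) \<times> real" where "e i = (axis i 1, 0)" for i
 define e0 :: "(real^'n) \<times> real" where "e0 = (0, 1)"
 have ye: "y <.> e i = fst y $ i" "y <.> e0 = snd y" for y i by (cases y; simp add: e_def e0_def inner_axis)+
 have P: "(\<Prod>i\<in>UNIV. bf bc L (k i) (y <.> e i)) = bas bc L k (fst y)" for y unfolding prodf_def ebas_def ye ..
 have ee: "e i <.> e j = (if i = j then 1 else 0)" for i j by (simp add: e_def inner_axis_axis)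
 obtain G H where G: "c2 (%y. bas bc L k (fst y)) G H" "!!y. lap H y = - freq2 bc L k*bas bc L k (fst y)"
  "!!y v. (\<forall>i\<in>UNIV. e i <.> v = 0) ==> G y <.> v = 0"
  using c2_prod_inner[of UNIV "%i. bf bc L (k i)" "%i. bf' bc L (k i)" "%i. (bfreq bc L (k i))^2" e, OF finite bf_DERIV ee]
  unfolding P freq2_def by blast
 have gc: "cont (%s. c*gh c s)" by (intro continuous_intros gh_cont)
 note cg = c2_inner_comp[OF gh_DERIV(1)[OF c] gh_DERIV(2)[OF c] gc, of e0]
 note cm = c2_mult[OF G(1) cg]
 have Ge: "G y <.> e0 = 0" for y by (rule G(3)) (simp add: e_def e0_def)
 have e00: "e0 <.> e0 = 1" by (simp add: e0_def)
 show ?thesis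
 proof (intro exI conjI)
  show "c2 (%y :: (real^'n) \<times> real. bas bc L k (fst y)*gh c (snd y))
    (%y. bas bc L k (fst y) *: (gh' c (y <.> e0) *: e0) + gh c (y <.> e0) *: G y)
    (%y h. bas bc L k (fst y) *: ((c*gh c (y <.> e0)*(h <.> e0)) *: e0) + (G y <.> h) *: (gh' c (y <.> e0) *: e0) +
     (gh c (y <.> e0) *: H y h + ((gh' c (y <.> e0) *: e0) <.> h) *: G y))" using cm by (simp only: ye)
  show "\<forall>y. lap (%y h. bas bc L k (fst y) *: ((c*gh c (y <.> e0)*(h <.> e0)) *: e0) + (G y <.> h) *: (gh' c (y <.> e0) *: e0) +
     (gh c (y <.> e0) *: H y h + ((gh' c (y <.> e0) *: e0) <.> h) *: G y)) y
    = (c - freq2 bc L k)*(bas bc L k (fst y)*gh c (snd y))"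
   unfolding lap_mult lap_inner_comp[of "%y. c*gh c (y <.> e0)" e0] G(2) inner_scaleR_right Ge e00
   by (simp only: ye) (simp add: algebra_simps)
  show "\<forall>x. (bas bc L k (fst (x, 0)) *: (gh' c ((x, 0) <.> e0) *: e0) + gh c ((x, 0) <.> e0) *: G (x, 0)) <.> (0, 1) = bas bc L k x"
   unfolding ye(2) by (simp add: gh_0 e0_def inner_simps)
 qed
qed

lemma bas_tile:
 fixes k :: "'n::finite => nat"
 assumes L: "L > 0"
 shows "bas bc L k (fst (tile_map (refl_sign bc) L m y)) = (\<Prod>i\<in>UNIV. val_sign bc (m $ i))*bas bc L k (fst y)"
  and "\<bar>\<Prod>i\<in>(UNIV::'n set). val_sign bc (m $ i)\<bar> = 1" unfolding tile_map_def prodf_def ebas_def abs_prod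
 by (simp_all add: bf_reflect[OF L] prod.distrib refl_sign_abs)

text \<open>The finite sums \<open>U\<close> approximate the extension \<open>\<Sum>n. al n * gh (E n) t * psi n x\<close>; being trigonometric
 polynomials, they are smooth and extend from the cube to the whole space by the reflections.\<close>

lemma extension_c2:
 fixes F :: "'f set" and c :: "'f => ('n::finite => nat) => real"
 assumes E: "!!n. n : F ==> 0 <= E n"
 shows "\<exists>G H. c2 (%y :: (real^'n) \<times> real. \<Sum>n\<in>F. \<Sum>k\<in>K. c n k*(bas bc L k (fst y)*gh (E n) (snd y))) G H &
  (\<forall>y. lap H y = (\<Sum>n\<in>F. \<Sum>k\<in>K. c n k*((E n - freq2 bc L k)*(bas bc L k (fst y)*gh (E n) (snd y))))) &
  (\<forall>x. G (x, 0) <.> (0, 1) = (\<Sum>n\<in>F. \<Sum>k\<in>K. c n k*bas bc L k x))"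
proof -
 define Q where "Q n k GH \<longleftrightarrow> c2 (%y :: (real^'n) \<times> real. bas bc L k (fst y)*gh (E n) (snd y)) (fst GH) (snd GH) &
  (\<forall>y. lap (snd GH) y = (E n - freq2 bc L k)*(bas bc L k (fst y)*gh (E n) (snd y))) &
  (\<forall>x. fst GH (x, 0) <.> (0, 1) = bas bc L k x)" for n k GH
 define GH where "GH n k = (SOME p. Q n k p)" for n k
 have "Q n k (GH n k)" if "n : F" for n k
 proof -
  from c2_separated[OF E[OF that], of bc L k] obtain G H where "c2 (%y :: (real^'n) \<times> real. bas bc L k (fst y)*gh (E n) (snd y)) G H"
   "\<forall>y. lap H y = (E n - freq2 bc L k)*(bas bc L k (fst y)*gh (E n) (snd y))" "\<forall>x. G (x, 0) <.> (0, 1) = bas bc L k x" by blast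
  then have "Q n k (G, H)" unfolding Q_def by simp
  then show ?thesis unfolding GH_def by (rule someI[of "Q n k"])
 qed
 note GH = this[unfolded Q_def]
 show ?thesis
 proof (intro exI conjI)
  show "c2 (%y :: (real^'n) \<times> real. \<Sum>n\<in>F. \<Sum>k\<in>K. c n k*(bas bc L k (fst y)*gh (E n) (snd y)))
    (%y. \<Sum>n\<in>F. \<Sum>k\<in>K. c n k *: fst (GH n k) y) (%y h. \<Sum>n\<in>F. \<Sum>k\<in>K. c n k *: snd (GH n k) y h)"
   by (intro c2_sum c2_scale conjunct1[OF GH])
  show "\<forall>y. lap (%y h. \<Sum>n\<in>F. \<Sum>k\<in>K. c n k *: snd (GH n k) y h) y
    = (\<Sum>n\<in>F. \<Sum>k\<in>K. c n k*((E n - freq2 bc L k)*(bas bc L k (fst y)*gh (E n) (snd y))))" unfolding lap_sum lap_scale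
   by (intro allI sum.cong refl) (simp only: GH[THEN conjunct2, THEN conjunct1, rule_format])
  show "\<forall>x. (\<Sum>n\<in>F. \<Sum>k\<in>K. c n k *: fst (GH n k) (x, 0)) <.> (0, 1) = (\<Sum>n\<in>F. \<Sum>k\<in>K. c n k*bas bc L k x)"
   unfolding inner_sum_left inner_scaleR_left by (intro allI sum.cong refl) (simp only: GH[THEN conjunct2, THEN conjunct2, rule_format])
 qed
qed

section \<open>Projections to the trigonometric basis\<close>

lemma bas_cont: "cont (bas bc L k)" unfolding prodf_def[abs_def]
 by (intro continuous_on_prod cont_comp2[OF sm1_deriv(3)[OF sm1_ebas(1)]] continuous_intros) simp_all

lemma bas_orthogonal:
 fixes k l :: "'n::finite => nat"
 assumes L: "L > 0"
 shows "sqi (cm L) (bas bc L k)"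
  and "k ~= l ==> ipr (cm L) (bas bc L k) (bas bc L l) = 0"
  and "nsq (cm L) (bas bc L k) > 0"
proof -
 have "\<bar>bas bc L k x\<bar> <= 1" for x unfolding prodf_def abs_prod ebas_def by (intro prod_le_1) (simp add: bf_bounds)
 then show "sqi (cm L) (bas bc L k)"
  by (intro sqi_bounded_cube(1)[where B = 1] borel_measurable_on_cube bmeas_contI bas_cont)
 show "nsq (cm L) (bas bc L k) > 0" unfolding ebas_def by (rule bf_prod_orthogonal(2)[OF L])
 show "k ~= l ==> ipr (cm L) (bas bc L k) (bas bc L l) = 0" unfolding ebas_def by (rule bf_prod_orthogonal(1)[OF L])
qed

lemma bas_proj_limit:
 fixes f :: "real^'n::finite => real"
 assumes L: "L > 0" and f: "sqi (cm L) f"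
 shows "(%N. nsq (cm L) (%x. f x - proj (cm L) (bas bc L) (freqs N) f x)) ~~> 0"
proof -
 interpret trig_family "bf bc L" L by (rule bf_trig_family[OF L])
 show ?thesis unfolding ebas_def by (rule proj_limit[OF bf_prod_orthogonal(1)[OF L] bf_prod_orthogonal(2)[OF L] f])
qed

lemma nsq_orthonormal:
 assumes F: "finite F" and psi: "!!n. n : F ==> sqi M (psi n)"
  and orth: "!!m n. m : F ==> n : F ==> ipr M (psi m) (psi n) = (if m = n then 1 else 0)"
 shows "nsq M (%x. \<Sum>n\<in>F. a n*psi n x) = (\<Sum>n\<in>F. (a n)^2)"
proof -
 let ?f = "%x. \<Sum>n\<in>F. a n*psi n x"
 have fs: "sqi M ?f" by (intro sqi_sum sqi_scale psi)
 have i: "ipr M (psi m) ?f = a m" if "m : F" for m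
 proof -
  have "ipr M (psi m) ?f = (\<Sum>n\<in>F. a n*ipr M (psi m) (psi n))"
   using ipr_sum_right[OF psi[OF that], of F "%n x. a n*psi n x"] psi by (simp add: sqi_scale ipr_scale_right)
  also have "... = (\<Sum>n\<in>F. if n = m then a n else 0)" using that by (intro sum.cong) (auto simp: orth)
  finally show ?thesis using F that by simp
 qed
 have "nsq M ?f = ipr M ?f ?f" by (simp add: nsq_def ipr_def power2_eq_square)
 also have "... = (\<Sum>n\<in>F. a n*ipr M ?f (psi n))"
  using ipr_sum_right[OF fs, of F "%n x. a n*psi n x"] psi by (simp add: sqi_scale ipr_scale_right)
 also have "... = (\<Sum>n\<in>F. (a n)^2)" by (intro sum.cong refl) (simp add: ipr_commute[of M ?f] i power2_eq_square)
 finally show ?thesis .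
qed

text \<open>The factor \<open>card F\<close> does no harm: the bound is applied to projection
  errors, which tend to 0 with \<open>F\<close> fixed.\<close>

lemma nsq_combination_le:
 assumes F: "finite F" and f: "!!n. n : F ==> sqi M (f n)" and a: "!!n. n : F ==> \<bar>a n\<bar> <= b n"
 shows "nsq M (%x. \<Sum>n\<in>F. a n*f n x) <= real (card F)*(\<Sum>n\<in>F. (b n)^2*nsq M (f n))"
proof -
 have "nsq M (%x. \<Sum>n\<in>F. a n*f n x) <= real (card F)*(\<Sum>n\<in>F. nsq M (%x. a n*f n x))"
  by (rule nsq_sum_le[OF sqi_scale[OF f] F])
 also have "... <= real (card F)*(\<Sum>n\<in>F. (b n)^2*nsq M (f n))" unfolding nsq_scale
 proof (intro mult_left_mono sum_mono mult_right_mono nsq_nonneg)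
  show "(a n)^2 <= (b n)^2" if "n : F" for n using power_mono[OF a[OF that], of 2] by simp
 qed simp
 finally show ?thesis .
qed

lemma S_set_open: "open (S_set L de z)" "S_set L de z \<subseteq> cube L" unfolding S_set_def by (auto intro!: open_Int open_UN cube_props)

text \<open>For finite \<open>N\<close> the projected extension satisfies the differential
  inequality only up to \<open>err\<close>. All constants of \<open>core_estimate\<close> are fixed
  before \<open>N\<close>, so in the limit the errors \<open>eh0\<close>, \<open>eh1\<close> and
  \<open>eh2\<close> disappear and an inequality between \<open>A\<close>, the squared norm of the
  combination, and \<open>X\<close>, its part on the observed set, remains.\<close>

theorem spectral_estimate:
 fixes z :: "int^'n::finite => real^'n" and de ta s M :: real and psi :: "'f => real^'n => real"
  and V :: "real^'n => real" and L :: nat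
 defines "d \<equiv> real CARD('n)" and "Q \<equiv> lebesgue_on (cube (real L) :: (real^'n) set)"
 assumes L: "1 <= L" and de: "0 < de" "de < 1/2"
  and z: "!!j. ball (z j) de \<subseteq> (%x. x + lattice_point j) ` cube 1"
  and M: "M >= 0" "M^2 <= s^3" "1 <= s" "36*d^2*M^2 <= ta^3" "36*d^2 <= ta^3" "0 < ta"
  and F: "finite F" and E: "!!n. n : F ==> 0 <= E n" "!!n. n : F ==> E n <= E0"
  and V: "V : bmeas Q" "!!x. \<bar>V x\<bar> <= B" "AE x in Q. \<bar>V x\<bar> <= M"
  and psi: "!!n. n : F ==> sqi Q (psi n)"
  and orth: "!!m n. m : F ==> n : F ==> ipr Q (psi m) (psi n) = (if m = n then 1 else 0)"
  and coeff: "!!n k. n : F ==> (E n - freq2 bc L k)*ipr Q (bas bc L k) (psi n) = ipr Q (bas bc L k) (%x. V x*psi n x)"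
  and small: "rem_const (d + 1) d de ta s*(8*d + 4) ^ (2*CARD('n))*(4*d*(2*(4*d*exp (sqrt E0*(4*d)))^2)) <= 1/12"
 shows "(\<Sum>n\<in>F. (al n)^2) <= 24* obs_const (d + 1) d de ta s *
   (LINT x|Q. ind (S_set (real L) de z) x*(\<Sum>n\<in>F. al n*psi n x)^2)"
proof -
 let ?S = "S_set (real L) de z" and ?e = "bas bc (real L) :: ('n => nat) => real^'n => real"
 let ?R = "rem_const (d + 1) d de ta s*(8*d + 4) ^ (2*CARD('n))" and ?O = "obs_const (d + 1) d de ta s"
 have L0: "real L > 0" using L by simp
 define T where "T = 4*d"
 define b where "b = T*exp (sqrt E0*T)"
 have T: "1 <= T" "0 <= T" unfolding T_def d_def using zero_less_card_finite[where 'a='n] by linarith+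
 define A where "A = (\<Sum>n\<in>F. (al n)^2)"
 define X where "X = (LINT x|Q. ind ?S x*(\<Sum>n\<in>F. al n*psi n x)^2)"
 define P where "P N f = proj Q ?e (freqs N) f" for N f
 have Ps: "sqi Q (P N f)" if "sqi Q f" for N f unfolding P_def Q_def
  by (rule orthogonal_projection(1)[OF bas_orthogonal[OF L0] that[unfolded Q_def] finite_freqs])
 have Vm: "sqi Q (%x. V x*psi n x)" if "n : F" for n
 proof (rule sqi_bound[OF sqi_scale[OF psi[OF that], of B]])
  show "(%x. V x*psi n x) : bmeas Q" by (intro borel_measurable_times V(1) sqi_measurable[OF psi[OF that]])
  have "\<bar>V x\<bar> <= \<bar>B\<bar>" for x using V(2)[of x] by linarith
  then show "AE x in Q. \<bar>V x*psi n x\<bar> <= \<bar>B*psi n x\<bar>" by (simp add: abs_mult mult_right_mono)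
 qed
 define a where "a t n = al n*gh (E n) t" for t n
 have a: "\<bar>a t n\<bar> <= \<bar>al n\<bar>*b" "\<bar>al n\<bar>*t <= \<bar>a t n\<bar>" if "n : F" "0 <= t" "t <= T" for t n
  using gh_bounds[OF E(1)[OF that(1)] E(2)[OF that(1)] that(2,3)] that(2) unfolding a_def b_def abs_mult by (auto intro!: mult_left_mono)
 define w where "w t x = (\<Sum>n\<in>F. a t n*psi n x)" for t x
 define u where "u N t x = (\<Sum>n\<in>F. a t n*P N (psi n) x)" for N t x
 define l where "l N t x = (\<Sum>n\<in>F. a t n*P N (%x. V x*psi n x) x)" for N t x
 have ws: "sqi Q (w t)" and us: "sqi Q (u N t)" and ls: "sqi Q (l N t)" for N t
  unfolding w_def[abs_def] u_def[abs_def] l_def[abs_def] by (intro sqi_sum sqi_scale Ps psi Vm; assumption)+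
 define eh1 where "eh1 N = real (card F)*(\<Sum>n\<in>F. (\<bar>al n\<bar>*b)^2*nsq Q (%x. psi n x - P N (psi n) x))" for N
 define eh2 where "eh2 N = real (card F)*(\<Sum>n\<in>F. (\<bar>al n\<bar>*b)^2*nsq Q (%x. V x*psi n x - P N (%x. V x*psi n x) x))" for N
 define eh0 where "eh0 N = real (card F)*(\<Sum>n\<in>F. \<bar>al n\<bar>^2*nsq Q (%x. psi n x - P N (psi n) x))" for N
 have lim: "eh0 ~~> 0" "eh1 ~~> 0" "eh2 ~~> 0"
 proof -
  have l: "(%N. real (card F)*(\<Sum>n\<in>F. c n*nsq Q (%x. f n x - P N (f n) x))) ~~> 0"
   if "!!n. n : F ==> sqi Q (f n)" for c f
  proof -
   have "(%N. real (card F)*(\<Sum>n\<in>F. c n*nsq Q (%x. f n x - P N (f n) x))) ~~> real (card F)*(\<Sum>n\<in>F. c n*0)"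
    unfolding P_def Q_def by (intro tendsto_mult_left tendsto_sum bas_proj_limit[OF L0] that[unfolded Q_def])
   then show ?thesis by simp
  qed
  show "eh0 ~~> 0" "eh1 ~~> 0" "eh2 ~~> 0" unfolding eh0_def eh1_def eh2_def by (intro l psi Vm; assumption)+
 qed
 have wu: "nsq Q (%x. w t x - u N t x) <= eh1 N" if "0 <= t" "t <= T" for t N
  unfolding w_def u_def eh1_def sum_subtractf[symmetric] right_diff_distrib[symmetric]
  by (rule nsq_combination_le[OF F sqi_diff[OF psi Ps[OF psi]]]) (auto intro: a(1)[OF _ that])
 have lw: "nsq Q (%x. V x*w t x - l N t x) <= eh2 N" if "0 <= t" "t <= T" for t N
 proof -
  have e: "V x*w t x - l N t x = (\<Sum>n\<in>F. a t n*(V x*psi n x - P N (%x. V x*psi n x) x))" for x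
   unfolding w_def l_def right_diff_distrib sum_subtractf by (simp add: sum_distrib_left mult.left_commute)
  show ?thesis unfolding e eh2_def by (rule nsq_combination_le[OF F sqi_diff[OF Vm Ps[OF Vm]]]) (auto intro: a(1)[OF _ that])
 qed
 have nw: "nsq Q (w t) = (\<Sum>n\<in>F. (a t n)^2)" for t unfolding w_def[abs_def] by (rule nsq_orthonormal[OF F psi orth])
 have nw1: "t^2*A <= nsq Q (w t)" "nsq Q (w t) <= b^2*A" if "0 <= t" "t <= T" for t
 proof -
  have "t^2*(al n)^2 <= (a t n)^2 & (a t n)^2 <= b^2*(al n)^2" if n: "n : F" for n
  proof -
   have "0 <= \<bar>al n\<bar>*t" using \<open>0 <= t\<close> by simp
   then have "(\<bar>al n\<bar>*t)^2 <= \<bar>a t n\<bar>^2" using a(2)[OF n \<open>0 <= t\<close> \<open>t <= T\<close>] by (intro power_mono)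
   moreover have "\<bar>a t n\<bar>^2 <= (\<bar>al n\<bar>*b)^2" using a(1)[OF n \<open>0 <= t\<close> \<open>t <= T\<close>] by (intro power_mono) simp_all
   ultimately show ?thesis by (simp add: power_mult_distrib mult.commute)
  qed
  then show "t^2*A <= nsq Q (w t)" "nsq Q (w t) <= b^2*A" unfolding nw A_def sum_distrib_left by (auto intro: sum_mono)
 qed
 define c where "c N n k = al n*(ipr Q (?e k) (psi n)/nsq Q (?e k))" for N :: nat and n k
 define U where "U N y = (\<Sum>n\<in>F. \<Sum>k\<in>freqs N. c N n k*(?e k (fst y)*gh (E n) (snd y)))" for N y
 have Uu: "U N y = u N (snd y) (fst y)" for N y unfolding U_def u_def a_def P_def proj_def c_def by (simp add: sum_distrib_left mult_ac)
 \<comment> \<open>By \<open>coeff\<close>, the Laplacian of the projected extension is exactly the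
   projection of \<open>V\<close> times the extension. This is the only use of the equation for
   \<open>psi n\<close>.\<close>
 have lapl: "(\<Sum>n\<in>F. \<Sum>k\<in>freqs N. c N n k*((E n - freq2 bc L k)*(?e k (fst y)*gh (E n) (snd y)))) = l N (snd y) (fst y)" for N y
  unfolding l_def a_def P_def proj_def sum_distrib_left
 proof (intro sum.cong refl)
  fix n k assume n: "n : F"
  have "c N n k*((E n - freq2 bc L k)*(?e k (fst y)*gh (E n) (snd y)))
    = al n*gh (E n) (snd y)*(((E n - freq2 bc L k)*ipr Q (?e k) (psi n))/nsq Q (?e k)*?e k (fst y))" by (simp add: c_def mult_ac)
  then show "c N n k*((E n - freq2 bc L k)*(?e k (fst y)*gh (E n) (snd y)))
    = al n*gh (E n) (snd y)*(ipr Q (?e k) (%x. V x*psi n x)/nsq Q (?e k)*?e k (fst y))" unfolding coeff[OF n] .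
 qed
 have Pc: "cont (P N f)" for N f unfolding P_def proj_def[abs_def] by (intro continuous_intros bas_cont)
 have lc: "cont (%y. l N (snd y) (fst y))" for N
  unfolding l_def a_def by (intro continuous_intros cont_comp2[OF Pc] cont_comp2[OF gh_cont]) auto
 have uc: "cont (%y. u N (snd y) (fst y))" for N
  unfolding u_def a_def by (intro continuous_intros cont_comp2[OF Pc] cont_comp2[OF gh_cont]) auto
 have xc: "cont (u N t)" "cont (l N t)" for N t unfolding u_def[abs_def] l_def[abs_def] by (intro continuous_intros Pc)+
 \<comment> \<open>The positive part of the defect is continuous, and it is invariant under the tile
   maps because \<open>l\<close> and \<open>u\<close> are multiplied by the same sign.\<close>
 define err where "err N y = max 0 (\<bar>l N (snd y) (fst y)\<bar> - M*\<bar>u N (snd y) (fst y)\<bar>)" for N y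
 have ec: "cont (err N)" for N unfolding err_def[abs_def] by (intro continuous_intros lc uc)
 obtain K where K: "K >= 0" and core: "!!(U :: (real^'n) \<times> real => real) G H err. c2 U G H ==> (\<forall>x. U (x, 0) = 0) ==>
   (\<forall>y. \<bar>lap H y\<bar> <= M*\<bar>U y\<bar> + err y) ==> cont err ==> (\<forall>y. 0 <= err y) ==>
   (\<forall>m y. \<bar>U (tile_map (refl_sign bc) (real L) m y)\<bar> = \<bar>U y\<bar>) ==> (\<forall>m y. err (tile_map (refl_sign bc) (real L) m y) = err y) ==>
   (LBINT y. ind (cube (real L) \<times> {0..1}) y*(U y)^2)
   <= ?O*(LBINT x. ind ?S x*(G (x, 0) <.> (0, 1))^2)
    + ?R*(LBINT y. ind (slab (real L) T 0) y*(U y)^2) + K*(LBINT y. ind (slab (real L) T 0) y*(err y)^2)"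
  using core_estimate[where sg = "refl_sign bc", OF L de z M(1,2,3) M(4,5)[unfolded d_def] M(6) refl_sign_abs(1), folded d_def] unfolding T_def by blast
 have O0: "?O >= 0" and R0: "?R >= 0"
 proof -
  have d0: "d >= 0" by (simp add: d_def)
  have cst0: "cst (d + 1) >= 0" unfolding cst_def using d0 by (intro add_nonneg_nonneg mult_nonneg_nonneg) auto
  have p0: "prop_const (d + 1) d de ta >= 0" unfolding prop_const_def using cst0 de by simp
  show "?O >= 0" unfolding obs_const_def using p0 de M(3) by simp
  show "?R >= 0" unfolding rem_const_def using p0 cst0 de d0 by simp
 qed
 have tile: "u N (snd (tile_map (refl_sign bc) L m y)) (fst (tile_map (refl_sign bc) L m y)) = (\<Prod>i\<in>UNIV. val_sign bc (m $ i))*u N (snd y) (fst y)"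
  "l N (snd (tile_map (refl_sign bc) L m y)) (fst (tile_map (refl_sign bc) L m y)) = (\<Prod>i\<in>UNIV. val_sign bc (m $ i))*l N (snd y) (fst y)" for N m y
 proof -
  have s: "snd (tile_map (refl_sign bc) L m y) = snd y" by (simp add: tile_map_def)
  show "u N (snd (tile_map (refl_sign bc) L m y)) (fst (tile_map (refl_sign bc) L m y)) = (\<Prod>i\<in>UNIV. val_sign bc (m $ i))*u N (snd y) (fst y)"
   "l N (snd (tile_map (refl_sign bc) L m y)) (fst (tile_map (refl_sign bc) L m y)) = (\<Prod>i\<in>UNIV. val_sign bc (m $ i))*l N (snd y) (fst y)"
   unfolding u_def l_def P_def proj_def s bas_tile(1)[OF L0] sum_distrib_left by (simp_all add: mult_ac)
 qed
 have cube_int: "(LBINT x. ind (cube (real L)) x*f x) = (LINT x|Q. f x)" if "cont f" for f :: "real^'n => real"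
  unfolding Q_def by (rule LINT_cube_lborel[symmetric]) (rule bmeas_contI[OF that])
 have main: "A/2/3 - eh1 N <= ?O*(2*X + 2*eh0 N) + ?R*(T*(2*(b^2*A) + 2*eh1 N)) + K*(T*(2*eh2 N + 2*M^2*eh1 N))" for N
 proof -
  obtain G H where GH: "c2 (U N) G H" "!!y. lap H y = l N (snd y) (fst y)" "!!x. G (x, 0) <.> (0, 1) = (\<Sum>n\<in>F. \<Sum>k\<in>freqs N. c N n k*?e k x)"
   using extension_c2[where F = F and E = E and bc = bc and L = "real L" and K = "freqs N" and c = "c N", OF E(1)] unfolding lapl U_def[abs_def] by blast
  have G0: "G (x, 0) <.> (0, 1) = (\<Sum>n\<in>F. al n*P N (psi n) x)" for x
   unfolding GH(3) P_def proj_def c_def by (simp add: sum_distrib_left mult_ac)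
  have "(LBINT y. ind (cube (real L) \<times> {0..1}) y*(U N y)^2)
    <= ?O*(LBINT x. ind ?S x*(G (x, 0) <.> (0, 1))^2)
    + ?R*(LBINT y. ind (slab (real L) T 0) y*(U N y)^2) + K*(LBINT y. ind (slab (real L) T 0) y*(err N y)^2)"
  proof (rule core[OF GH(1)])
   show "\<forall>x. U N (x, 0) = 0" unfolding U_def by (simp add: gh_0)
   show "\<forall>y. \<bar>lap H y\<bar> <= M*\<bar>U N y\<bar> + err N y" unfolding GH(2) Uu err_def by (simp add: max_def)
   show "\<forall>y. 0 <= err N y" unfolding err_def by simp
   show "\<forall>m y. \<bar>U N (tile_map (refl_sign bc) L m y)\<bar> = \<bar>U N y\<bar>" unfolding Uu tile abs_mult bas_tile(2)[OF L0] by simp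
   show "\<forall>m y. err N (tile_map (refl_sign bc) L m y) = err N y" unfolding err_def tile abs_mult bas_tile(2)[OF L0] by simp
  qed (rule ec)
  moreover have "A/2/3 - eh1 N <= (LBINT y. ind (cube (real L) \<times> {0..1}) y*(U N y)^2)" unfolding Uu
  proof (rule slab_lower)
   show "cont (%y. (u N (snd y) (fst y))^2)" by (intro continuous_intros uc)
   fix t :: real assume t: "0 <= t" "t <= 1"
   then have t': "t <= T" using T by linarith
   have "t^2*A <= nsq Q (%x. u N t x + (w t x - u N t x))" using nw1(1)[OF t(1) t'] by simp
   also have "... <= 2*nsq Q (u N t) + 2*nsq Q (%x. w t x - u N t x)" by (rule nsq_triangle[OF us sqi_diff[OF ws us]])
   also have "... <= 2*nsq Q (u N t) + 2*eh1 N" using wu[OF t(1) t', of N] by simp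
   finally have "t^2*(A/2) - eh1 N <= nsq Q (u N t)" by simp
   also have "nsq Q (u N t) = (LBINT x. ind (cube (real L)) x*(u N t x)^2)"
    unfolding nsq_def by (rule cube_int[symmetric]) (intro continuous_intros xc)
   finally show "t^2*(A/2) - eh1 N <= (LBINT x. ind (cube (real L)) x*(u N (snd (x, t)) (fst (x, t)))^2)" by simp
  qed
  moreover have "(LBINT y. ind (slab (real L) T 0) y*(U N y)^2) <= T*(2*(b^2*A) + 2*eh1 N)" unfolding Uu
  proof (rule slab_upper[OF _ T(2)])
   show "cont (%y. (u N (snd y) (fst y))^2)" by (intro continuous_intros uc)
   fix t :: real assume t: "0 <= t" "t <= T"
   have "(LBINT x. ind (cube (real L)) x*(u N t x)^2) = nsq Q (u N t)"
    unfolding nsq_def by (rule cube_int) (intro continuous_intros xc)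
   also have "... = nsq Q (%x. w t x + - 1*(w t x - u N t x))" by simp
   also have "... <= 2*nsq Q (w t) + 2*nsq Q (%x. - 1*(w t x - u N t x))" by (rule nsq_triangle[OF ws sqi_scale[OF sqi_diff[OF ws us]]])
   also have "... <= 2*(b^2*A) + 2*eh1 N" unfolding nsq_scale using wu[OF t, of N] nw1(2)[OF t] by simp
   finally show "(LBINT x. ind (cube (real L)) x*(u N (snd (x, t)) (fst (x, t)))^2) <= 2*(b^2*A) + 2*eh1 N" by simp
  qed
  then have "?R*(LBINT y. ind (slab (real L) T 0) y*(U N y)^2) <= ?R*(T*(2*(b^2*A) + 2*eh1 N))"
   by (rule mult_left_mono[OF _ R0])
  moreover have "(LBINT y. ind (slab (real L) T 0) y*(err N y)^2) <= T*(2*eh2 N + 2*M^2*eh1 N)"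
  proof (rule slab_upper[OF _ T(2)])
   show "cont (%y. (err N y)^2)" by (intro continuous_intros ec)
   fix t :: real assume t: "0 <= t" "t <= T"
   have ect: "cont (%x. (err N (x, t))^2)" unfolding err_def by (intro continuous_intros) (simp_all add: xc)
   have Vw: "sqi Q (%x. V x*w t x)"
   proof (rule sqi_bound[OF sqi_scale[OF ws[of t], of B]])
    show "(%x. V x*w t x) : bmeas Q" by (intro borel_measurable_times V(1) sqi_measurable[OF ws])
    have "\<bar>V x\<bar> <= \<bar>B\<bar>" for x using V(2)[of x] by linarith
    then show "AE x in Q. \<bar>V x*w t x\<bar> <= \<bar>B*w t x\<bar>" by (simp add: abs_mult mult_right_mono)
   qed
   have s1: "sqi Q (%x. V x*w t x - l N t x)" and s2: "sqi Q (%x. w t x - u N t x)" by (intro sqi_diff Vw ls ws us)+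
   have "(LBINT x. ind (cube (real L)) x*(err N (x, t))^2) = (LINT x|Q. (err N (x, t))^2)" by (rule cube_int[OF ect])
   also have "... <= (LINT x|Q. 2*(V x*w t x - l N t x)^2 + 2*M^2*(w t x - u N t x)^2)"
   proof (rule integral_mono_AE')
    show "integrable Q (%x. 2*(V x*w t x - l N t x)^2 + 2*M^2*(w t x - u N t x)^2)" using s1 s2 unfolding sqi_def by simp
    show "AE x in Q. (err N (x, t))^2 <= 2*(V x*w t x - l N t x)^2 + 2*M^2*(w t x - u N t x)^2" using V(3)
    proof eventually_elim
     case (elim x)
     have "\<bar>V x*w t x\<bar> <= M*\<bar>w t x\<bar>" unfolding abs_mult using elim by (intro mult_right_mono) auto
     moreover have "\<bar>w t x\<bar> <= \<bar>u N t x\<bar> + \<bar>w t x - u N t x\<bar>" by simp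
     then have "M*\<bar>w t x\<bar> <= M*(\<bar>u N t x\<bar> + \<bar>w t x - u N t x\<bar>)" using M(1) by (rule mult_left_mono)
     ultimately have "\<bar>l N t x\<bar> - M*\<bar>u N t x\<bar> <= \<bar>V x*w t x - l N t x\<bar> + M*\<bar>w t x - u N t x\<bar>"
      unfolding distrib_left by linarith
     moreover have "0 <= \<bar>V x*w t x - l N t x\<bar> + M*\<bar>w t x - u N t x\<bar>" using M(1) by simp
     ultimately have "err N (x, t) <= \<bar>V x*w t x - l N t x\<bar> + M*\<bar>w t x - u N t x\<bar>" unfolding err_def by simp
     then have "(err N (x, t))^2 <= (\<bar>V x*w t x - l N t x\<bar> + M*\<bar>w t x - u N t x\<bar>)^2"
      by (rule power_mono) (simp add: err_def)
     also have "... <= 2*\<bar>V x*w t x - l N t x\<bar>^2 + 2*(M*\<bar>w t x - u N t x\<bar>)^2"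
      using sum_squares_bound[of "\<bar>V x*w t x - l N t x\<bar>" "M*\<bar>w t x - u N t x\<bar>"] by (simp add: power2_sum)
     finally show ?case by (simp add: power_mult_distrib)
    qed
   qed simp
   also have "... = 2*nsq Q (%x. V x*w t x - l N t x) + 2*M^2*nsq Q (%x. w t x - u N t x)"
    unfolding nsq_def using s1 s2 unfolding sqi_def by simp
   also have "... <= 2*eh2 N + 2*M^2*eh1 N" by (intro add_mono mult_left_mono lw wu t) simp_all
   finally show "(LBINT x. ind (cube (real L)) x*(err N (x, t))^2) <= 2*eh2 N + 2*M^2*eh1 N" .
  qed
  then have "K*(LBINT y. ind (slab (real L) T 0) y*(err N y)^2) <= K*(T*(2*eh2 N + 2*M^2*eh1 N))"
   by (rule mult_left_mono[OF _ K])
  moreover have "(LBINT x. ind ?S x*(G (x, 0) <.> (0, 1))^2) <= 2*X + 2*eh0 N"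
  proof -
   define p where "p x = (\<Sum>n\<in>F. al n*P N (psi n) x)" for x
   define q where "q x = (\<Sum>n\<in>F. al n*psi n x)" for x
   have ps: "sqi Q p" and qs: "sqi Q q" unfolding p_def[abs_def] q_def[abs_def] by (intro sqi_sum sqi_scale Ps psi; assumption)+
   have pc: "cont p" unfolding p_def[abs_def] by (intro continuous_intros Pc)
   have Sb: "?S : sets borel" using S_set_open(1) by (rule borel_open)
   have im: "(ind ?S :: _ => real) : bmeas Q" unfolding Q_def by (rule borel_measurable_on_cube) (use Sb in simp)
   have "(LBINT x. ind ?S x*(p x)^2) = (LBINT x. ind (cube (real L)) x*(ind ?S x*(p x)^2))"
    using S_set_open(2)[of "real L" de z] by (intro Lint_cong refl) (auto simp: indicator_def)
   also have "... = (LINT x|Q. ind ?S x*(p x)^2)" unfolding Q_def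
    by (rule LINT_cube_lborel[symmetric]) (use Sb bmeas_contI[OF pc] in measurable)
   also have "... <= (LINT x|Q. 2*(ind ?S x*(q x)^2) + 2*(q x - p x)^2)"
   proof (rule integral_mono')
    have "integrable Q (%x. ind ?S x*(q x)^2)"
    proof (rule Lintb_bound)
     show "integrable Q (%x. (q x)^2)" using qs by (simp add: sqi_def)
     show "(%x. ind ?S x*(q x)^2) : bmeas Q"
      by (intro borel_measurable_times im borel_measurable_power sqi_measurable[OF qs])
     show "AE x in Q. norm (ind ?S x*(q x)^2) <= norm ((q x)^2)" by (simp add: indicator_def)
    qed
    then show "integrable Q (%x. 2*(ind ?S x*(q x)^2) + 2*(q x - p x)^2)"
     using sqi_diff[OF qs ps] unfolding sqi_def by simp
    fix x
    have "(p x)^2 <= 2*(q x)^2 + 2*(q x - p x)^2"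
     using sum_squares_bound[of "q x" "p x - q x"] power2_sum[of "q x" "p x - q x"] by (simp add: power2_commute[of "q x"])
    then show "ind ?S x*(p x)^2 <= 2*(ind ?S x*(q x)^2) + 2*(q x - p x)^2" by (simp add: indicator_def)
   qed (simp add: indicator_def)
   also have "... = 2*X + 2*nsq Q (%x. q x - p x)"
   proof -
    have "integrable Q (%x. ind ?S x*(q x)^2)"
    proof (rule Lintb_bound)
     show "integrable Q (%x. (q x)^2)" using qs by (simp add: sqi_def)
     show "(%x. ind ?S x*(q x)^2) : bmeas Q"
      by (intro borel_measurable_times im borel_measurable_power sqi_measurable[OF qs])
     show "AE x in Q. norm (ind ?S x*(q x)^2) <= norm ((q x)^2)" by (simp add: indicator_def)
    qed
    then show ?thesis using sqi_diff[OF qs ps] unfolding X_def nsq_def sqi_def q_def[symmetric] by simp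
   qed
   also have "nsq Q (%x. q x - p x) <= eh0 N" unfolding q_def p_def eh0_def sum_subtractf[symmetric] right_diff_distrib[symmetric]
    by (rule nsq_combination_le[OF F sqi_diff[OF psi Ps[OF psi]]]) simp_all
   finally show ?thesis unfolding G0 p_def by simp
  qed
  then have "?O*(LBINT x. ind ?S x*(G (x, 0) <.> (0, 1))^2) <= ?O*(2*X + 2*eh0 N)" by (rule mult_left_mono[OF _ O0])
  ultimately show ?thesis by linarith
 qed
 have "A/2/3 - 0 <= ?O*(2*X + 2*0) + ?R*(T*(2*(b^2*A) + 2*0)) + K*(T*(2*0 + 2*M^2*0))"
  by (rule LIMSEQ_le[OF tendsto_diff[OF tendsto_const lim(2)] tendsto_add[OF tendsto_add[OF tendsto_mult_left[OF tendsto_add[OF tendsto_const tendsto_mult_left[OF lim(1)]]]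
    tendsto_mult_left[OF tendsto_mult_left[OF tendsto_add[OF tendsto_const tendsto_mult_left[OF lim(2)]]]]]
    tendsto_mult_left[OF tendsto_mult_left[OF tendsto_add[OF tendsto_mult_left[OF lim(3)] tendsto_mult_left[OF lim(2)]]]]]]) (use main in blast)
 then have "A/6 <= 2*(?O*X) + (?R*(T*(2*b^2)))*A" by (simp add: algebra_simps)
 \<comment> \<open>The absorption: \<open>A/6\<close> minus \<open>A/12\<close> leaves
   \<open>A/12\<close>, and with the factor 2 in front of the observed term the constant becomes
   24.\<close>
 moreover have "(?R*(T*(2*b^2)))*A <= 1/12*A"
  using small unfolding b_def T_def by (rule mult_right_mono) (simp add: A_def sum_nonneg)
 ultimately have "A <= 24*(?O*X)" by linarith
 then show ?thesis unfolding A_def X_def by (simp add: mult.assoc)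
qed

section \<open>Choice of the parameters\<close>

text \<open>With \<open>de = exp (- l)\<close> all constants become single exponentials, so that
  choosing the parameters is linear arithmetic in the exponents. The number 4096 is 16 times
  \<open>16^2\<close>.\<close>

lemma rem_obs_exp:
 fixes l :: real
 assumes de: "de = exp (- l)" and d: "1 <= d" and cst: "cst (d + 1) = exp a" and s: "0 < s"
 defines "p \<equiv> ln (4096*d)"
 shows "rem_const (d + 1) d de ta s = exp (a - ta/5) + exp (2*a + 4*ln 16 + 4*ln 4 + 8*l + 2*ta*(p + 2*l) - s/4)"
  and "obs_const (d + 1) d de ta s = exp (a + 5*ln 16 + 5*l + 2*ta*(p + 2*l) + 6* s + ln s)"
proof -
 have d16: "de/16 = exp (- l - ln 16)" and d4: "de/4 = exp (- l - ln 4)" unfolding de exp_diff by simp_all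
 have p4: "exp x ^ 4 = exp (4*x)" for x :: real using exp_of_nat_mult[of 4 x] by simp
 have ln: "ln (16*d/(de/16)^2) = p + 2*l"
 proof -
  have "16*d/(de/16)^2 = (4096*d)*exp (2*l)"
  proof -
   have "(exp (- l))^2 = exp (- (2*l))" using exp_of_nat_mult[of 2 "- l"] by simp
   then show ?thesis unfolding de power_divide by (simp add: exp_minus field_simps)
  qed
  then show ?thesis unfolding p_def using d by (simp add: ln_mult)
 qed
 have P: "prop_const (d + 1) d de ta = exp (a + 4*ln 16 + 4*l + 2*ta*(p + 2*l))"
  unfolding prop_const_def ln cst unfolding d16 p4 exp_diff[symmetric] exp_add[symmetric] by (simp add: algebra_simps)
 show "rem_const (d + 1) d de ta s = exp (a - ta/5) + exp (2*a + 4*ln 16 + 4*ln 4 + 8*l + 2*ta*(p + 2*l) - s/4)"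
  unfolding rem_const_def P cst d4 p4 exp_diff[symmetric] exp_add[symmetric] by (simp add: algebra_simps)
 have "16* s/de*exp (6* s) = exp (ln 16 + ln s + l + 6* s)" unfolding de exp_add using s by (simp add: exp_minus field_simps)
 then show "obs_const (d + 1) d de ta s = exp (a + 5*ln 16 + 5*l + 2*ta*(p + 2*l) + 6* s + ln s)"
  unfolding obs_const_def P by (simp only: exp_add[symmetric]) (simp add: algebra_simps)
qed

text \<open>The order of the choices matters. First \<open>ta = k1 g\<close> is made large enough to
  beat \<open>exp (8 d g)\<close>, the growth in the ghost variable. This fixes the price
  \<open>exp (2 ta (p + 2 l))\<close> of propagation, and \<open>s = k2 g l\<close> is then chosen
  to beat that price. As \<open>l = ln (1/de)\<close> is at least 1/2 and \<open>g\<close> at least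
  1, all constants can be absorbed into multiples of \<open>g l\<close>.\<close>

lemma parameters:
 fixes d c :: real
 assumes d: "1 <= d" and c: "1 <= c"
 shows "\<exists>k1 k2 K0. 144*d^2 <= k1 & 4 <= k2 & (\<forall>de g. 0 < de --> de < 1/2 --> 1 <= g -->
  rem_const (d + 1) d de (k1*g) (k2*g*ln (1/de))*(c*exp (8*d*g)) <= 1/12 &
  24* obs_const (d + 1) d de (k1*g) (k2*g*ln (1/de)) <= exp (K0*g*ln (1/de)))"
proof -
 have cst1: "cst (d + 1) >= 1" unfolding cst_def using d by (simp add: add_nonneg_nonneg mult_nonneg_nonneg)
 define a where "a = ln (cst (d + 1))"
 have a: "cst (d + 1) = exp a" "0 <= a" unfolding a_def using cst1 by simp_all
 define b where "b = ln c"
 have b: "c = exp b" "0 <= b" unfolding b_def using c by simp_all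
 define p where "p = ln (4096*d)"
 have p: "0 <= p" unfolding p_def using d by simp
 \<comment> \<open>With \<open>q = ln 24\<close>, each of the two summands of the remainder is
   brought below 1/24.\<close>
 define q r :: real where "q = ln 24" and "r = 4*ln 16 + 4*ln 4"
 have q: "0 <= q" "0 <= r" "(24::real) = exp q" unfolding q_def r_def by simp_all
 define k1 where "k1 = 5*(a + b + q + 8*d) + 144*d^2"
 have k1: "0 <= k1" "144*d^2 <= k1" unfolding k1_def using a b q d by simp_all
 define ka where "ka = 2*(2*a + b + r + q) + 8 + 4*k1*p + 4*k1 + 16*d"
 have ka: "0 <= ka" unfolding ka_def using a b q d k1 p by simp
 define k2 where "k2 = 4*ka + 4"
 define K0 where "K0 = 2*(q + a + 5*ln 16) + 5 + 4*k1*p + 4*k1 + 7*k2"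
 have "rem_const (d + 1) d de (k1*g) (k2*g*ln (1/de))*(c*exp (8*d*g)) <= 1/12 &
  24* obs_const (d + 1) d de (k1*g) (k2*g*ln (1/de)) <= exp (K0*g*ln (1/de))" if de: "0 < de" "de < 1/2" and g: "1 <= g" for de g
 proof -
  define l where "l = ln (1/de)"
  have del: "de = exp (- l)" unfolding l_def using de by (simp add: ln_div)
  have l: "1 <= 2*l"
  proof -
   have "exp (1/2 :: real) <= 2"
   proof -
    have "(exp (1/2 :: real))^2 <= 2^2" using exp_le by (simp add: exp_of_nat_mult[of 2 "1/2 :: real", symmetric, simplified])
    then show ?thesis by (rule power2_le_imp_le) simp
   qed
   also have "2 <= 1/de" using de by (simp add: field_simps)
   finally have "ln (exp (1/2)) <= ln (1/de)" using de by (subst ln_le_cancel_iff) auto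
   then show ?thesis unfolding l_def by simp
  qed
  then have l0: "0 < l" by simp
  define s where "s = k2*g*l"
  have s: "0 < s" unfolding s_def k2_def using ka g l0 by simp
  have gl: "l <= g*l" "1 <= 2*(g*l)" "g <= 2*(g*l)" "0 <= g*l"
  proof -
   show 1: "l <= g*l" using mult_right_mono[OF g, of l] l0 by simp
   then show "1 <= 2*(g*l)" using l by linarith
   show "g <= 2*(g*l)" using mult_left_mono[OF l, of g] g by simp
   show "0 <= g*l" using g l0 by simp
  qed
  have mid: "2*(k1*g)*(p + 2*l) <= (4*k1*p + 4*k1)*(g*l)"
  proof -
   have "(2*k1*p)*g <= (2*k1*p)*(2*(g*l))" using gl(3) k1 p by (intro mult_left_mono) auto
   then show ?thesis by (simp add: algebra_simps)
  qed
  have mul: "x <= 2*x*(g*l)" if "0 <= x" for x using mult_left_mono[OF gl(2) that] by simp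
  have rem: "rem_const (d + 1) d de (k1*g) s*(c*exp (8*d*g)) <= 1/12"
  proof -
   have r1: "a - k1*g/5 + b + 8*d*g <= - q"
   proof -
    have "(a + b + q + 8*d)*g <= k1*g/5" unfolding k1_def using g by (simp add: algebra_simps)
    moreover have "(a + b + q)*1 <= (a + b + q)*g" using a b q g by (intro mult_left_mono) auto
    ultimately show ?thesis by (simp add: algebra_simps)
   qed
   have r2: "2*a + r + 8*l + 2*(k1*g)*(p + 2*l) - s/4 + b + 8*d*g <= - q"
   proof -
    have "2*a + b + r + q <= 2*(2*a + b + r + q)*(g*l)" using a b q by (intro mul) simp
    moreover have "8*l <= 8*(g*l)" using gl(1) by simp
    moreover have "8*d*g <= 16*d*(g*l)" using mult_left_mono[OF gl(3), of "8*d"] d by simp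
    moreover have "s/4 = ka*(g*l) + g*l" unfolding s_def k2_def by (simp add: algebra_simps)
    moreover have "ka*(g*l) = 2*(2*a + b + r + q)*(g*l) + 8*(g*l) + (4*k1*p + 4*k1)*(g*l) + 16*d*(g*l)"
     unfolding ka_def by (simp add: algebra_simps)
    ultimately show ?thesis using mid gl(4) by linarith
   qed
   have "rem_const (d + 1) d de (k1*g) s*(c*exp (8*d*g))
    = exp (a - k1*g/5 + b + 8*d*g) + exp (2*a + r + 8*l + 2*(k1*g)*(p + 2*l) - s/4 + b + 8*d*g)"
    unfolding rem_obs_exp(1)[OF del d a(1) s] b(1) p_def[symmetric] r_def distrib_right exp_add[symmetric] by (simp add: algebra_simps)
   also have "... <= exp (- q) + exp (- q)" using r1 r2 by (intro add_mono) simp_all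
   also have "... = 1/12" unfolding exp_minus q(3)[symmetric] by simp
   finally show ?thesis .
  qed
  have obs: "24* obs_const (d + 1) d de (k1*g) s <= exp (K0*g*l)"
  proof -
   have "ln s <= s" using ln_bound[OF s] .
   moreover have "q + a + 5*ln 16 <= 2*(q + a + 5*ln 16)*(g*l)" using a q by (intro mul) simp
   moreover have "5*l <= 5*(g*l)" using gl(1) by simp
   moreover have "K0*g*l = 2*(q + a + 5*ln 16)*(g*l) + 5*(g*l) + (4*k1*p + 4*k1)*(g*l) + 7* s"
    unfolding K0_def s_def by (simp add: algebra_simps)
   ultimately have "q + (a + 5*ln 16 + 5*l + 2*(k1*g)*(p + 2*l) + 6* s + ln s) <= K0*g*l" using mid by linarith
   moreover have "24* obs_const (d + 1) d de (k1*g) s = exp (q + (a + 5*ln 16 + 5*l + 2*(k1*g)*(p + 2*l) + 6* s + ln s))"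
    unfolding rem_obs_exp(2)[OF del d a(1) s] q(3) p_def[symmetric] by (rule exp_add[symmetric])
   ultimately show ?thesis by simp
  qed
  show ?thesis using rem obs unfolding s_def l_def[symmetric] by blast
 qed
 moreover have "4 <= k2" unfolding k2_def using ka by simp
 ultimately show ?thesis using k1(2) by blast
qed

section \<open>The theorem\<close>

text \<open>\<open>real_of_ereal\<close> sends infinite values to 0. Boundedness of \<open>V\<close>
  excludes the value infinity and comparison with the zero function excludes negative values, so
  \<open>sup_norm V\<close> is the true essential supremum.\<close>

lemma sup_norm_bounds:
 fixes V :: "real^'n::finite => real"
 assumes V: "V : bmeas lebesgue" "bounded (range V)"
 shows "0 <= sup_norm V" "AE x in lebesgue. \<bar>V x\<bar> <= sup_norm V"
proof -
 obtain B where B: "!!x. \<bar>V x\<bar> <= B" using V(2) unfolding bounded_iff by auto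
 define e where "e = esssup lebesgue (%x. ereal \<bar>V x\<bar>)"
 have m: "(%x. ereal \<bar>V x\<bar>) : bmeas lebesgue" using V(1) by measurable
 have "e <= ereal B" unfolding e_def using m B by (intro esssup_I) simp_all
 moreover have "esssup lebesgue (%x :: real^'n. 0 :: ereal) <= e" unfolding e_def by (intro esssup_mono) simp_all
 moreover have "esssup lebesgue (%x :: real^'n. 0 :: ereal) = 0" by (rule esssup_const) simp
 ultimately have e: "e = ereal (sup_norm V)" "0 <= sup_norm V" unfolding sup_norm_def e_def[symmetric] by (cases e; simp)+
 show "0 <= sup_norm V" by (rule e(2))
 have "AE x in lebesgue. ereal \<bar>V x\<bar> <= e" unfolding e_def by (rule esssup_AE)
 then show "AE x in lebesgue. \<bar>V x\<bar> <= sup_norm V" unfolding e(1) by simp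
qed

lemma real_of_complex_L2:
 fixes f :: "real^'n::finite => real"
 assumes "(%x. cr (f x)) : L2 Om"
 shows "sqi (lebesgue_on Om) f"
proof (rule sqi_bound[OF L2_sqi[OF assms]])
 have "(%x. Re (cr (f x))) : bmeas (lebesgue_on Om)"
  by (rule measurable_compose[OF L2_measurable[OF assms] borel_measurable_Re])
 then show "f : bmeas (lebesgue_on Om)" by simp
qed simp

lemma cmod_sum_of_real:
 "(cmod (\<Sum>n\<in>F. al n*cr (psi n)))^2 = (\<Sum>n\<in>F. Re (al n)*psi n)^2 + (\<Sum>n\<in>F. Im (al n)*psi n)^2"
 unfolding cmod_power2 by simp

text \<open>The potential is shifted by its norm \<open>v\<close>: almost everywhere it then lies
  between 0 and \<open>2 v\<close>, and the shifted eigenvalues are nonnegative, as the real square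
  roots in \<open>gh\<close> require. So \<open>M = 2 v\<close>, and 144 is 36 times the square of
  that 2.\<close>

lemma spectral_inequality_real:
 fixes V :: "real^'n::finite => real" and L :: nat and psi :: "nat => real^'n => real" and z :: "int^'n => real^'n"
 defines "d \<equiv> real CARD('n)" and "Q \<equiv> lebesgue_on (cube (real L) :: (real^'n) set)" and "v \<equiv> sup_norm V"
 defines "c \<equiv> (8*d + 4) ^ (2*CARD('n))*(128*d^3)"
  and "g \<equiv> %E. 1 + v powr (2/3) + \<bar>E\<bar> powr (1/2)"
 assumes k: "144*d^2 <= k1" "4 <= k2"
  and par: "!!de g. 0 < de ==> de < 1/2 ==> 1 <= g ==>
   rem_const (d + 1) d de (k1*g) (k2*g*ln (1/de))*(c*exp (8*d*g)) <= 1/12 &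
   24* obs_const (d + 1) d de (k1*g) (k2*g*ln (1/de)) <= exp (K0*g*ln (1/de))"
  and de: "0 < de" "de < 1/2" and V: "V : bmeas lebesgue" "bounded (range V)" and L: "1 <= L"
  and z: "!!j. ball (z j) de \<subseteq> (%x. x + lattice_point j) ` cube 1"
  and F: "finite F" and eE: "!!n. n : F ==> ev n <= E"
  and eig: "!!n. n : F ==> H_eigen_eq bc V (real L) (ev n) (%x. cr (psi n x))"
  and psi: "!!n. n : F ==> sqi Q (psi n)"
  and orth: "!!m n. m : F ==> n : F ==> ipr Q (psi m) (psi n) = (if m = n then 1 else 0)"
 shows "C_sfuc K0 de V E*(\<Sum>n\<in>F. (al n)^2)
   <= (LINT x|Q. ind (S_set (real L) de z) x*(\<Sum>n\<in>F. al n*psi n x)^2)" (is "_ <= ?X")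
proof -
 have L0: "real L > 0" using L by simp
 note vb = sup_norm_bounds[OF V, folded v_def]
 obtain B where B: "!!x. \<bar>V x\<bar> <= B" using V(2) unfolding bounded_iff by auto
 have d1: "1 <= d" unfolding d_def using zero_less_card_finite[where 'a='n] by linarith
 have Vm: "V : bmeas Q" unfolding Q_def by (intro measurable_restrict_space1 V(1))
 have Vae: "AE x in Q. \<bar>V x\<bar> <= v" unfolding Q_def using vb(2) by (subst AE_restrict_space_iff) auto
 have mult_sqi: "sqi Q (%x. f x*psi n x)" if "n : F" "f : bmeas Q" "!!x. \<bar>f x\<bar> <= B'" for n f B'
 proof (rule sqi_bound[OF sqi_scale[OF psi[OF that(1)], of B']])
  show "(%x. f x*psi n x) : bmeas Q" by (intro borel_measurable_times that sqi_measurable[OF psi])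
  have "\<bar>f x\<bar> <= \<bar>B'\<bar>" for x using that(3)[of x] by linarith
  then show "AE x in Q. \<bar>f x*psi n x\<bar> <= \<bar>B'*psi n x\<bar>" by (simp add: abs_mult mult_right_mono)
 qed
 have muV: "sqi Q (%x. (mu - V x)*psi n x)" if "n : F" for mu n
 proof (rule mult_sqi[OF that, of _ "\<bar>mu\<bar> + B"])
  show "(%x. mu - V x) : bmeas Q" using Vm by measurable
  show "\<bar>mu - V x\<bar> <= \<bar>mu\<bar> + B" for x using B[of x] by linarith
 qed
 define g0 where "g0 = g E"
 have g: "1 <= g0" "v powr (2/3) <= g0" "\<bar>E\<bar> powr (1/2) <= g0" unfolding g0_def g_def by simp_all
 define l where "l = ln (1/de)"
 define ta s where "ta = k1*g0" and "s = k2*g0*l"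
 have l: "1 <= 2*l"
 proof -
  have "(exp (1/2 :: real))^2 <= 2^2" using exp_le by (simp add: exp_of_nat_mult[of 2 "1/2 :: real", symmetric, simplified])
  then have "exp (1/2 :: real) <= 2" by (rule power2_le_imp_le) simp
  also have "2 <= 1/de" using de by (simp add: field_simps)
  finally have "ln (exp (1/2)) <= ln (1/de)" using de by (subst ln_le_cancel_iff) auto
  then show ?thesis unfolding l_def by simp
 qed
 have k1: "144 <= k1" "0 <= k1"
 proof -
  have "144*1 <= 144*d^2" using d1 by (intro mult_left_mono one_le_power) simp_all
  then show "144 <= k1" "0 <= k1" using k(1) by linarith+
 qed
 have s2: "2*g0 <= s"
 proof -
  have "4*g0*(1/2) <= k2*g0*l" using k(2) g l by (intro mult_mono) simp_all
  then show ?thesis unfolding s_def by simp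
 qed
 \<comment> \<open>The origin of the exponent 2/3: \<open>g0 >= v powr (2/3)\<close> is what makes
   \<open>g0^3\<close> dominate \<open>v^2\<close>, as the Carleman parameters demand.\<close>
 have v3: "v^2 <= g0^3"
 proof -
  have "v^2 = (v powr (2/3))^3"
  proof (cases "v = 0")
   case False
   then have "v > 0" using vb(1) by simp
   then have "(v powr (2/3))^3 = v powr 2" by (simp add: powr_power)
   also have "... = v^2" using \<open>v > 0\<close> by simp
   finally show ?thesis ..
  qed simp
  also have "... <= g0^3" using g by (intro power_mono) simp_all
  finally show ?thesis .
 qed
 \<comment> \<open>A bound for the shifted energies. Since
   \<open>sqrt v <= 1 + v powr (2/3)\<close>, the shift does not change the order of
   \<open>sqrt E0\<close>.\<close>
 define E0 where "E0 = \<bar>E\<bar> + v"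
 have E0: "sqrt E0 <= g0"
 proof -
  have "E0 <= (\<bar>E\<bar> powr (1/2) + (1 + v powr (2/3)))^2"
  proof -
   have "\<bar>E\<bar> = (\<bar>E\<bar> powr (1/2))^2" by (cases "E = 0") (simp_all add: powr_half_sqrt)
   moreover have "v <= (1 + v powr (2/3))^2"
   proof (cases "v <= 1")
    case True
    have "1 <= (1 + v powr (2/3))^2" by (rule one_le_power) simp
    then show ?thesis using True by linarith
   next
    case False
    have "v = v powr 1" using False by simp
    also have "... <= v powr (4/3)" using False by (intro powr_mono) simp_all
    also have "... = (v powr (2/3))^2" using False by (simp add: powr_power)
    also have "... <= (1 + v powr (2/3))^2" by (intro power_mono) simp_all
    finally show ?thesis .
   qed
   moreover have "0 <= 2*(\<bar>E\<bar> powr (1/2))*(1 + v powr (2/3))" by simp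
   ultimately show ?thesis unfolding E0_def power2_sum by linarith
  qed
  then have "sqrt E0 <= \<bar>E\<bar> powr (1/2) + (1 + v powr (2/3))" by (rule real_le_lsqrt[rotated]) simp_all
  then show ?thesis unfolding g0_def g_def by simp
 qed
 have ev: "0 <= ev n + v" if n: "n : F" for n
 proof -
  have n1: "nsq Q (psi n) = 1" using orth[OF n n] by (simp add: nsq_def ipr_def power2_eq_square)
  have "0 <= (LINT x|Q. (ev n - V x)*(psi n x)^2)" unfolding Q_def by (rule eigen_nonneg[OF L0 eig[OF n]])
  also have "... <= (LINT x|Q. (ev n + v)*(psi n x)^2)"
  proof (rule integral_mono_AE)
   show "integrable Q (%x. (ev n - V x)*(psi n x)^2)"
    using sqi_integrable_mult[OF muV[OF n] psi[OF n]] by (simp add: power2_eq_square mult.assoc)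
   show "integrable Q (%x. (ev n + v)*(psi n x)^2)" using psi[OF n] unfolding sqi_def by simp
   show "AE x in Q. (ev n - V x)*(psi n x)^2 <= (ev n + v)*(psi n x)^2" using Vae by eventually_elim (intro mult_right_mono, simp_all)
  qed
  also have "... = ev n + v" using n1 unfolding nsq_def by simp
  finally show ?thesis .
 qed
 have "(\<Sum>n\<in>F. (al n)^2) <= 24* obs_const (d + 1) d de ta s*?X"
 proof (rule spectral_estimate[where E = "%n. ev n + v" and V = "%x. V x + v" and M = "2* v" and B = "B + v" and ?E0.0 = E0 and bc = bc, OF L de z, folded d_def Q_def])
  show "0 <= 2* v" using vb(1) by simp
  show "1 <= s" using s2 g by simp
  show "(2* v)^2 <= s^3"
  proof -
   have "0 <= g0^3" using g by simp
   then have "4* v^2 <= 8*g0^3" using v3 by linarith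
   then have "(2* v)^2 <= 8*g0^3" by (simp add: power_mult_distrib)
   also have "... = (2*g0)^3" by (simp add: power_mult_distrib)
   also have "... <= s^3" using s2 g by (intro power_mono) simp_all
   finally show ?thesis .
  qed
  have k13: "k1 <= k1^3"
  proof -
   have "k1*1 <= k1*k1^2" using k1 by (intro mult_left_mono one_le_power) simp_all
   then show ?thesis by (simp add: power3_eq_cube power2_eq_square)
  qed
  have k1d: "144*d^2 <= k1^3" using k(1) k13 by linarith
  show "36*d^2*(2* v)^2 <= ta^3"
  proof -
   have "36*d^2*(2* v)^2 = (144*d^2)* v^2" by (simp add: power_mult_distrib)
   also have "... <= k1^3*g0^3" using k1d v3 k1 g by (intro mult_mono) simp_all
   finally show ?thesis unfolding ta_def power_mult_distrib .
  qed
  show "36*d^2 <= ta^3"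
  proof -
   have "36*d^2 <= 144*d^2*1" by simp
   also have "... <= k1^3*g0^3" using k1d g k1 by (intro mult_mono one_le_power) simp_all
   finally show ?thesis unfolding ta_def power_mult_distrib .
  qed
  show "0 < ta" unfolding ta_def using k1 g by simp
  show "finite F" by (rule F)
  show "0 <= ev n + v" if "n : F" for n by (rule ev[OF that])
  show "ev n + v <= E0" if "n : F" for n unfolding E0_def using eE[OF that] by linarith
  show "(%x. V x + v) : bmeas Q" using Vm by measurable
  show "\<bar>V x + v\<bar> <= B + v" for x using B[of x] vb(1) by linarith
  show "AE x in Q. \<bar>V x + v\<bar> <= 2* v" using Vae by eventually_elim linarith
  show "sqi Q (psi n)" if "n : F" for n by (rule psi[OF that])
  show "ipr Q (psi m) (psi n) = (if m = n then 1 else 0)" if "m : F" "n : F" for m n by (rule orth[OF that])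
  show "(ev n + v - freq2 bc L k)*ipr Q (bas bc L k) (psi n) = ipr Q (bas bc L k) (%x. (V x + v)*psi n x)" if n: "n : F" for n k
  proof -
   have bs: "sqi Q (bas bc L k)" unfolding Q_def by (rule bas_orthogonal(1)[OF L0])
   have "(%x. (V x + v)*psi n x) = (%x. (ev n + v)*psi n x - (ev n - V x)*psi n x)" by (simp add: algebra_simps)
   then have "ipr Q (bas bc L k) (%x. (V x + v)*psi n x)
     = (ev n + v)*ipr Q (bas bc L k) (psi n) - ipr Q (bas bc L k) (%x. (ev n - V x)*psi n x)"
    using ipr_diff_right[OF bs sqi_scale[OF psi[OF n], of "ev n + v"] muV[OF n, of "ev n"]] by (simp add: ipr_scale_right)
   also have "ipr Q (bas bc L k) (%x. (ev n - V x)*psi n x) = freq2 bc L k*ipr Q (bas bc L k) (psi n)"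
    unfolding freq2_def Q_def by (rule eigen_coeff[OF L0 eig[OF n], symmetric])
   finally show ?thesis by (simp add: algebra_simps)
  qed
  show "rem_const (d + 1) d de ta s*(8*d + 4) ^ (2*CARD('n))*(4*d*(2*(4*d*exp (sqrt E0*(4*d)))^2)) <= 1/12"
  proof -
   have r0: "rem_const (d + 1) d de ta s >= 0"
   proof -
    have "cst (d + 1) >= 0" unfolding cst_def using d1 by (intro add_nonneg_nonneg mult_nonneg_nonneg) auto
    then show ?thesis unfolding rem_const_def prop_const_def using de by simp
   qed
   have "(exp (sqrt E0*(4*d)))^2 = exp (8*d* sqrt E0)" using exp_of_nat_mult[of 2 "sqrt E0*(4*d)"] by (simp add: algebra_simps)
   moreover have "4*d*(2*(4*d*y)^2) = 128*d^3*y^2" for y by (simp add: power2_eq_square power3_eq_cube)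
   ultimately have "rem_const (d + 1) d de ta s*(8*d + 4) ^ (2*CARD('n))*(4*d*(2*(4*d*exp (sqrt E0*(4*d)))^2))
    = rem_const (d + 1) d de ta s*(c*exp (8*d* sqrt E0))" unfolding c_def by (simp only: mult.assoc)
   also have "... <= rem_const (d + 1) d de ta s*(c*exp (8*d*g0))"
    using r0 d1 E0 unfolding c_def by (intro mult_left_mono) (auto intro!: mult_nonneg_nonneg)
   also have "... <= 1/12" using par[OF de g(1)] unfolding ta_def s_def l_def by blast
   finally show ?thesis .
  qed
 qed
 also have "... <= exp (K0*g0*l)*?X"
 proof (rule mult_right_mono)
  show "24* obs_const (d + 1) d de ta s <= exp (K0*g0*l)" using par[OF de g(1)] unfolding ta_def s_def l_def by blast
  show "0 <= ?X" by (intro integral_nonneg_AE AE_I2) simp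
 qed
 finally have A: "(\<Sum>n\<in>F. (al n)^2) <= exp (K0*g0*l)*?X" .
 have C: "C_sfuc K0 de V E = exp (- (K0*g0*l))" unfolding C_sfuc_def powr_def l_def g0_def g_def v_def using de by (simp add: ln_div)
 have "C_sfuc K0 de V E*(\<Sum>n\<in>F. (al n)^2) <= exp (- (K0*g0*l))*(exp (K0*g0*l)*?X)"
  unfolding C by (rule mult_left_mono[OF A]) simp
 also have "... = ?X" by (simp add: mult.assoc[symmetric] exp_add[symmetric])
 finally show ?thesis .
qed

theorem theorem2p1:
  shows "\<exists>K0::real. \<forall>(\<delta>::real) (E::real) (V::real^'n::finite \<Rightarrow> real) (L::nat)
      (z::int^'n \<Rightarrow> real^'n) (bc::boundary_condition)
      (\<psi>::nat \<Rightarrow> real^'n \<Rightarrow> real) (ev::nat \<Rightarrow> real) (\<alpha>::nat \<Rightarrow> complex) (F::nat set).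
    0 < \<delta> \<and> \<delta> < 1/2 \<longrightarrow>
    V \<in> borel_measurable lebesgue \<and> bounded (range V) \<longrightarrow>
    1 \<le> L \<longrightarrow>
    (\<forall>j. ball (z j) \<delta> \<subseteq> (\<lambda>x. x + lattice_point j) ` cube 1) \<longrightarrow>
    (\<forall>n\<ge>1. (\<lambda>x. complex_of_real (\<psi> n x)) \<in> W22 (cube (real L))) \<longrightarrow>
    orthonormal_basis_L2 (cube (real L)) (\<lambda>n x. complex_of_real (\<psi> n x)) \<longrightarrow>
    (\<forall>n\<ge>1. H_eigen_eq bc V (real L) (ev n) (\<lambda>x. complex_of_real (\<psi> n x))) \<longrightarrow>
    finite F \<and> F \<subseteq> {n. 1 \<le> n \<and> ev n \<le> E} \<longrightarrow>
    (let \<Psi> = (\<lambda>x. \<Sum>n\<in>F. \<alpha> n * complex_of_real (\<psi> n x)) in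
      (LINT x|lebesgue_on (S_set (real L) \<delta> z). (cmod (\<Psi> x))\<^sup>2)
        \<ge> C_sfuc K0 \<delta> V E * (LINT x|lebesgue_on (cube (real L)). (cmod (\<Psi> x))\<^sup>2))"
proof -
 define d where "d = real CARD('n)"
 have d1: "1 <= d" unfolding d_def using zero_less_card_finite[where 'a='n] by linarith
 have "1 <= (8*d + 4) ^ (2*CARD('n))*(128*d^3)"
 proof -
  have "1 <= d^3" using d1 by (rule one_le_power)
  then have "1 <= 128*d^3" by linarith
  moreover have "1 <= (8*d + 4) ^ (2*CARD('n))" using d1 by (intro one_le_power) simp
  ultimately have "1*1 <= (8*d + 4) ^ (2*CARD('n))*(128*d^3)" by (intro mult_mono) simp_all
  then show ?thesis by simp
 qed
 from parameters[OF d1 this] obtain k1 k2 K0 where k: "144*d^2 <= k1" "4 <= k2"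
  and par: "!!\<delta> g. 0 < \<delta> ==> \<delta> < 1/2 ==> 1 <= g ==>
   rem_const (d + 1) d \<delta> (k1*g) (k2*g*ln (1/\<delta>))*((8*d + 4) ^ (2*CARD('n))*(128*d^3)*exp (8*d*g)) <= 1/12 &
   24* obs_const (d + 1) d \<delta> (k1*g) (k2*g*ln (1/\<delta>)) <= exp (K0*g*ln (1/\<delta>))" by blast
 have main: "C_sfuc K0 \<delta> V E*(LINT x|lebesgue_on (cube (real L)). (cmod (\<Sum>n\<in>F. \<alpha> n*cr (\<psi> n x)))^2)
    <= (LINT x|lebesgue_on (S_set (real L) \<delta> z). (cmod (\<Sum>n\<in>F. \<alpha> n*cr (\<psi> n x)))^2)"
  if \<delta>: "0 < \<delta>" "\<delta> < 1/2" and V: "V : bmeas lebesgue" "bounded (range V)" and L: "1 <= L"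
   and z: "\<forall>j. ball (z j) \<delta> \<subseteq> (%x. x + lattice_point j) ` cube 1"
   and onb: "orthonormal_basis_L2 (cube (real L)) (%n x. cr (\<psi> n x))"
   and eig: "\<forall>n\<ge>1. H_eigen_eq bc V (real L) (ev n) (%x. cr (\<psi> n x))"
   and F: "finite F" "F \<subseteq> {n. 1 <= n & ev n <= E}"
  for \<delta> E and V :: "real^'n => real" and L :: nat and z :: "int^'n => real^'n" and bc \<psi> ev \<alpha> F
 proof -
  define Q where "Q = lebesgue_on (cube (real L) :: (real^'n) set)"
  let ?S = "S_set (real L) \<delta> z"
  have F1: "1 <= n" "ev n <= E" if "n : F" for n using F(2) that by auto
  have \<psi>: "sqi Q (\<psi> n)" if "n : F" for n
   unfolding Q_def using onb F1[OF that] unfolding orthonormal_basis_L2_def by (intro real_of_complex_L2) blast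
  have orth: "ipr Q (\<psi> m) (\<psi> n) = (if m = n then 1 else 0)" if "m : F" "n : F" for m n
  proof -
   have "cr (ipr Q (\<psi> m) (\<psi> n)) = L2_inner (cube (real L)) (%x. cr (\<psi> m x)) (%x. cr (\<psi> n x))"
    unfolding ipr_def L2_inner_def Q_def complex_cnj_complex_of_real of_real_mult[symmetric] by (rule integral_complex_of_real[symmetric])
   also have "... = (if m = n then 1 else 0)" using onb F1[OF that(1)] F1[OF that(2)] unfolding orthonormal_basis_L2_def by simp
   also have "... = cr (if m = n then 1 else 0)" by simp
   finally show ?thesis unfolding of_real_eq_iff .
  qed
  have real: "C_sfuc K0 \<delta> V E*(\<Sum>n\<in>F. (a n)^2) <= (LINT x|Q. ind ?S x*(\<Sum>n\<in>F. a n*\<psi> n x)^2)" for a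
   unfolding Q_def
   by (rule spectral_inequality_real[OF k(1)[unfolded d_def] k(2) par[unfolded d_def] \<delta> V L z[rule_format] F(1) F1(2) _ \<psi>[unfolded Q_def] orth[unfolded Q_def], where bc = bc])
     (use eig F1 in blast)+
  define f where "f a x = (\<Sum>n\<in>F. a n*\<psi> n x)" for a x
  have fs: "sqi Q (f a)" for a unfolding f_def[abs_def] by (intro sqi_sum sqi_scale \<psi>)
  have fi: "integrable Q (%x. (f a x)^2)" for a using fs unfolding sqi_def by blast
  have Sb: "?S : sets borel" by (rule borel_open[OF S_set_open(1)])
  then have Sl: "?S : sets lebesgue" by simp
  have im: "(ind ?S :: _ => real) : bmeas Q" unfolding Q_def by (rule borel_measurable_on_cube) (use Sb in simp)
  have fSi: "integrable Q (%x. ind ?S x*(f a x)^2)" for a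
  proof (rule Lintb_bound[OF fi[of a]])
   show "(%x. ind ?S x*(f a x)^2) : bmeas Q"
    by (intro borel_measurable_times im borel_measurable_power sqi_measurable[OF fs])
   show "AE x in Q. norm (ind ?S x*(f a x)^2) <= norm ((f a x)^2)" by (simp add: indicator_def)
  qed
  let ?r = "%n. Re (\<alpha> n)" and ?i = "%n. Im (\<alpha> n)"
  \<comment> \<open>The functions \<open>\<psi> n\<close> are real, so the real and imaginary parts
    of the coefficients separate pointwise and the real inequality is applied to each of
    them.\<close>
  have cm: "(cmod (\<Sum>n\<in>F. \<alpha> n*cr (\<psi> n x)))^2 = (f ?r x)^2 + (f ?i x)^2" for x
   unfolding f_def by (rule cmod_sum_of_real)
  have "(LINT x|Q. (f ?r x)^2 + (f ?i x)^2) = nsq Q (f ?r) + nsq Q (f ?i)"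
   unfolding nsq_def by (rule Lint_add[OF fi fi])
  also have "... = (\<Sum>n\<in>F. (?r n)^2) + (\<Sum>n\<in>F. (?i n)^2)"
   unfolding f_def[abs_def] by (simp only: nsq_orthonormal[OF F(1) \<psi> orth])
  finally have R: "(LINT x|Q. (f ?r x)^2 + (f ?i x)^2) = (\<Sum>n\<in>F. (?r n)^2) + (\<Sum>n\<in>F. (?i n)^2)" .
  have "(LINT x|lebesgue_on ?S. (f ?r x)^2 + (f ?i x)^2) = (LINT x|lebesgue. ind ?S x *: ((f ?r x)^2 + (f ?i x)^2))"
   by (rule integral_restrict_space) (use Sl in simp)
  also have "... = (LINT x|lebesgue. ind (cube (real L)) x *: (ind ?S x*(f ?r x)^2 + ind ?S x*(f ?i x)^2))"
   using S_set_open(2)[of "real L" \<delta> z] by (intro Lint_cong refl) (auto simp: indicator_def)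
  also have "... = (LINT x|Q. ind ?S x*(f ?r x)^2 + ind ?S x*(f ?i x)^2)"
   unfolding Q_def by (rule integral_restrict_space[symmetric]) simp
  also have "... = (LINT x|Q. ind ?S x*(f ?r x)^2) + (LINT x|Q. ind ?S x*(f ?i x)^2)"
   by (rule Lint_add[OF fSi fSi])
  finally show ?thesis unfolding cm Q_def[symmetric] R distrib_left using real[of ?r] real[of ?i] unfolding f_def by linarith
 qed
 show ?thesis unfolding Let_def by (intro exI[of _ K0] allI impI) (elim conjE, rule main, assumption+)
qed

end
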